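(* Suppose that $\mathscr D$ is a convex polytopal domain. Let $T>0$, $\epsilon\in(0,1)$, and assume that $\mathbf u^\epsilon$ is the strong solution on $[0,T]$ of the $\epsilon$-LLBE with the higher regularity $$\mathbf u^\epsilon\in L^\infty_T(\mathbb W^{2,3})\cap W^{1,\infty}_T(\mathbb H^2).$$ Let $\{\mathbf u_h^{\epsilon,(j)}\}_{j=1}^N$ be generated by the linear finite element scheme in the context. Then for any $n=1,\dots,N$ we have, unconditionally (i.e. with no restriction relating $h$ and $k$), $$\|\mathbf u_h^{\epsilon,(n)}-\mathbf u^\epsilon(t_n)\|_{\mathbb H^1}\le c\,e^{cT}(h+k),$$ where the positive constant $c$ is independent of $n$, $h$ and $k$, but may depend on $\epsilon^{-1}$.
   Context: Domain: $d\in\{1,2,3\}$ and $\mathscr D\subset\mathbb R^d$ is a bounded convex polytopal domain. Spaces: $\mathbb L^p,\mathbb W^{k,p},\mathbb H^k=\mathbb W^{k,2}$ are the Lebesgue and Sobolev spaces of $\mathbb R^3$-valued functions on $\mathscr D$. $\mathbb H^1_\Delta:=\{\mathbf v\in\mathbb H^1:\Delta\mathbf v\in\mathbb L^2\}$ with norm $\|\mathbf v\|_{\mathbb H^1}+\|\Delta\mathbf v\|_{\mathbb L^2}$. $L^q_T(X)=L^q(0,T;X)$, $W^{1,q}_T(X)=W^{1,q}(0,T;X)$, $H^1_T=W^{1,2}_T$. $\langle\mathbf u\times\nabla\mathbf v,\nabla\mathbf w\rangle_{\mathbb L^2}=\sum_{j=1}^d\int_{\mathscr D}(\mathbf u\times\partial_j\mathbf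 v)\cdot\partial_j\mathbf w\,dx$. $\epsilon$-LLBE ($\kappa_1,\kappa_2,\mu>0$, $\gamma\in\mathbb R$): $\partial_t\mathbf u^\epsilon-\epsilon\Delta\partial_t\mathbf u^\epsilon=\kappa_1\Delta\mathbf u^\epsilon+\gamma\,\mathbf u^\epsilon\times\Delta\mathbf u^\epsilon-\kappa_2(1+\mu|\mathbf u^\epsilon|^2)\mathbf u^\epsilon$ in $(0,T)\times\mathscr D$, $\mathbf u^\epsilon(0)=\mathbf u_0^\epsilon\in\mathbb H^1_\Delta$, $\partial\mathbf u^\epsilon/\partial\boldsymbol\nu=0$ on $\partial\mathscr D$. Strong solution on $[0,T]$: $\mathbf u^\epsilon\in W^{1,\infty}_T(\mathbb H^1)\cap H^1_T(\mathbb H^1_\Delta)\cap L^2_T(\mathbb H^2)$ such that for all $t\in(0,T)$, $\mathbf v\in\mathbb H^1$, $$\langle\mathbf u^\epsilon(t),\mathbf v\rangle_{\mathbb L^2}+\epsilon\langle\nabla\mathbf u^\epsilon(t),\nabla\mathbf v\rangle_{\mathbb L^2}+\kappa_1\!\int_0^t\!\langle\nabla\mathbf u^\epsilon,\nabla\mathbf v\rangle_{\mathbb L^2}ds+\gamma\!\int_0^t\!\langle\mathbf u^\epsilon\times\nabla\mathbf u^\epsilon,\nabla\mathbf v\rangle_{\mathbb L^2}ds+\kappa_2\!\int_0^t\!\langle(1+\mu|\mathbf u^\epsilon|^2)\mathbf u^\epsilon,\mathbf v\rangle_{\mathbb L^2}ds=\langle\mathbf u_0^\epsilon,\mathbf v\rangle_{\mathbb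 L^2}+\epsilon\langle\nabla\mathbf u_0^\epsilon,\nabla\mathbf v\rangle_{\mathbb L^2}.$$ Finite elements: $\{\mathcal T_h\}_{h>0}$ is a quasi-uniform family of triangulations of $\mathscr D$ with maximal mesh size $h$; $\mathbb V_h\subset\mathbb H^1$ is the space of continuous $\mathbb R^3$-valued piecewise linear functions on $\mathcal T_h$; $P_h:\mathbb L^2\to\mathbb V_h$ is the $\mathbb L^2$-orthogonal projection. Scheme: $N\in\mathbb N$, $k=T/N$, $t_n=nk$, $\mathrm d_t\mathbf v^{(j)}:=(\mathbf v^{(j)}-\mathbf v^{(j-1)})/k$. Set $\mathbf u_h^{\epsilon,(0)}=P_h\mathbf u_0^\epsilon$; for $j=1,\dots,N$ find $\mathbf u_h^{\epsilon,(j)}\in\mathbb V_h$ such that for all $\boldsymbol\phi_h\in\mathbb V_h$ $$\langle\mathrm d_t\mathbf u_h^{\epsilon,(j)},\boldsymbol\phi_h\rangle_{\mathbb L^2}+\epsilon\langle\nabla\mathrm d_t\mathbf u_h^{\epsilon,(j)},\nabla\boldsymbol\phi_h\rangle_{\mathbb L^2}+\kappa_1\langle\nabla\mathbf u_h^{\epsilon,(j)},\nabla\boldsymbol\phi_h\rangle_{\mathbb L^2}+\gamma\langle\mathbf u_h^{\epsilon,(j-1)}\times\nabla\mathbf u_h^{\epsilon,(j)},\nabla\boldsymbol\phi_h\rangle_{\mathbb L^2}+\kappa_2\langle\mathbf u_h^{\epsilon,(j)},\boldsymbol\phi_h\rangle_{\mathbb L^2}+\kappa_2\mu\langle|\mathbf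 u_h^{\epsilon,(j-1)}|^2\mathbf u_h^{\epsilon,(j)},\boldsymbol\phi_h\rangle_{\mathbb L^2}=0 .$$ *)

theory Defs
  imports "HOL-Analysis.Analysis"
begin

section \<open>Test functions and weak derivatives\<close>

primrec Ck :: "nat \<Rightarrow> ('a::euclidean_space \<Rightarrow> real) \<Rightarrow> bool" where
  "Ck 0 f \<longleftrightarrow> continuous_on UNIV f"
| "Ck (Suc m) f \<longleftrightarrow> (\<forall>x. f differentiable (at x)) \<and>
     (\<forall>v. Ck m (\<lambda>x. frechet_derivative f (at x) v))"

text \<open>The space of smooth functions on the whole space with compact support contained in \<open>S\<close>.\<close>

definition test_function :: "'a::euclidean_space set \<Rightarrow> ('a \<Rightarrow> real) \<Rightarrow> bool" where
  "test_function S \<phi> \<longleftrightarrow> (\<forall>m. Ck m \<phi>) \<and>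
     (\<exists>K. compact K \<and> K \<subseteq> S \<and> (\<forall>x. x \<notin> K \<longrightarrow> \<phi> x = 0))"

text \<open>Mixed partial derivatives are indexed by lists of coordinate directions;
  the length of the list is the order of the derivative.\<close>

primrec iter_partial :: "'d::finite list \<Rightarrow> (real^'d \<Rightarrow> real) \<Rightarrow> real^'d \<Rightarrow> real" where
  "iter_partial [] \<phi> = \<phi>"
| "iter_partial (j # js) \<phi> =
     (\<lambda>x. frechet_derivative (iter_partial js \<phi>) (at x) (axis j 1))"

definition locally_integrable :: "(real^'d) set \<Rightarrow> (real^'d \<Rightarrow> real^3) \<Rightarrow> bool" where
  "locally_integrable D v \<longleftrightarrow>
     (\<forall>K. compact K \<and> K \<subseteq> D \<longrightarrow> set_integrable lebesgue K v)"

definition has_weak_deriv ::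
  "(real^'d::finite) set \<Rightarrow> 'd list \<Rightarrow> (real^'d \<Rightarrow> real^3) \<Rightarrow> (real^'d \<Rightarrow> real^3) \<Rightarrow> bool" where
  "has_weak_deriv D js v w \<longleftrightarrow> locally_integrable D v \<and> locally_integrable D w \<and>
     (\<forall>\<phi>. test_function D \<phi> \<longrightarrow>
        (\<integral>x. iter_partial js \<phi> x *\<^sub>R v x \<partial>lebesgue_on D)
          = (- 1) ^ length js *\<^sub>R (\<integral>x. \<phi> x *\<^sub>R w x \<partial>lebesgue_on D))"

definition weak_deriv ::
  "(real^'d::finite) set \<Rightarrow> 'd list \<Rightarrow> (real^'d \<Rightarrow> real^3) \<Rightarrow> real^'d \<Rightarrow> real^3" where
  "weak_deriv D js v = (SOME w. has_weak_deriv D js v w)"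

definition has_weak_laplacian ::
  "(real^'d::finite) set \<Rightarrow> (real^'d \<Rightarrow> real^3) \<Rightarrow> (real^'d \<Rightarrow> real^3) \<Rightarrow> bool" where
  "has_weak_laplacian D v w \<longleftrightarrow> locally_integrable D v \<and> locally_integrable D w \<and>
     (\<forall>\<phi>. test_function D \<phi> \<longrightarrow>
        (\<integral>x. (\<Sum>j\<in>UNIV. iter_partial [j, j] \<phi> x) *\<^sub>R v x \<partial>lebesgue_on D)
          = (\<integral>x. \<phi> x *\<^sub>R w x \<partial>lebesgue_on D))"

definition weak_laplacian ::
  "(real^'d::finite) set \<Rightarrow> (real^'d \<Rightarrow> real^3) \<Rightarrow> real^'d \<Rightarrow> real^3" where
  "weak_laplacian D v = (SOME w. has_weak_laplacian D v w)"

section \<open>Lebesgue and Sobolev spaces\<close>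

text \<open>A space is a carrier together with a seminorm. Its elements are functions, not classes of
  functions modulo equality almost everywhere; every notion below is invariant under changing a
  function on a null set of \<open>D\<close> (and arbitrarily outside \<open>D\<close>).\<close>

type_synonym ('a, 'b) fspace = "('a \<Rightarrow> 'b) set \<times> (('a \<Rightarrow> 'b) \<Rightarrow> real)"

definition Lp_set :: "(real^'d) set \<Rightarrow> real \<Rightarrow> (real^'d \<Rightarrow> real^3) set" where
  "Lp_set D p = {v \<in> borel_measurable (lebesgue_on D).
                   integrable (lebesgue_on D) (\<lambda>x. norm (v x) powr p)}"

definition Lp_norm :: "(real^'d) set \<Rightarrow> real \<Rightarrow> (real^'d \<Rightarrow> real^3) \<Rightarrow> real" where
  "Lp_norm D p v = (\<integral>x. norm (v x) powr p \<partial>lebesgue_on D) powr (1 / p)"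

definition Sobolev_set :: "(real^'d::finite) set \<Rightarrow> nat \<Rightarrow> real \<Rightarrow> (real^'d \<Rightarrow> real^3) set" where
  "Sobolev_set D m p = {v \<in> Lp_set D p.
     \<forall>js. length js \<le> m \<longrightarrow> (\<exists>w \<in> Lp_set D p. has_weak_deriv D js v w)}"

definition Sobolev_norm ::
  "(real^'d::finite) set \<Rightarrow> nat \<Rightarrow> real \<Rightarrow> (real^'d \<Rightarrow> real^3) \<Rightarrow> real" where
  "Sobolev_norm D m p v =
     (\<Sum>js | length js \<le> m. Lp_norm D p (weak_deriv D js v) powr p) powr (1 / p)"

definition W_space :: "(real^'d::finite) set \<Rightarrow> nat \<Rightarrow> real \<Rightarrow> (real^'d, real^3) fspace" where
  "W_space D m p = (Sobolev_set D m p, Sobolev_norm D m p)"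

abbreviation H_space :: "(real^'d::finite) set \<Rightarrow> nat \<Rightarrow> (real^'d, real^3) fspace" where
  "H_space D m \<equiv> W_space D m 2"

abbreviation H_set :: "(real^'d::finite) set \<Rightarrow> nat \<Rightarrow> (real^'d \<Rightarrow> real^3) set" where
  "H_set D m \<equiv> Sobolev_set D m 2"

abbreviation H_norm :: "(real^'d::finite) set \<Rightarrow> nat \<Rightarrow> (real^'d \<Rightarrow> real^3) \<Rightarrow> real" where
  "H_norm D m \<equiv> Sobolev_norm D m 2"

definition H1_Delta_set :: "(real^'d::finite) set \<Rightarrow> (real^'d \<Rightarrow> real^3) set" where
  "H1_Delta_set D = {v \<in> H_set D 1. \<exists>w \<in> Lp_set D 2. has_weak_laplacian D v w}"

definition H1_Delta_space :: "(real^'d::finite) set \<Rightarrow> (real^'d, real^3) fspace" where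
  "H1_Delta_space D =
     (H1_Delta_set D, \<lambda>v. H_norm D 1 v + Lp_norm D 2 (weak_laplacian D v))"

definition ip :: "(real^'d) set \<Rightarrow> (real^'d \<Rightarrow> real^3) \<Rightarrow> (real^'d \<Rightarrow> real^3) \<Rightarrow> real" where
  "ip D v w = (\<integral>x. v x \<bullet> w x \<partial>lebesgue_on D)"

definition ip_grad ::
  "(real^'d::finite) set \<Rightarrow> (real^'d \<Rightarrow> real^3) \<Rightarrow> (real^'d \<Rightarrow> real^3) \<Rightarrow> real" where
  "ip_grad D v w = (\<Sum>j\<in>UNIV. ip D (weak_deriv D [j] v) (weak_deriv D [j] w))"

definition ip_cross_grad ::
  "(real^'d::finite) set \<Rightarrow> (real^'d \<Rightarrow> real^3) \<Rightarrow> (real^'d \<Rightarrow> real^3) \<Rightarrow> (real^'d \<Rightarrow> real^3) \<Rightarrow> real"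
  where
  "ip_cross_grad D u v w =
     (\<Sum>j\<in>UNIV. ip D (\<lambda>x. cross3 (u x) (weak_deriv D [j] v x)) (weak_deriv D [j] w))"

section \<open>Bochner spaces over a bounded time interval\<close>

text \<open>The Bochner integral of the library needs the value space to be a Banach space type, so the
  standard construction is repeated here for functions on \<open>(0,T)\<close> with values in a space given by
  a carrier and a seminorm.\<close>

definition time_simple ::
  "real \<Rightarrow> ('a, 'b::real_vector) fspace \<Rightarrow> (real \<Rightarrow> 'a \<Rightarrow> 'b) \<Rightarrow> bool" where
  "time_simple T E s \<longleftrightarrow> finite (s ` {0<..<T}) \<and> s ` {0<..<T} \<subseteq> fst E \<and>
     (\<forall>f. {t \<in> {0<..<T}. s t = f} \<in> sets lebesgue)"

definition time_simple_integral :: "real \<Rightarrow> (real \<Rightarrow> 'a \<Rightarrow> 'b::real_vector) \<Rightarrow> 'a \<Rightarrow> 'b" where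
  "time_simple_integral T s =
     (\<lambda>x. \<Sum>f \<in> s ` {0<..<T}. measure lebesgue {t \<in> {0<..<T}. s t = f} *\<^sub>R f x)"

definition strongly_measurable ::
  "real \<Rightarrow> ('a, 'b::real_vector) fspace \<Rightarrow> (real \<Rightarrow> 'a \<Rightarrow> 'b) \<Rightarrow> bool" where
  "strongly_measurable T E u \<longleftrightarrow>
     (AE t in lebesgue_on {0<..<T}. u t \<in> fst E) \<and>
     (\<exists>s :: nat \<Rightarrow> real \<Rightarrow> 'a \<Rightarrow> 'b. (\<forall>i. time_simple T E (s i)) \<and>
        (AE t in lebesgue_on {0<..<T}. (\<lambda>i. snd E (\<lambda>x. s i t x - u t x)) \<longlonglongrightarrow> 0))"

definition has_time_integral ::
  "real \<Rightarrow> ('a, 'b::real_vector) fspace \<Rightarrow> (real \<Rightarrow> 'a \<Rightarrow> 'b) \<Rightarrow> ('a \<Rightarrow> 'b) \<Rightarrow> bool" where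
  "has_time_integral T E u I \<longleftrightarrow> strongly_measurable T E u \<and> I \<in> fst E \<and>
     (\<exists>s :: nat \<Rightarrow> real \<Rightarrow> 'a \<Rightarrow> 'b. (\<forall>i. time_simple T E (s i)) \<and>
        (\<lambda>i. \<integral>\<^sup>+t. ennreal (snd E (\<lambda>x. u t x - s i t x)) \<partial>lebesgue_on {0<..<T}) \<longlonglongrightarrow> 0 \<and>
        (\<lambda>i. snd E (\<lambda>x. time_simple_integral T (s i) x - I x)) \<longlonglongrightarrow> 0)"

definition Lq_time ::
  "real \<Rightarrow> ennreal \<Rightarrow> ('a, 'b::real_vector) fspace \<Rightarrow> (real \<Rightarrow> 'a \<Rightarrow> 'b) set" where
  "Lq_time T q E = {u. strongly_measurable T E u \<and>
     (if q = \<infinity> then \<exists>C. AE t in lebesgue_on {0<..<T}. snd E (u t) \<le> C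
      else integrable (lebesgue_on {0<..<T}) (\<lambda>t. snd E (u t) powr enn2real q))}"

definition has_weak_time_deriv ::
  "real \<Rightarrow> ('a, 'b::real_vector) fspace \<Rightarrow> (real \<Rightarrow> 'a \<Rightarrow> 'b) \<Rightarrow> (real \<Rightarrow> 'a \<Rightarrow> 'b) \<Rightarrow> bool" where
  "has_weak_time_deriv T E u u' \<longleftrightarrow>
     (\<forall>\<phi>. test_function {0<..<T} \<phi> \<longrightarrow>
        (\<exists>I. has_time_integral T E (\<lambda>t x. deriv \<phi> t *\<^sub>R u t x) I \<and>
             has_time_integral T E (\<lambda>t x. \<phi> t *\<^sub>R u' t x) (\<lambda>x. - I x)))"

definition W1q_time ::
  "real \<Rightarrow> ennreal \<Rightarrow> ('a, 'b::real_vector) fspace \<Rightarrow> (real \<Rightarrow> 'a \<Rightarrow> 'b) set" where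
  "W1q_time T q E =
     {u \<in> Lq_time T q E. \<exists>u' \<in> Lq_time T q E. has_weak_time_deriv T E u u'}"

definition time_continuous ::
  "real \<Rightarrow> ('a, 'b::real_vector) fspace \<Rightarrow> (real \<Rightarrow> 'a \<Rightarrow> 'b) \<Rightarrow> bool" where
  "time_continuous T E u \<longleftrightarrow> (\<forall>t\<in>{0..T}. u t \<in> fst E \<and>
     ((\<lambda>s. snd E (\<lambda>x. u s x - u t x)) \<longlongrightarrow> 0) (at t within {0..T}))"

section \<open>Strong solutions\<close>

text \<open>Elements of \<open>W\<^sup>1\<^sup>,\<^sup>\<infinity>(0,T;H\<^sup>1)\<close> are evaluated at individual times, in particular at the
  endpoint \<open>T\<close>, through their representative in \<open>C([0,T];H\<^sup>1)\<close>; the clause \<open>time_continuous\<close>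
  says that \<open>u\<close> is this representative. The homogeneous Neumann condition is
  expressed by the variational equation being tested with all of \<open>H\<^sup>1\<close>.\<close>

definition strong_solution ::
  "(real^'d::finite) set \<Rightarrow> real \<Rightarrow> real \<Rightarrow> real \<Rightarrow> real \<Rightarrow> real \<Rightarrow> real \<Rightarrow>
     (real^'d \<Rightarrow> real^3) \<Rightarrow> (real \<Rightarrow> real^'d \<Rightarrow> real^3) \<Rightarrow> bool" where
  "strong_solution D \<kappa>1 \<kappa>2 \<mu> \<gamma> \<epsilon> T u0 u \<longleftrightarrow>
     u0 \<in> H1_Delta_set D \<and>
     u \<in> W1q_time T \<infinity> (H_space D 1) \<and>
     u \<in> W1q_time T 2 (H1_Delta_space D) \<and>
     u \<in> Lq_time T 2 (H_space D 2) \<and>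
     time_continuous T (H_space D 1) u \<and>
     (\<forall>t\<in>{0<..<T}. \<forall>v\<in>H_set D 1.
        ip D (u t) v + \<epsilon> * ip_grad D (u t) v
        + \<kappa>1 * (\<integral>s. ip_grad D (u s) v \<partial>lebesgue_on {0<..<t})
        + \<gamma> * (\<integral>s. ip_cross_grad D (u s) (u s) v \<partial>lebesgue_on {0<..<t})
        + \<kappa>2 * (\<integral>s. ip D (\<lambda>x. (1 + \<mu> * (norm (u s x))\<^sup>2) *\<^sub>R u s x) v \<partial>lebesgue_on {0<..<t})
        = ip D u0 v + \<epsilon> * ip_grad D u0 v)"

section \<open>Finite elements\<close>

definition convex_polytopal_domain :: "(real^'d) set \<Rightarrow> bool" where
  "convex_polytopal_domain D \<longleftrightarrow>
     open D \<and> D \<noteq> {} \<and> bounded D \<and> convex D \<and> polytope (closure D)"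

definition mesh :: "(real^'d::finite) set \<Rightarrow> (real^'d) set set \<Rightarrow> bool" where
  "mesh D \<T> \<longleftrightarrow> triangulation \<T> \<and> (\<forall>K\<in>\<T>. int CARD('d) simplex K) \<and> \<Union>\<T> = closure D"

text \<open>The family is indexed by a set \<open>H\<close> of positive mesh sizes (no triangulation of a bounded
  domain has a mesh size above the diameter). Quasi-uniformity: every element
  contains a ball whose radius is bounded below by a fixed multiple of the maximal mesh size.\<close>

definition quasi_uniform_family ::
  "(real^'d::finite) set \<Rightarrow> real set \<Rightarrow> (real \<Rightarrow> (real^'d) set set) \<Rightarrow> bool" where
  "quasi_uniform_family D H \<T> \<longleftrightarrow>
     (\<forall>h\<in>H. h > 0 \<and> mesh D (\<T> h) \<and> Max (diameter ` \<T> h) = h) \<and>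
     (\<exists>\<rho>>0. \<forall>h\<in>H. \<forall>K\<in>\<T> h. \<exists>x. cball x (\<rho> * h) \<subseteq> K)"

definition fem_space ::
  "(real^'d::finite) set \<Rightarrow> (real^'d) set set \<Rightarrow> (real^'d \<Rightarrow> real^3) set" where
  "fem_space D \<T> = {v. continuous_on (closure D) v \<and>
     (\<forall>K\<in>\<T>. \<exists>(A :: real^'d^3) b. \<forall>x\<in>K. v x = A *v x + b)}"

definition is_L2_projection ::
  "(real^'d) set \<Rightarrow> (real^'d \<Rightarrow> real^3) set \<Rightarrow> (real^'d \<Rightarrow> real^3) \<Rightarrow> (real^'d \<Rightarrow> real^3) \<Rightarrow> bool" where
  "is_L2_projection D V v p \<longleftrightarrow> p \<in> V \<and> (\<forall>\<phi>\<in>V. ip D (\<lambda>x. v x - p x) \<phi> = 0)"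

definition fem_scheme ::
  "(real^'d::finite) set \<Rightarrow> real \<Rightarrow> real \<Rightarrow> real \<Rightarrow> real \<Rightarrow> real \<Rightarrow> real \<Rightarrow> (real^'d \<Rightarrow> real^3) \<Rightarrow>
     (real^'d) set set \<Rightarrow> nat \<Rightarrow> (nat \<Rightarrow> real^'d \<Rightarrow> real^3) \<Rightarrow> bool" where
  "fem_scheme D \<kappa>1 \<kappa>2 \<mu> \<gamma> \<epsilon> T u0 \<T> N U \<longleftrightarrow>
     (let V = fem_space D \<T>; k = T / real N;
          dt = (\<lambda>j x. (1 / k) *\<^sub>R (U j x - U (j - 1) x)) in
      is_L2_projection D V u0 (U 0) \<and>
      (\<forall>j\<in>{1..N}. U j \<in> V \<and>
         (\<forall>\<phi>\<in>V. ip D (dt j) \<phi> + \<epsilon> * ip_grad D (dt j) \<phi>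
            + \<kappa>1 * ip_grad D (U j) \<phi>
            + \<gamma> * ip_cross_grad D (U (j - 1)) (U j) \<phi>
            + \<kappa>2 * ip D (U j) \<phi>
            + \<kappa>2 * \<mu> * ip D (\<lambda>x. (norm (U (j - 1) x))\<^sup>2 *\<^sub>R U j x) \<phi> = 0)))"

end

theory Submission
  imports Defs
begin

text \<open>The error is split by an approximate Ritz projection \<open>R\<close> of \<open>u(t\<^sub>n)\<close> with respect to
  \<open>\<langle>v,w\<rangle> + \<epsilon> \<langle>\<nabla>v,\<nabla>w\<rangle>\<close>, the inner product that carries the discrete time derivative. Testing the
  error equation with \<open>\<theta> = U - R\<close> removes the top order part of the cross product, because
  \<open>(U \<times> p) \<bullet> p = 0\<close>; the remaining trilinear terms are of type \<open>L\<^sup>4 L\<^sup>4 L\<^sup>2\<close> and are controlled by the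
  embedding of \<open>H\<^sup>1\<close> into \<open>L\<^sup>4\<close> and by an \<open>L\<^sup>4\<close> bound for \<open>\<nabla>R\<close>, which follows from an inverse estimate
  since \<open>\<nabla>(R - u)\<close> is of order \<open>h\<close> in \<open>L\<^sup>2\<close> and \<open>d \<le> 3\<close>. The \<open>\<epsilon>\<close>-norm of the scheme is nonincreasing, so all
  constants are uniform without a condition on \<open>h\<close> and \<open>k\<close>, and a discrete Gronwall argument concludes.
  In time only the Lipschitz continuity of \<open>u\<close> with values in \<open>H\<^sup>1\<close> is needed: it makes the
  increment of the variational equation over one step correct up to \<open>O(k\<^sup>2)\<close>.\<close>

section \<open>Smooth functions\<close>

text \<open>All analytic tools come from integrals along segments, and convexity is used twice.
  Points are pulled towards an inner ball before mollifying, so no extension operator occurs; and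
  segments stay in the domain, so embeddings and interpolation bounds follow from the fundamental
  theorem of calculus, a contraction with Jacobian \<tau>^d and Cauchy-Schwarz with a power weight
  in \<tau>, which is integrable because d \<le> 3. Nodal values of an H^2 function are avoided by
  interpolating a mollification that is fine enough for the given h. The values u(t) are bounded in
  H^2 for almost every t only, hence the class \<open>H2_limit\<close>, an H^1 closure of a ball of
  H^2. In each step the nonlinearity is frozen at the old iterate and the implicit part is
  nonnegative, so the recursion for \<theta> has only the old error on its right-hand side and
  Gronwall holds for every k. The Ritz tolerance is \<open>min h (k\<^sup>2)\<close>: a defect of
  size k^2 in every step sums to order k. The initial L^2 projection is of order h in H^1 by the
  inverse estimate.\<close>

definition smooth :: "('a::euclidean_space \<Rightarrow> real) \<Rightarrow> bool" where
  "smooth f \<longleftrightarrow> (\<forall>m. Ck m f)"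

lemma Ck_SucD: "Ck (Suc m) f \<Longrightarrow> Ck m f"
proof (induction m arbitrary: f)
  case 0
  then have "f differentiable_on UNIV" by (simp add: differentiable_on_def)
  then show ?case by (simp add: differentiable_imp_continuous_on)
next
  case (Suc m)
  then show ?case by (metis Ck.simps(2))
qed

lemma Ck_const [simp]: "Ck m (\<lambda>x. c)"
proof (induction m arbitrary: c)
  case (Suc m)
  show ?case using Suc by (simp add: frechet_derivative_const)
qed simp

text \<open>\<open>Ck\<close> is phrased with the chosen \<open>frechet_derivative\<close>; by
  uniqueness any explicitly computed derivative can be used instead, and the closure rules all go
  through this.\<close>

lemma Ck_Suc_has_derivative:
  assumes "\<And>x. (f has_derivative f' x) (at x)" "\<And>v. Ck m (\<lambda>x. f' x v)"
  shows "Ck (Suc m) f"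
proof -
  have "frechet_derivative f (at x) = f' x" for x
    using assms(1) frechet_derivative_at by metis
  then show ?thesis using assms by (auto simp: differentiable_def)
qed

lemma Ck_SucE:
  assumes "Ck (Suc m) f"
  obtains f' where "\<And>x. (f has_derivative f' x) (at x)" "\<And>v. Ck m (\<lambda>x. f' x v)"
proof
  show "(f has_derivative frechet_derivative f (at x)) (at x)" for x
    using assms by (simp add: frechet_derivative_works[symmetric])
  show "Ck m (\<lambda>x. frechet_derivative f (at x) v)" for v using assms by simp
qed

lemma Ck_inner [simp]: "Ck m (\<lambda>x. x \<bullet> b)"
proof (cases m)
  case 0 then show ?thesis by (simp add: continuous_on_inner)
next
  case (Suc n)
  show ?thesis unfolding Suc
    by (rule Ck_Suc_has_derivative[where f'="\<lambda>x v. v \<bullet> b"]) (auto intro!: derivative_eq_intros)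
qed

lemma Ck_add: "Ck m f \<Longrightarrow> Ck m g \<Longrightarrow> Ck m (\<lambda>x. f x + g x)"
proof (induction m arbitrary: f g)
  case 0 then show ?case by (simp add: continuous_on_add)
next
  case (Suc m)
  obtain f' where f: "\<And>x. (f has_derivative f' x) (at x)" "\<And>v. Ck m (\<lambda>x. f' x v)"
    using Ck_SucE[OF Suc.prems(1)] by blast
  obtain g' where g: "\<And>x. (g has_derivative g' x) (at x)" "\<And>v. Ck m (\<lambda>x. g' x v)"
    using Ck_SucE[OF Suc.prems(2)] by blast
  show ?case
    by (rule Ck_Suc_has_derivative[where f'="\<lambda>x v. f' x v + g' x v"])
       (auto intro!: derivative_eq_intros f g Suc.IH)
qed

lemma Ck_mult: "Ck m f \<Longrightarrow> Ck m g \<Longrightarrow> Ck m (\<lambda>x. f x * g x)"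
proof (induction m arbitrary: f g)
  case 0 then show ?case by (simp add: continuous_on_mult)
next
  case (Suc m)
  obtain f' where f: "\<And>x. (f has_derivative f' x) (at x)" "\<And>v. Ck m (\<lambda>x. f' x v)"
    using Ck_SucE[OF Suc.prems(1)] by blast
  obtain g' where g: "\<And>x. (g has_derivative g' x) (at x)" "\<And>v. Ck m (\<lambda>x. g' x v)"
    using Ck_SucE[OF Suc.prems(2)] by blast
  have "Ck m f" "Ck m g" using Suc.prems Ck_SucD by auto
  show ?case
    by (rule Ck_Suc_has_derivative[where f'="\<lambda>x v. f x * g' x v + f' x v * g x"])
       (auto intro!: derivative_eq_intros f g Suc.IH Ck_add \<open>Ck m f\<close> \<open>Ck m g\<close>)
qed

lemma Ck_sum: "(\<And>i. i \<in> I \<Longrightarrow> Ck m (f i)) \<Longrightarrow> Ck m (\<lambda>x. \<Sum>i\<in>I. f i x)"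
  by (induction I rule: infinite_finite_induct) (auto intro!: Ck_add)

lemma smooth_imp_has_derivative:
  assumes "smooth f"
  shows "(f has_derivative frechet_derivative f (at x)) (at x)"
  using assms[unfolded smooth_def, rule_format, of 1]
  by (simp add: frechet_derivative_works[symmetric])

lemma smooth_frechet: "smooth f \<Longrightarrow> smooth (\<lambda>x. frechet_derivative f (at x) v)"
  unfolding smooth_def by (metis Ck.simps(2))

lemma smooth_continuous: "smooth f \<Longrightarrow> continuous_on S f"
  unfolding smooth_def using continuous_on_subset[of UNIV f S] by (metis Ck.simps(1) subset_UNIV)

section \<open>Flat exponentials, bumps and test functions\<close>

definition bexp :: "nat \<Rightarrow> real \<Rightarrow> real" where
  "bexp n t = (if t > 0 then exp (- 1 / t) / t ^ n else 0)"

lemma bexp_tendsto_0: "(bexp n \<longlongrightarrow> 0) (at 0)"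
proof -
  have "((\<lambda>t::real. inverse t ^ n / exp (inverse t)) \<longlongrightarrow> 0) (at_right 0)"
    by (rule filterlim_compose[OF tendsto_power_div_exp_0 filterlim_inverse_at_top_right])
  then have "(bexp n \<longlongrightarrow> 0) (at_right 0)"
    by (rule Lim_transform_eventually)
       (auto simp: bexp_def eventually_at_filter exp_minus field_simps power_divide)
  moreover have "(bexp n \<longlongrightarrow> 0) (at_left 0)"
    by (rule Lim_transform_eventually[OF tendsto_const]) (auto simp: bexp_def eventually_at_filter)
  ultimately show ?thesis using filterlim_split_at_real by blast
qed

text \<open>The extra powers of t make the family \<open>bexp n\<close> closed under differentiation
  up to linear combinations, which is the reason for carrying the index n.\<close>

lemma DERIV_bexp: "(bexp n has_real_derivative (bexp (n+2) t - real n * bexp (n+1) t)) (at t)"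
proof -
  consider "t < 0" | "t = 0" | "t > 0" by linarith
  then show ?thesis
  proof cases
    case 1
    have "((\<lambda>t. 0) has_real_derivative 0) (at t)" by simp
    then have "(bexp n has_real_derivative 0) (at t)"
      by (rule has_field_derivative_transform_within_open[where S="{..<0}"]) (use 1 in \<open>auto simp: bexp_def\<close>)
    then show ?thesis using 1 by (simp add: bexp_def)
  next
    case 2
    \<comment> \<open>At 0 the difference quotient of \<open>bexp n\<close> is
      \<open>bexp (n+1)\<close>, whose limit is known.\<close>
    have "((\<lambda>h. bexp n h / h) \<longlongrightarrow> 0) (at 0)"
      by (rule Lim_transform_eventually[OF bexp_tendsto_0[of "n+1"]])
         (auto simp: bexp_def eventually_at_filter)
    then show ?thesis using 2 by (simp add: bexp_def DERIV_def)
  next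
    case 3
    have "((\<lambda>t. exp (-1/t) / t^n) has_real_derivative (bexp (n+2) t - real n * bexp (n+1) t)) (at t)"
    proof -
      have "((\<lambda>t. exp (-1/t)) has_real_derivative exp (-1/t) * (1/t\<^sup>2)) (at t)"
        using 3 by (auto intro!: derivative_eq_intros simp: field_simps power2_eq_square)
      moreover have "((\<lambda>t. 1/t) has_real_derivative - (1/t\<^sup>2)) (at t)"
        using 3 by (auto intro!: derivative_eq_intros simp: field_simps power2_eq_square)
      from DERIV_power[OF this, of n]
      have "((\<lambda>t. (1/t)^n) has_real_derivative - (real n * (1/t)^(n+1))) (at t)"
        by (rule back_subst[of "\<lambda>D. (_ has_real_derivative D) _"])
           (use 3 in \<open>cases n; simp add: power2_eq_square field_simps\<close>)
      ultimately have "((\<lambda>t. exp (-1/t) * (1/t)^n) has_real_derivative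
          exp (-1/t) * - (real n * (1/t)^(n+1)) + exp (-1/t) * (1/t\<^sup>2) * (1/t)^n) (at t)"
        by (rule DERIV_mult')
      then show ?thesis
        using 3 by (simp add: bexp_def field_simps power2_eq_square)
    qed
    then show ?thesis
      by (rule has_field_derivative_transform_within_open[where S="{0<..}"]) (use 3 in \<open>auto simp: bexp_def\<close>)
  qed
qed

text \<open>The induction has to treat all n at once, since differentiating raises the
  index.\<close>

lemma Ck_bexp_comp: "smooth g \<Longrightarrow> Ck m (\<lambda>x. bexp n (g x))"
proof (induction m arbitrary: n)
  case 0
  have "continuous_on UNIV (bexp n)"
    by (rule DERIV_continuous_on[OF has_field_derivative_at_within[OF DERIV_bexp]])
  then show ?case using 0 smooth_continuous[of g UNIV]
    by (auto intro: continuous_on_compose2[where g="bexp n" and t=UNIV])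
next
  case (Suc m)
  have g: "(g has_derivative frechet_derivative g (at x)) (at x)" for x
    using Suc.prems by (rule smooth_imp_has_derivative)
  show ?case
  proof (rule Ck_Suc_has_derivative[where f'="\<lambda>x v. (bexp (n+2) (g x) + (- real n) * bexp (n+1) (g x)) * frechet_derivative g (at x) v"])
    show "((\<lambda>x. bexp n (g x)) has_derivative (\<lambda>v. (bexp (n+2) (g x) + (- real n) * bexp (n+1) (g x)) * frechet_derivative g (at x) v)) (at x)" for x
      using has_derivative_compose[OF g DERIV_bexp[THEN has_field_derivative_imp_has_derivative]] by simp
    show "Ck m (\<lambda>x. (bexp (n+2) (g x) + (- real n) * bexp (n+1) (g x)) * frechet_derivative g (at x) v)" for v
      using Suc smooth_frechet[of g v] by (intro Ck_mult Ck_add Ck_const) (auto simp: smooth_def)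
  qed
qed

definition bump :: "'a::euclidean_space \<Rightarrow> real \<Rightarrow> 'a \<Rightarrow> real" where
  "bump c \<rho> z = bexp 0 (1 - (norm (z - c) / \<rho>)\<^sup>2)"

lemma smooth_bump: "smooth (bump c \<rho>)"
proof -
  \<comment> \<open>In coordinates the squared norm is a polynomial, to which the closure rules of
    \<open>Ck\<close> apply.\<close>
  have eq: "1 - (norm (z - c) / \<rho>)\<^sup>2 = 1 + (\<Sum>b\<in>Basis. (-1/\<rho>\<^sup>2) * ((z \<bullet> b + - (c \<bullet> b)) * (z \<bullet> b + - (c \<bullet> b))))" for z
    by (subst power_divide, subst power2_norm_eq_inner, subst euclidean_inner)
       (simp add: inner_diff_left sum_divide_distrib sum_negf)
  have "smooth (\<lambda>z. 1 - (norm (z - c) / \<rho>)\<^sup>2)"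
    unfolding eq smooth_def by (intro allI Ck_add Ck_sum Ck_mult Ck_const Ck_inner)
  from Ck_bexp_comp[OF this, of _ 0] show ?thesis
    unfolding bump_def[abs_def] smooth_def by blast
qed

lemma bump_nonneg [simp]: "bump c \<rho> z \<ge> 0"
  by (simp add: bump_def bexp_def)

lemma bump_pos_iff: "\<rho> > 0 \<Longrightarrow> bump c \<rho> z > 0 \<longleftrightarrow> dist c z < \<rho>"
  by (auto simp: bump_def bexp_def dist_norm norm_minus_commute divide_simps)
     (smt (verit, best) norm_ge_zero power2_less_imp_less power_strict_mono zero_less_numeral)+

lemma bump_eq_0: "\<rho> > 0 \<Longrightarrow> z \<notin> cball c \<rho> \<Longrightarrow> bump c \<rho> z = 0"
  using bump_pos_iff[of \<rho> c z] bump_nonneg[of c \<rho> z] by (auto simp: less_le)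

lemma bump_shift: "bump c \<rho> (z - a) = bump (c + a) \<rho> z"
  by (simp add: bump_def algebra_simps)

lemma test_function_smooth: "test_function S \<phi> \<Longrightarrow> smooth \<phi>"
  by (simp add: test_function_def smooth_def)

lemma test_function_bump:
  assumes "\<rho> > 0" "cball c \<rho> \<subseteq> S"
  shows "test_function S (\<lambda>z. a * bump c \<rho> z)"
  unfolding test_function_def
proof (intro conjI allI exI[of _ "cball c \<rho>"])
  show "Ck m (\<lambda>z. a * bump c \<rho> z)" for m
    using smooth_bump[of c \<rho>] by (auto intro!: Ck_mult Ck_const simp: smooth_def)
qed (use assms bump_eq_0 in \<open>auto simp del: mem_cball\<close>)

lemma test_function_frechet:
  assumes "test_function S \<phi>"
  shows "test_function S (\<lambda>x. frechet_derivative \<phi> (at x) v)"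
proof -
  obtain K where K: "compact K" "K \<subseteq> S" "\<And>x. x \<notin> K \<Longrightarrow> \<phi> x = 0"
    using assms by (auto simp: test_function_def)
  have "frechet_derivative \<phi> (at x) v = 0" if "x \<notin> K" for x
  proof -
    have "((\<lambda>_. 0) has_derivative (\<lambda>_. 0)) (at x)" by simp
    then have "(\<phi> has_derivative (\<lambda>_. 0)) (at x)"
      by (rule has_derivative_transform_within_open[of _ _ _ UNIV "- K"])
         (use K that in \<open>auto intro: compact_imp_closed\<close>)
    then show ?thesis using frechet_derivative_at by metis
  qed
  moreover have "Ck m (\<lambda>x. frechet_derivative \<phi> (at x) v)" for m
    using smooth_frechet[OF test_function_smooth[OF assms]] by (simp add: smooth_def)
  ultimately show ?thesis using K by (auto simp: test_function_def)
qed

lemma test_function_bounded: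
  assumes "test_function S \<phi>"
  obtains B where "B > 0" "\<And>x. \<bar>\<phi> x\<bar> \<le> B"
proof -
  obtain K where K: "compact K" "K \<subseteq> S" "\<And>x. x \<notin> K \<Longrightarrow> \<phi> x = 0"
    using assms by (auto simp: test_function_def)
  have "bounded (\<phi> ` K)"
    using smooth_continuous[OF test_function_smooth[OF assms]] K(1)
    by (intro compact_imp_bounded compact_continuous_image)
  then obtain B where "B > 0" "\<And>x. x \<in> K \<Longrightarrow> \<bar>\<phi> x\<bar> \<le> B"
    unfolding bounded_pos by auto
  then show ?thesis using K(3) that[of B] by (metis abs_zero less_eq_real_def)
qed

text \<open>Compact support bounds the derivative in each basis direction; the sum of these bounds
  dominates the operator norm, and the mean value inequality on the whole space finishes.\<close>

lemma test_function_lipschitz: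
  assumes "test_function S \<phi>"
  obtains L where "L > 0" "\<And>x y. \<bar>\<phi> x - \<phi> y\<bar> \<le> L * norm (x - y)"
proof -
  have "\<exists>B>0. \<forall>x. \<bar>frechet_derivative \<phi> (at x) b\<bar> \<le> B" for b
    using test_function_bounded[OF test_function_frechet[OF assms, of b]] by metis
  then obtain B where B: "\<And>b. B b > 0" "\<And>b x. \<bar>frechet_derivative \<phi> (at x) b\<bar> \<le> B b" by metis
  define L where "L = (\<Sum>b\<in>Basis. B b)"
  have L: "L > 0" unfolding L_def using B by (intro sum_pos) auto
  have der: "(\<phi> has_derivative frechet_derivative \<phi> (at x)) (at x)" for x
    using smooth_imp_has_derivative[OF test_function_smooth[OF assms]] .
  have "onorm (frechet_derivative \<phi> (at x)) \<le> L" for x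
  proof (rule onorm_bound)
    fix v
    have lin: "linear (frechet_derivative \<phi> (at x))" using der has_derivative_linear by blast
    have "frechet_derivative \<phi> (at x) v = frechet_derivative \<phi> (at x) (\<Sum>b\<in>Basis. (v \<bullet> b) *\<^sub>R b)"
      by (simp add: euclidean_representation)
    also have "\<dots> = (\<Sum>b\<in>Basis. (v \<bullet> b) *\<^sub>R frechet_derivative \<phi> (at x) b)"
      using lin by (simp add: linear_sum linear_cmul)
    also have "norm \<dots> \<le> (\<Sum>b\<in>Basis. norm v * B b)"
      by (rule order_trans[OF norm_sum])
         (auto intro!: sum_mono mult_mono B(2) Basis_le_norm simp: abs_mult)
    finally have "norm (frechet_derivative \<phi> (at x) v) \<le> (\<Sum>b\<in>Basis. norm v * B b)" .
    then show "norm (frechet_derivative \<phi> (at x) v) \<le> L * norm v"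
      by (simp add: L_def sum_distrib_left mult.commute sum_distrib_right)
  qed (use L in simp)
  then have "norm (\<phi> x - \<phi> y) \<le> L * norm (x - y)" for x y
    using differentiable_bound[of UNIV \<phi> "\<lambda>x. frechet_derivative \<phi> (at x)" L x y] der
    by (auto simp: has_derivative_at_withinI)
  with L that show ?thesis by auto
qed

section \<open>Square integrable functions\<close>

text \<open>Kept for arbitrary measures and Euclidean values, so that the same rules serve the
  domain, a single element, gradients, and the scalar functions |v|^2 through which L^4 norms are
  expressed.\<close>

definition sqi :: "'a measure \<Rightarrow> ('a \<Rightarrow> 'b::euclidean_space) \<Rightarrow> bool" where
  "sqi M f \<longleftrightarrow> f \<in> borel_measurable M \<and> integrable M (\<lambda>x. (norm (f x))\<^sup>2)"

definition l2n :: "'a measure \<Rightarrow> ('a \<Rightarrow> 'b::euclidean_space) \<Rightarrow> real" where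
  "l2n M f = sqrt (\<integral>x. (norm (f x))\<^sup>2 \<partial>M)"

lemma sqiD [dest]: "sqi M f \<Longrightarrow> f \<in> borel_measurable M" "sqi M f \<Longrightarrow> integrable M (\<lambda>x. (norm (f x))\<^sup>2)"
  by (auto simp: sqi_def)

lemma l2n_nonneg [simp]: "l2n M f \<ge> 0" by (simp add: l2n_def)

lemma l2n_sq: "(l2n M f)\<^sup>2 = (\<integral>x. (norm (f x))\<^sup>2 \<partial>M)" by (simp add: l2n_def)

lemma sqi_bound:
  assumes "sqi M g" "f \<in> borel_measurable M" "AE x in M. norm (f x) \<le> norm (g x)"
  shows "sqi M f"
proof -
  have "integrable M (\<lambda>x. (norm (f x))\<^sup>2)"
    by (rule Bochner_Integration.integrable_bound[OF sqiD(2)[OF assms(1)]])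
       (use assms(2,3) in \<open>auto simp: power_mono elim!: eventually_mono\<close>)
  then show ?thesis using assms by (simp add: sqi_def)
qed

lemma l2n_mono:
  assumes "sqi M g" "f \<in> borel_measurable M" "AE x in M. norm (f x) \<le> norm (g x)"
  shows "l2n M f \<le> l2n M g"
  unfolding l2n_def using assms sqi_bound[OF assms]
  by (intro real_sqrt_le_mono integral_mono_AE) (auto simp: power_mono elim!: eventually_mono)

lemma sqi_norm: "sqi M f \<Longrightarrow> sqi M (\<lambda>x. norm (f x))"
  by (auto simp: sqi_def intro: borel_measurable_norm)

lemma l2n_norm: "l2n M (\<lambda>x. norm (f x)) = l2n M f" by (simp add: l2n_def)

lemma sqi_add: assumes "sqi M f" "sqi M g" shows "sqi M (\<lambda>x. f x + g x)"
proof -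
  have [measurable]: "f \<in> borel_measurable M" "g \<in> borel_measurable M" using assms by auto
  have "(norm (f x + g x))\<^sup>2 \<le> 2 * (norm (f x))\<^sup>2 + 2 * (norm (g x))\<^sup>2" for x
  proof -
    have "(norm (f x + g x))\<^sup>2 \<le> (norm (f x) + norm (g x))\<^sup>2" by (simp add: norm_triangle_ineq)
    also have "\<dots> \<le> 2 * (norm (f x))\<^sup>2 + 2 * (norm (g x))\<^sup>2"       using sum_squares_bound[of "norm (f x)" "norm (g x)"] by (simp add: power2_sum)
    finally show ?thesis .
  qed
  moreover have "integrable M (\<lambda>x. 2 * (norm (f x))\<^sup>2 + 2 * (norm (g x))\<^sup>2)" using assms by (auto simp: sqi_def)
  ultimately have "integrable M (\<lambda>x. (norm (f x + g x))\<^sup>2)"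
    by (rule_tac Bochner_Integration.integrable_bound) auto
  then show ?thesis by (simp add: sqi_def)
qed

lemma sqi_scaleR: "sqi M f \<Longrightarrow> sqi M (\<lambda>x. c *\<^sub>R f x)"
  by (auto simp: sqi_def power_mult_distrib)

lemma sqi_uminus: "sqi M f \<Longrightarrow> sqi M (\<lambda>x. - f x)" by (auto simp: sqi_def)

lemma sqi_diff: "sqi M f \<Longrightarrow> sqi M g \<Longrightarrow> sqi M (\<lambda>x. f x - g x)"
  using sqi_add[of M f "\<lambda>x. - g x"] sqi_uminus[of M g] by simp

lemma sqi_zero [simp]: "sqi M (\<lambda>x. 0)" by (simp add: sqi_def)

lemma sqi_sum: "(\<And>i. i \<in> I \<Longrightarrow> sqi M (f i)) \<Longrightarrow> sqi M (\<lambda>x. \<Sum>i\<in>I. f i x)"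
  by (induction I rule: infinite_finite_induct) (auto intro!: sqi_add)

lemma sqi_bounded:
  assumes "finite_measure M" "f \<in> borel_measurable M" "AE x in M. norm (f x) \<le> B"
  shows "sqi M f"
proof -
  interpret finite_measure M by fact
  have "integrable M (\<lambda>x. (norm (f x))\<^sup>2)"
    by (rule integrable_const_bound[where B="B\<^sup>2"]) (use assms in \<open>auto simp: power_mono elim!: eventually_mono\<close>)
  then show ?thesis using assms by (simp add: sqi_def)
qed

lemma sqi_cong_AE:
  assumes "sqi M f" "g \<in> borel_measurable M" "AE x in M. f x = g x" shows "sqi M g"
  by (rule sqi_bound[OF assms(1,2)]) (use assms(3) in auto)

lemma l2n_cong_AE:
  assumes "f \<in> borel_measurable M" "g \<in> borel_measurable M" "AE x in M. f x = g x"
  shows "l2n M f = l2n M g"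
proof -
  have "(\<integral>x. (norm (f x))\<^sup>2 \<partial>M) = (\<integral>x. (norm (g x))\<^sup>2 \<partial>M)"
    by (rule integral_cong_AE) (use assms in auto)
  then show ?thesis by (simp add: l2n_def)
qed

lemma l2n_scaleR: "l2n M (\<lambda>x. c *\<^sub>R f x) = \<bar>c\<bar> * l2n M f"
  by (simp add: l2n_def power_mult_distrib real_sqrt_mult)

lemma l2n_uminus: "l2n M (\<lambda>x. - f x) = l2n M f" by (simp add: l2n_def)

lemma l2n_minus_commute: "l2n M (\<lambda>x. f x - g x) = l2n M (\<lambda>x. g x - f x)"
  by (simp add: l2n_def norm_minus_commute)

lemma sqi_mult_integrable:
  assumes "sqi M f" "sqi M g" shows "integrable M (\<lambda>x. norm (f x) * norm (g x))"
proof -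
  have [measurable]: "f \<in> borel_measurable M" "g \<in> borel_measurable M" using assms by auto
  have "integrable M (\<lambda>x. (norm (f x))\<^sup>2 + (norm (g x))\<^sup>2)" using assms by (auto simp: sqi_def)
  then show ?thesis
  proof (rule Bochner_Integration.integrable_bound)
    have "norm (f x) * norm (g x) \<le> (norm (f x))\<^sup>2 + (norm (g x))\<^sup>2" for x
      using sum_squares_bound[of "norm (f x)" "norm (g x)"] mult_nonneg_nonneg[OF norm_ge_zero[of "f x"] norm_ge_zero[of "g x"]] by linarith
    then show "AE x in M. norm (norm (f x) * norm (g x)) \<le> norm ((norm (f x))\<^sup>2 + (norm (g x))\<^sup>2)" by auto
  qed measurable
qed

lemma sqi_inner_integrable:
  assumes "sqi M f" "sqi M g" shows "integrable M (\<lambda>x. f x \<bullet> g x)"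
  by (rule Bochner_Integration.integrable_bound[OF sqi_mult_integrable[OF assms]])
     (use assms in \<open>auto simp: Cauchy_Schwarz_ineq2 intro!: borel_measurable_inner\<close>)

text \<open>The discriminant argument behind the Cauchy-Schwarz inequalities for \<open>l2n\<close>
  and \<open>hip\<close>. Stated for reals, it also yields the near-orthogonality of an approximate
  minimiser.\<close>

lemma sqrt_bound_quadratic:
  fixes a b c :: real
  assumes "a \<ge> 0" "c \<ge> 0" "\<And>t. 0 \<le> a - 2 * t * b + t\<^sup>2 * c"
  shows "b\<^sup>2 \<le> a * c"
proof (cases "c = 0")
  case True
  have "b = 0"
  proof (rule ccontr)
    assume "b \<noteq> 0"
    \<comment> \<open>This t makes the linear expression equal to -1.\<close>
    have "0 \<le> a - 2 * ((a+1) / (2*b)) * b" using assms(3)[of "(a+1)/(2*b)"] True by simp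
    then show False using \<open>b \<noteq> 0\<close> assms(1) by simp
  qed
  then show ?thesis using True by simp
next
  case False
  then have "c > 0" using assms(2) by simp
  have "0 \<le> a - 2 * (b/c) * b + (b/c)\<^sup>2 * c" by (rule assms(3))
  also have "\<dots> = a - b\<^sup>2 / c" using \<open>c > 0\<close> by (simp add: field_simps power2_eq_square)
  finally show ?thesis using \<open>c > 0\<close> by (simp add: field_simps)
qed

lemma l2n_Cauchy_Schwarz:
  assumes "sqi M f" "sqi M g"
  shows "(\<integral>x. norm (f x) * norm (g x) \<partial>M) \<le> l2n M f * l2n M g"
proof -
  let ?b = "\<integral>x. norm (f x) * norm (g x) \<partial>M"
  note i = sqi_mult_integrable[OF assms] sqiD(2)[OF assms(1)] sqiD(2)[OF assms(2)]
  have "?b\<^sup>2 \<le> (\<integral>x. (norm (f x))\<^sup>2 \<partial>M) * (\<integral>x. (norm (g x))\<^sup>2 \<partial>M)"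
  proof (rule sqrt_bound_quadratic)
    fix t :: real
    have "0 \<le> (\<integral>x. (norm (f x) - t * norm (g x))\<^sup>2 \<partial>M)" by simp
    also have "\<dots> = (\<integral>x. (norm (f x))\<^sup>2 - 2 * t * (norm (f x) * norm (g x)) + t\<^sup>2 * (norm (g x))\<^sup>2 \<partial>M)"
      by (rule Bochner_Integration.integral_cong) (auto simp: power2_eq_square algebra_simps)
    also have "\<dots> = (\<integral>x. (norm (f x))\<^sup>2 \<partial>M) - 2 * t * ?b + t\<^sup>2 * (\<integral>x. (norm (g x))\<^sup>2 \<partial>M)"
      using i by simp
    finally show "0 \<le> (\<integral>x. (norm (f x))\<^sup>2 \<partial>M) - 2 * t * ?b + t\<^sup>2 * (\<integral>x. (norm (g x))\<^sup>2 \<partial>M)" .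
  qed auto
  then have "?b\<^sup>2 \<le> (l2n M f * l2n M g)\<^sup>2" by (simp add: power_mult_distrib l2n_sq)
  then show ?thesis by (rule power2_le_imp_le) simp
qed

lemma l2n_inner_le:
  assumes "sqi M f" "sqi M g" shows "\<bar>\<integral>x. f x \<bullet> g x \<partial>M\<bar> \<le> l2n M f * l2n M g"
proof -
  have "\<bar>\<integral>x. f x \<bullet> g x \<partial>M\<bar> \<le> (\<integral>x. \<bar>f x \<bullet> g x\<bar> \<partial>M)" by (rule integral_abs_bound)
  also have "\<dots> \<le> (\<integral>x. norm (f x) * norm (g x) \<partial>M)"
    using sqi_inner_integrable[OF assms] sqi_mult_integrable[OF assms]
    by (intro integral_mono) (auto simp: Cauchy_Schwarz_ineq2)
  finally show ?thesis using l2n_Cauchy_Schwarz[OF assms] by linarith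
qed

lemma l2n_triangle:
  assumes "sqi M f" "sqi M g" shows "l2n M (\<lambda>x. f x + g x) \<le> l2n M f + l2n M g"
proof -
  have "(l2n M (\<lambda>x. f x + g x))\<^sup>2 \<le> (\<integral>x. (norm (f x))\<^sup>2 + 2 * (norm (f x) * norm (g x)) + (norm (g x))\<^sup>2 \<partial>M)"
    unfolding l2n_sq
  proof (rule integral_mono)
    show "integrable M (\<lambda>x. (norm (f x))\<^sup>2 + 2 * (norm (f x) * norm (g x)) + (norm (g x))\<^sup>2)"
      using sqi_mult_integrable[OF assms] assms by (auto simp: sqi_def)
    show "(norm (f x + g x))\<^sup>2 \<le> (norm (f x))\<^sup>2 + 2 * (norm (f x) * norm (g x)) + (norm (g x))\<^sup>2" for x
      using power_mono[OF norm_triangle_ineq[of "f x" "g x"], of 2] by (simp add: power2_sum)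
  qed (use sqi_add[OF assms] in auto)
  also have "\<dots> = (l2n M f)\<^sup>2 + 2 * (\<integral>x. norm (f x) * norm (g x) \<partial>M) + (l2n M g)\<^sup>2"
    using sqi_mult_integrable[OF assms] assms by (simp add: l2n_sq sqi_def)
  also have "\<dots> \<le> (l2n M f)\<^sup>2 + 2 * (l2n M f * l2n M g) + (l2n M g)\<^sup>2"
    using l2n_Cauchy_Schwarz[OF assms] by simp
  also have "\<dots> = (l2n M f + l2n M g)\<^sup>2" by (simp add: power2_sum)
  finally show ?thesis by (rule power2_le_imp_le) simp
qed

lemma l2n_triangle_diff:
  assumes "sqi M f" "sqi M g" shows "l2n M (\<lambda>x. f x - g x) \<le> l2n M f + l2n M g"
  using l2n_triangle[OF assms(1) sqi_uminus[OF assms(2)]] by (simp add: l2n_uminus)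

lemma l2n_triangle3:
  assumes "sqi M f" "sqi M g" "sqi M h"
  shows "l2n M (\<lambda>x. f x - h x) \<le> l2n M (\<lambda>x. f x - g x) + l2n M (\<lambda>x. g x - h x)"
  using l2n_triangle[OF sqi_diff[OF assms(1,2)] sqi_diff[OF assms(2,3)]] by simp

lemma l2n_sum:
  assumes "\<And>i. i \<in> I \<Longrightarrow> sqi M (f i)"
  shows "l2n M (\<lambda>x. \<Sum>i\<in>I. f i x) \<le> (\<Sum>i\<in>I. l2n M (f i))"
  using assms
proof (induction I rule: infinite_finite_induct)
  case (insert i I)
  then show ?case
    using l2n_triangle[of M "f i" "\<lambda>x. \<Sum>i\<in>I. f i x"] sqi_sum[of I M f] by force
qed (simp_all add: l2n_def)

lemma sqi_imp_integrable:
  assumes "finite_measure M" "sqi M f"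
  shows "integrable M f" "(\<integral>x. norm (f x) \<partial>M) \<le> sqrt (measure M (space M)) * l2n M f"
proof -
  interpret finite_measure M by fact
  have 1: "sqi M (\<lambda>_. 1 :: real)" by (rule sqi_bounded[where B=1]) (use assms in auto)
  from sqi_mult_integrable[OF assms(2) 1] show "integrable M f"
    using assms(2) by (auto intro: integrable_norm_cancel)
  show "(\<integral>x. norm (f x) \<partial>M) \<le> sqrt (measure M (space M)) * l2n M f"
    using l2n_Cauchy_Schwarz[OF 1 assms(2)] by (simp add: l2n_def)
qed

text \<open>Convergence in L^2 does not pass to sup bounds or fourth powers by itself; along an
  almost everywhere convergent subsequence it does, directly or by Fatou.\<close>

lemma l2n_tendsto_AE_subseq:
  fixes f :: "nat \<Rightarrow> 'a \<Rightarrow> 'b::euclidean_space"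
  assumes "\<And>n. sqi M (f n)" "sqi M g" "(\<lambda>n. l2n M (\<lambda>x. f n x - g x)) \<longlonglongrightarrow> 0"
  obtains r where "strict_mono r" "AE x in M. (\<lambda>n. f (r n) x) \<longlonglongrightarrow> g x"
proof -
  have "(\<lambda>n. (l2n M (\<lambda>x. f n x - g x))\<^sup>2) \<longlonglongrightarrow> 0\<^sup>2" by (rule tendsto_power[OF assms(3)])
  then have "(\<lambda>n. \<integral>x. norm ((norm (f n x - g x))\<^sup>2) \<partial>M) \<longlonglongrightarrow> 0" by (simp add: l2n_sq)
  from tendsto_L1_AE_subseq[OF _ this] sqi_diff[OF assms(1,2)]
  obtain r where r: "strict_mono r" "AE x in M. (\<lambda>n. (norm (f (r n) x - g x))\<^sup>2) \<longlonglongrightarrow> 0"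
    by (auto simp: sqi_def)
  from r(2) have "AE x in M. (\<lambda>n. f (r n) x) \<longlonglongrightarrow> g x"
  proof eventually_elim
    case (elim x)
    have "(\<lambda>n. norm (f (r n) x - g x)) \<longlonglongrightarrow> 0"
      using tendsto_real_sqrt[OF elim] by simp
    then show ?case by (simp add: LIM_zero_cancel tendsto_norm_zero_iff)
  qed
  with r(1) that show ?thesis by blast
qed

section \<open>Differentiation under the integral sign\<close>

text \<open>The Lipschitz bound at t dominates all difference quotients by a multiple of |g|, so
  dominated convergence applies. All smoothness sits in the kernel; g is merely integrable.\<close>

lemma has_vector_derivative_integral:
  fixes \<kappa> :: "real \<Rightarrow> 'a \<Rightarrow> real" and g :: "'a \<Rightarrow> 'b::euclidean_space"
  assumes meas: "\<And>s. \<kappa> s \<in> borel_measurable M" and int: "integrable M g"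
    and bnd: "\<And>s x. \<bar>\<kappa> s x\<bar> \<le> B"
    and lip: "\<And>s x. \<bar>\<kappa> s x - \<kappa> t x\<bar> \<le> L * \<bar>s - t\<bar>"
    and der: "\<And>x. ((\<lambda>s. \<kappa> s x) has_real_derivative \<kappa>' x) (at t)"
  shows "((\<lambda>s. \<integral>x. \<kappa> s x *\<^sub>R g x \<partial>M) has_vector_derivative (\<integral>x. \<kappa>' x *\<^sub>R g x \<partial>M)) (at t)"
proof -
  have [measurable]: "g \<in> borel_measurable M" using int by auto
  note meas[measurable]
  have int\<kappa>: "integrable M (\<lambda>x. \<kappa> s x *\<^sub>R g x)" for s
    by (rule Bochner_Integration.integrable_bound[of M "\<lambda>x. B *\<^sub>R g x"])
       (use int bnd in \<open>auto intro!: mult_right_mono order_trans[OF bnd abs_ge_self]\<close>)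
  have L: "L \<ge> 0" using lip[of "t+1" undefined] by simp
  have "((\<lambda>h. (\<integral>x. \<kappa> (t+h) x *\<^sub>R g x \<partial>M - (\<integral>x. \<kappa> t x *\<^sub>R g x \<partial>M)) /\<^sub>R h) \<longlongrightarrow> (\<integral>x. \<kappa>' x *\<^sub>R g x \<partial>M)) (at 0)"
    unfolding tendsto_at_iff_sequentially comp_def
  proof (intro allI impI)
    fix h :: "nat \<Rightarrow> real" assume h: "\<forall>i. h i \<in> UNIV - {0}" "h \<longlonglongrightarrow> 0"
    define q where "q i x = ((\<kappa> (t + h i) x - \<kappa> t x) / h i)" for i x
    have lim: "(\<lambda>i. q i x) \<longlonglongrightarrow> \<kappa>' x" for x
      using der[of x] h unfolding DERIV_def tendsto_at_iff_sequentially comp_def q_def by blast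
    have [measurable]: "q i \<in> borel_measurable M" for i unfolding q_def by measurable
    have m': "\<kappa>' \<in> borel_measurable M"
      by (rule borel_measurable_LIMSEQ_real[where u=q]) (use lim in auto)
    have "(\<lambda>i. \<integral>x. q i x *\<^sub>R g x \<partial>M) \<longlonglongrightarrow> (\<integral>x. \<kappa>' x *\<^sub>R g x \<partial>M)"
    proof (rule integral_dominated_convergence[where w="\<lambda>x. L * norm (g x)"])
      show "AE x in M. norm (q i x *\<^sub>R g x) \<le> L * norm (g x)" for i
      proof (rule AE_I2)
        fix x
        have "\<bar>\<kappa> (t + h i) x - \<kappa> t x\<bar> \<le> L * \<bar>h i\<bar>" using lip[of "t + h i" x] by simp
        then have "\<bar>q i x\<bar> \<le> L" using h(1) by (auto simp: q_def abs_divide divide_le_eq)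
        then show "norm (q i x *\<^sub>R g x) \<le> L * norm (g x)" by (simp add: mult_right_mono)
      qed
    qed (use int m' lim in \<open>auto intro!: tendsto_scaleR\<close>)
    moreover have "(\<integral>x. q i x *\<^sub>R g x \<partial>M) = ((\<integral>x. \<kappa> (t+h i) x *\<^sub>R g x \<partial>M) - (\<integral>x. \<kappa> t x *\<^sub>R g x \<partial>M)) /\<^sub>R h i" for i
    proof -
      have "(\<integral>x. q i x *\<^sub>R g x \<partial>M) = (\<integral>x. (\<kappa> (t+h i) x *\<^sub>R g x - \<kappa> t x *\<^sub>R g x) /\<^sub>R h i \<partial>M)"
        by (rule Bochner_Integration.integral_cong) (auto simp: q_def divide_inverse_commute right_diff_distrib scaleR_diff_left scaleR_diff_right)
      then show ?thesis by (simp add: Bochner_Integration.integral_diff[OF int\<kappa> int\<kappa>])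
    qed
    ultimately show "(\<lambda>i. (\<integral>x. \<kappa> (t+h i) x *\<^sub>R g x \<partial>M - (\<integral>x. \<kappa> t x *\<^sub>R g x \<partial>M)) /\<^sub>R h i) \<longlonglongrightarrow> (\<integral>x. \<kappa>' x *\<^sub>R g x \<partial>M)"
      by simp
  qed
  then have "((\<lambda>h. norm (((\<integral>x. \<kappa> (t+h) x *\<^sub>R g x \<partial>M) - (\<integral>x. \<kappa> t x *\<^sub>R g x \<partial>M)) /\<^sub>R h - (\<integral>x. \<kappa>' x *\<^sub>R g x \<partial>M))) \<longlongrightarrow> 0) (at 0)"
    by (simp add: LIM_zero_iff tendsto_norm_zero_iff)
  then have "((\<lambda>h. norm ((\<integral>x. \<kappa> (t+h) x *\<^sub>R g x \<partial>M) - (\<integral>x. \<kappa> t x *\<^sub>R g x \<partial>M) - h *\<^sub>R (\<integral>x. \<kappa>' x *\<^sub>R g x \<partial>M)) / norm h) \<longlongrightarrow> 0) (at 0)"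
  proof (rule Lim_transform_eventually)
    show "\<forall>\<^sub>F h in at 0. norm (((\<integral>x. \<kappa> (t+h) x *\<^sub>R g x \<partial>M) - (\<integral>x. \<kappa> t x *\<^sub>R g x \<partial>M)) /\<^sub>R h - (\<integral>x. \<kappa>' x *\<^sub>R g x \<partial>M))
       = norm ((\<integral>x. \<kappa> (t+h) x *\<^sub>R g x \<partial>M) - (\<integral>x. \<kappa> t x *\<^sub>R g x \<partial>M) - h *\<^sub>R (\<integral>x. \<kappa>' x *\<^sub>R g x \<partial>M)) / norm h"
      unfolding eventually_at_filter
    proof (rule always_eventually, intro allI impI)
      fix h :: real assume "h \<noteq> 0"
      then have "a /\<^sub>R h - b = (a - h *\<^sub>R b) /\<^sub>R h" for a b :: 'b
        by (simp add: scaleR_diff_right)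
      then show "norm (((\<integral>x. \<kappa> (t+h) x *\<^sub>R g x \<partial>M) - (\<integral>x. \<kappa> t x *\<^sub>R g x \<partial>M)) /\<^sub>R h - (\<integral>x. \<kappa>' x *\<^sub>R g x \<partial>M))
       = norm ((\<integral>x. \<kappa> (t+h) x *\<^sub>R g x \<partial>M) - (\<integral>x. \<kappa> t x *\<^sub>R g x \<partial>M) - h *\<^sub>R (\<integral>x. \<kappa>' x *\<^sub>R g x \<partial>M)) / norm h"
        by (simp add: divide_inverse_commute)
    qed
  qed
  then show ?thesis
    unfolding has_vector_derivative_def has_derivative_at by (auto intro: bounded_linear_scaleR_left)
qed

section \<open>Affine changes of variables and mollification\<close>

lemma nn_integral_lborel_affine:
  fixes a :: "'a::euclidean_space"
  assumes [measurable]: "f \<in> borel_measurable borel" and "c \<noteq> 0"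
  shows "(\<integral>\<^sup>+x. f (a + c *\<^sub>R x) \<partial>lborel) = ennreal (1 / \<bar>c\<bar> ^ DIM('a)) * (\<integral>\<^sup>+x. f x \<partial>lborel)"
proof -
  have "(\<integral>\<^sup>+x. f x \<partial>lborel) = (\<integral>\<^sup>+x. f x \<partial>density (distr lborel borel (\<lambda>x. a + c *\<^sub>R x)) (\<lambda>_. ennreal (\<bar>c\<bar> ^ DIM('a))))"
    using assms(2) by (subst lborel_affine[of c a]) auto
  also have "\<dots> = ennreal (\<bar>c\<bar> ^ DIM('a)) * (\<integral>\<^sup>+x. f (a + c *\<^sub>R x) \<partial>lborel)"
    by (subst nn_integral_density) (auto simp: nn_integral_distr nn_integral_cmult)
  finally have "ennreal (1 / \<bar>c\<bar> ^ DIM('a)) * (\<integral>\<^sup>+x. f x \<partial>lborel)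
     = (ennreal (1 / \<bar>c\<bar> ^ DIM('a)) * ennreal (\<bar>c\<bar> ^ DIM('a))) * (\<integral>\<^sup>+x. f (a + c *\<^sub>R x) \<partial>lborel)"
    by (simp add: mult.assoc)
  also have "ennreal (1 / \<bar>c\<bar> ^ DIM('a)) * ennreal (\<bar>c\<bar> ^ DIM('a)) = 1"
    using assms(2) by (subst ennreal_mult[symmetric]) auto
  finally show ?thesis by simp
qed

lemma nn_integral_lebesgue_on:
  assumes "S \<in> sets lebesgue"
  shows "(\<integral>\<^sup>+x. f x \<partial>lebesgue_on S) = (\<integral>\<^sup>+x. f x * indicator S x \<partial>lborel)"
  using assms by (simp add: nn_integral_restrict_space nn_integral_completion)

lemma integral_lebesgue_on_indicator:
  fixes f :: "_ \<Rightarrow> 'b::{banach, second_countable_topology}"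
  assumes "S \<in> sets lebesgue"
  shows "(\<integral>x. f x \<partial>lebesgue_on S) = (\<integral>x. indicator S x *\<^sub>R f x \<partial>lebesgue)"
  using assms by (simp add: integral_restrict_space)

lemma borel_imp_lebesgue_on: "f \<in> borel_measurable borel \<Longrightarrow> f \<in> borel_measurable (lebesgue_on S)"
  by (simp add: measurable_completion measurable_restrict_space1)

text \<open>Tonelli is applied to Borel functions under \<open>lborel\<close>, so a Lebesgue
  measurable function is exchanged for a Borel representative beforehand.\<close>

lemma ex_borel_lebesgue_on:
  fixes f :: "'a::euclidean_space \<Rightarrow> ennreal"
  assumes "f \<in> borel_measurable (lebesgue_on S)" "S \<in> sets lebesgue"
  obtains g where "g \<in> borel_measurable borel" "AE x in lebesgue_on S. f x = g x"
proof -
  have "(\<lambda>x. f x * indicator S x) \<in> borel_measurable lebesgue"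
    using assms by (simp add: borel_measurable_restrict_space_iff_ennreal mult.commute)
  from completion_ex_borel_measurable[OF this] obtain g where
    g: "g \<in> borel_measurable lborel" "AE x in lborel. f x * indicator S x = g x" by auto
  have "AE x in lebesgue_on S. f x = g x"
    using AE_completion[OF g(2)] assms(2)
    by (subst AE_restrict_space_iff) (auto elim!: eventually_mono simp: indicator_def split: if_splits)
  with g(1) that show ?thesis by simp
qed

lemma sqi_ennreal:
  assumes "sqi M f"
  shows "(\<integral>\<^sup>+x. ennreal ((norm (f x))\<^sup>2) \<partial>M) = ennreal ((l2n M f)\<^sup>2)"
  unfolding l2n_sq using assms by (subst nn_integral_eq_integral) (auto simp: sqi_def)

lemma sqiI_ennreal:
  assumes "f \<in> borel_measurable M" "(\<integral>\<^sup>+x. ennreal ((norm (f x))\<^sup>2) \<partial>M) \<le> ennreal (B\<^sup>2)" "B \<ge> 0"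
  shows "sqi M f" "l2n M f \<le> B"
proof -
  show s: "sqi M f"
    using assms by (auto simp: sqi_def integrable_iff_bounded intro!: le_less_trans[OF assms(2)])
  have "ennreal ((l2n M f)\<^sup>2) \<le> ennreal (B\<^sup>2)" using assms(2) sqi_ennreal[OF s] by simp
  then have "(l2n M f)\<^sup>2 \<le> B\<^sup>2" by (simp add: ennreal_le_iff)
  then show "l2n M f \<le> B" using assms(3) by (rule power2_le_imp_le)
qed

definition bump_mass :: "'a::euclidean_space \<Rightarrow> real \<Rightarrow> real" where
  "bump_mass a \<rho> = (\<integral>x. bump a \<rho> x \<partial>lborel)"

lemma integrable_bump:
  assumes "\<rho> > 0"
  shows "integrable lborel (bump (a::'a::euclidean_space) \<rho>)"
proof -
  have "integrable lborel (\<lambda>x. indicator (cball a \<rho>) x *\<^sub>R bump a \<rho> x)"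
    by (intro borel_integrable_compact compact_cball smooth_continuous smooth_bump)
  moreover have "(\<lambda>x. indicator (cball a \<rho>) x *\<^sub>R bump a \<rho> x) = bump a \<rho>"
    using bump_eq_0[OF assms, of _ a] by (auto simp: indicator_def fun_eq_iff)
  ultimately show ?thesis by (simp only:)
qed

lemma borel_measurable_bump [measurable]: "bump a \<rho> \<in> borel_measurable borel"
  by (intro borel_measurable_continuous_onI smooth_continuous smooth_bump)

lemma bump_mass_pos:
  assumes "\<rho> > 0" shows "bump_mass (a::'a::euclidean_space) \<rho> > 0"
proof (rule ccontr)
  assume "\<not> bump_mass a \<rho> > 0"
  moreover have "bump_mass a \<rho> \<ge> 0" unfolding bump_mass_def by simp
  ultimately have "(\<integral>x. bump a \<rho> x \<partial>lborel) = 0" unfolding bump_mass_def by simp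
  then have "AE x in lborel. bump a \<rho> x = 0"
    using integral_nonneg_eq_0_iff_AE[OF integrable_bump[OF assms, of a]] by simp
  then have "AE x in lborel. x \<notin> ball a \<rho>"
    by eventually_elim (metis bump_pos_iff[OF assms] less_irrefl mem_ball)
  then have "emeasure lborel (ball a \<rho>) = 0"
    by (subst (asm) AE_iff_measurable[where N="ball a \<rho>"]) auto
  then show False using content_ball_pos[OF assms, of a]
    by (simp add: measure_def emeasure_lborel_ball_finite)
qed

lemma bump_mass_shift: "bump_mass (a + b) \<rho> = bump_mass (a::'a::euclidean_space) \<rho>"
proof -
  have "bump_mass (a + b) \<rho> = (\<integral>x. bump (a + b) \<rho> x \<partial>distr lborel borel (\<lambda>x. b + x))"
    unfolding bump_mass_def by (subst lborel_distr_plus) simp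
  also have "\<dots> = bump_mass a \<rho>"
    unfolding bump_mass_def by (subst integral_distr) (auto simp: bump_shift[symmetric])
  finally show ?thesis .
qed

section \<open>Mollification on a convex domain by contraction to an inner ball\<close>

locale convex_dom =
  fixes D :: "(real^'d::finite) set" and c :: "real^'d" and r :: real
  assumes open_D: "open D" and bounded_D: "bounded D" and convex_D: "convex D"
    and r_pos: "r > 0" and ball_D: "cball c r \<subseteq> D"
begin

abbreviation LD where "LD \<equiv> lebesgue_on D"

text \<open>At most 1/2, so the contraction factor \<open>1 - ms n\<close> is at least 1/2 and its
  inverse Jacobian at most 2^d for all n.\<close>

definition ms :: "nat \<Rightarrow> real" where "ms n = 1 / (real n + 2)"

text \<open>The bump is centred at \<open>ms n *\<^sub>R c\<close> instead of 0: translated by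
  \<open>(1 - ms n) *\<^sub>R x\<close>, its support is the image of \<open>cball c r\<close> under
  the contraction y -> (1 - ms n) x + (ms n) y, and the factor in front gives unit mass.\<close>

definition mkern :: "nat \<Rightarrow> real^'d \<Rightarrow> real" where
  "mkern n y = 1 / bump_mass (ms n *\<^sub>R c) (ms n * r) * bump (ms n *\<^sub>R c) (ms n * r) y"

text \<open>The point \<open>x\<close> is first contracted towards \<open>c\<close>, so that the support of the kernel stays
  inside \<open>D\<close> and no extension of \<open>g\<close> across the boundary is needed.\<close>

definition moll :: "nat \<Rightarrow> (real^'d \<Rightarrow> real^3) \<Rightarrow> real^'d \<Rightarrow> real^3" where
  "moll n g x = (\<integral>z. mkern n (z - (1 - ms n) *\<^sub>R x) *\<^sub>R g z \<partial>LD)"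

lemma ms: "0 < ms n" "ms n \<le> 1/2" by (auto simp: ms_def field_simps)

lemma msr_pos: "ms n * r > 0" using ms r_pos by simp

lemma D_sets [simp]: "D \<in> sets lebesgue" "D \<in> sets borel" using open_D by auto

lemma finite_LD: "finite_measure LD"
  using bounded_D by (intro finite_measure_lebesgue_on bounded_set_imp_lmeasurable) auto

lemma mkern_eq: "mkern n (z - a) = 1 / bump_mass (ms n *\<^sub>R c) (ms n * r) * bump (ms n *\<^sub>R c + a) (ms n * r) z"
  by (simp add: mkern_def bump_shift)

lemma mkern_nonneg [simp]: "mkern n y \<ge> 0"
  using bump_mass_pos[OF msr_pos, of "ms n *\<^sub>R c" n] by (simp add: mkern_def)

lemma mkern_test: "test_function UNIV (mkern n)"
  unfolding mkern_def[abs_def] by (rule test_function_bump[OF msr_pos]) simp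

lemma mkern_measurable [measurable]: "mkern n \<in> borel_measurable borel"
  unfolding mkern_def[abs_def] by measurable

text \<open>Each point of the ball lies on a segment from a point y of the inner ball to x, and such
  a segment is interior except possibly at x. Points x of the closure are included because mesh
  vertices may lie on the boundary.\<close>

lemma mkern_cball: "x \<in> closure D \<Longrightarrow> cball (ms n *\<^sub>R c + (1 - ms n) *\<^sub>R x) (ms n * r) \<subseteq> D"
proof
  fix z assume x: "x \<in> closure D" and z: "z \<in> cball (ms n *\<^sub>R c + (1 - ms n) *\<^sub>R x) (ms n * r)"
  define y where "y = (1 / ms n) *\<^sub>R (z - (1 - ms n) *\<^sub>R x)"
  have "ms n * norm (c - y) = norm (ms n *\<^sub>R (c - y))" using ms[of n] by simp
  also have "ms n *\<^sub>R (c - y) = ms n *\<^sub>R c + (1 - ms n) *\<^sub>R x - z"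
    using ms(1)[of n] by (simp add: y_def scaleR_diff_right)
  also have "norm \<dots> \<le> ms n * r" using z by (simp add: dist_norm)
  finally have "y \<in> cball c r" using ms(1)[of n] by (simp add: dist_norm)
  then have "y \<in> interior D" using ball_D open_D by (auto simp: interior_open)
  have zz: "z = (1 - ms n) *\<^sub>R x + ms n *\<^sub>R y" using ms(1)[of n] by (simp add: y_def)
  show "z \<in> D"
  proof (cases "x = y")
    case True
    then show ?thesis using zz \<open>y \<in> interior D\<close> open_D by (simp add: interior_open flip: scaleR_left_distrib)
  next
    case False
    then have "z \<in> open_segment y x"
      using zz ms[of n] by (auto simp: in_segment intro!: exI[of _ "1 - ms n"])
    then show ?thesis
      using in_interior_closure_convex_segment[OF convex_D \<open>y \<in> interior D\<close> x] open_D
      by (auto simp: interior_open)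
  qed
qed

lemma mkern_test_D: "x \<in> closure D \<Longrightarrow> test_function D (\<lambda>z. mkern n (z - (1 - ms n) *\<^sub>R x))"
  unfolding mkern_eq by (rule test_function_bump[OF msr_pos mkern_cball])

lemma mkern_0: "x \<in> closure D \<Longrightarrow> z \<notin> D \<Longrightarrow> mkern n (z - (1 - ms n) *\<^sub>R x) = 0"
  unfolding mkern_eq using mkern_cball[of x n] bump_eq_0[OF msr_pos, of z] by fastforce

lemma mkern_integrable: "integrable lborel (\<lambda>z. mkern n (z - a))"
  unfolding mkern_eq by (intro integrable_mult_right integrable_bump msr_pos)

lemma mkern_integral: "(\<integral>z. mkern n (z - a) \<partial>lborel) = 1"
  unfolding mkern_eq
  using bump_mass_pos[OF msr_pos, of "ms n *\<^sub>R c" n] bump_mass_shift[of "ms n *\<^sub>R c" a "ms n * r"]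
  by (simp add: bump_mass_def)

lemma mkern_nn_integral_D:
  assumes "x \<in> closure D"
  shows "(\<integral>\<^sup>+z. ennreal (mkern n (z - (1 - ms n) *\<^sub>R x)) \<partial>LD) = 1"
proof -
  have "(\<integral>\<^sup>+z. ennreal (mkern n (z - (1 - ms n) *\<^sub>R x)) \<partial>LD) = (\<integral>\<^sup>+z. ennreal (mkern n (z - (1 - ms n) *\<^sub>R x)) \<partial>lborel)"
    unfolding nn_integral_lebesgue_on[OF D_sets(1)]
    by (rule nn_integral_cong) (use mkern_0[OF assms, of _ n] in \<open>auto simp: indicator_def\<close>)
  also have "\<dots> = 1" by (subst nn_integral_eq_integral) (auto simp: mkern_integrable mkern_integral)
  finally show ?thesis .
qed

text \<open>The kernel is normalised in z, not in x; as a function of x it is composed with a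
  contraction, which costs at most 2^d.\<close>

lemma mkern_nn_integral_x:
  "(\<integral>\<^sup>+x. ennreal (mkern n (z - (1 - ms n) *\<^sub>R x)) \<partial>lborel) \<le> ennreal (2 ^ CARD('d))"
proof -
  have "(\<integral>\<^sup>+x. ennreal (mkern n (z + (- (1 - ms n)) *\<^sub>R x)) \<partial>lborel)
    = ennreal (1 / \<bar>- (1 - ms n)\<bar> ^ DIM(real^'d)) * (\<integral>\<^sup>+x. ennreal (mkern n x) \<partial>lborel)"
    by (rule nn_integral_lborel_affine) (use ms[of n] in auto)
  also have "(\<integral>\<^sup>+x. ennreal (mkern n x) \<partial>lborel) = 1"
    using mkern_integrable[of n 0] mkern_integral[of n 0]
    by (subst nn_integral_eq_integral) auto
  also have "1 / \<bar>- (1 - ms n)\<bar> ^ DIM(real^'d) \<le> 2 ^ CARD('d)"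
  proof -
    have "1 / \<bar>- (1 - ms n)\<bar> \<le> 2" using ms[of n] by (simp add: field_simps)
    then have "(1 / \<bar>- (1 - ms n)\<bar>) ^ CARD('d) \<le> 2 ^ CARD('d)" by (intro power_mono) auto
    then show ?thesis by (simp add: power_divide)
  qed
  then have "ennreal (1 / \<bar>- (1 - ms n)\<bar> ^ DIM(real^'d)) * 1 \<le> ennreal (2 ^ CARD('d))"
    by (simp add: ennreal_leI)
  also have "(\<lambda>x. z + (- (1 - ms n)) *\<^sub>R x) = (\<lambda>x. z - (1 - ms n) *\<^sub>R x)"
    by (simp add: algebra_simps)
  finally show ?thesis by simp
qed

lemma mkern_LD [measurable]: "(\<lambda>z. mkern n (z - a)) \<in> borel_measurable LD"
  by (intro borel_imp_lebesgue_on) measurable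

text \<open>Exchanging the integrals leaves only the mass of the kernel in x. Both the L^1 and the
  L^2 bound of \<open>moll\<close> are reduced to this.\<close>

lemma mkern_tonelli:
  assumes "f \<in> borel_measurable LD"
  shows "(\<integral>\<^sup>+x. (\<integral>\<^sup>+z. ennreal (mkern n (z - (1 - ms n) *\<^sub>R x)) * f z \<partial>LD) \<partial>LD)
      \<le> ennreal (2 ^ CARD('d)) * (\<integral>\<^sup>+x. f x \<partial>LD)"
proof -
  obtain g where [measurable]: "g \<in> borel_measurable borel" and g: "AE x in LD. f x = g x"
    using ex_borel_lebesgue_on[OF assms D_sets(1)] .
  have [measurable]: "D \<in> sets borel" by simp
  let ?K = "\<lambda>x z. ennreal (mkern n (z - (1 - ms n) *\<^sub>R x))"
  have "(\<integral>\<^sup>+x. (\<integral>\<^sup>+z. ?K x z * f z \<partial>LD) \<partial>LD) = (\<integral>\<^sup>+x. (\<integral>\<^sup>+z. ?K x z * g z \<partial>LD) \<partial>LD)"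
    by (intro nn_integral_cong nn_integral_cong_AE) (use g in auto)
  also have "\<dots> \<le> (\<integral>\<^sup>+x. (\<integral>\<^sup>+z. ?K x z * (g z * indicator D z) \<partial>lborel) \<partial>lborel)"
    unfolding nn_integral_lebesgue_on[OF D_sets(1)]
    by (intro nn_integral_mono) (auto simp: indicator_def mult.assoc)
  also have "\<dots> = (\<integral>\<^sup>+z. (\<integral>\<^sup>+x. ?K x z * (g z * indicator D z) \<partial>lborel) \<partial>lborel)"
    by (rule lborel_pair.Fubini') measurable
  also have "\<dots> = (\<integral>\<^sup>+z. (\<integral>\<^sup>+x. ?K x z \<partial>lborel) * (g z * indicator D z) \<partial>lborel)"
    by (intro nn_integral_cong nn_integral_multc) measurable
  also have "\<dots> \<le> (\<integral>\<^sup>+z. ennreal (2 ^ CARD('d)) * (g z * indicator D z) \<partial>lborel)"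
    by (intro nn_integral_mono mult_right_mono mkern_nn_integral_x) auto
  also have "\<dots> = ennreal (2 ^ CARD('d)) * (\<integral>\<^sup>+z. g z \<partial>LD)"
    by (simp add: nn_integral_lebesgue_on nn_integral_cmult)
  also have "(\<integral>\<^sup>+z. g z \<partial>LD) = (\<integral>\<^sup>+z. f z \<partial>LD)" by (rule nn_integral_cong_AE) (use g in auto)
  finally show ?thesis .
qed

lemma mkern_scaleR_integrable:
  assumes "integrable LD (g :: real^'d \<Rightarrow> 'b::euclidean_space)"
  shows "integrable LD (\<lambda>z. mkern n (z - a) *\<^sub>R g z)"
proof -
  obtain B where B: "\<And>y. \<bar>mkern n y\<bar> \<le> B" using test_function_bounded[OF mkern_test] by metis
  then have B': "\<bar>mkern n y\<bar> \<le> \<bar>B\<bar>" for y by (meson abs_ge_self order_trans)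
  have [measurable]: "g \<in> borel_measurable LD" using assms by auto
  show ?thesis
  proof (rule Bochner_Integration.integrable_bound[of _ "\<lambda>x. B *\<^sub>R g x"])
    show "AE x in LD. norm (mkern n (x - a) *\<^sub>R g x) \<le> norm (B *\<^sub>R g x)"
      unfolding norm_scaleR by (intro AE_I2 mult_right_mono B') simp
  qed (use assms in auto)
qed

lemma moll_diff:
  assumes "integrable LD f" "integrable LD g"
  shows "moll n (\<lambda>x. f x - g x) x = moll n f x - moll n g x"
  unfolding moll_def by (simp add: scaleR_diff_right mkern_scaleR_integrable assms)

lemma moll_lipschitz:
  obtains L where "L > 0" "\<And>g x y. integrable LD g \<Longrightarrow> norm (moll n g x - moll n g y) \<le> L * norm (x - y) * (\<integral>z. norm (g z) \<partial>LD)"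
proof -
  obtain L where L: "L > 0" "\<And>x y. \<bar>mkern n x - mkern n y\<bar> \<le> L * norm (x - y)"
    using test_function_lipschitz[OF mkern_test] by metis
  show ?thesis
  proof (rule that[OF L(1)])
    fix g :: "real^'d \<Rightarrow> real^3" and x y assume g: "integrable LD g"
    have "moll n g x - moll n g y = (\<integral>z. (mkern n (z - (1 - ms n) *\<^sub>R x) - mkern n (z - (1 - ms n) *\<^sub>R y)) *\<^sub>R g z \<partial>LD)"
      unfolding moll_def by (simp add: scaleR_diff_left mkern_scaleR_integrable g)
    also have "norm \<dots> \<le> (\<integral>z. norm ((mkern n (z - (1 - ms n) *\<^sub>R x) - mkern n (z - (1 - ms n) *\<^sub>R y)) *\<^sub>R g z) \<partial>LD)"
      by (rule integral_norm_bound)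
    also have "\<dots> \<le> (\<integral>z. (L * norm (x - y)) * norm (g z) \<partial>LD)"
    proof (rule integral_mono)
      show "integrable LD (\<lambda>z. norm ((mkern n (z - (1 - ms n) *\<^sub>R x) - mkern n (z - (1 - ms n) *\<^sub>R y)) *\<^sub>R g z))"
        using mkern_scaleR_integrable[OF g] by (auto simp: scaleR_diff_left)
      fix z
      have "\<bar>mkern n (z - (1 - ms n) *\<^sub>R x) - mkern n (z - (1 - ms n) *\<^sub>R y)\<bar> \<le> L * norm ((1 - ms n) *\<^sub>R (y - x))"
        using L(2)[of "z - (1 - ms n) *\<^sub>R x" "z - (1 - ms n) *\<^sub>R y"] by (simp add: scaleR_diff_right)
      also have "\<dots> \<le> L * (1 * norm (y - x))"
        unfolding norm_scaleR using ms[of n] L(1) by (intro mult_left_mono mult_right_mono) auto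
      finally show "norm ((mkern n (z - (1 - ms n) *\<^sub>R x) - mkern n (z - (1 - ms n) *\<^sub>R y)) *\<^sub>R g z) \<le> L * norm (x - y) * norm (g z)"
        by (simp add: norm_minus_commute mult_right_mono)
    qed (use g in auto)
    finally show "norm (moll n g x - moll n g y) \<le> L * norm (x - y) * (\<integral>z. norm (g z) \<partial>LD)"
      by simp
  qed
qed

lemma moll_continuous:
  assumes "integrable LD g" shows "continuous_on S (moll n g)"
proof -
  obtain L where L: "L > 0" "\<And>g x y. integrable LD g \<Longrightarrow> norm (moll n g x - moll n g y) \<le> L * norm (x - y) * (\<integral>z. norm (g z) \<partial>LD)"
    using moll_lipschitz[where n=n] by blast
  have "(L * (\<integral>z. norm (g z) \<partial>LD))-lipschitz_on S (moll n g)"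
    using L(2)[OF assms] L(1) by (intro lipschitz_onI) (auto simp: dist_norm mult_ac)
  then show ?thesis by (rule lipschitz_on_continuous_on)
qed

lemma moll_borel [measurable]: "integrable LD g \<Longrightarrow> moll n g \<in> borel_measurable borel"
  by (intro borel_measurable_continuous_onI moll_continuous)

lemma moll_LD: "integrable LD g \<Longrightarrow> moll n g \<in> borel_measurable LD"
  by (intro borel_imp_lebesgue_on moll_borel)

lemma moll_norm_le:
  assumes "integrable LD g"
  shows "ennreal (norm (moll n g x)) \<le> (\<integral>\<^sup>+z. ennreal (mkern n (z - (1 - ms n) *\<^sub>R x)) * ennreal (norm (g z)) \<partial>LD)"
proof -
  have "norm (moll n g x) \<le> (\<integral>z. norm (mkern n (z - (1 - ms n) *\<^sub>R x) *\<^sub>R g z) \<partial>LD)"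
    unfolding moll_def by (rule integral_norm_bound)
  then have "ennreal (norm (moll n g x)) \<le> ennreal (\<integral>z. norm (mkern n (z - (1 - ms n) *\<^sub>R x) *\<^sub>R g z) \<partial>LD)"
    by (rule ennreal_leI)
  also have "\<dots> = (\<integral>\<^sup>+z. ennreal (norm (mkern n (z - (1 - ms n) *\<^sub>R x) *\<^sub>R g z)) \<partial>LD)"
    using integrable_norm[OF mkern_scaleR_integrable[OF assms]] by (subst nn_integral_eq_integral) auto
  finally show ?thesis by (simp add: ennreal_mult)
qed

lemma moll_L1:
  assumes "integrable LD g"
  shows "(\<integral>\<^sup>+x. ennreal (norm (moll n g x)) \<partial>LD) \<le> ennreal (2 ^ CARD('d)) * (\<integral>\<^sup>+x. ennreal (norm (g x)) \<partial>LD)"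
proof -
  have [measurable]: "g \<in> borel_measurable LD" using assms by auto
  have "(\<integral>\<^sup>+x. ennreal (norm (moll n g x)) \<partial>LD) \<le> (\<integral>\<^sup>+x. (\<integral>\<^sup>+z. ennreal (mkern n (z - (1 - ms n) *\<^sub>R x)) * ennreal (norm (g z)) \<partial>LD) \<partial>LD)"
    by (intro nn_integral_mono moll_norm_le assms)
  also have "\<dots> \<le> ennreal (2 ^ CARD('d)) * (\<integral>\<^sup>+x. ennreal (norm (g x)) \<partial>LD)"
    by (rule mkern_tonelli) measurable
  finally show ?thesis .
qed

lemma sqi_LD_integrable: "sqi LD g \<Longrightarrow> integrable LD g"
  by (rule sqi_imp_integrable(1)[OF finite_LD])

text \<open>Jensen's inequality through Cauchy-Schwarz: the kernel is written as a product of two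
  square roots, one of which integrates to 1 in z, and Tonelli integrates the rest over x.\<close>

lemma moll_L2:
  assumes "sqi LD g"
  shows "sqi LD (moll n g)" "l2n LD (moll n g) \<le> sqrt (2 ^ CARD('d)) * l2n LD g"
proof -
  note g = sqi_LD_integrable[OF assms]
  have [measurable]: "g \<in> borel_measurable LD" using assms by auto

  have "ennreal ((norm (moll n g x))\<^sup>2) \<le> (\<integral>\<^sup>+z. ennreal (mkern n (z - (1 - ms n) *\<^sub>R x)) * ennreal ((norm (g z))\<^sup>2) \<partial>LD)"
    if "x \<in> D" for x
  proof -
    let ?k = "\<lambda>z. mkern n (z - (1 - ms n) *\<^sub>R x)"
    have "ennreal ((norm (moll n g x))\<^sup>2) = (ennreal (norm (moll n g x)))\<^sup>2" by (simp add: ennreal_power)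
    also have "\<dots> \<le> (\<integral>\<^sup>+z. ennreal (?k z) * ennreal (norm (g z)) \<partial>LD)\<^sup>2"
      using moll_norm_le[OF g] by (rule power_mono) simp
    also have "\<dots> = (\<integral>\<^sup>+z. ennreal (sqrt (?k z)) * ennreal (sqrt (?k z) * norm (g z)) \<partial>LD)\<^sup>2"
      by (simp add: ennreal_mult[symmetric] mult.assoc[symmetric])
    also have "\<dots> \<le> (\<integral>\<^sup>+z. (ennreal (sqrt (?k z)))\<^sup>2 \<partial>LD) * (\<integral>\<^sup>+z. (ennreal (sqrt (?k z) * norm (g z)))\<^sup>2 \<partial>LD)"
      by (rule Cauchy_Schwarz_nn_integral) measurable
    also have "(\<integral>\<^sup>+z. (ennreal (sqrt (?k z)))\<^sup>2 \<partial>LD) = 1"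
      using mkern_nn_integral_D[of x n] that closure_subset by (auto simp: ennreal_power subset_eq)
    also have "(\<integral>\<^sup>+z. (ennreal (sqrt (?k z) * norm (g z)))\<^sup>2 \<partial>LD) = (\<integral>\<^sup>+z. ennreal (?k z) * ennreal ((norm (g z))\<^sup>2) \<partial>LD)"
      by (simp add: ennreal_power power_mult_distrib ennreal_mult)
    finally show ?thesis by simp
  qed
  then have "(\<integral>\<^sup>+x. ennreal ((norm (moll n g x))\<^sup>2) \<partial>LD) \<le> (\<integral>\<^sup>+x. (\<integral>\<^sup>+z. ennreal (mkern n (z - (1 - ms n) *\<^sub>R x)) * ennreal ((norm (g z))\<^sup>2) \<partial>LD) \<partial>LD)"
    by (intro nn_integral_mono) simp
  also have "\<dots> \<le> ennreal (2 ^ CARD('d)) * (\<integral>\<^sup>+x. ennreal ((norm (g x))\<^sup>2) \<partial>LD)"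
    by (rule mkern_tonelli) measurable
  also have "\<dots> = ennreal ((sqrt (2 ^ CARD('d)) * l2n LD g)\<^sup>2)"
    unfolding sqi_ennreal[OF assms] by (simp add: power_mult_distrib ennreal_mult)
  finally have *: "(\<integral>\<^sup>+x. ennreal ((norm (moll n g x))\<^sup>2) \<partial>LD) \<le> ennreal ((sqrt (2 ^ CARD('d)) * l2n LD g)\<^sup>2)" .
  show "sqi LD (moll n g)" "l2n LD (moll n g) \<le> sqrt (2 ^ CARD('d)) * l2n LD g"
    using sqiI_ennreal[OF moll_LD[OF g] *] by auto
qed

end

section \<open>Density of continuous functions and convergence of mollifications\<close>

definition clip :: "real \<Rightarrow> 'a::real_normed_vector \<Rightarrow> 'a" where
  "clip N y = (N / max N (norm y)) *\<^sub>R y"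

lemma clip_le: "N > 0 \<Longrightarrow> norm (clip N y) \<le> N"
  by (auto simp: clip_def max_def field_simps)

lemma clip_id: "N > 0 \<Longrightarrow> norm y \<le> N \<Longrightarrow> clip N y = y"
  by (simp add: clip_def max_def)

lemma clip_diff_le:
  assumes "N > 0" shows "norm (y - clip N y) \<le> norm y"
proof -
  have "y - clip N y = (1 - N / max N (norm y)) *\<^sub>R y" by (simp add: clip_def scaleR_diff_left)
  moreover have "0 \<le> N / max N (norm y) \<and> N / max N (norm y) \<le> 1" using assms by (auto simp: max_def divide_le_eq_1)
  then have "\<bar>1 - N / max N (norm y)\<bar> \<le> 1" by linarith
  ultimately show ?thesis by (simp add: mult_left_le_one_le)
qed

lemma continuous_clip: "N > 0 \<Longrightarrow> continuous_on UNIV (clip N)"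
  unfolding clip_def[abs_def] by (intro continuous_intros) (auto simp: max_def)

lemma power_add_le:
  fixes a b :: real assumes "a \<ge> 0" "b \<ge> 0" shows "(a + b) ^ p \<le> 2 ^ p * (a ^ p + b ^ p)"
proof -
  have "(a + b) ^ p \<le> (2 * max a b) ^ p" using assms by (intro power_mono) auto
  also have "\<dots> = 2 ^ p * max a b ^ p" by (simp add: power_mult_distrib)
  also have "\<dots> \<le> 2 ^ p * (a ^ p + b ^ p)" using assms by (intro mult_left_mono) (auto simp: max_def)
  finally show ?thesis .
qed

context convex_dom begin

text \<open>Truncation makes g bounded; truncated continuous functions that converge to it almost
  everywhere then converge in p-th mean by dominated convergence on a finite measure space. The
  general p covers L^1 and L^2 together.\<close>

lemma dense_continuous:
  fixes g :: "real^'d \<Rightarrow> real^3"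
  assumes g[measurable]: "g \<in> borel_measurable LD" and int: "integrable LD (\<lambda>x. norm (g x) ^ p)"
    and "p > 0" "e > 0"
  obtains f where "continuous_on UNIV f" "bounded (range f)" "integrable LD (\<lambda>x. norm (g x - f x) ^ p)"
    "(\<integral>x. norm (g x - f x) ^ p \<partial>LD) < e"
proof -
  interpret finite_measure LD by (rule finite_LD)
  \<comment> \<open>Two errors below e' are combined by (a + b)^p \<le> 2^p (a^p + b^p).\<close>
  define e' where "e' = e / (2 ^ p * 2)"
  have e': "e' > 0" using assms by (simp add: e'_def)
  have [measurable]: "(\<lambda>x. clip (real (Suc n)) (g x)) \<in> borel_measurable LD" for n
    by (rule measurable_compose[OF g borel_measurable_continuous_onI[OF continuous_clip]]) simp
  have "(\<lambda>n. \<integral>x. norm (g x - clip (real (Suc n)) (g x)) ^ p \<partial>LD) \<longlonglongrightarrow> (\<integral>x. 0 \<partial>LD)"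
  proof (rule integral_dominated_convergence[where w="\<lambda>x. norm (g x) ^ p"])
    show "AE x in LD. (\<lambda>n. norm (g x - clip (real (Suc n)) (g x)) ^ p) \<longlonglongrightarrow> 0"
    proof (rule AE_I2)
      fix x
      have "\<forall>\<^sub>F n in sequentially. norm (g x - clip (real (Suc n)) (g x)) ^ p = 0"
        using eventually_ge_at_top[of "nat \<lceil>norm (g x)\<rceil>"]
      proof eventually_elim
        case (elim n)
        then have "norm (g x) \<le> real (Suc n)" by linarith
        then show ?case using \<open>p > 0\<close> by (simp add: clip_id)
      qed
      then show "(\<lambda>n. norm (g x - clip (real (Suc n)) (g x)) ^ p) \<longlonglongrightarrow> 0" by (rule tendsto_eventually)
    qed
    show "AE x in LD. norm (norm (g x - clip (real (Suc n)) (g x)) ^ p) \<le> norm (g x) ^ p" for n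
      using clip_diff_le[of "real (Suc n)"] by (intro AE_I2) (auto intro!: power_mono simp del: of_nat_Suc)
  qed (use int in measurable)
  then have "\<forall>\<^sub>F n in sequentially. (\<integral>x. norm (g x - clip (real (Suc n)) (g x)) ^ p \<partial>LD) < e'"
    using e' by (intro order_tendstoD(2)) auto
  then obtain n0 where n0: "(\<integral>x. norm (g x - clip (real (Suc n0)) (g x)) ^ p \<partial>LD) < e'"
    using eventually_happens' by force
  define N where "N = real (Suc n0)"
  have N: "N > 0" by (simp add: N_def)
  define h where "h = (\<lambda>x. clip N (g x))"
  have [measurable]: "h \<in> borel_measurable LD" unfolding h_def N_def by measurable
  have [measurable]: "(\<lambda>x. clip N (g x)) \<in> borel_measurable LD" unfolding N_def by measurable
  have "(\<lambda>x. if x \<in> D then g x else 0) \<in> borel_measurable lebesgue" by (simp add: borel_measurable_if)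
  from lebesgue_measurable_imp_measurable_on[OF this, of UNIV] obtain Z F where
    Z: "negligible Z" and F: "\<And>n. continuous_on UNIV (F n)"
      "\<And>x. x \<notin> Z \<Longrightarrow> (\<lambda>n. F n x) \<longlonglongrightarrow> (if x \<in> D then g x else 0)"
    by (auto simp: measurable_on_def)
  define f where "f = (\<lambda>n x. clip N (F n x))"
  have fcont: "continuous_on UNIV (f n)" for n
    unfolding f_def by (rule continuous_on_compose2[OF continuous_clip[OF N] F(1)]) simp
  have [measurable]: "f n \<in> borel_measurable LD" for n
    by (intro borel_imp_lebesgue_on borel_measurable_continuous_onI fcont)
  have f_le: "norm (f n x) \<le> N" for n x unfolding f_def by (rule clip_le[OF N])
  have hf_le: "norm (h x - f n x) ^ p \<le> (2 * N) ^ p" for n x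
    using norm_triangle_ineq4[of "h x" "f n x"] clip_le[OF N, of "g x"] f_le[of n x]
    by (intro power_mono) (auto simp: h_def)
  have AEZ: "AE x in LD. x \<notin> Z"
    using Z AE_not_in[of Z lebesgue] by (subst AE_restrict_space_iff) (auto simp: negligible_iff_null_sets elim: eventually_mono)
  have "(\<lambda>n. \<integral>x. norm (h x - f n x) ^ p \<partial>LD) \<longlonglongrightarrow> (\<integral>x. 0 \<partial>LD)"
  proof (rule integral_dominated_convergence[where w="\<lambda>x. (2 * N) ^ p"])
    show "AE x in LD. (\<lambda>n. norm (h x - f n x) ^ p) \<longlonglongrightarrow> 0"
      using AEZ AE_space
    proof eventually_elim
      case (elim x)
      then have "(\<lambda>n. F n x) \<longlonglongrightarrow> g x" using F(2)[of x] by (simp add: space_restrict_space)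
      then have "(\<lambda>n. f n x) \<longlonglongrightarrow> h x"
        unfolding f_def h_def using continuous_clip[OF N, where 'a="real^3"]
        by (auto intro: continuous_on_tendsto_compose[where s=UNIV])
      then have "(\<lambda>n. norm (h x - f n x) ^ p) \<longlonglongrightarrow> norm (h x - h x) ^ p"
        by (intro tendsto_intros)
      moreover have "norm (h x - h x) ^ p = 0" using \<open>p > 0\<close> by simp
      ultimately show ?case by (simp only:)
    qed
  qed (use hf_le in auto)
  then have "\<forall>\<^sub>F n in sequentially. (\<integral>x. norm (h x - f n x) ^ p \<partial>LD) < e'"
    using e' by (intro order_tendstoD(2)) auto
  then obtain n where n: "(\<integral>x. norm (h x - f n x) ^ p \<partial>LD) < e'"
    using eventually_happens' by force
  have i1: "integrable LD (\<lambda>x. norm (g x - h x) ^ p)"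
    by (rule Bochner_Integration.integrable_bound[OF int]) (auto simp: h_def clip_diff_le[OF N] intro!: power_mono)
  have i2: "integrable LD (\<lambda>x. norm (h x - f n x) ^ p)"
    by (rule integrable_const_bound[where B="(2*N)^p"]) (use hf_le in auto)
  have le: "norm (g x - f n x) ^ p \<le> 2 ^ p * (norm (g x - h x) ^ p + norm (h x - f n x) ^ p)" for x
  proof -
    have "norm (g x - f n x) ^ p \<le> (norm (g x - h x) + norm (h x - f n x)) ^ p"
      using norm_triangle_ineq[of "g x - h x" "h x - f n x"] by (intro power_mono) auto
    also have "\<dots> \<le> 2 ^ p * (norm (g x - h x) ^ p + norm (h x - f n x) ^ p)" by (rule power_add_le) auto
    finally show ?thesis .
  qed
  have i3: "integrable LD (\<lambda>x. norm (g x - f n x) ^ p)"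
    by (rule Bochner_Integration.integrable_bound[of _ "\<lambda>x. 2 ^ p * (norm (g x - h x) ^ p + norm (h x - f n x) ^ p)"])
       (use i1 i2 le in \<open>auto intro!: order_trans[OF le]\<close>)
  have "(\<integral>x. norm (g x - f n x) ^ p \<partial>LD) \<le> (\<integral>x. 2 ^ p * (norm (g x - h x) ^ p + norm (h x - f n x) ^ p) \<partial>LD)"
    using i1 i2 i3 le by (intro integral_mono) auto
  also have "\<dots> < 2 ^ p * (e' + e')"
    using i1 i2 n n0 by (auto simp: h_def N_def intro!: mult_strict_left_mono)
  also have "\<dots> = e" by (simp add: e'_def)
  finally show ?thesis using that[of "f n"] fcont f_le i3 by (auto simp: bounded_iff)
qed

text \<open>The kernel at x only sees points at distance at most \<open>ms n * R\<close> from x, so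
  uniform continuity on the compact closure applies.\<close>

lemma moll_uniform:
  fixes f :: "real^'d \<Rightarrow> real^3"
  assumes f: "continuous_on UNIV f" "bounded (range f)" and "e > 0"
  shows "\<forall>\<^sub>F n in sequentially. \<forall>x\<in>D. norm (moll n f x - f x) \<le> e"
proof -
  interpret finite_measure LD by (rule finite_LD)
  obtain B where B: "B > 0" "\<And>x. x \<in> D \<Longrightarrow> norm x \<le> B"
    using bounded_D by (auto simp: bounded_pos)
  define R where "R = norm c + B + r"
  have R: "R > 0" using B r_pos by (auto simp: R_def intro: add_nonneg_pos)
  have "uniformly_continuous_on (closure D) f"
    using bounded_D f(1) by (intro compact_uniformly_continuous) (auto intro: continuous_on_subset)
  then obtain d where d: "d > 0" "\<And>x y. x \<in> closure D \<Longrightarrow> y \<in> closure D \<Longrightarrow> dist y x < d \<Longrightarrow> dist (f y) (f x) < e"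
    using \<open>e > 0\<close> by (auto simp: uniformly_continuous_on_def)
  have fint: "integrable LD f"
  proof -
    obtain C where "\<And>x. norm (f x) \<le> C" using f(2) by (auto simp: bounded_iff)
    then show ?thesis
      using f(1) by (intro integrable_const_bound[where B=C] borel_imp_lebesgue_on borel_measurable_continuous_onI) auto
  qed
  have "(\<lambda>n. ms n * R) \<longlonglongrightarrow> 0 * R"
    unfolding ms_def by (intro tendsto_mult_right) real_asymp
  then have "\<forall>\<^sub>F n in sequentially. ms n * R < d" using d(1) by (intro order_tendstoD(2)) auto
  then show ?thesis
  proof eventually_elim
    case (elim n)
    show ?case
    proof
      fix x assume x: "x \<in> D"
      then have xc: "x \<in> closure D" using closure_subset by blast
      let ?k = "\<lambda>z. mkern n (z - (1 - ms n) *\<^sub>R x)"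
      have ki: "integrable LD ?k"
        using mkern_scaleR_integrable[of "\<lambda>_. 1::real" n] by simp
      have k1: "(\<integral>z. ?k z \<partial>LD) = 1"
        using mkern_nn_integral_D[OF xc, of n] ki
        by (simp add: integral_eq_nn_integral)
      have "moll n f x - f x = (\<integral>z. ?k z *\<^sub>R (f z - f x) \<partial>LD)"
        using k1 ki by (simp add: moll_def scaleR_diff_right mkern_scaleR_integrable[OF fint])
      also have "norm \<dots> \<le> (\<integral>z. norm (?k z *\<^sub>R (f z - f x)) \<partial>LD)" by (rule integral_norm_bound)
      also have "\<dots> \<le> (\<integral>z. ?k z * e \<partial>LD)"
      proof (rule integral_mono_AE)
        show "integrable LD (\<lambda>z. norm (?k z *\<^sub>R (f z - f x)))"
          by (intro integrable_norm mkern_scaleR_integrable) (use fint in auto)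
        show "AE z in LD. norm (?k z *\<^sub>R (f z - f x)) \<le> ?k z * e"
        proof (rule AE_I2)
          fix z assume z: "z \<in> space LD"
          then have zD: "z \<in> D" by (simp add: space_restrict_space)
          show "norm (?k z *\<^sub>R (f z - f x)) \<le> ?k z * e"
          proof (cases "?k z = 0")
            case False
            then have "z \<in> cball (ms n *\<^sub>R c + (1 - ms n) *\<^sub>R x) (ms n * r)"
              using bump_eq_0[OF msr_pos] unfolding mkern_eq by fastforce
            then have 1: "norm (z - (ms n *\<^sub>R c + (1 - ms n) *\<^sub>R x)) \<le> ms n * r"
              by (simp add: dist_norm norm_minus_commute)
            have zx: "z - x = (z - (ms n *\<^sub>R c + (1 - ms n) *\<^sub>R x)) + ms n *\<^sub>R (c - x)"
              by (simp add: algebra_simps)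
            have "norm (z - x) \<le> norm (z - (ms n *\<^sub>R c + (1 - ms n) *\<^sub>R x)) + norm (ms n *\<^sub>R (c - x))"
              unfolding zx by (rule norm_triangle_ineq)
            also have "norm (z - (ms n *\<^sub>R c + (1 - ms n) *\<^sub>R x)) \<le> ms n * r" by (rule 1)
            finally have "norm (z - x) \<le> ms n * r + norm (ms n *\<^sub>R (c - x))" by simp
            also have "norm (ms n *\<^sub>R (c - x)) \<le> ms n * (norm c + B)"
              using ms(1)[of n] norm_triangle_ineq4[of c x] B(2)[OF x] by simp
            also have "ms n * r + ms n * (norm c + B) = ms n * R" by (simp add: R_def algebra_simps)
            finally have "dist z x < d" using elim by (simp add: dist_norm)
            then have "norm (f z - f x) \<le> e" using d(2)[OF xc, of z] zD closure_subset by (force simp: dist_norm)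
            then show ?thesis by (simp add: mult_left_mono)
          qed simp
        qed
      qed (use ki in auto)
      also have "\<dots> = e" using k1 ki by simp
      finally show "norm (moll n f x - f x) \<le> e" .
    qed
  qed
qed

lemma continuous_bounded_sqi:
  fixes f :: "real^'d \<Rightarrow> real^3"
  assumes "continuous_on UNIV f" "bounded (range f)" shows "sqi LD f"
proof -
  obtain C where "\<And>x. norm (f x) \<le> C" using assms(2) by (auto simp: bounded_iff)
  then show ?thesis
    using assms(1) by (intro sqi_bounded[OF finite_LD, where B=C] borel_imp_lebesgue_on borel_measurable_continuous_onI) auto
qed

lemma l2n_uniform_le:
  assumes "sqi LD f" "\<And>x. x \<in> D \<Longrightarrow> norm (f x) \<le> e" "e \<ge> 0"
  shows "l2n LD f \<le> sqrt (measure LD D) * e"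
proof -
  interpret finite_measure LD by (rule finite_LD)
  have "l2n LD f \<le> l2n LD (\<lambda>_. e)"
    by (rule l2n_mono) (use assms in \<open>auto intro: sqi_bounded[OF finite_LD] simp: space_restrict_space\<close>)
  also have "\<dots> = sqrt (measure LD D) * e"
    using assms(3) by (simp add: l2n_def space_restrict_space real_sqrt_mult mult.commute)
  finally show ?thesis .
qed

text \<open>A continuous f is inserted: the uniform L^2 bound controls the mollified difference of g
  and f, uniform convergence the middle term. \<open>A\<close> collects the factors of the three
  errors.\<close>

lemma moll_L2_tendsto:
  assumes g: "sqi LD g"
  shows "(\<lambda>n. l2n LD (\<lambda>x. moll n g x - g x)) \<longlonglongrightarrow> 0"
proof (rule LIMSEQ_I)
  fix e :: real assume "e > 0"
  define A where "A = sqrt (2 ^ CARD('d)) + sqrt (measure LD D) + 1"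
  have A: "A > 0" unfolding A_def by (intro add_nonneg_pos) auto
  define e' where "e' = e / (2 * A)"
  have e': "e' > 0" using \<open>e > 0\<close> A by (simp add: e'_def)
  obtain f where f: "continuous_on UNIV f" "bounded (range f)" "(\<integral>x. norm (g x - f x) ^ 2 \<partial>LD) < e'\<^sup>2"
    using dense_continuous[of g 2 "e'\<^sup>2"] g e' by (auto simp: sqi_def)
  have f_sq: "sqi LD f" by (rule continuous_bounded_sqi[OF f(1,2)])
  have gf: "l2n LD (\<lambda>x. g x - f x) \<le> e'"
    using f(3) e' unfolding l2n_sq[symmetric] by (meson less_eq_real_def power2_le_imp_le)
  have "\<forall>\<^sub>F n in sequentially. l2n LD (\<lambda>x. moll n g x - g x) < e"
    using moll_uniform[OF f(1,2) e']
  proof eventually_elim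
    case (elim n)
    note s = moll_L2(1)[OF g, of n] moll_L2(1)[OF f_sq, of n] f_sq g
    have "(\<lambda>x. moll n g x - moll n f x) = moll n (\<lambda>x. g x - f x)"
      using moll_diff[OF sqi_LD_integrable[OF g] sqi_LD_integrable[OF f_sq]] by auto
    then have "l2n LD (\<lambda>x. moll n g x - moll n f x) = l2n LD (moll n (\<lambda>x. g x - f x))" by simp
    also have "\<dots> \<le> sqrt (2 ^ CARD('d)) * e'"
      using moll_L2(2)[OF sqi_diff[OF g f_sq], of n] gf by (smt (verit) mult_left_mono real_sqrt_ge_zero zero_le_power)
    finally have 1: "l2n LD (\<lambda>x. moll n g x - moll n f x) \<le> sqrt (2 ^ CARD('d)) * e'" .
    have 2: "l2n LD (\<lambda>x. moll n f x - f x) \<le> sqrt (measure LD D) * e'"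
      using elim e' s by (intro l2n_uniform_le sqi_diff) auto
    have "l2n LD (\<lambda>x. moll n g x - g x) \<le> l2n LD (\<lambda>x. moll n g x - moll n f x) + l2n LD (\<lambda>x. moll n f x - f x) + l2n LD (\<lambda>x. f x - g x)"
      using l2n_triangle3[OF s(1,2,4)] l2n_triangle3[OF s(2,3,4)] by simp
    also have "\<dots> \<le> A * e'" using 1 2 gf by (simp add: A_def l2n_minus_commute[of _ f g] algebra_simps)
    also have "\<dots> < e" using A \<open>e > 0\<close> by (simp add: e'_def)
    finally show ?case .
  qed
  then show "\<exists>no. \<forall>n\<ge>no. norm (l2n LD (\<lambda>x. moll n g x - g x) - 0) < e"
    by (auto simp: eventually_sequentially)
qed

lemma moll_L1_real:
  assumes "integrable LD g"
  shows "integrable LD (moll n g)" "(\<integral>x. norm (moll n g x) \<partial>LD) \<le> 2 ^ CARD('d) * (\<integral>x. norm (g x) \<partial>LD)"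
proof -
  have *: "(\<integral>\<^sup>+x. ennreal (norm (moll n g x)) \<partial>LD) \<le> ennreal (2 ^ CARD('d) * (\<integral>x. norm (g x) \<partial>LD))"
    using moll_L1[OF assms, of n] nn_integral_eq_integral[of LD "\<lambda>x. norm (g x)"] assms
    by (simp add: ennreal_mult)
  then show i: "integrable LD (moll n g)"
    using moll_LD[OF assms] by (auto simp: integrable_iff_bounded le_less_trans)
  show "(\<integral>x. norm (moll n g x) \<partial>LD) \<le> 2 ^ CARD('d) * (\<integral>x. norm (g x) \<partial>LD)"
    using * nn_integral_eq_integral[of LD "\<lambda>x. norm (moll n g x)"] i by (simp add: ennreal_le_iff)
qed

text \<open>The fundamental lemma works with functions that are only integrable, where the L^2
  statement says nothing.\<close>

lemma moll_L1_tendsto: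
  assumes g: "integrable LD g"
  shows "(\<lambda>n. \<integral>x. norm (moll n g x - g x) \<partial>LD) \<longlonglongrightarrow> 0"
proof (rule LIMSEQ_I)
  fix e :: real assume "e > 0"
  interpret finite_measure LD by (rule finite_LD)
  define A where "A = 2 ^ CARD('d) + measure LD D + 1"
  have A: "A > 0" unfolding A_def by (intro add_nonneg_pos) auto
  define e' where "e' = e / (2 * A)"
  have e': "e' > 0" using \<open>e > 0\<close> A by (simp add: e'_def)
  obtain f where f: "continuous_on UNIV f" "bounded (range f)" "(\<integral>x. norm (g x - f x) \<partial>LD) < e'"
    using dense_continuous[of g 1 "e'"] g e' by auto
  have fi: "integrable LD f" by (rule sqi_LD_integrable[OF continuous_bounded_sqi[OF f(1,2)]])
  have "\<forall>\<^sub>F n in sequentially. (\<integral>x. norm (moll n g x - g x) \<partial>LD) < e"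
    using moll_uniform[OF f(1,2) e']
  proof eventually_elim
    case (elim n)
    note s = moll_L1_real(1)[OF g, of n] moll_L1_real(1)[OF fi, of n] fi g
    have "(\<integral>x. norm (moll n g x - moll n f x) \<partial>LD) = (\<integral>x. norm (moll n (\<lambda>x. g x - f x) x) \<partial>LD)"
      using moll_diff[OF g fi] by simp
    also have "\<dots> \<le> 2 ^ CARD('d) * e'"
      using moll_L1_real(2)[OF Bochner_Integration.integrable_diff[OF g fi], of n] f(3) by (smt (verit) mult_left_mono zero_le_power)
    finally have 1: "(\<integral>x. norm (moll n g x - moll n f x) \<partial>LD) \<le> 2 ^ CARD('d) * e'" .
    have "(\<integral>x. norm (moll n f x - f x) \<partial>LD) \<le> (\<integral>x. e' \<partial>LD)"
      using s elim by (intro integral_mono) (auto simp: space_restrict_space)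
    then have 2: "(\<integral>x. norm (moll n f x - f x) \<partial>LD) \<le> measure LD D * e'" by (simp add: space_restrict_space)
    have "(\<integral>x. norm (moll n g x - g x) \<partial>LD) \<le> (\<integral>x. norm (moll n g x - moll n f x) + norm (moll n f x - f x) + norm (g x - f x) \<partial>LD)"
    proof (rule integral_mono)
      show "norm (moll n g x - g x) \<le> norm (moll n g x - moll n f x) + norm (moll n f x - f x) + norm (g x - f x)" for x
        using norm_triangle_ineq4[of "(moll n g x - moll n f x) + (moll n f x - f x)" "g x - f x"] norm_triangle_ineq[of "moll n g x - moll n f x" "moll n f x - f x"]
        by simp
    qed (use s in auto)
    also have "\<dots> \<le> A * e'" using 1 2 f(3) s by (simp add: A_def algebra_simps)
    also have "\<dots> < e" using A \<open>e > 0\<close> by (simp add: e'_def)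
    finally show ?case .
  qed
  then show "\<exists>no. \<forall>n\<ge>no. norm ((\<integral>x. norm (moll n g x - g x) \<partial>LD) - 0) < e"
    by (auto simp: eventually_sequentially)
qed

end

section \<open>Weak derivatives\<close>

lemma test_function_scaleR_integrable:
  fixes \<phi> :: "real^'d::finite \<Rightarrow> real"
  assumes "test_function D \<phi>" "locally_integrable D v" "D \<in> sets lebesgue"
  shows "integrable (lebesgue_on D) (\<lambda>x. \<phi> x *\<^sub>R v x)"
proof -
  obtain K where K: "compact K" "K \<subseteq> D" "\<And>x. x \<notin> K \<Longrightarrow> \<phi> x = 0"
    using assms(1) by (auto simp: test_function_def)
  obtain B where B: "\<And>x. \<bar>\<phi> x\<bar> \<le> B" using test_function_bounded[OF assms(1)] by metis
  have i: "integrable lebesgue (\<lambda>x. indicator K x *\<^sub>R v x)"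
    using assms(2) K by (auto simp: locally_integrable_def set_integrable_def)
  have [measurable]: "\<phi> \<in> borel_measurable lebesgue"
    using smooth_continuous[OF test_function_smooth[OF assms(1)], of UNIV]
    by (intro measurable_completion) (simp add: borel_measurable_continuous_onI)
  have "integrable lebesgue (\<lambda>x. \<phi> x *\<^sub>R (indicator K x *\<^sub>R v x))"
  proof (rule Bochner_Integration.integrable_bound[of _ "\<lambda>x. B *\<^sub>R (indicator K x *\<^sub>R v x)"])
    show "AE x in lebesgue. norm (\<phi> x *\<^sub>R (indicator K x *\<^sub>R v x)) \<le> norm (B *\<^sub>R (indicator K x *\<^sub>R v x))"
      unfolding norm_scaleR by (intro AE_I2 mult_right_mono) (auto intro: order_trans[OF B abs_ge_self])
    show "integrable lebesgue (\<lambda>x. B *\<^sub>R (indicator K x *\<^sub>R v x))" by (intro integrable_scaleR_right i)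
    show "(\<lambda>x. \<phi> x *\<^sub>R (indicator K x *\<^sub>R v x)) \<in> borel_measurable lebesgue"
      using borel_measurable_integrable[OF i] by (rule borel_measurable_scaleR[rotated]) measurable
  qed
  also have "(\<lambda>x. \<phi> x *\<^sub>R (indicator K x *\<^sub>R v x)) = (\<lambda>x. indicator D x *\<^sub>R \<phi> x *\<^sub>R v x)"
    using K by (auto simp: indicator_def fun_eq_iff)
  finally show ?thesis using assms(3) by (simp add: integrable_restrict_space)
qed

lemma integrable_imp_locally_integrable:
  assumes "integrable (lebesgue_on D) v" "D \<in> sets lebesgue" shows "locally_integrable D v"
  unfolding locally_integrable_def
proof (intro allI impI)
  fix K assume "compact K \<and> K \<subseteq> D"
  moreover have "set_integrable lebesgue D v"
    using assms by (simp add: set_integrable_def integrable_restrict_space)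
  ultimately show "set_integrable lebesgue K v"
    by (meson set_integrable_subset lmeasurable_compact fmeasurableD)
qed

lemma iter_partial_test: "test_function D \<phi> \<Longrightarrow> test_function D (iter_partial js \<phi>)"
  by (induction js) (auto intro: test_function_frechet)

section \<open>Fundamental lemma, uniqueness and linearity of weak derivatives\<close>

context convex_dom begin

text \<open>For x in the domain the translated kernels are admissible test functions, so every
  mollification of g vanishes there; but the mollifications converge to g in L^1.\<close>

lemma fundamental_lemma_integrable:
  fixes g :: "real^'d \<Rightarrow> real^3"
  assumes g: "integrable LD g" and 0: "\<And>\<phi>. test_function D \<phi> \<Longrightarrow> (\<integral>x. \<phi> x *\<^sub>R g x \<partial>LD) = 0"
  shows "AE x in LD. g x = 0"
proof -
  have "moll n g x = 0" if "x \<in> D" for n x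
    unfolding moll_def using that closure_subset by (intro 0 mkern_test_D) auto
  then have "(\<integral>x. norm (moll n g x - g x) \<partial>LD) = (\<integral>x. norm (g x) \<partial>LD)" for n
    by (intro Bochner_Integration.integral_cong) (auto simp: space_restrict_space)
  then have "(\<integral>x. norm (g x) \<partial>LD) = 0"
    using moll_L1_tendsto[OF g] by (simp add: LIMSEQ_const_iff)
  then show ?thesis
    using integral_nonneg_eq_0_iff_AE[of LD "\<lambda>x. norm (g x)"] g by auto
qed

text \<open>Weak derivatives are a priori only locally integrable. On a copy of D shrunk towards c,
  whose closure is a compact subset of D, they are integrable, and the shrunk copy is again a domain
  of the same kind.\<close>

lemma shrink_convex_dom:
  assumes t: "0 < t" "t < 1"
  shows "convex_dom ((\<lambda>x. (1 - t) *\<^sub>R c + t *\<^sub>R x) ` D) c (t * r)"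
    "compact ((\<lambda>x. (1 - t) *\<^sub>R c + t *\<^sub>R x) ` closure D)"
    "(\<lambda>x. (1 - t) *\<^sub>R c + t *\<^sub>R x) ` closure D \<subseteq> D"
proof -
  show "convex_dom ((\<lambda>x. (1 - t) *\<^sub>R c + t *\<^sub>R x) ` D) c (t * r)"
  proof
    show "open ((\<lambda>x. (1 - t) *\<^sub>R c + t *\<^sub>R x) ` D)" using t open_D by (intro open_affinity) auto
    show "bounded ((\<lambda>x. (1 - t) *\<^sub>R c + t *\<^sub>R x) ` D)"
      using bounded_D by (metis bounded_scaling bounded_translation image_image)
    show "convex ((\<lambda>x. (1 - t) *\<^sub>R c + t *\<^sub>R x) ` D)" using convex_D by (rule convex_affinity)
    show "cball c (t * r) \<subseteq> (\<lambda>x. (1 - t) *\<^sub>R c + t *\<^sub>R x) ` D"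
    proof
      fix z assume z: "z \<in> cball c (t * r)"
      define y where "y = c + (1 / t) *\<^sub>R (z - c)"
      have "norm (y - c) \<le> r" using z t by (simp add: y_def dist_norm norm_minus_commute divide_le_eq mult.commute)
      then have "y \<in> D" using ball_D by (auto simp: dist_norm norm_minus_commute)
      moreover have "z = (1 - t) *\<^sub>R c + t *\<^sub>R y" using t by (simp add: y_def algebra_simps)
      ultimately show "z \<in> (\<lambda>x. (1 - t) *\<^sub>R c + t *\<^sub>R x) ` D" by blast
    qed
  qed (use t r_pos in auto)
  show "compact ((\<lambda>x. (1 - t) *\<^sub>R c + t *\<^sub>R x) ` closure D)"
    using bounded_D by (intro compact_continuous_image continuous_intros) auto
  have cI: "c \<in> interior D" using ball_D r_pos open_D by (auto simp: interior_open)
  show "(\<lambda>x. (1 - t) *\<^sub>R c + t *\<^sub>R x) ` closure D \<subseteq> D"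
  proof clarify
    fix x assume x: "x \<in> closure D"
    show "(1 - t) *\<^sub>R c + t *\<^sub>R x \<in> D"
    proof (cases "x = c")
      case True
      then show ?thesis using cI open_D by (simp add: interior_open flip: scaleR_left_distrib)
    next
      case False
      then have "(1 - t) *\<^sub>R c + t *\<^sub>R x \<in> open_segment c x" using t by (auto simp: in_segment)
      then show ?thesis using in_interior_closure_convex_segment[OF convex_D cI x] open_D
        by (auto simp: interior_open)
    qed
  qed
qed

text \<open>The shrunk copies exhaust D, as the contraction factors \<open>t m\<close> tend to 1,
  and countably many exceptional null sets are collected.\<close>

lemma fundamental_lemma:
  fixes g :: "real^'d \<Rightarrow> real^3"
  assumes g: "locally_integrable D g" and 0: "\<And>\<phi>. test_function D \<phi> \<Longrightarrow> (\<integral>x. \<phi> x *\<^sub>R g x \<partial>LD) = 0"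
  shows "AE x in LD. g x = 0"
proof -
  define t where "t = (\<lambda>m. 1 - 1 / (real m + 2))"
  have t: "0 < t m" "t m < 1" for m by (auto simp: t_def field_simps)
  define E where "E = (\<lambda>m. (\<lambda>x. (1 - t m) *\<^sub>R c + t m *\<^sub>R x) ` D)"
  have E: "AE x in lebesgue. x \<in> E m \<longrightarrow> g x = 0" for m
  proof -
    interpret E: convex_dom "E m" c "t m * r" unfolding E_def by (rule shrink_convex_dom(1)[OF t])
    have sub: "E m \<subseteq> (\<lambda>x. (1 - t m) *\<^sub>R c + t m *\<^sub>R x) ` closure D"
      unfolding E_def using closure_subset by blast
    then have ED: "E m \<subseteq> D" using shrink_convex_dom(3)[OF t] by blast
    have "set_integrable lebesgue ((\<lambda>x. (1 - t m) *\<^sub>R c + t m *\<^sub>R x) ` closure D) g"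
      using g shrink_convex_dom(2,3)[OF t] unfolding locally_integrable_def by blast
    then have "set_integrable lebesgue (E m) g" by (rule set_integrable_subset) (use sub in auto)
    then have int: "integrable (lebesgue_on (E m)) g"
      by (simp add: set_integrable_def integrable_restrict_space)
    have "AE x in lebesgue_on (E m). g x = 0"
    proof (rule E.fundamental_lemma_integrable[OF int])
      fix \<phi> assume \<phi>: "test_function (E m) \<phi>"
      then have "test_function D \<phi>" using ED by (auto simp: test_function_def)
      have z: "\<phi> x = 0" if "x \<notin> E m" for x using \<phi> that by (auto simp: test_function_def)
      have "(\<integral>x. \<phi> x *\<^sub>R g x \<partial>lebesgue_on (E m)) = (\<integral>x. \<phi> x *\<^sub>R g x \<partial>LD)"
        unfolding integral_lebesgue_on_indicator[OF D_sets(1)] integral_lebesgue_on_indicator[OF E.D_sets(1)]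
        by (rule Bochner_Integration.integral_cong) (use ED z in \<open>auto simp: indicator_def\<close>)
      then show "(\<integral>x. \<phi> x *\<^sub>R g x \<partial>lebesgue_on (E m)) = 0" using 0[OF \<open>test_function D \<phi>\<close>] by simp
    qed
    then show ?thesis by (simp add: AE_restrict_space_iff)
  qed
  have "D \<subseteq> (\<Union>m. E m)"
  proof
    fix x assume x: "x \<in> D"
    have "(\<lambda>m. c + (1 / t m) *\<^sub>R (x - c)) \<longlonglongrightarrow> c + (1 / 1) *\<^sub>R (x - c)"
    proof (intro tendsto_intros)
      show "t \<longlonglongrightarrow> 1" unfolding t_def by real_asymp
    qed simp
    then have "(\<lambda>m. c + (1 / t m) *\<^sub>R (x - c)) \<longlonglongrightarrow> x" by simp
    from topological_tendstoD[OF this open_D x] obtain m where m: "c + (1 / t m) *\<^sub>R (x - c) \<in> D"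
      using eventually_happens' by force
    have "x = (1 - t m) *\<^sub>R c + t m *\<^sub>R (c + (1 / t m) *\<^sub>R (x - c))"
      using t[of m] by (simp add: algebra_simps)
    then have "x \<in> E m" unfolding E_def using m by blast
    then show "x \<in> (\<Union>m. E m)" by blast
  qed
  moreover have "AE x in lebesgue. \<forall>m. x \<in> E m \<longrightarrow> g x = 0" unfolding AE_all_countable using E by blast
  ultimately show ?thesis by (subst AE_restrict_space_iff) (auto elim!: eventually_mono)
qed

lemma locally_integrable_diff:
  "locally_integrable D v \<Longrightarrow> locally_integrable D w \<Longrightarrow> locally_integrable D (\<lambda>x. a *\<^sub>R v x + b *\<^sub>R w x)"
  unfolding locally_integrable_def by (auto intro!: set_integral_add set_integrable_scaleR_right)

text \<open>\<open>weak_deriv\<close> is a choice by \<open>SOME\<close>; uniqueness almost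
  everywhere is what connects it with any explicitly known weak derivative.\<close>

lemma weak_deriv_unique:
  assumes "has_weak_deriv D js v w" "has_weak_deriv D js v w'"
  shows "AE x in LD. w x = w' x"
proof -
  have li: "locally_integrable D w" "locally_integrable D w'" using assms by (auto simp: has_weak_deriv_def)
  have "AE x in LD. 1 *\<^sub>R w x + (-1) *\<^sub>R w' x = 0"
  proof (rule fundamental_lemma[OF locally_integrable_diff[OF li]])
    fix \<phi> assume \<phi>: "test_function D \<phi>"
    have "(-1) ^ length js *\<^sub>R (\<integral>x. \<phi> x *\<^sub>R w x \<partial>LD) = (-1::real) ^ length js *\<^sub>R (\<integral>x. \<phi> x *\<^sub>R w' x \<partial>LD)"
      using assms \<phi> by (simp add: has_weak_deriv_def)
    then have "(\<integral>x. \<phi> x *\<^sub>R w x \<partial>LD) = (\<integral>x. \<phi> x *\<^sub>R w' x \<partial>LD)" by simp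
    then show "(\<integral>x. \<phi> x *\<^sub>R (1 *\<^sub>R w x + (-1) *\<^sub>R w' x) \<partial>LD) = 0"
      using test_function_scaleR_integrable[OF \<phi>, of w] test_function_scaleR_integrable[OF \<phi>, of w'] li
      by (simp add: scaleR_diff_right)
  qed
  then show ?thesis by eventually_elim simp
qed

lemma weak_deriv_works: "has_weak_deriv D js v w \<Longrightarrow> has_weak_deriv D js v (weak_deriv D js v)"
  unfolding weak_deriv_def by (rule someI[of "has_weak_deriv D js v"])

lemma weak_deriv_AE: "has_weak_deriv D js v w \<Longrightarrow> AE x in LD. weak_deriv D js v x = w x"
  using weak_deriv_unique[OF weak_deriv_works] .

lemma has_weak_deriv_linear:
  assumes "has_weak_deriv D js v w" "has_weak_deriv D js v' w'"
  shows "has_weak_deriv D js (\<lambda>x. a *\<^sub>R v x + b *\<^sub>R v' x) (\<lambda>x. a *\<^sub>R w x + b *\<^sub>R w' x)"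
proof -
  have li: "locally_integrable D v" "locally_integrable D w" "locally_integrable D v'" "locally_integrable D w'"
    using assms by (auto simp: has_weak_deriv_def)
  have lin: "(\<integral>x. \<phi> x *\<^sub>R (a *\<^sub>R f x + b *\<^sub>R g x) \<partial>LD) = a *\<^sub>R (\<integral>x. \<phi> x *\<^sub>R f x \<partial>LD) + b *\<^sub>R (\<integral>x. \<phi> x *\<^sub>R g x \<partial>LD)"
    if "test_function D \<phi>" "locally_integrable D f" "locally_integrable D g" for \<phi> f g
  proof -
    have "(\<integral>x. \<phi> x *\<^sub>R (a *\<^sub>R f x + b *\<^sub>R g x) \<partial>LD) = (\<integral>x. a *\<^sub>R (\<phi> x *\<^sub>R f x) + b *\<^sub>R (\<phi> x *\<^sub>R g x) \<partial>LD)"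
      by (simp add: scaleR_add_right mult.commute)
    then show ?thesis using test_function_scaleR_integrable[OF that(1)] that
      by (subst (asm) Bochner_Integration.integral_add) (auto simp del: scaleR_scaleR)
  qed
  show ?thesis
    unfolding has_weak_deriv_def
  proof (intro conjI allI impI locally_integrable_diff li)
    fix \<phi> assume \<phi>: "test_function D \<phi>"
    show "(\<integral>x. iter_partial js \<phi> x *\<^sub>R (a *\<^sub>R v x + b *\<^sub>R v' x) \<partial>LD)
      = (- 1) ^ length js *\<^sub>R (\<integral>x. \<phi> x *\<^sub>R (a *\<^sub>R w x + b *\<^sub>R w' x) \<partial>LD)"
      unfolding lin[OF iter_partial_test[OF \<phi>] li(1,3)] lin[OF \<phi> li(2,4)]
      using assms \<phi> by (simp add: has_weak_deriv_def scaleR_add_right mult.commute)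
  qed
qed

text \<open>The derivative in \<tau> falls on the kernel, a test function of z, and the definition
  of weak derivatives moves it to v. The minus sign of the inner derivative cancels the one from
  integration by parts, and the contraction leaves the factor \<open>1 - ms n\<close>. Paths may
  touch the boundary, because the kernel is still supported in D there.\<close>

lemma moll_path_derivative:
  fixes v :: "real^'d \<Rightarrow> real^3"
  assumes w: "\<And>j. has_weak_deriv D [j] v (w j)" and vi: "integrable LD v"
    and p: "p + \<tau> *\<^sub>R q \<in> closure D"
  shows "((\<lambda>\<tau>. moll n v (p + \<tau> *\<^sub>R q)) has_vector_derivative
           (\<Sum>j\<in>UNIV. ((1 - ms n) * q $ j) *\<^sub>R moll n (w j) (p + \<tau> *\<^sub>R q))) (at \<tau>)"
proof -
  let ?s = "1 - ms n"
  let ?P = "\<lambda>\<tau>. p + \<tau> *\<^sub>R q"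
  let ?F = "\<lambda>y. frechet_derivative (mkern n) (at y)"
  have sm: "smooth (mkern n)" using mkern_test test_function_smooth by blast
  note dk = smooth_imp_has_derivative[OF sm]
  obtain B where B: "\<And>y. \<bar>mkern n y\<bar> \<le> B" using test_function_bounded[OF mkern_test] by metis
  obtain L where L: "L > 0" "\<And>x y. \<bar>mkern n x - mkern n y\<bar> \<le> L * norm (x - y)"
    using test_function_lipschitz[OF mkern_test] by metis
  have lin: "linear (?F y)" for y using dk has_derivative_linear by blast
  have "((\<lambda>\<tau>. \<integral>z. mkern n (z - ?s *\<^sub>R ?P \<tau>) *\<^sub>R v z \<partial>LD) has_vector_derivative
        (\<integral>z. ?F (z - ?s *\<^sub>R ?P \<tau>) (- (?s *\<^sub>R q)) *\<^sub>R v z \<partial>LD)) (at \<tau>)"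
  proof (rule has_vector_derivative_integral[where B=B and L="L * norm (?s *\<^sub>R q)"])
    show "\<bar>mkern n (z - ?s *\<^sub>R ?P s) - mkern n (z - ?s *\<^sub>R ?P \<tau>)\<bar> \<le> L * norm (?s *\<^sub>R q) * \<bar>s - \<tau>\<bar>" for s z
    proof -
      have "(z - ?s *\<^sub>R ?P s) - (z - ?s *\<^sub>R ?P \<tau>) = (\<tau> - s) *\<^sub>R (?s *\<^sub>R q)" by (simp add: algebra_simps)
      then have "norm ((z - ?s *\<^sub>R ?P s) - (z - ?s *\<^sub>R ?P \<tau>)) = \<bar>s - \<tau>\<bar> * norm (?s *\<^sub>R q)"
        by (simp only: norm_scaleR abs_minus_commute)
      then show ?thesis using L(2)[of "z - ?s *\<^sub>R ?P s" "z - ?s *\<^sub>R ?P \<tau>"] by (simp only: mult.assoc mult.commute mult.left_commute)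
    qed
    show "((\<lambda>s. mkern n (z - ?s *\<^sub>R ?P s)) has_real_derivative ?F (z - ?s *\<^sub>R ?P \<tau>) (- (?s *\<^sub>R q))) (at \<tau>)" for z
    proof -
      have "((\<lambda>s. z - ?s *\<^sub>R ?P s) has_derivative (\<lambda>h. h *\<^sub>R (- (?s *\<^sub>R q)))) (at \<tau>)"
        by (auto intro!: derivative_eq_intros simp: algebra_simps)
      from has_derivative_compose[OF this dk]
      have "((\<lambda>s. mkern n (z - ?s *\<^sub>R ?P s)) has_derivative (\<lambda>h. ?F (z - ?s *\<^sub>R ?P \<tau>) (h *\<^sub>R (- (?s *\<^sub>R q))))) (at \<tau>)" .
      then show ?thesis
        unfolding has_field_derivative_def
        by (rule has_derivative_eq_rhs) (auto simp only: linear_cmul[OF lin] real_scaleR_def mult.commute)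
    qed
  qed (use B vi in auto)
  also have "(\<integral>z. ?F (z - ?s *\<^sub>R ?P \<tau>) (- (?s *\<^sub>R q)) *\<^sub>R v z \<partial>LD)
      = (\<Sum>j\<in>UNIV. (?s * q $ j) *\<^sub>R moll n (w j) (?P \<tau>))"
  proof -
    let ?\<phi> = "\<lambda>z. mkern n (z - ?s *\<^sub>R ?P \<tau>)"
    have ip: "iter_partial [j] ?\<phi> z = ?F (z - ?s *\<^sub>R ?P \<tau>) (axis j 1)" for j z
    proof -
      have "((\<lambda>z. z - ?s *\<^sub>R ?P \<tau>) has_derivative (\<lambda>h. h)) (at z)"
        by (auto intro!: derivative_eq_intros)
      from has_derivative_compose[OF this dk]
      have "(?\<phi> has_derivative ?F (z - ?s *\<^sub>R ?P \<tau>)) (at z)" by simp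
      then show ?thesis using frechet_derivative_at by (metis iter_partial.simps)
    qed
    have \<phi>: "test_function D ?\<phi>" by (rule mkern_test_D[OF p])
    have vl: "locally_integrable D v" using w by (auto simp: has_weak_deriv_def)
    have "?F y (- (?s *\<^sub>R q)) = (\<Sum>j\<in>UNIV. - (?s * q $ j) * ?F y (axis j 1))" for y
    proof -
      have "- (?s *\<^sub>R q) = (\<Sum>j\<in>UNIV. (- (?s * q $ j)) *\<^sub>R axis j 1)"
        using basis_expansion[of "- (?s *\<^sub>R q)"] by (simp add: scalar_mult_eq_scaleR)
      then have "?F y (- (?s *\<^sub>R q)) = ?F y (\<Sum>j\<in>UNIV. (- (?s * q $ j)) *\<^sub>R axis j 1)" by simp
      then show ?thesis by (simp only: linear_sum[OF lin] linear_cmul[OF lin] real_scaleR_def)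
    qed
    then have "(\<integral>z. ?F (z - ?s *\<^sub>R ?P \<tau>) (- (?s *\<^sub>R q)) *\<^sub>R v z \<partial>LD)
      = (\<integral>z. (\<Sum>j\<in>UNIV. - (?s * q $ j) *\<^sub>R (iter_partial [j] ?\<phi> z *\<^sub>R v z)) \<partial>LD)"
      by (simp only: ip scaleR_sum_left scaleR_scaleR)
    also have "\<dots> = (\<Sum>j\<in>UNIV. - (?s * q $ j) *\<^sub>R (\<integral>z. iter_partial [j] ?\<phi> z *\<^sub>R v z \<partial>LD))"
      using test_function_scaleR_integrable[OF iter_partial_test[OF \<phi>] vl]
      by (subst Bochner_Integration.integral_sum) (auto simp del: iter_partial.simps scaleR_scaleR)
    also have "\<dots> = (\<Sum>j\<in>UNIV. (?s * q $ j) *\<^sub>R (\<integral>z. ?\<phi> z *\<^sub>R w j z \<partial>LD))"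
      using w \<phi> by (intro sum.cong) (auto simp: has_weak_deriv_def simp del: iter_partial.simps)
    finally show ?thesis by (simp add: moll_def)
  qed
  finally show ?thesis by (simp add: moll_def)
qed

end

section \<open>The space \<open>H\<^sup>1\<close>\<close>

context convex_dom begin

lemma Lp2_iff: "v \<in> Lp_set D 2 \<longleftrightarrow> sqi LD v"
  by (simp add: Lp_set_def sqi_def)

text \<open>Completeness of Lebesgue measure. It transfers measurability to the chosen weak
  derivatives, which are known only almost everywhere.\<close>

lemma AE_measurable:
  fixes f g :: "real^'d \<Rightarrow> real^3"
  assumes "f \<in> borel_measurable LD" "AE x in LD. g x = f x" shows "g \<in> borel_measurable LD"
proof -
  have "(\<lambda>x. if x \<in> D then f x else 0) \<in> borel_measurable lebesgue" using assms(1) by (simp add: borel_measurable_if)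
  moreover have "AE x in lebesgue. (if x \<in> D then f x else 0) = (if x \<in> D then g x else 0)"
    using assms(2) by (subst (asm) AE_restrict_space_iff) (auto elim!: eventually_mono)
  ultimately have "(\<lambda>x. if x \<in> D then g x else 0) \<in> borel_measurable lebesgue"
    by (rule borel_measurable_AE)
  then show ?thesis by (simp add: borel_measurable_if)
qed

lemma sqi_locally_integrable: "sqi LD v \<Longrightarrow> locally_integrable D v"
  by (intro integrable_imp_locally_integrable sqi_LD_integrable) auto

lemma has_weak_deriv_Nil: "sqi LD v \<Longrightarrow> has_weak_deriv D [] v v"
  by (simp add: has_weak_deriv_def sqi_locally_integrable)

lemma weak_deriv_sqi:
  assumes "has_weak_deriv D js v w" "sqi LD w" shows "sqi LD (weak_deriv D js v)"
proof -
  note AE = weak_deriv_AE[OF assms(1)]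
  have "AE x in LD. w x = weak_deriv D js v x" using AE by eventually_elim (rule sym)
  then show ?thesis using sqi_cong_AE[OF assms(2) AE_measurable[OF sqiD(1)[OF assms(2)] AE]] by blast
qed

lemma H1_I:
  assumes "sqi LD v" "\<And>j. has_weak_deriv D [j] v (w j)" "\<And>j. sqi LD (w j)"
  shows "v \<in> H_set D 1"
  unfolding Sobolev_set_def
proof (intro CollectI conjI allI impI)
  show "v \<in> Lp_set D 2" using assms(1) by (simp add: Lp2_iff)
  fix js :: "'d list" assume "length js \<le> 1"
  then consider "js = []" | j where "js = [j]" by (cases js) auto
  then show "\<exists>w\<in>Lp_set D 2. has_weak_deriv D js v w"
  proof cases
    case 1
    then show ?thesis using assms(1) has_weak_deriv_Nil[OF assms(1)] unfolding Bex_def Lp2_iff by blast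
  next
    case 2
    then show ?thesis using assms(2)[of j] assms(3)[of j] unfolding Bex_def Lp2_iff by blast
  qed
qed

abbreviation pd where "pd j v \<equiv> weak_deriv D [j] v"

lemma H1_D:
  assumes "v \<in> H_set D 1"
  shows "sqi LD v" "has_weak_deriv D [j] v (pd j v)" "sqi LD (pd j v)"
proof -
  show "sqi LD v" using assms by (simp add: Sobolev_set_def Lp2_iff)
  have "length [j] \<le> 1" by simp
  then have "\<exists>w\<in>Lp_set D 2. has_weak_deriv D [j] v w"
    using assms unfolding Sobolev_set_def mem_Collect_eq by meson
  then obtain w where w: "sqi LD w" "has_weak_deriv D [j] v w" unfolding Bex_def Lp2_iff by blast
  show "has_weak_deriv D [j] v (pd j v)" by (rule weak_deriv_works[OF w(2)])
  show "sqi LD (pd j v)" by (rule weak_deriv_sqi[OF w(2,1)])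
qed

lemma H1_lin:
  assumes "v \<in> H_set D 1" "w \<in> H_set D 1"
  shows "(\<lambda>x. a *\<^sub>R v x + b *\<^sub>R w x) \<in> H_set D 1"
    "AE x in LD. pd j (\<lambda>x. a *\<^sub>R v x + b *\<^sub>R w x) x = a *\<^sub>R pd j v x + b *\<^sub>R pd j w x"
proof -
  note d = has_weak_deriv_linear[OF H1_D(2)[OF assms(1)] H1_D(2)[OF assms(2)], where a=a and b=b]
  show "(\<lambda>x. a *\<^sub>R v x + b *\<^sub>R w x) \<in> H_set D 1"
    by (rule H1_I[OF _ d]) (intro sqi_add sqi_scaleR H1_D assms)+
  show "AE x in LD. pd j (\<lambda>x. a *\<^sub>R v x + b *\<^sub>R w x) x = a *\<^sub>R pd j v x + b *\<^sub>R pd j w x"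
    by (rule weak_deriv_AE[OF d])
qed

lemma H1_diff:
  assumes "v \<in> H_set D 1" "w \<in> H_set D 1"
  shows "(\<lambda>x. v x - w x) \<in> H_set D 1" "AE x in LD. pd j (\<lambda>x. v x - w x) x = pd j v x - pd j w x"
  using H1_lin[OF assms, where a=1 and b="-1"] by auto

lemma H1_add:
  assumes "v \<in> H_set D 1" "w \<in> H_set D 1"
  shows "(\<lambda>x. v x + w x) \<in> H_set D 1" "AE x in LD. pd j (\<lambda>x. v x + w x) x = pd j v x + pd j w x"
  using H1_lin[OF assms, where a=1 and b=1] by auto

lemma H1_scaleR:
  assumes "v \<in> H_set D 1"
  shows "(\<lambda>x. a *\<^sub>R v x) \<in> H_set D 1" "AE x in LD. pd j (\<lambda>x. a *\<^sub>R v x) x = a *\<^sub>R pd j v x"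
  using H1_lin[OF assms assms, where a=a and b=0] by auto

lemma H1_zero: "(\<lambda>x. 0) \<in> H_set D 1"
  by (rule H1_I[where w="\<lambda>_ _. 0"]) (auto simp: has_weak_deriv_def sqi_locally_integrable)

text \<open>The case e = 1 is the H^1 inner product, e = \<epsilon> is the one of the discrete time
  derivative; keeping e as a parameter lets one theory serve both.\<close>

definition hip :: "real \<Rightarrow> (real^'d \<Rightarrow> real^3) \<Rightarrow> (real^'d \<Rightarrow> real^3) \<Rightarrow> real" where
  "hip e v w = ip D v w + e * ip_grad D v w"

definition hn :: "real \<Rightarrow> (real^'d \<Rightarrow> real^3) \<Rightarrow> real" where
  "hn e v = sqrt (hip e v v)"

lemma ip_commute: "ip D v w = ip D w v" by (simp add: ip_def inner_commute)

lemma ip_lin: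
  assumes "sqi LD v" "sqi LD w" "sqi LD z"
  shows "ip D (\<lambda>x. a *\<^sub>R v x + b *\<^sub>R w x) z = a * ip D v z + b * ip D w z"
  using sqi_inner_integrable[OF assms(1,3)] sqi_inner_integrable[OF assms(2,3)]
  by (simp add: ip_def inner_add_left)

lemma ip_cong_AE:
  assumes "sqi LD v" "sqi LD v'" "sqi LD z" "AE x in LD. v x = v' x" shows "ip D v z = ip D v' z"
  unfolding ip_def
  using assms by (intro integral_cong_AE borel_measurable_inner) (auto elim!: eventually_mono)

lemma ip_self: "ip D v v = (l2n LD v)\<^sup>2" by (simp add: ip_def l2n_sq power2_norm_eq_inner)

lemma ip_le: "sqi LD v \<Longrightarrow> sqi LD w \<Longrightarrow> \<bar>ip D v w\<bar> \<le> l2n LD v * l2n LD w"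
  unfolding ip_def by (rule l2n_inner_le)

lemma ip_grad_lin:
  assumes "v \<in> H_set D 1" "w \<in> H_set D 1" "z \<in> H_set D 1"
  shows "ip_grad D (\<lambda>x. a *\<^sub>R v x + b *\<^sub>R w x) z = a * ip_grad D v z + b * ip_grad D w z"
proof -
  have "ip D (pd j (\<lambda>x. a *\<^sub>R v x + b *\<^sub>R w x)) (pd j z) = a * ip D (pd j v) (pd j z) + b * ip D (pd j w) (pd j z)" for j
  proof -
    have "ip D (pd j (\<lambda>x. a *\<^sub>R v x + b *\<^sub>R w x)) (pd j z) = ip D (\<lambda>x. a *\<^sub>R pd j v x + b *\<^sub>R pd j w x) (pd j z)"
      by (intro ip_cong_AE H1_lin H1_D sqi_add sqi_scaleR assms)
    then show ?thesis using assms by (simp add: ip_lin H1_D(3))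
  qed
  then show ?thesis by (simp add: ip_grad_def sum.distrib sum_distrib_left)
qed

lemma hip_lin:
  assumes "v \<in> H_set D 1" "w \<in> H_set D 1" "z \<in> H_set D 1"
  shows "hip e (\<lambda>x. a *\<^sub>R v x + b *\<^sub>R w x) z = a * hip e v z + b * hip e w z"
  using ip_grad_lin[OF assms] ip_lin[of v w z] assms by (simp add: hip_def H1_D algebra_simps)

lemma hip_commute: "hip e v w = hip e w v"
  by (simp add: hip_def ip_grad_def ip_commute)

lemma hip_diff:
  assumes "v \<in> H_set D 1" "w \<in> H_set D 1" "z \<in> H_set D 1"
  shows "hip e (\<lambda>x. v x - w x) z = hip e v z - hip e w z"
  using hip_lin[OF assms, of e 1 "-1"] by simp

lemma hip_self: "hip e v v = (l2n LD v)\<^sup>2 + e * (\<Sum>j\<in>UNIV. (l2n LD (pd j v))\<^sup>2)"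
  by (simp add: hip_def ip_grad_def ip_self)

lemma hip_self_nonneg: "e \<ge> 0 \<Longrightarrow> hip e v v \<ge> 0"
  unfolding hip_self by (intro add_nonneg_nonneg mult_nonneg_nonneg sum_nonneg) auto

lemma hn_sq: "e \<ge> 0 \<Longrightarrow> (hn e v)\<^sup>2 = hip e v v" by (simp add: hn_def hip_self_nonneg)

lemma hn_nonneg [simp]: "e \<ge> 0 \<Longrightarrow> hn e v \<ge> 0" by (simp add: hn_def hip_self_nonneg)

lemma hip_Cauchy_Schwarz:
  assumes "e \<ge> 0" "v \<in> H_set D 1" "w \<in> H_set D 1" shows "\<bar>hip e v w\<bar> \<le> hn e v * hn e w"
proof -
  have "(hip e v w)\<^sup>2 \<le> hip e v v * hip e w w"
  proof (rule sqrt_bound_quadratic)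
    fix t :: real
    let ?z = "\<lambda>x. 1 *\<^sub>R v x + (- t) *\<^sub>R w x"
    have z: "?z \<in> H_set D 1" using assms by (intro H1_lin(1))
    have "0 \<le> hip e ?z ?z" using assms by (intro hip_self_nonneg)
    also have "hip e ?z ?z = hip e v ?z - t * hip e w ?z" using hip_lin[OF assms(2,3) z, of e 1 "-t"] by simp
    also have "hip e v ?z = hip e v v - t * hip e v w"
      using hip_lin[OF assms(2,3,2), of e 1 "-t"] by (simp add: hip_commute)
    also have "hip e w ?z = hip e v w - t * hip e w w"
      using hip_lin[OF assms(2,3,3), of e 1 "-t"] by (simp add: hip_commute)
    finally show "0 \<le> hip e v v - 2 * t * hip e v w + t\<^sup>2 * hip e w w"
      by (simp add: algebra_simps power2_eq_square)
  qed (use assms hip_self_nonneg in auto)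
  then have "(\<bar>hip e v w\<bar>)\<^sup>2 \<le> (hn e v * hn e w)\<^sup>2" using assms(1) by (simp add: power_mult_distrib hn_sq)
  then show ?thesis by (rule power2_le_imp_le) (use assms in auto)
qed

lemma hn_triangle:
  assumes "e \<ge> 0" "v \<in> H_set D 1" "w \<in> H_set D 1" shows "hn e (\<lambda>x. v x + w x) \<le> hn e v + hn e w"
proof -
  note vw = H1_add(1)[OF assms(2,3)]
  have "(hn e (\<lambda>x. v x + w x))\<^sup>2 = hip e v (\<lambda>x. v x + w x) + hip e w (\<lambda>x. v x + w x)"
    using hip_lin[OF assms(2,3) vw, of e 1 1] assms(1) by (simp add: hn_sq)
  also have "\<dots> \<le> hn e v * hn e (\<lambda>x. v x + w x) + hn e w * hn e (\<lambda>x. v x + w x)"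
    using hip_Cauchy_Schwarz[OF assms(1,2) vw] hip_Cauchy_Schwarz[OF assms(1,3) vw] by linarith
  finally have *: "hn e (\<lambda>x. v x + w x) * hn e (\<lambda>x. v x + w x) \<le> (hn e v + hn e w) * hn e (\<lambda>x. v x + w x)"
    by (simp add: power2_eq_square algebra_simps)
  show ?thesis
  proof (cases "hn e (\<lambda>x. v x + w x) = 0")
    case False
    then have "hn e (\<lambda>x. v x + w x) > 0" using hn_nonneg[OF assms(1)] by (simp add: less_le)
    then show ?thesis using * by (simp add: mult_le_cancel_right)
  qed (use assms(1) in simp)
qed

lemma hn_minus:
  assumes "e \<ge> 0" "v \<in> H_set D 1" shows "hn e (\<lambda>x. - v x) = hn e v"
proof -
  have m: "(\<lambda>x. - v x) \<in> H_set D 1" using H1_scaleR(1)[OF assms(2), of "-1"] by simp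
  have "hip e (\<lambda>x. - v x) z = - hip e v z" if "z \<in> H_set D 1" for z
    using hip_lin[OF assms(2) assms(2) that, of e "-1" 0] by simp
  then show ?thesis using m assms(2) by (simp add: hn_def hip_commute[of e v "\<lambda>x. - v x"])
qed

lemma hn_triangle_diff:
  assumes "e \<ge> 0" "v \<in> H_set D 1" "w \<in> H_set D 1" shows "hn e (\<lambda>x. v x - w x) \<le> hn e v + hn e w"
proof -
  have m: "(\<lambda>x. - w x) \<in> H_set D 1" using H1_scaleR(1)[OF assms(3), of "-1"] by simp
  show ?thesis using hn_triangle[OF assms(1,2) m] hn_minus[OF assms(1,3)] by simp
qed

lemma hn_diff_commute:
  assumes "e \<ge> 0" "v \<in> H_set D 1" "w \<in> H_set D 1" shows "hn e (\<lambda>x. v x - w x) = hn e (\<lambda>x. w x - v x)"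
  using hn_minus[OF assms(1) H1_diff(1)[OF assms(2,3)]] by simp

lemma l2n_le_hn: "e \<ge> 0 \<Longrightarrow> l2n LD v \<le> hn e v"
  unfolding hn_def hip_self by (rule real_le_rsqrt) (simp add: sum_nonneg)

lemma pd_le_hn:
  assumes "e > 0" shows "l2n LD (pd j v) \<le> hn e v / sqrt e"
proof -
  have "(l2n LD (pd j v))\<^sup>2 \<le> (\<Sum>j\<in>UNIV. (l2n LD (pd j v))\<^sup>2)" by (rule member_le_sum) auto
  then have "e * (l2n LD (pd j v))\<^sup>2 \<le> hip e v v" unfolding hip_self using assms
    by (smt (verit) mult_left_mono zero_le_power2)
  then have "sqrt (e * (l2n LD (pd j v))\<^sup>2) \<le> hn e v" unfolding hn_def by (rule real_sqrt_le_mono)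
  then show ?thesis using assms by (simp add: real_sqrt_mult field_simps)
qed

text \<open>Multi-indices are lists, so orders up to 1 are the empty list and the singletons. Even
  \<open>weak_deriv D [] v\<close> is a chosen function and agrees with v only almost
  everywhere.\<close>

lemma H1_norm_eq:
  assumes "v \<in> H_set D 1" shows "H_norm D 1 v = hn 1 v"
proof -
  have set: "{js :: 'd list. length js \<le> 1} = insert [] (range (\<lambda>j. [j]))"
  proof -
    have "length js \<le> 1 \<longleftrightarrow> js = [] \<or> (\<exists>j. js = [j])" for js :: "'d list"
      by (cases js) auto
    then show ?thesis by auto
  qed
  have lp: "Lp_norm D 2 w powr 2 = (l2n LD w)\<^sup>2" for w :: "real^'d \<Rightarrow> real^3"
    by (simp add: Lp_norm_def l2n_sq powr_powr)
  have nil: "l2n LD (weak_deriv D [] v) = l2n LD v"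
    using weak_deriv_AE[OF has_weak_deriv_Nil[OF H1_D(1)[OF assms]]] H1_D(1)[OF assms]
      weak_deriv_sqi[OF has_weak_deriv_Nil[OF H1_D(1)[OF assms]] H1_D(1)[OF assms]]
    by (intro l2n_cong_AE) auto
  have "(\<Sum>js | length js \<le> 1. Lp_norm D 2 (weak_deriv D js v) powr 2) = (l2n LD v)\<^sup>2 + (\<Sum>j\<in>UNIV. (l2n LD (pd j v))\<^sup>2)"
    unfolding set by (subst sum.insert) (auto simp: lp nil sum.reindex inj_on_def)
  then show ?thesis unfolding Sobolev_norm_def
    by (simp add: hn_def hip_self powr_half_sqrt sum_nonneg)
qed

text \<open>This conversion is where negative powers of \<epsilon> enter the error constant; e \<le>
  1 takes care of the L^2 part.\<close>

lemma hn_1_le: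
  assumes "0 < e" "e \<le> 1" shows "hn 1 v \<le> hn e v / sqrt e"
proof -
  have "hip 1 v v * e \<le> hip e v v"
    unfolding hip_self using assms by (simp add: algebra_simps mult_left_le_one_le)
  then have "sqrt (hip 1 v v * e) \<le> hn e v" unfolding hn_def by (rule real_sqrt_le_mono)
  then show ?thesis using assms by (simp add: real_sqrt_mult hn_def field_simps)
qed

lemma hn_le_1:
  assumes "0 \<le> e" "e \<le> 1" shows "hn e v \<le> hn 1 v"
  unfolding hn_def hip_self using assms
  by (intro real_sqrt_le_mono add_left_mono mult_right_mono sum_nonneg) auto

end

section \<open>Integral inequalities along segments\<close>

lemma nn_integral_powr_01:
  assumes "\<alpha> > -1"
  shows "(\<integral>\<^sup>+\<tau>. ennreal (\<tau> powr \<alpha>) * indicator {0..1} \<tau> \<partial>lborel) = ennreal (1 / (\<alpha> + 1))"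
  using nn_integral_has_integral_lebesgue'[OF _ has_integral_powr_from_0[OF assms, of 1]] by simp

text \<open>The exponent is split so that \<open>\<tau> powr (2 * a)\<close> is integrable at 0,
  while the power 2 b stays with G to absorb the Jacobian of a later contraction.\<close>

lemma Cauchy_Schwarz_powr_01:
  fixes G :: "real \<Rightarrow> ennreal"
  assumes [measurable]: "G \<in> borel_measurable borel" and ab: "a > -1/2"
  shows "(\<integral>\<^sup>+\<tau>. ennreal (\<tau> powr (a + b)) * G \<tau> * indicator {0..1} \<tau> \<partial>lborel)\<^sup>2
    \<le> ennreal (1 / (2 * a + 1)) * (\<integral>\<^sup>+\<tau>. ennreal (\<tau> powr (2 * b)) * (G \<tau>)\<^sup>2 * indicator {0..1} \<tau> \<partial>lborel)"
proof -
  have sq: "(x powr c)\<^sup>2 = x powr (2 * c)" for x c :: real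
    by (simp add: power2_eq_square powr_add[symmetric])
  have isq: "(indicator {0..1} x)\<^sup>2 = (indicator {0..1} x :: ennreal)" for x :: real by (simp add: indicator_def)
  have "(\<integral>\<^sup>+\<tau>. ennreal (\<tau> powr (a + b)) * G \<tau> * indicator {0..1} \<tau> \<partial>lborel)
    = (\<integral>\<^sup>+\<tau>. (ennreal (\<tau> powr a) * indicator {0..1} \<tau>) * (ennreal (\<tau> powr b) * G \<tau> * indicator {0..1} \<tau>) \<partial>lborel)"
    by (rule nn_integral_cong) (auto simp: powr_add ennreal_mult indicator_def mult_ac)
  then have "(\<integral>\<^sup>+\<tau>. ennreal (\<tau> powr (a + b)) * G \<tau> * indicator {0..1} \<tau> \<partial>lborel)\<^sup>2
    \<le> (\<integral>\<^sup>+\<tau>. (ennreal (\<tau> powr a) * indicator {0..1} \<tau>)\<^sup>2 \<partial>lborel) * (\<integral>\<^sup>+\<tau>. (ennreal (\<tau> powr b) * G \<tau> * indicator {0..1} \<tau>)\<^sup>2 \<partial>lborel)"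
    by (simp only:) (rule Cauchy_Schwarz_nn_integral; measurable)
  also have "(\<integral>\<^sup>+\<tau>. (ennreal (\<tau> powr a) * indicator {0..1} \<tau>)\<^sup>2 \<partial>lborel) = ennreal (1 / (2 * a + 1))"
    using nn_integral_powr_01[of "2 * a"] ab by (simp add: power_mult_distrib ennreal_power sq isq)
  also have "(\<integral>\<^sup>+\<tau>. (ennreal (\<tau> powr b) * G \<tau> * indicator {0..1} \<tau>)\<^sup>2 \<partial>lborel)
     = (\<integral>\<^sup>+\<tau>. ennreal (\<tau> powr (2 * b)) * (G \<tau>)\<^sup>2 * indicator {0..1} \<tau> \<partial>lborel)"
    by (simp add: power_mult_distrib ennreal_power sq isq)
  finally show ?thesis .
qed

text \<open>The contraction towards a maps the convex set K into itself; substituting costs the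
  inverse Jacobian.\<close>

lemma nn_integral_segment_le:
  fixes a :: "'a::euclidean_space"
  assumes [measurable]: "h \<in> borel_measurable borel" "K \<in> sets borel"
    and K: "convex K" "a \<in> K" and \<tau>: "0 < \<tau>" "\<tau> \<le> 1"
  shows "(\<integral>\<^sup>+x. h (a + \<tau> *\<^sub>R (x - a)) * indicator K x \<partial>lborel)
      \<le> ennreal (1 / \<tau> ^ DIM('a)) * (\<integral>\<^sup>+x. h x * indicator K x \<partial>lborel)"
proof -
  have "(\<integral>\<^sup>+x. h (a + \<tau> *\<^sub>R (x - a)) * indicator K x \<partial>lborel)
     \<le> (\<integral>\<^sup>+x. h ((a - \<tau> *\<^sub>R a) + \<tau> *\<^sub>R x) * indicator K ((a - \<tau> *\<^sub>R a) + \<tau> *\<^sub>R x) \<partial>lborel)"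
  proof (rule nn_integral_mono)
    fix x
    have eq: "(a - \<tau> *\<^sub>R a) + \<tau> *\<^sub>R x = a + \<tau> *\<^sub>R (x - a)" by (simp add: algebra_simps)
    have "a + \<tau> *\<^sub>R (x - a) \<in> K" if "x \<in> K"
    proof -
      have "a + \<tau> *\<^sub>R (x - a) = (1 - \<tau>) *\<^sub>R a + \<tau> *\<^sub>R x" by (simp add: algebra_simps)
      then show ?thesis using convexD[OF K(1,2) that, of "1 - \<tau>" \<tau>] \<tau> by simp
    qed
    then show "h (a + \<tau> *\<^sub>R (x - a)) * indicator K x \<le> h ((a - \<tau> *\<^sub>R a) + \<tau> *\<^sub>R x) * indicator K ((a - \<tau> *\<^sub>R a) + \<tau> *\<^sub>R x)"
      unfolding eq by (auto simp: indicator_def)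
  qed
  also have "\<dots> = ennreal (1 / \<bar>\<tau>\<bar> ^ DIM('a)) * (\<integral>\<^sup>+x. h x * indicator K x \<partial>lborel)"
    by (rule nn_integral_lborel_affine) (use \<tau> in auto)
  finally show ?thesis using \<tau> by simp
qed

text \<open>For \<tau> \<le> 1 dimension 3 is the worst case, so a single choice of exponents serves
  d = 1, 2, 3.\<close>

lemma powr_dim_le:
  fixes \<tau> c :: real
  assumes "0 < \<tau>" "\<tau> \<le> 1" "n \<le> 3"
  shows "\<tau> powr c * (1 / \<tau> ^ n) \<le> \<tau> powr (c - 3)"
proof -
  have "\<tau> powr c * (1 / \<tau> ^ n) = \<tau> powr (c - real n)"
    using assms by (simp add: powr_diff powr_realpow)
  also have "\<dots> \<le> \<tau> powr (c - 3)" using assms by (intro powr_mono') auto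
  finally show ?thesis .
qed

text \<open>The weight \<tau> of the Taylor remainder is decisive. Split as -1/4 + 5/4, it leaves
  \<open>\<tau> powr (5/2)\<close> against an inverse Jacobian of order at most 3, which is still
  integrable. The constant 4 is the square of the integral 2 of
  \<open>\<tau> powr (-1/2)\<close>.\<close>

lemma segment_average_L2:
  fixes a :: "'a::euclidean_space"
  assumes [measurable]: "g \<in> borel_measurable borel" "K \<in> sets borel"
    and K: "convex K" "a \<in> K" and dim: "DIM('a) \<le> 3"
  shows "(\<integral>\<^sup>+x. (\<integral>\<^sup>+\<tau>. ennreal \<tau> * g (a + \<tau> *\<^sub>R (x - a)) * indicator {0..1} \<tau> \<partial>lborel)\<^sup>2 * indicator K x \<partial>lborel)
      \<le> 4 * (\<integral>\<^sup>+x. (g x)\<^sup>2 * indicator K x \<partial>lborel)"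
proof -
  let ?N = "\<integral>\<^sup>+x. (g x)\<^sup>2 * indicator K x \<partial>lborel"
  have "(\<integral>\<^sup>+x. (\<integral>\<^sup>+\<tau>. ennreal \<tau> * g (a + \<tau> *\<^sub>R (x - a)) * indicator {0..1} \<tau> \<partial>lborel)\<^sup>2 * indicator K x \<partial>lborel)
    \<le> (\<integral>\<^sup>+x. 2 * (\<integral>\<^sup>+\<tau>. ennreal (\<tau> powr (5/2)) * (g (a + \<tau> *\<^sub>R (x - a)))\<^sup>2 * indicator {0..1} \<tau> * indicator K x \<partial>lborel) \<partial>lborel)"
  proof (rule nn_integral_mono)
    fix x
    have "(\<integral>\<^sup>+\<tau>. ennreal \<tau> * g (a + \<tau> *\<^sub>R (x - a)) * indicator {0..1} \<tau> \<partial>lborel)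
      = (\<integral>\<^sup>+\<tau>. ennreal (\<tau> powr (-1/4 + 5/4)) * g (a + \<tau> *\<^sub>R (x - a)) * indicator {0..1} \<tau> \<partial>lborel)"
      by (rule nn_integral_cong) (auto simp: indicator_def)
    then have "(\<integral>\<^sup>+\<tau>. ennreal \<tau> * g (a + \<tau> *\<^sub>R (x - a)) * indicator {0..1} \<tau> \<partial>lborel)\<^sup>2
      \<le> ennreal (1 / (2 * (-1/4) + 1)) * (\<integral>\<^sup>+\<tau>. ennreal (\<tau> powr (2 * (5/4))) * (g (a + \<tau> *\<^sub>R (x - a)))\<^sup>2 * indicator {0..1} \<tau> \<partial>lborel)"
      by (simp only:) (rule Cauchy_Schwarz_powr_01; (measurable | simp))
    also have "ennreal (1 / (2 * (-1/4) + 1)) = 2" by (simp flip: ennreal_numeral)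
    finally show "(\<integral>\<^sup>+\<tau>. ennreal \<tau> * g (a + \<tau> *\<^sub>R (x - a)) * indicator {0..1} \<tau> \<partial>lborel)\<^sup>2 * indicator K x
      \<le> 2 * (\<integral>\<^sup>+\<tau>. ennreal (\<tau> powr (5/2)) * (g (a + \<tau> *\<^sub>R (x - a)))\<^sup>2 * indicator {0..1} \<tau> * indicator K x \<partial>lborel)"
      by (auto simp: indicator_def)
  qed
  also have "\<dots> = 2 * (\<integral>\<^sup>+x. (\<integral>\<^sup>+\<tau>. ennreal (\<tau> powr (5/2)) * (g (a + \<tau> *\<^sub>R (x - a)))\<^sup>2 * indicator {0..1} \<tau> * indicator K x \<partial>lborel) \<partial>lborel)"
    by (rule nn_integral_cmult) measurable
  also have "(\<integral>\<^sup>+x. (\<integral>\<^sup>+\<tau>. ennreal (\<tau> powr (5/2)) * (g (a + \<tau> *\<^sub>R (x - a)))\<^sup>2 * indicator {0..1} \<tau> * indicator K x \<partial>lborel) \<partial>lborel)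
     = (\<integral>\<^sup>+\<tau>. (\<integral>\<^sup>+x. ennreal (\<tau> powr (5/2)) * (g (a + \<tau> *\<^sub>R (x - a)))\<^sup>2 * indicator {0..1} \<tau> * indicator K x \<partial>lborel) \<partial>lborel)"
    by (rule lborel_pair.Fubini') measurable
  also have "\<dots> \<le> (\<integral>\<^sup>+\<tau>. ennreal (\<tau> powr (-1/2)) * indicator {0..1} \<tau> * ?N \<partial>lborel)"
  proof (rule nn_integral_mono)
    fix \<tau> :: real
    have "(\<integral>\<^sup>+x. ennreal (\<tau> powr (5/2)) * (g (a + \<tau> *\<^sub>R (x - a)))\<^sup>2 * indicator {0..1} \<tau> * indicator K x \<partial>lborel)
      = (ennreal (\<tau> powr (5/2)) * indicator {0..1} \<tau>) * (\<integral>\<^sup>+x. (g (a + \<tau> *\<^sub>R (x - a)))\<^sup>2 * indicator K x \<partial>lborel)"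
      by (subst nn_integral_cmult[symmetric]) (auto simp: mult_ac)
    also have "\<dots> \<le> ennreal (\<tau> powr (-1/2)) * indicator {0..1} \<tau> * ?N"
    proof (cases "0 < \<tau> \<and> \<tau> \<le> 1")
      case True
      then have "(\<integral>\<^sup>+x. (g (a + \<tau> *\<^sub>R (x - a)))\<^sup>2 * indicator K x \<partial>lborel) \<le> ennreal (1 / \<tau> ^ DIM('a)) * ?N"
        by (intro nn_integral_segment_le[where h="\<lambda>x. (g x)\<^sup>2"] K) auto
      then have "ennreal (\<tau> powr (5/2)) * (\<integral>\<^sup>+x. (g (a + \<tau> *\<^sub>R (x - a)))\<^sup>2 * indicator K x \<partial>lborel)
         \<le> ennreal (\<tau> powr (5/2)) * (ennreal (1 / \<tau> ^ DIM('a)) * ?N)" by (rule mult_left_mono) simp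
      also have "\<dots> = ennreal (\<tau> powr (5/2) * (1 / \<tau> ^ DIM('a))) * ?N"
        using True by (subst ennreal_mult) (auto simp: mult.assoc)
      also have "\<dots> \<le> ennreal (\<tau> powr (-1/2)) * ?N"
        using powr_dim_le[of \<tau> "DIM('a)" "5/2"] True dim by (intro mult_right_mono ennreal_leI) auto
      finally show ?thesis using True by simp
    qed (auto simp: indicator_def)
    finally show "(\<integral>\<^sup>+x. ennreal (\<tau> powr (5/2)) * (g (a + \<tau> *\<^sub>R (x - a)))\<^sup>2 * indicator {0..1} \<tau> * indicator K x \<partial>lborel)
       \<le> ennreal (\<tau> powr (-1/2)) * indicator {0..1} \<tau> * ?N" .
  qed
  also have "\<dots> = 2 * ?N"
    using nn_integral_powr_01[of "-1/2"] by (subst nn_integral_multc) (auto simp flip: ennreal_numeral)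
  finally show ?thesis by (simp add: mult.assoc[symmetric] mult_left_mono)
qed

text \<open>Let A be the inner integral over y and P the same integral of g^2, so that A^4 \<le>
  \<mu>^2 P^2. One factor P is bounded pointwise by the L^2 mass of g times the inverse Jacobian,
  the other is integrated over x, where no negative power of \<tau> appears. Two Cauchy-Schwarz
  steps in \<tau> compensate the single Jacobian; 2500 is 125 times 5/2 times 8.\<close>

lemma segment_average_L4:
  fixes g :: "'a::euclidean_space \<Rightarrow> ennreal"
  assumes [measurable]: "g \<in> borel_measurable borel" "D \<in> sets borel"
    and D: "convex D" and dim: "DIM('a) \<le> 3"
  defines "\<mu> \<equiv> emeasure lborel D"
  shows "(\<integral>\<^sup>+x. (\<integral>\<^sup>+\<tau>. (\<integral>\<^sup>+y. g (x + \<tau> *\<^sub>R (y - x)) * indicator D y \<partial>lborel) * indicator {0..1} \<tau> \<partial>lborel) ^ 4 * indicator D x \<partial>lborel)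
      \<le> 2500 * \<mu> ^ 3 * (\<integral>\<^sup>+x. (g x)\<^sup>2 * indicator D x \<partial>lborel)\<^sup>2"
proof -
  define N where "N = (\<integral>\<^sup>+x. (g x)\<^sup>2 * indicator D x \<partial>lborel)"
  define A where "A = (\<lambda>\<tau> x. \<integral>\<^sup>+y. g (x + \<tau> *\<^sub>R (y - x)) * indicator D y \<partial>lborel)"
  define P where "P = (\<lambda>\<tau> x. \<integral>\<^sup>+y. (g (x + \<tau> *\<^sub>R (y - x)))\<^sup>2 * indicator D y \<partial>lborel)"
  have Am [measurable]: "(\<lambda>p. A (fst p) (snd p)) \<in> borel_measurable (borel \<Otimes>\<^sub>M borel)"
    unfolding A_def by measurable
  have Pm [measurable]: "(\<lambda>p. P (fst p) (snd p)) \<in> borel_measurable (borel \<Otimes>\<^sub>M borel)"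
    unfolding P_def by measurable
  have [measurable]: "A \<tau> \<in> borel_measurable borel" "(\<lambda>\<tau>. A \<tau> x) \<in> borel_measurable borel" "P \<tau> \<in> borel_measurable borel" for \<tau> x
    unfolding A_def P_def by measurable
  have isq: "(indicator S x)\<^sup>2 = (indicator S x :: ennreal)" for x and S :: "'a set" by (simp add: indicator_def)
  have AP: "(A \<tau> x)\<^sup>2 \<le> \<mu> * P \<tau> x" for \<tau> x
  proof -
    have "A \<tau> x = (\<integral>\<^sup>+y. indicator D y * (g (x + \<tau> *\<^sub>R (y - x)) * indicator D y) \<partial>lborel)"
      unfolding A_def by (rule nn_integral_cong) (auto simp: indicator_def)
    then have "(A \<tau> x)\<^sup>2 \<le> (\<integral>\<^sup>+y. (indicator D y)\<^sup>2 \<partial>lborel) * (\<integral>\<^sup>+y. (g (x + \<tau> *\<^sub>R (y - x)) * indicator D y)\<^sup>2 \<partial>lborel)"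
      by (simp only:) (rule Cauchy_Schwarz_nn_integral; measurable)
    then show ?thesis by (simp add: isq \<mu>_def P_def power_mult_distrib)
  qed
  have Psup: "P \<tau> x \<le> ennreal (1 / \<tau> ^ DIM('a)) * N" if "x \<in> D" "0 < \<tau>" "\<tau> \<le> 1" for \<tau> x
    unfolding P_def N_def by (rule nn_integral_segment_le[where h="\<lambda>x. (g x)\<^sup>2"]) (use that D in auto)
  have pow2: "1 / t ^ DIM('a) \<le> 2 ^ DIM('a)" if "t \<ge> 1/2" for t :: real
  proof -
    have "(1 / t) ^ DIM('a) \<le> 2 ^ DIM('a)" using that by (intro power_mono) (auto simp: field_simps)
    then show ?thesis by (simp add: power_divide)
  qed
  have pow8: "ennreal (2 ^ DIM('a)) \<le> 8"
  proof -
    have "(2::real) ^ DIM('a) \<le> 2 ^ 3" using dim by (intro power_increasing) auto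
    then have "ennreal (2 ^ DIM('a)) \<le> ennreal 8" by (intro ennreal_leI) simp
    then show ?thesis by simp
  qed
  \<comment> \<open>For \<tau> \<ge> 1/2 the pointwise bound is already at most 8 N. For smaller
    \<tau> the roles of x and y are exchanged: the point is a contraction of x towards y with factor
    1 - \<tau>, so the bound is uniform in \<tau>.\<close>
  have Pint: "(\<integral>\<^sup>+x. P \<tau> x * indicator D x \<partial>lborel) \<le> 8 * N * \<mu>" if \<tau>: "0 < \<tau>" "\<tau> \<le> 1" for \<tau>
  proof (cases "\<tau> \<ge> 1/2")
    case True
    have "P \<tau> x * indicator D x \<le> 8 * N * indicator D x" for x
    proof (cases "x \<in> D")
      case xD: True
      have "P \<tau> x \<le> ennreal (1 / \<tau> ^ DIM('a)) * N" by (rule Psup[OF xD \<tau>])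
      also have "\<dots> \<le> 8 * N"
        using order_trans[OF ennreal_leI[OF pow2[OF True]] pow8] by (rule mult_right_mono) simp
      finally show ?thesis using xD by simp
    qed simp
    then have "(\<integral>\<^sup>+x. P \<tau> x * indicator D x \<partial>lborel) \<le> (\<integral>\<^sup>+x. 8 * N * indicator D x \<partial>lborel)"
      by (rule nn_integral_mono)
    also have "\<dots> = 8 * N * \<mu>" by (simp add: nn_integral_cmult_indicator \<mu>_def)
    finally show ?thesis .
  next
    case False
    have "(\<integral>\<^sup>+x. P \<tau> x * indicator D x \<partial>lborel) = (\<integral>\<^sup>+x. (\<integral>\<^sup>+y. (g (x + \<tau> *\<^sub>R (y - x)))\<^sup>2 * indicator D y * indicator D x \<partial>lborel) \<partial>lborel)"
      unfolding P_def by (intro nn_integral_cong nn_integral_multc[symmetric]) measurable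
    also have "\<dots> = (\<integral>\<^sup>+y. (\<integral>\<^sup>+x. (g (x + \<tau> *\<^sub>R (y - x)))\<^sup>2 * indicator D y * indicator D x \<partial>lborel) \<partial>lborel)"
      by (rule lborel_pair.Fubini') measurable
    also have "\<dots> \<le> (\<integral>\<^sup>+y. 8 * N * indicator D y \<partial>lborel)"
    proof (rule nn_integral_mono)
      fix y
      show "(\<integral>\<^sup>+x. (g (x + \<tau> *\<^sub>R (y - x)))\<^sup>2 * indicator D y * indicator D x \<partial>lborel) \<le> 8 * N * indicator D y"
      proof (cases "y \<in> D")
        case True
        have "x + \<tau> *\<^sub>R (y - x) = y + (1 - \<tau>) *\<^sub>R (x - y)" for x by (simp add: algebra_simps)
        then have "(\<integral>\<^sup>+x. (g (x + \<tau> *\<^sub>R (y - x)))\<^sup>2 * indicator D x \<partial>lborel)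
          = (\<integral>\<^sup>+x. (g (y + (1 - \<tau>) *\<^sub>R (x - y)))\<^sup>2 * indicator D x \<partial>lborel)" by simp
        also have "\<dots> \<le> ennreal (1 / (1 - \<tau>) ^ DIM('a)) * N"
          unfolding N_def using False \<tau> by (intro nn_integral_segment_le[where h="\<lambda>x. (g x)\<^sup>2"] D True) auto
        also have "\<dots> \<le> 8 * N"
          using order_trans[OF ennreal_leI[OF pow2[of "1 - \<tau>"]] pow8] False by (intro mult_right_mono) auto
        finally show ?thesis using True by simp
      qed simp
    qed
    also have "\<dots> = 8 * N * \<mu>" by (simp add: nn_integral_cmult_indicator \<mu>_def)
    finally show ?thesis .
  qed
  have A4: "(\<integral>\<^sup>+x. (A \<tau> x) ^ 4 * indicator D x \<partial>lborel) \<le> ennreal (1 / \<tau> ^ DIM('a)) * (8 * \<mu> ^ 3 * N\<^sup>2)"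
    if \<tau>: "0 < \<tau>" "\<tau> \<le> 1" for \<tau>
  proof -
    have "(\<integral>\<^sup>+x. (A \<tau> x) ^ 4 * indicator D x \<partial>lborel) \<le> (\<integral>\<^sup>+x. (\<mu>\<^sup>2 * (ennreal (1 / \<tau> ^ DIM('a)) * N)) * (P \<tau> x * indicator D x) \<partial>lborel)"
    proof (rule nn_integral_mono)
      fix x
      show "(A \<tau> x) ^ 4 * indicator D x \<le> (\<mu>\<^sup>2 * (ennreal (1 / \<tau> ^ DIM('a)) * N)) * (P \<tau> x * indicator D x)"
      proof (cases "x \<in> D")
        case True
        have "(A \<tau> x) ^ 4 = ((A \<tau> x)\<^sup>2)\<^sup>2" by simp
        also have "\<dots> \<le> (\<mu> * P \<tau> x)\<^sup>2" using AP by (rule power_mono) simp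
        also have "\<dots> = \<mu>\<^sup>2 * (P \<tau> x * P \<tau> x)" by (simp add: power2_eq_square mult_ac)
        also have "\<dots> \<le> \<mu>\<^sup>2 * ((ennreal (1 / \<tau> ^ DIM('a)) * N) * P \<tau> x)"
          using Psup[OF True \<tau>] by (intro mult_left_mono mult_right_mono) auto
        finally show ?thesis using True by (simp add: mult.assoc)
      qed simp
    qed
    also have "\<dots> = (\<mu>\<^sup>2 * (ennreal (1 / \<tau> ^ DIM('a)) * N)) * (\<integral>\<^sup>+x. P \<tau> x * indicator D x \<partial>lborel)"
      by (rule nn_integral_cmult) measurable
    also have "\<dots> \<le> (\<mu>\<^sup>2 * (ennreal (1 / \<tau> ^ DIM('a)) * N)) * (8 * N * \<mu>)"
      by (intro mult_left_mono Pint \<tau>) simp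
    also have "\<dots> = ennreal (1 / \<tau> ^ DIM('a)) * (8 * \<mu> ^ 3 * N\<^sup>2)"
      by (simp add: power2_eq_square power3_eq_cube mult_ac)
    finally show ?thesis .
  qed
  \<comment> \<open>Splitting off \<open>\<tau> powr (-2/5)\<close> twice yields 25 times 5 and the
    weight 12/5; after an inverse Jacobian of order 3 the exponent is -3/5, which is
    integrable.\<close>
  have F4: "(\<integral>\<^sup>+\<tau>. A \<tau> x * indicator {0..1} \<tau> \<partial>lborel) ^ 4
     \<le> 125 * (\<integral>\<^sup>+\<tau>. ennreal (\<tau> powr (12/5)) * (A \<tau> x) ^ 4 * indicator {0..1} \<tau> \<partial>lborel)" for x
  proof -
    have "(\<integral>\<^sup>+\<tau>. A \<tau> x * indicator {0..1} \<tau> \<partial>lborel) = (\<integral>\<^sup>+\<tau>. ennreal (\<tau> powr (-2/5 + 2/5)) * A \<tau> x * indicator {0..1} \<tau> \<partial>lborel)"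
    proof (rule nn_integral_cong_AE)
      \<comment> \<open>The value of \<open>0 powr 0\<close> is 0, so the integrands may differ at
        \<tau> = 0.\<close>
      have "AE \<tau> in lborel. \<tau> \<noteq> (0::real)" by (rule AE_lborel_singleton)
      then show "AE \<tau> in lborel. A \<tau> x * indicator {0..1} \<tau> = ennreal (\<tau> powr (-2/5 + 2/5)) * A \<tau> x * indicator {0..1} \<tau>"
        by eventually_elim simp
    qed
    then have "(\<integral>\<^sup>+\<tau>. A \<tau> x * indicator {0..1} \<tau> \<partial>lborel)\<^sup>2
       \<le> ennreal (1 / (2 * (-2/5) + 1)) * (\<integral>\<^sup>+\<tau>. ennreal (\<tau> powr (2 * (2/5))) * (A \<tau> x)\<^sup>2 * indicator {0..1} \<tau> \<partial>lborel)"
      by (simp only:) (rule Cauchy_Schwarz_powr_01; (measurable | simp))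
    also have "ennreal (1 / (2 * (-2/5) + 1)) = 5" by (simp flip: ennreal_numeral)
    finally have 1: "(\<integral>\<^sup>+\<tau>. A \<tau> x * indicator {0..1} \<tau> \<partial>lborel)\<^sup>2
       \<le> 5 * (\<integral>\<^sup>+\<tau>. ennreal (\<tau> powr (-2/5 + 6/5)) * (A \<tau> x)\<^sup>2 * indicator {0..1} \<tau> \<partial>lborel)" by simp
    have "(\<integral>\<^sup>+\<tau>. ennreal (\<tau> powr (-2/5 + 6/5)) * (A \<tau> x)\<^sup>2 * indicator {0..1} \<tau> \<partial>lborel)\<^sup>2
       \<le> ennreal (1 / (2 * (-2/5) + 1)) * (\<integral>\<^sup>+\<tau>. ennreal (\<tau> powr (2 * (6/5))) * ((A \<tau> x)\<^sup>2)\<^sup>2 * indicator {0..1} \<tau> \<partial>lborel)"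
      by (rule Cauchy_Schwarz_powr_01; (measurable | simp))
    also have "ennreal (1 / (2 * (-2/5) + 1)) = 5" by (simp flip: ennreal_numeral)
    finally have 2: "(\<integral>\<^sup>+\<tau>. ennreal (\<tau> powr (-2/5 + 6/5)) * (A \<tau> x)\<^sup>2 * indicator {0..1} \<tau> \<partial>lborel)\<^sup>2
       \<le> 5 * (\<integral>\<^sup>+\<tau>. ennreal (\<tau> powr (12/5)) * (A \<tau> x) ^ 4 * indicator {0..1} \<tau> \<partial>lborel)" by simp
    have "(\<integral>\<^sup>+\<tau>. A \<tau> x * indicator {0..1} \<tau> \<partial>lborel) ^ 4 = ((\<integral>\<^sup>+\<tau>. A \<tau> x * indicator {0..1} \<tau> \<partial>lborel)\<^sup>2)\<^sup>2" by simp
    also have "\<dots> \<le> (5 * (\<integral>\<^sup>+\<tau>. ennreal (\<tau> powr (-2/5 + 6/5)) * (A \<tau> x)\<^sup>2 * indicator {0..1} \<tau> \<partial>lborel))\<^sup>2"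
      using 1 by (rule power_mono) simp
    also have "\<dots> = 25 * (\<integral>\<^sup>+\<tau>. ennreal (\<tau> powr (-2/5 + 6/5)) * (A \<tau> x)\<^sup>2 * indicator {0..1} \<tau> \<partial>lborel)\<^sup>2"
      by (simp add: power_mult_distrib)
    also have "\<dots> \<le> 25 * (5 * (\<integral>\<^sup>+\<tau>. ennreal (\<tau> powr (12/5)) * (A \<tau> x) ^ 4 * indicator {0..1} \<tau> \<partial>lborel))"
      using 2 by (rule mult_left_mono) simp
    finally show ?thesis by (simp add: mult.assoc[symmetric])
  qed
  have "(\<integral>\<^sup>+x. (\<integral>\<^sup>+\<tau>. A \<tau> x * indicator {0..1} \<tau> \<partial>lborel) ^ 4 * indicator D x \<partial>lborel)
     \<le> (\<integral>\<^sup>+x. 125 * (\<integral>\<^sup>+\<tau>. ennreal (\<tau> powr (12/5)) * (A \<tau> x) ^ 4 * indicator {0..1} \<tau> * indicator D x \<partial>lborel) \<partial>lborel)"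
    by (rule nn_integral_mono) (use F4 in \<open>auto simp: indicator_def\<close>)
  also have "\<dots> = 125 * (\<integral>\<^sup>+x. (\<integral>\<^sup>+\<tau>. ennreal (\<tau> powr (12/5)) * (A \<tau> x) ^ 4 * indicator {0..1} \<tau> * indicator D x \<partial>lborel) \<partial>lborel)"
    unfolding A_def by (rule nn_integral_cmult) measurable
  also have "(\<integral>\<^sup>+x. (\<integral>\<^sup>+\<tau>. ennreal (\<tau> powr (12/5)) * (A \<tau> x) ^ 4 * indicator {0..1} \<tau> * indicator D x \<partial>lborel) \<partial>lborel)
     = (\<integral>\<^sup>+\<tau>. (\<integral>\<^sup>+x. ennreal (\<tau> powr (12/5)) * (A \<tau> x) ^ 4 * indicator {0..1} \<tau> * indicator D x \<partial>lborel) \<partial>lborel)"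
    unfolding A_def by (rule lborel_pair.Fubini') measurable
  also have "\<dots> \<le> (\<integral>\<^sup>+\<tau>. ennreal (\<tau> powr (-3/5)) * indicator {0..1} \<tau> * (8 * \<mu> ^ 3 * N\<^sup>2) \<partial>lborel)"
  proof (rule nn_integral_mono)
    fix \<tau> :: real
    have "(\<integral>\<^sup>+x. ennreal (\<tau> powr (12/5)) * (A \<tau> x) ^ 4 * indicator {0..1} \<tau> * indicator D x \<partial>lborel)
      = (ennreal (\<tau> powr (12/5)) * indicator {0..1} \<tau>) * (\<integral>\<^sup>+x. (A \<tau> x) ^ 4 * indicator D x \<partial>lborel)"
      by (subst nn_integral_cmult[symmetric]) (auto simp: mult_ac)
    also have "\<dots> \<le> ennreal (\<tau> powr (-3/5)) * indicator {0..1} \<tau> * (8 * \<mu> ^ 3 * N\<^sup>2)"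
    proof (cases "0 < \<tau> \<and> \<tau> \<le> 1")
      case True
      then have "ennreal (\<tau> powr (12/5)) * (\<integral>\<^sup>+x. (A \<tau> x) ^ 4 * indicator D x \<partial>lborel)
         \<le> ennreal (\<tau> powr (12/5)) * (ennreal (1 / \<tau> ^ DIM('a)) * (8 * \<mu> ^ 3 * N\<^sup>2))"
        by (intro mult_left_mono A4) auto
      also have "\<dots> = ennreal (\<tau> powr (12/5) * (1 / \<tau> ^ DIM('a))) * (8 * \<mu> ^ 3 * N\<^sup>2)"
        using True by (subst ennreal_mult) (auto simp: mult.assoc)
      also have "\<dots> \<le> ennreal (\<tau> powr (-3/5)) * (8 * \<mu> ^ 3 * N\<^sup>2)"
        using powr_dim_le[of \<tau> "DIM('a)" "12/5"] True dim by (intro mult_right_mono ennreal_leI) auto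
      finally show ?thesis using True by simp
    qed (auto simp: indicator_def)
    finally show "(\<integral>\<^sup>+x. ennreal (\<tau> powr (12/5)) * (A \<tau> x) ^ 4 * indicator {0..1} \<tau> * indicator D x \<partial>lborel)
       \<le> ennreal (\<tau> powr (-3/5)) * indicator {0..1} \<tau> * (8 * \<mu> ^ 3 * N\<^sup>2)" .
  qed
  also have "\<dots> = ennreal (5/2) * (8 * \<mu> ^ 3 * N\<^sup>2)"
    using nn_integral_powr_01[of "-3/5"] by (subst nn_integral_multc) auto
  also have "125 * (ennreal (5/2) * (8 * \<mu> ^ 3 * N\<^sup>2)) = 2500 * \<mu> ^ 3 * N\<^sup>2"
  proof -
    have ac: "a * (b * (c * m * n)) = (a * b * c) * (m * n)" for a b c m n :: ennreal by (simp add: mult_ac)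
    have "125 * (ennreal (5/2) * (8 * \<mu> ^ 3 * N\<^sup>2)) = (ennreal 125 * ennreal (5/2) * ennreal 8) * (\<mu> ^ 3 * N\<^sup>2)"
      unfolding ac by simp
    also have "ennreal 125 * ennreal (5/2) * ennreal 8 = ennreal 2500" by (simp only: ennreal_mult[symmetric]) simp
    finally show ?thesis by (simp add: mult_ac)
  qed
  finally show ?thesis by (simp add: A_def N_def mult_left_mono)
qed

section \<open>Sobolev embeddings\<close>

lemma ftc_nn_integral:
  fixes F :: "real \<Rightarrow> 'b::euclidean_space"
  assumes F: "\<And>\<tau>. \<tau> \<in> {0..1} \<Longrightarrow> (F has_vector_derivative f \<tau>) (at \<tau>)"
    and g: "continuous_on {0..1} g" "\<And>\<tau>. \<tau> \<in> {0..1} \<Longrightarrow> norm (f \<tau>) \<le> g \<tau>"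
  shows "ennreal (norm (F 1 - F 0)) \<le> (\<integral>\<^sup>+\<tau>. ennreal (g \<tau>) * indicator {0..1} \<tau> \<partial>lborel)"
proof -
  have f: "(f has_integral (F 1 - F 0)) {0..1}"
    by (rule fundamental_theorem_of_calculus[OF _ has_vector_derivative_at_within[OF F]]) auto
  have gi: "g integrable_on {0..1}" using g(1) by (rule integrable_continuous_real)
  have "norm (integral {0..1} f) \<le> integral {0..1} g"
    using f gi g(2) by (intro integral_norm_bound_integral) auto
  then have "norm (F 1 - F 0) \<le> integral {0..1} g" using f by (simp add: integral_unique)
  moreover have "(\<integral>\<^sup>+\<tau>. ennreal (g \<tau>) * indicator {0..1} \<tau> \<partial>lborel) = ennreal (integral {0..1} g)"
  proof (rule nn_integral_has_integral_lebesgue'[OF _ integrable_integral[OF gi]])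
    show "0 \<le> g \<tau>" if "\<tau> \<in> {0..1}" for \<tau> using g(2)[OF that] norm_ge_zero[of "f \<tau>"] by linarith
  qed
  ultimately show ?thesis by (simp add: ennreal_leI)
qed

lemma ennreal_power2_le_imp_le:
  assumes "x\<^sup>2 \<le> ennreal (y\<^sup>2)" "y \<ge> 0" shows "x \<le> ennreal y"
proof (cases x)
  case (real r)
  have "ennreal (r\<^sup>2) \<le> ennreal (y\<^sup>2)" using assms(1) unfolding real(2) ennreal_power[OF real(1)] .
  then have "r\<^sup>2 \<le> y\<^sup>2" by (subst (asm) ennreal_le_iff) auto
  then have "r \<le> y" using assms(2) by (rule power2_le_imp_le)
  then show ?thesis unfolding real(2) by (rule ennreal_leI)
next
  case top
  have "(top :: ennreal) * top \<le> ennreal (y\<^sup>2)" using assms(1) unfolding top power2_eq_square .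
  then show ?thesis by (simp add: top_unique)
qed

lemma ennreal_power4_add_le: "(a + b) ^ 4 \<le> 16 * (a ^ 4 + b ^ 4)" for a b :: ennreal
proof -
  have "(a + b) ^ 4 \<le> (2 * max a b) ^ 4"
    by (intro power_mono) (auto simp: mult_2 intro: add_mono)
  also have "\<dots> = 16 * max a b ^ 4" by (simp add: power_mult_distrib)
  also have "max a b ^ 4 \<le> a ^ 4 + b ^ 4" by (auto simp: max_def)
  finally show ?thesis by (simp add: mult_left_mono)
qed

text \<open>Fatou along an almost everywhere convergent subsequence carries a uniform L^4 bound to
  the L^2 limit. The bound is written as a square to match the L^2 norm of the squared
  modulus.\<close>

lemma l2n_tendsto_power2_bound:
  fixes f :: "nat \<Rightarrow> 'a \<Rightarrow> 'b::euclidean_space"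
  assumes f: "\<And>n. sqi M (f n)" "sqi M g" "(\<lambda>n. l2n M (\<lambda>x. f n x - g x)) \<longlonglongrightarrow> 0"
    and B: "\<And>n. (\<integral>\<^sup>+x. ennreal (norm (f n x) ^ 4) \<partial>M) \<le> ennreal (B\<^sup>2)" "B \<ge> 0"
  shows "sqi M (\<lambda>x. (norm (g x))\<^sup>2)" "l2n M (\<lambda>x. (norm (g x))\<^sup>2) \<le> B"
proof -
  have [measurable]: "g \<in> borel_measurable M" "\<And>n. f n \<in> borel_measurable M" using f by auto
  obtain r where r: "strict_mono r" "AE x in M. (\<lambda>n. f (r n) x) \<longlonglongrightarrow> g x"
    using l2n_tendsto_AE_subseq[OF f] .
  have "(\<integral>\<^sup>+x. ennreal ((norm ((norm (g x))\<^sup>2))\<^sup>2) \<partial>M) = (\<integral>\<^sup>+x. liminf (\<lambda>n. ennreal (norm (f (r n) x) ^ 4)) \<partial>M)"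
  proof (rule nn_integral_cong_AE)
    show "AE x in M. ennreal ((norm ((norm (g x))\<^sup>2))\<^sup>2) = liminf (\<lambda>n. ennreal (norm (f (r n) x) ^ 4))"
      using r(2)
    proof eventually_elim
      case (elim x)
      then have "(\<lambda>n. ennreal (norm (f (r n) x) ^ 4)) \<longlonglongrightarrow> ennreal (norm (g x) ^ 4)"
        by (intro tendsto_ennrealI tendsto_intros)
      then show ?case by (subst lim_imp_Liminf) auto
    qed
  qed
  also have "\<dots> \<le> liminf (\<lambda>n. \<integral>\<^sup>+x. ennreal (norm (f (r n) x) ^ 4) \<partial>M)" by (rule nn_integral_liminf) measurable
  also have "\<dots> \<le> ennreal (B\<^sup>2)"
    by (rule Liminf_le) (use B in auto)
  finally show "sqi M (\<lambda>x. (norm (g x))\<^sup>2)" "l2n M (\<lambda>x. (norm (g x))\<^sup>2) \<le> B"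
    using sqiI_ennreal[of "\<lambda>x. (norm (g x))\<^sup>2" M B] B(2) by auto
qed

lemma l2n_tendsto_bounded:
  fixes f :: "nat \<Rightarrow> 'a \<Rightarrow> 'b::euclidean_space"
  assumes f: "\<And>n. sqi M (f n)" "sqi M g" "(\<lambda>n. l2n M (\<lambda>x. f n x - g x)) \<longlonglongrightarrow> 0"
    and B: "\<And>n. AE x in M. norm (f n x) \<le> B"
  shows "AE x in M. norm (g x) \<le> B"
proof -
  obtain r where r: "strict_mono r" "AE x in M. (\<lambda>n. f (r n) x) \<longlonglongrightarrow> g x"
    using l2n_tendsto_AE_subseq[OF f] .
  have "AE x in M. \<forall>n. norm (f n x) \<le> B" unfolding AE_all_countable using B by blast
  with r(2) show ?thesis
  proof eventually_elim
    case (elim x)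
    then show ?case using LIMSEQ_le_const2[OF tendsto_norm[OF elim(1)]] by auto
  qed
qed

locale convex_dom3 = convex_dom D c r for D :: "(real^'d::finite) set" and c r +
  assumes dim3: "CARD('d) \<le> 3"

section \<open>Segment estimates for mollified functions\<close>

context convex_dom begin

definition diamD :: real where "diamD = diameter D + 1"

lemma diamD: "diamD > 0" "x \<in> closure D \<Longrightarrow> y \<in> closure D \<Longrightarrow> norm (x - y) \<le> diamD"
proof -
  show "diamD > 0" unfolding diamD_def using diameter_ge_0[OF bounded_D] by simp
  show "norm (x - y) \<le> diamD" if "x \<in> closure D" "y \<in> closure D"
    using diameter_bounded_bound[OF bounded_closure[OF bounded_D] that] bounded_D
    by (simp add: dist_norm diamD_def diameter_closure)
qed

definition mD :: real where "mD = measure lebesgue D"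

lemma mD: "mD > 0" "emeasure lborel D = ennreal mD" "measure LD (space LD) = mD"
proof -
  have b: "ball c r \<subseteq> D" using ball_D by auto
  have fin: "D \<in> lmeasurable" using bounded_D by (intro bounded_set_imp_lmeasurable) auto
  have "measure lebesgue (ball c r) \<le> measure lebesgue D"
    using b fin by (intro measure_mono_fmeasurable) auto
  moreover have "measure lebesgue (ball c r) = measure lborel (ball c r)" by (rule measure_completion) simp
  ultimately show "mD > 0" using content_ball_pos[OF r_pos, of c] unfolding mD_def by linarith
  show "emeasure lborel D = ennreal mD"
    using emeasure_eq_measure2[OF fin] emeasure_completion[of D lborel] D_sets(2) unfolding mD_def by simp
  show "measure LD (space LD) = mD" by (simp add: mD_def measure_restrict_space space_restrict_space)
qed

lemma segment_in_closure:
  assumes "a \<in> closure D" "x \<in> closure D" "\<tau> \<in> {0..1}" shows "a + \<tau> *\<^sub>R (x - a) \<in> closure D"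
proof -
  have "a + \<tau> *\<^sub>R (x - a) = (1 - \<tau>) *\<^sub>R a + \<tau> *\<^sub>R x" by (simp add: algebra_simps)
  then show ?thesis using convexD[OF convex_closure[OF convex_D] assms(1,2), of "1 - \<tau>" \<tau>] assms(3) by simp
qed

lemma moll_grad_norm_le:
  "norm (\<Sum>j\<in>UNIV. ((1 - ms n) * q $ j) *\<^sub>R f j) \<le> norm q * (\<Sum>j\<in>UNIV. norm (f j))"
  for q :: "real^'d" and f :: "'d \<Rightarrow> real^3"
proof -
  have "norm (\<Sum>j\<in>UNIV. ((1 - ms n) * q $ j) *\<^sub>R f j) \<le> (\<Sum>j\<in>UNIV. norm q * norm (f j))"
  proof (rule order_trans[OF norm_sum sum_mono])
    fix j
    have "\<bar>(1 - ms n) * q $ j\<bar> \<le> 1 * norm q"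
      unfolding abs_mult using ms[of n] component_le_norm_cart[of q j] by (intro mult_mono) auto
    then show "norm (((1 - ms n) * q $ j) *\<^sub>R f j) \<le> norm q * norm (f j)" by (simp add: mult_right_mono)
  qed
  then show ?thesis by (simp add: sum_distrib_left)
qed

lemma moll_diff_le:
  fixes v :: "real^'d \<Rightarrow> real^3"
  assumes w: "\<And>j. has_weak_deriv D [j] v (w j)" and int: "integrable LD v" "\<And>j. integrable LD (w j)"
    and xy: "x \<in> closure D" "y \<in> closure D"
  shows "ennreal (norm (moll n v y - moll n v x))
     \<le> ennreal (norm (y - x)) * (\<integral>\<^sup>+\<tau>. ennreal (\<Sum>j\<in>UNIV. norm (moll n (w j) (x + \<tau> *\<^sub>R (y - x)))) * indicator {0..1} \<tau> \<partial>lborel)"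
proof -
  let ?G = "\<lambda>\<tau>. \<Sum>j\<in>UNIV. norm (moll n (w j) (x + \<tau> *\<^sub>R (y - x)))"
  have c: "continuous_on UNIV ?G"
    by (intro continuous_intros continuous_on_compose2[OF moll_continuous[OF int(2), where S=UNIV]]) auto
  have [measurable]: "?G \<in> borel_measurable borel" by (rule borel_measurable_continuous_onI[OF c])
  have "ennreal (norm (moll n v (x + 1 *\<^sub>R (y - x)) - moll n v (x + 0 *\<^sub>R (y - x))))
     \<le> (\<integral>\<^sup>+\<tau>. ennreal (norm (y - x) * ?G \<tau>) * indicator {0..1} \<tau> \<partial>lborel)"
  proof (rule ftc_nn_integral[OF moll_path_derivative[OF w int(1) segment_in_closure[OF xy]]])
    show "continuous_on {0..1} (\<lambda>\<tau>. norm (y - x) * ?G \<tau>)"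
      by (intro continuous_on_mult continuous_on_const continuous_on_subset[OF c]) simp
  qed (assumption, rule moll_grad_norm_le)
  also have "\<dots> = (\<integral>\<^sup>+\<tau>. ennreal (norm (y - x)) * (ennreal (?G \<tau>) * indicator {0..1} \<tau>) \<partial>lborel)"
    by (rule nn_integral_cong) (simp add: ennreal_mult sum_nonneg mult.assoc)
  also have "\<dots> = ennreal (norm (y - x)) * (\<integral>\<^sup>+\<tau>. ennreal (?G \<tau>) * indicator {0..1} \<tau> \<partial>lborel)"
    by (rule nn_integral_cmult) measurable
  finally show ?thesis by simp
qed

text \<open>With \<psi> the restriction to the segment from a to x, the derivative of \<tau> \<psi>'
  - \<psi> is \<tau> \<psi>''; integrating over [0,1] expands the value at a around x. The weight
  \<tau> vanishes at a, precisely where the contraction towards a has a singular inverse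
  Jacobian.\<close>

lemma moll_taylor:
  fixes v :: "real^'d \<Rightarrow> real^3"
  assumes w: "\<And>j. has_weak_deriv D [j] v (w j)" and ww: "\<And>j i. has_weak_deriv D [i] (w j) (ww j i)"
    and int: "integrable LD v" "\<And>j. integrable LD (w j)" "\<And>j i. integrable LD (ww j i)"
    and ax: "a \<in> closure D" "x \<in> closure D"
  shows "ennreal (norm (moll n v a - (moll n v x + (\<Sum>j\<in>UNIV. ((1 - ms n) * (a - x) $ j) *\<^sub>R moll n (w j) x))))
     \<le> ennreal ((norm (x - a))\<^sup>2) * (\<integral>\<^sup>+\<tau>. ennreal \<tau> * ennreal (\<Sum>j\<in>UNIV. \<Sum>i\<in>UNIV. norm (moll n (ww j i) (a + \<tau> *\<^sub>R (x - a)))) * indicator {0..1} \<tau> \<partial>lborel)"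
proof -
  let ?q = "x - a"
  let ?G = "\<lambda>\<tau>. \<Sum>j\<in>UNIV. \<Sum>i\<in>UNIV. norm (moll n (ww j i) (a + \<tau> *\<^sub>R ?q))"
  define \<psi> where "\<psi> = (\<lambda>\<tau>. moll n v (a + \<tau> *\<^sub>R ?q))"
  define \<psi>1 where "\<psi>1 = (\<lambda>\<tau>. \<Sum>j\<in>UNIV. ((1 - ms n) * ?q $ j) *\<^sub>R moll n (w j) (a + \<tau> *\<^sub>R ?q))"
  define \<psi>2 where "\<psi>2 = (\<lambda>\<tau>. \<Sum>j\<in>UNIV. ((1 - ms n) * ?q $ j) *\<^sub>R
     (\<Sum>i\<in>UNIV. ((1 - ms n) * ?q $ i) *\<^sub>R moll n (ww j i) (a + \<tau> *\<^sub>R ?q)))"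
  have d1: "(\<psi> has_vector_derivative \<psi>1 \<tau>) (at \<tau>)" if "\<tau> \<in> {0..1}" for \<tau>
    unfolding \<psi>_def \<psi>1_def by (rule moll_path_derivative[OF w int(1) segment_in_closure[OF ax that]])
  have d2: "(\<psi>1 has_vector_derivative \<psi>2 \<tau>) (at \<tau>)" if "\<tau> \<in> {0..1}" for \<tau>
    unfolding \<psi>1_def \<psi>2_def
    by (intro has_vector_derivative_sum bounded_linear.has_vector_derivative[OF bounded_linear_scaleR_right]
        moll_path_derivative[OF ww int(2) segment_in_closure[OF ax that]])
  have d3: "((\<lambda>\<tau>. \<tau> *\<^sub>R \<psi>1 \<tau> - \<psi> \<tau>) has_vector_derivative \<tau> *\<^sub>R \<psi>2 \<tau>) (at \<tau>)" if "\<tau> \<in> {0..1}" for \<tau>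
  proof -
    have "((\<lambda>\<tau>. \<tau> *\<^sub>R \<psi>1 \<tau>) has_vector_derivative (\<tau> *\<^sub>R \<psi>2 \<tau> + 1 *\<^sub>R \<psi>1 \<tau>)) (at \<tau>)"
      by (rule has_vector_derivative_scaleR[OF DERIV_ident d2[OF that]])
    from has_vector_derivative_diff[OF this d1[OF that]] show ?thesis by simp
  qed
  have G2: "norm (\<psi>2 \<tau>) \<le> (norm ?q)\<^sup>2 * ?G \<tau>" for \<tau>
  proof -
    have "norm (\<psi>2 \<tau>) \<le> norm ?q * (\<Sum>j\<in>UNIV. norm (\<Sum>i\<in>UNIV. ((1 - ms n) * ?q $ i) *\<^sub>R moll n (ww j i) (a + \<tau> *\<^sub>R ?q)))"
      unfolding \<psi>2_def by (rule moll_grad_norm_le)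
    also have "\<dots> \<le> norm ?q * (\<Sum>j\<in>UNIV. norm ?q * (\<Sum>i\<in>UNIV. norm (moll n (ww j i) (a + \<tau> *\<^sub>R ?q))))"
      by (intro mult_left_mono sum_mono moll_grad_norm_le) simp
    finally show ?thesis by (simp add: sum_distrib_left[symmetric] power2_eq_square mult.assoc)
  qed
  have c: "continuous_on UNIV ?G"
    by (intro continuous_intros continuous_on_compose2[OF moll_continuous[OF int(3), where S=UNIV]]) auto
  have [measurable]: "?G \<in> borel_measurable borel" by (rule borel_measurable_continuous_onI[OF c])
  have "ennreal (norm ((1 *\<^sub>R \<psi>1 1 - \<psi> 1) - (0 *\<^sub>R \<psi>1 0 - \<psi> 0)))
     \<le> (\<integral>\<^sup>+\<tau>. ennreal (\<tau> * ((norm ?q)\<^sup>2 * ?G \<tau>)) * indicator {0..1} \<tau> \<partial>lborel)"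
  proof (rule ftc_nn_integral[OF d3])
    show "continuous_on {0..1} (\<lambda>\<tau>. \<tau> * ((norm ?q)\<^sup>2 * ?G \<tau>))"
      by (intro continuous_on_mult continuous_on_id continuous_on_const continuous_on_subset[OF c]) simp
    show "norm (\<tau> *\<^sub>R \<psi>2 \<tau>) \<le> \<tau> * ((norm ?q)\<^sup>2 * ?G \<tau>)" if "\<tau> \<in> {0..1}" for \<tau>
      using that G2[of \<tau>] by (simp add: mult_left_mono)
  qed
  also have "\<dots> = (\<integral>\<^sup>+\<tau>. ennreal ((norm ?q)\<^sup>2) * (ennreal \<tau> * ennreal (?G \<tau>) * indicator {0..1} \<tau>) \<partial>lborel)"
    by (rule nn_integral_cong) (auto simp: ennreal_mult sum_nonneg mult_ac indicator_def)
  also have "\<dots> = ennreal ((norm ?q)\<^sup>2) * (\<integral>\<^sup>+\<tau>. ennreal \<tau> * ennreal (?G \<tau>) * indicator {0..1} \<tau> \<partial>lborel)"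
    by (rule nn_integral_cmult) measurable
  also have "(1 *\<^sub>R \<psi>1 1 - \<psi> 1) - (0 *\<^sub>R \<psi>1 0 - \<psi> 0)
     = moll n v a - (moll n v x + (\<Sum>j\<in>UNIV. ((1 - ms n) * (a - x) $ j) *\<^sub>R moll n (w j) x))"
  proof -
    have "\<psi>1 1 = - (\<Sum>j\<in>UNIV. ((1 - ms n) * (a - x) $ j) *\<^sub>R moll n (w j) x)"
      by (simp add: \<psi>1_def sum_negf[symmetric] algebra_simps)
    then show ?thesis by (simp add: \<psi>_def)
  qed
  finally show ?thesis .
qed

definition mollC :: real where "mollC = sqrt (2 ^ CARD('d))"

lemma mollC: "mollC \<ge> 1" unfolding mollC_def by simp

lemma moll_sum_sqi:
  assumes "\<And>i. i \<in> I \<Longrightarrow> sqi LD (f i)" "\<And>i. i \<in> I \<Longrightarrow> l2n LD (f i) \<le> B"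
  shows "sqi LD (\<lambda>x. \<Sum>i\<in>I. norm (moll n (f i) x))" "l2n LD (\<lambda>x. \<Sum>i\<in>I. norm (moll n (f i) x)) \<le> real (card I) * mollC * B"
proof -
  show "sqi LD (\<lambda>x. \<Sum>i\<in>I. norm (moll n (f i) x))"
    by (intro sqi_sum sqi_norm moll_L2(1) assms)
  have "l2n LD (\<lambda>x. \<Sum>i\<in>I. norm (moll n (f i) x)) \<le> (\<Sum>i\<in>I. l2n LD (\<lambda>x. norm (moll n (f i) x)))"
    by (intro l2n_sum sqi_norm moll_L2(1) assms)
  also have "\<dots> \<le> (\<Sum>i\<in>I. mollC * B)"
  proof (rule sum_mono)
    fix i assume i: "i \<in> I"
    have "l2n LD (moll n (f i)) \<le> mollC * l2n LD (f i)" unfolding mollC_def by (rule moll_L2(2)[OF assms(1)[OF i]])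
    also have "\<dots> \<le> mollC * B" using assms(2)[OF i] mollC by (intro mult_left_mono) auto
    finally show "l2n LD (\<lambda>x. norm (moll n (f i) x)) \<le> mollC * B" by (simp add: l2n_norm)
  qed
  finally show "l2n LD (\<lambda>x. \<Sum>i\<in>I. norm (moll n (f i) x)) \<le> real (card I) * mollC * B" by simp
qed

lemma l2n_nn_lborel:
  assumes "sqi LD (G :: real^'d \<Rightarrow> real)"
  shows "(\<integral>\<^sup>+x. (ennreal \<bar>G x\<bar>)\<^sup>2 * indicator D x \<partial>lborel) = ennreal ((l2n LD G)\<^sup>2)"
  using sqi_ennreal[OF assms] by (simp add: nn_integral_lebesgue_on ennreal_power)

text \<open>H^2 regularity with explicit first and second derivatives and one common bound on the
  separate L^2 norms, the form in which it enters all constants.\<close>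

definition h2 :: "(real^'d \<Rightarrow> real^3) \<Rightarrow> ('d \<Rightarrow> real^'d \<Rightarrow> real^3) \<Rightarrow> ('d \<Rightarrow> 'd \<Rightarrow> real^'d \<Rightarrow> real^3) \<Rightarrow> real \<Rightarrow> bool" where
  "h2 v w ww B \<longleftrightarrow> sqi LD v \<and> l2n LD v \<le> B
     \<and> (\<forall>j. has_weak_deriv D [j] v (w j) \<and> sqi LD (w j) \<and> l2n LD (w j) \<le> B)
     \<and> (\<forall>j i. has_weak_deriv D [i] (w j) (ww j i) \<and> sqi LD (ww j i) \<and> l2n LD (ww j i) \<le> B)"

lemma h2D:
  assumes "h2 v w ww B"
  shows "sqi LD v" "l2n LD v \<le> B" "has_weak_deriv D [j] v (w j)" "sqi LD (w j)" "l2n LD (w j) \<le> B"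
    "has_weak_deriv D [i] (w j) (ww j i)" "sqi LD (ww j i)" "l2n LD (ww j i) \<le> B" "B \<ge> 0"
    "integrable LD v" "integrable LD (w j)" "integrable LD (ww j i)"
  using assms unfolding h2_def by (auto intro: sqi_LD_integrable order_trans[OF l2n_nonneg])

lemma moll_sum2_sqi:
  assumes "h2 v w ww B"
  shows "sqi LD (\<lambda>x. \<Sum>j\<in>UNIV. \<Sum>i\<in>UNIV. norm (moll n (ww j i) x))"
    "l2n LD (\<lambda>x. \<Sum>j\<in>UNIV. \<Sum>i\<in>UNIV. norm (moll n (ww j i) x)) \<le> (real CARD('d))\<^sup>2 * mollC * B"
proof -
  have 1: "sqi LD (\<lambda>x. \<Sum>i\<in>UNIV. norm (moll n (ww j i) x))"
    "l2n LD (\<lambda>x. \<Sum>i\<in>UNIV. norm (moll n (ww j i) x)) \<le> real CARD('d) * mollC * B" for j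
    using moll_sum_sqi[of UNIV "ww j" B] h2D[OF assms] by auto
  show "sqi LD (\<lambda>x. \<Sum>j\<in>UNIV. \<Sum>i\<in>UNIV. norm (moll n (ww j i) x))" by (intro sqi_sum 1)
  have "l2n LD (\<lambda>x. \<Sum>j\<in>UNIV. \<Sum>i\<in>UNIV. norm (moll n (ww j i) x)) \<le> (\<Sum>j\<in>(UNIV::'d set). real CARD('d) * mollC * B)"
    by (rule order_trans[OF l2n_sum sum_mono]) (auto intro: 1)
  then show "l2n LD (\<lambda>x. \<Sum>j\<in>UNIV. \<Sum>i\<in>UNIV. norm (moll n (ww j i) x)) \<le> (real CARD('d))\<^sup>2 * mollC * B"
    by (simp add: power2_eq_square mult.assoc)
qed

end

context convex_dom3 begin

text \<open>The value at x is compared with the value at y along the segment and integrated over all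
  y in D. The mean of |V| is bounded through L^2, and the oscillation becomes the double average
  estimated by \<open>segment_average_L4\<close>. The right-hand side is a square so that it fits
  the later passage to the limit.\<close>

lemma moll_L4:
  assumes w: "w \<in> H_set D 1"
  shows "(\<integral>\<^sup>+x. ennreal (norm (moll n w x) ^ 4) \<partial>LD)
    \<le> ennreal ((sqrt (16 * (1 + 2500 * diamD ^ 4) / mD) * (real CARD('d) * mollC * hn 1 w)\<^sup>2)\<^sup>2)"
proof -
  define b where "b = hn 1 w"
  define Kb where "Kb = real CARD('d) * mollC * b"
  have b0: "b \<ge> 0" by (simp add: b_def)
  have Kb0: "Kb \<ge> 0" using b0 mollC by (simp add: Kb_def)
  note wi = sqi_LD_integrable[OF H1_D(1)[OF w]] sqi_LD_integrable[OF H1_D(3)[OF w]]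
  let ?V = "moll n w"
  define G where "G = (\<lambda>z. \<Sum>j\<in>UNIV. norm (moll n (pd j w) z))"
  have pdb: "l2n LD (pd j w) \<le> b" for j using pd_le_hn[of 1 j w] by (simp add: b_def)
  have G: "sqi LD G" "l2n LD G \<le> Kb"
    unfolding G_def Kb_def using moll_sum_sqi[of UNIV "\<lambda>j. pd j w" b n] H1_D(3)[OF w] pdb by auto
  have G0: "G z \<ge> 0" for z unfolding G_def by (simp add: sum_nonneg)
  have [measurable]: "G \<in> borel_measurable borel" unfolding G_def using moll_borel[OF wi(2)] by measurable
  have [measurable]: "?V \<in> borel_measurable borel" by (rule moll_borel[OF wi(1)])
  have [measurable]: "D \<in> sets borel" by simp
  define g where "g = (\<lambda>z. ennreal (G z))"
  have [measurable]: "g \<in> borel_measurable borel" unfolding g_def by measurable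
  have V: "sqi LD ?V" "l2n LD ?V \<le> Kb"
  proof -
    show "sqi LD ?V" by (rule moll_L2(1)[OF H1_D(1)[OF w]])
    have "l2n LD ?V \<le> mollC * l2n LD w" unfolding mollC_def by (rule moll_L2(2)[OF H1_D(1)[OF w]])
    also have "\<dots> \<le> mollC * b" using mollC l2n_le_hn[of 1 w] by (intro mult_left_mono) (auto simp: b_def)
    also have "\<dots> \<le> real CARD('d) * (mollC * b)" using mollC b0 mult_right_mono[of 1 "real CARD('d)" "mollC * b"]
      by (simp add: Suc_le_eq)
    finally show "l2n LD ?V \<le> Kb" by (simp add: Kb_def mult.assoc)
  qed
  define \<mu> where "\<mu> = ennreal mD"
  define I0 where "I0 = (\<integral>\<^sup>+y. ennreal (norm (?V y)) * indicator D y \<partial>lborel)"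
  define F where "F = (\<lambda>x. \<integral>\<^sup>+\<tau>. (\<integral>\<^sup>+y. g (x + \<tau> *\<^sub>R (y - x)) * indicator D y \<partial>lborel) * indicator {0..1} \<tau> \<partial>lborel)"
  have [measurable]: "F \<in> borel_measurable borel" unfolding F_def by measurable
  have I0: "I0 \<le> ennreal (sqrt mD * Kb)"
  proof -
    have "I0 = ennreal (\<integral>y. norm (?V y) \<partial>LD)"
      unfolding I0_def using sqi_LD_integrable[OF V(1)]
      by (subst nn_integral_lebesgue_on[symmetric]) (auto intro!: nn_integral_eq_integral)
    also have "\<dots> \<le> ennreal (sqrt mD * Kb)"
      using sqi_imp_integrable(2)[OF finite_LD V(1)] V(2) mD
      by (intro ennreal_leI) (auto intro: order_trans mult_left_mono)
    finally show ?thesis .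
  qed
  have pw: "ennreal (norm (?V x)) * \<mu> \<le> I0 + ennreal diamD * F x" if x: "x \<in> D" for x
  proof -
    have "ennreal (norm (?V x)) * \<mu> = (\<integral>\<^sup>+y. ennreal (norm (?V x)) * indicator D y \<partial>lborel)"
      by (simp add: nn_integral_cmult_indicator \<mu>_def mD(2))
    also have "\<dots> \<le> (\<integral>\<^sup>+y. ennreal (norm (?V y)) * indicator D y + ennreal diamD * (\<integral>\<^sup>+\<tau>. g (x + \<tau> *\<^sub>R (y - x)) * indicator {0..1} \<tau> * indicator D y \<partial>lborel) \<partial>lborel)"
    proof (rule nn_integral_mono)
      fix y
      show "ennreal (norm (?V x)) * indicator D y \<le> ennreal (norm (?V y)) * indicator D y + ennreal diamD * (\<integral>\<^sup>+\<tau>. g (x + \<tau> *\<^sub>R (y - x)) * indicator {0..1} \<tau> * indicator D y \<partial>lborel)"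
      proof (cases "y \<in> D")
        case True
        have xy: "x \<in> closure D" "y \<in> closure D" using x True closure_subset by auto
        have "ennreal (norm (?V x)) \<le> ennreal (norm (?V y)) + ennreal (norm (?V y - ?V x))"
          using norm_triangle_ineq4[of "?V y" "?V y - ?V x"] by (simp add: ennreal_plus[symmetric] ennreal_leI del: ennreal_plus)
        also have "ennreal (norm (?V y - ?V x)) \<le> ennreal (norm (y - x)) * (\<integral>\<^sup>+\<tau>. g (x + \<tau> *\<^sub>R (y - x)) * indicator {0..1} \<tau> \<partial>lborel)"
          unfolding g_def G_def by (rule moll_diff_le[OF H1_D(2)[OF w] wi xy])
        also have "\<dots> \<le> ennreal diamD * (\<integral>\<^sup>+\<tau>. g (x + \<tau> *\<^sub>R (y - x)) * indicator {0..1} \<tau> \<partial>lborel)"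
          using diamD(2)[OF xy(2,1)] by (intro mult_right_mono ennreal_leI) auto
        finally show ?thesis using True by (simp add: add_left_mono)
      qed simp
    qed
    also have "\<dots> = I0 + ennreal diamD * (\<integral>\<^sup>+y. (\<integral>\<^sup>+\<tau>. g (x + \<tau> *\<^sub>R (y - x)) * indicator {0..1} \<tau> * indicator D y \<partial>lborel) \<partial>lborel)"
      unfolding I0_def by (subst nn_integral_add) (auto simp: nn_integral_cmult)
    also have "(\<integral>\<^sup>+y. (\<integral>\<^sup>+\<tau>. g (x + \<tau> *\<^sub>R (y - x)) * indicator {0..1} \<tau> * indicator D y \<partial>lborel) \<partial>lborel)
       = (\<integral>\<^sup>+\<tau>. (\<integral>\<^sup>+y. g (x + \<tau> *\<^sub>R (y - x)) * indicator {0..1} \<tau> * indicator D y \<partial>lborel) \<partial>lborel)"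
      by (rule lborel_pair.Fubini') measurable
    also have "\<dots> = F x"
      unfolding F_def
    proof (rule nn_integral_cong)
      fix \<tau> :: real
      show "(\<integral>\<^sup>+y. g (x + \<tau> *\<^sub>R (y - x)) * indicator {0..1} \<tau> * indicator D y \<partial>lborel)
        = (\<integral>\<^sup>+y. g (x + \<tau> *\<^sub>R (y - x)) * indicator D y \<partial>lborel) * indicator {0..1} \<tau>"
        by (subst nn_integral_multc[symmetric]) (auto simp: mult_ac)
    qed
    finally show ?thesis .
  qed
  have "(\<mu> ^ 4) * (\<integral>\<^sup>+x. ennreal (norm (?V x) ^ 4) \<partial>LD) = (\<integral>\<^sup>+x. (ennreal (norm (?V x)) * \<mu>) ^ 4 * indicator D x \<partial>lborel)"
    unfolding nn_integral_lebesgue_on[OF D_sets(1)]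
    by (subst nn_integral_cmult[symmetric]) (auto simp: power_mult_distrib ennreal_power mult_ac intro!: nn_integral_cong)
  also have "\<dots> \<le> (\<integral>\<^sup>+x. 16 * I0 ^ 4 * indicator D x + 16 * ennreal diamD ^ 4 * (F x ^ 4 * indicator D x) \<partial>lborel)"
  proof (rule nn_integral_mono)
    fix x
    show "(ennreal (norm (?V x)) * \<mu>) ^ 4 * indicator D x \<le> 16 * I0 ^ 4 * indicator D x + 16 * ennreal diamD ^ 4 * (F x ^ 4 * indicator D x)"
    proof (cases "x \<in> D")
      case True
      have "(ennreal (norm (?V x)) * \<mu>) ^ 4 \<le> (I0 + ennreal diamD * F x) ^ 4"
        using pw[OF True] by (rule power_mono) simp
      also have "\<dots> \<le> 16 * (I0 ^ 4 + (ennreal diamD * F x) ^ 4)" by (rule ennreal_power4_add_le)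
      finally show ?thesis using True by (simp add: power_mult_distrib distrib_left mult.assoc)
    qed simp
  qed
  also have "\<dots> = 16 * I0 ^ 4 * \<mu> + 16 * ennreal diamD ^ 4 * (\<integral>\<^sup>+x. F x ^ 4 * indicator D x \<partial>lborel)"
    by (subst nn_integral_add) (auto simp: nn_integral_cmult nn_integral_cmult_indicator mD(2) \<mu>_def)
  also have "\<dots> \<le> 16 * ennreal (sqrt mD * Kb) ^ 4 * \<mu> + 16 * ennreal diamD ^ 4 * (2500 * \<mu> ^ 3 * (ennreal (Kb\<^sup>2))\<^sup>2)"
  proof (intro add_mono mult_left_mono mult_right_mono power_mono I0)
    have "(\<integral>\<^sup>+x. F x ^ 4 * indicator D x \<partial>lborel) \<le> 2500 * emeasure lborel D ^ 3 * (\<integral>\<^sup>+x. (g x)\<^sup>2 * indicator D x \<partial>lborel)\<^sup>2"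
      unfolding F_def using dim3 by (intro segment_average_L4 convex_D) auto
    also have "(\<integral>\<^sup>+x. (g x)\<^sup>2 * indicator D x \<partial>lborel) = ennreal ((l2n LD G)\<^sup>2)"
      using l2n_nn_lborel[OF G(1)] G0 by (simp add: g_def)
    also have "2500 * emeasure lborel D ^ 3 * (ennreal ((l2n LD G)\<^sup>2))\<^sup>2 \<le> 2500 * \<mu> ^ 3 * (ennreal (Kb\<^sup>2))\<^sup>2"
      unfolding mD(2) \<mu>_def using G(2) by (intro mult_left_mono power_mono ennreal_leI) auto
    finally show "(\<integral>\<^sup>+x. F x ^ 4 * indicator D x \<partial>lborel) \<le> 2500 * \<mu> ^ 3 * (ennreal (Kb\<^sup>2))\<^sup>2" .
  qed auto
  also have "\<dots> = ennreal (16 * (sqrt mD * Kb) ^ 4 * mD + 16 * diamD ^ 4 * (2500 * mD ^ 3 * (Kb\<^sup>2)\<^sup>2))"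
    using mD(1) Kb0 diamD(1)
    by (simp add: \<mu>_def ennreal_power ennreal_mult[symmetric] ennreal_plus[symmetric] ennreal_numeral[symmetric] del: ennreal_plus ennreal_numeral)
  also have "16 * (sqrt mD * Kb) ^ 4 * mD + 16 * diamD ^ 4 * (2500 * mD ^ 3 * (Kb\<^sup>2)\<^sup>2)
     = mD ^ 4 * (16 * (1 + 2500 * diamD ^ 4) / mD * Kb ^ 4)"
  proof -
    have "sqrt mD ^ 4 = mD\<^sup>2" using mD(1) by (simp add: power4_eq_xxxx power2_eq_square)
    then show ?thesis using mD(1)
      by (simp add: power_mult_distrib) (simp add: field_simps power4_eq_xxxx power2_eq_square power3_eq_cube)
  qed
  also have "ennreal (mD ^ 4 * (16 * (1 + 2500 * diamD ^ 4) / mD * Kb ^ 4)) = ennreal (mD ^ 4) * ennreal (16 * (1 + 2500 * diamD ^ 4) / mD * Kb ^ 4)"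
    using mD(1) by (intro ennreal_mult) auto
  also have "\<mu> ^ 4 = ennreal (mD ^ 4)" using mD(1) unfolding \<mu>_def by (intro ennreal_power) simp
  finally have *: "ennreal (mD ^ 4) * (\<integral>\<^sup>+x. ennreal (norm (?V x) ^ 4) \<partial>LD) \<le> ennreal (mD ^ 4) * ennreal (16 * (1 + 2500 * diamD ^ 4) / mD * Kb ^ 4)" .
  have "ennreal (mD ^ 4) \<noteq> 0" using mD(1) by (simp add: ennreal_eq_0_iff not_le)
  then have "(\<integral>\<^sup>+x. ennreal (norm (?V x) ^ 4) \<partial>LD) \<le> ennreal (16 * (1 + 2500 * diamD ^ 4) / mD * Kb ^ 4)"
    by (intro ennreal_mult_le_mult_iff[THEN iffD1, OF _ _ *]) simp_all
  also have "16 * (1 + 2500 * diamD ^ 4) / mD * Kb ^ 4 = (sqrt (16 * (1 + 2500 * diamD ^ 4) / mD) * Kb\<^sup>2)\<^sup>2"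
    using mD(1) by (simp add: power_mult_distrib)
  finally show ?thesis by (simp add: Kb_def b_def)
qed

text \<open>Plays the part of the square of an embedding constant of H^1 into L^4, since it bounds
  |w|^2 in L^2.\<close>

definition sobC :: real where "sobC = sqrt (16 * (1 + 2500 * diamD ^ 4) / mD) * (real CARD('d) * mollC)\<^sup>2"

lemma sobC_nonneg: "sobC \<ge> 0" unfolding sobC_def using mD(1) by simp

lemma sobolev_L4:
  assumes w: "w \<in> H_set D 1"
  shows "sqi LD (\<lambda>x. (norm (w x))\<^sup>2)" "l2n LD (\<lambda>x. (norm (w x))\<^sup>2) \<le> sobC * (hn 1 w)\<^sup>2"
proof -
  note l = l2n_tendsto_power2_bound[OF moll_L2(1)[OF H1_D(1)[OF w]] H1_D(1)[OF w] moll_L2_tendsto[OF H1_D(1)[OF w]] moll_L4[OF w]]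
  show "sqi LD (\<lambda>x. (norm (w x))\<^sup>2)" by (rule l(1)) (use mD(1) in simp)
  have "l2n LD (\<lambda>x. (norm (w x))\<^sup>2) \<le> sqrt (16 * (1 + 2500 * diamD ^ 4) / mD) * (real CARD('d) * mollC * hn 1 w)\<^sup>2"
    by (rule l(2)) (use mD(1) in simp)
  then show "l2n LD (\<lambda>x. (norm (w x))\<^sup>2) \<le> sobC * (hn 1 w)\<^sup>2" by (simp add: sobC_def power_mult_distrib mult_ac)
qed

text \<open>The numerator adds L^1 bounds over D for the three parts of a Taylor expansion: value,
  gradient times diameter, and remainder. Division by \<open>mD\<close> turns the integral into a
  mean.\<close>

definition sobC_inf :: real where
  "sobC_inf = (sqrt mD * (mollC + diamD * (real CARD('d) * mollC)) + diamD\<^sup>2 * (2 * sqrt mD * ((real CARD('d))\<^sup>2 * mollC))) / mD"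

text \<open>The embedding of H^2 into bounded functions for d \<le> 3: the value at a is expanded
  around x, and the expansion is averaged over all x in D. The weighted remainder is square
  integrable in x by \<open>segment_average_L2\<close>, uniformly in a.\<close>

lemma moll_bounded:
  assumes h2: "h2 v w ww B" and a: "a \<in> D"
  shows "norm (moll n v a) \<le> sobC_inf * B"
proof -
  note h = h2D[OF h2]
  let ?V = "moll n v"
  have [measurable]: "D \<in> sets borel" by simp
  define G where "G = (\<lambda>z. \<Sum>j\<in>UNIV. \<Sum>i\<in>UNIV. norm (moll n (ww j i) z))"
  define G1 where "G1 = (\<lambda>z. \<Sum>j\<in>UNIV. norm (moll n (w j) z))"
  have G: "sqi LD G" "l2n LD G \<le> (real CARD('d))\<^sup>2 * mollC * B" unfolding G_def by (rule moll_sum2_sqi[OF h2])+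
  have G1: "sqi LD G1" "l2n LD G1 \<le> real CARD('d) * mollC * B"
    unfolding G1_def using moll_sum_sqi[of UNIV w B n] h by auto
  have G0: "G z \<ge> 0" "G1 z \<ge> 0" for z unfolding G_def G1_def by (simp_all add: sum_nonneg)
  have [measurable]: "G \<in> borel_measurable borel" unfolding G_def using moll_borel[OF h(12)] by measurable
  have [measurable]: "G1 \<in> borel_measurable borel" unfolding G1_def using moll_borel[OF h(11)] by measurable
  have [measurable]: "?V \<in> borel_measurable borel" by (rule moll_borel[OF h(10)])
  have V: "sqi LD ?V" "l2n LD ?V \<le> mollC * B"
  proof -
    show "sqi LD ?V" by (rule moll_L2(1)[OF h(1)])
    have "l2n LD ?V \<le> mollC * l2n LD v" unfolding mollC_def by (rule moll_L2(2)[OF h(1)])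
    also have "\<dots> \<le> mollC * B" using mollC h(2) by (intro mult_left_mono) auto
    finally show "l2n LD ?V \<le> mollC * B" .
  qed
  define Q where "Q = (\<lambda>x. \<integral>\<^sup>+\<tau>. ennreal \<tau> * ennreal (G (a + \<tau> *\<^sub>R (x - a))) * indicator {0..1} \<tau> \<partial>lborel)"
  have [measurable]: "Q \<in> borel_measurable borel" unfolding Q_def by measurable
  have isq: "(indicator S x)\<^sup>2 = (indicator S x :: ennreal)" for x and S :: "(real^'d) set" by (simp add: indicator_def)
  let ?K = "(real CARD('d))\<^sup>2 * mollC * B"
  have K0: "?K \<ge> 0" using mollC h(9) by simp
  have Q: "(\<integral>\<^sup>+x. Q x * indicator D x \<partial>lborel) \<le> ennreal (2 * sqrt mD * ?K)"
  proof (rule ennreal_power2_le_imp_le)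
    have "(\<integral>\<^sup>+x. Q x * indicator D x \<partial>lborel) = (\<integral>\<^sup>+x. indicator D x * (Q x * indicator D x) \<partial>lborel)"
      by (rule nn_integral_cong) (auto simp: indicator_def)
    then have "(\<integral>\<^sup>+x. Q x * indicator D x \<partial>lborel)\<^sup>2 \<le> (\<integral>\<^sup>+x. (indicator D x)\<^sup>2 \<partial>lborel) * (\<integral>\<^sup>+x. (Q x * indicator D x)\<^sup>2 \<partial>lborel)"
      by (simp only:) (rule Cauchy_Schwarz_nn_integral; measurable)
    also have "\<dots> = ennreal mD * (\<integral>\<^sup>+x. (Q x)\<^sup>2 * indicator D x \<partial>lborel)"
      by (simp add: power_mult_distrib isq mD(2))
    also have "(\<integral>\<^sup>+x. (Q x)\<^sup>2 * indicator D x \<partial>lborel) \<le> 4 * (\<integral>\<^sup>+x. (ennreal (G x))\<^sup>2 * indicator D x \<partial>lborel)"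
      unfolding Q_def using dim3 by (intro segment_average_L2 convex_D a) auto
    also have "(\<integral>\<^sup>+x. (ennreal (G x))\<^sup>2 * indicator D x \<partial>lborel) = ennreal ((l2n LD G)\<^sup>2)"
      using l2n_nn_lborel[OF G(1)] G0 by simp
    also have "ennreal mD * (4 * ennreal ((l2n LD G)\<^sup>2)) \<le> ennreal mD * (4 * ennreal (?K\<^sup>2))"
      using G(2) by (intro mult_left_mono ennreal_leI power_mono) auto
    also have "\<dots> = ennreal ((2 * sqrt mD * ?K)\<^sup>2)"
      using mD(1) by (simp add: ennreal_mult[symmetric] ennreal_numeral[symmetric] power_mult_distrib del: ennreal_numeral)
    finally show "(\<integral>\<^sup>+x. Q x * indicator D x \<partial>lborel)\<^sup>2 \<le> ennreal ((2 * sqrt mD * ?K)\<^sup>2)"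
      by (simp add: mult_left_mono)
  qed (use K0 mD(1) in simp)
  have pw: "ennreal (norm (?V a)) * indicator D x \<le> ennreal (norm (?V x) + diamD * G1 x) * indicator D x + ennreal (diamD\<^sup>2) * (Q x * indicator D x)" for x
  proof (cases "x \<in> D")
    case True
    then have ax: "a \<in> closure D" "x \<in> closure D" using a closure_subset by auto
    let ?L = "\<Sum>j\<in>UNIV. ((1 - ms n) * (a - x) $ j) *\<^sub>R moll n (w j) x"
    have "norm (?V a) \<le> norm (?V x) + norm ?L + norm (?V a - (?V x + ?L))"
      using norm_triangle_ineq[of "?V x + ?L" "?V a - (?V x + ?L)"] norm_triangle_ineq[of "?V x" ?L] by simp
    moreover have "norm ?L \<le> diamD * G1 x"
      using moll_grad_norm_le[of n "a - x" "\<lambda>j. moll n (w j) x"] mult_right_mono[OF diamD(2)[OF ax] G0(2)[of x]]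
      unfolding G1_def by linarith
    ultimately have "ennreal (norm (?V a)) \<le> ennreal ((norm (?V x) + diamD * G1 x) + norm (?V a - (?V x + ?L)))"
      by (intro ennreal_leI) linarith
    also have "\<dots> = ennreal (norm (?V x) + diamD * G1 x) + ennreal (norm (?V a - (?V x + ?L)))"
      using diamD(1) G0 by (intro ennreal_plus) auto
    also have "ennreal (norm (?V a - (?V x + ?L))) \<le> ennreal ((norm (x - a))\<^sup>2) * Q x"
      unfolding Q_def G_def by (rule moll_taylor[OF h(3,6,10,11,12) ax])
    also have "\<dots> \<le> ennreal (diamD\<^sup>2) * Q x"
      using diamD(2)[OF ax(2,1)] by (intro mult_right_mono ennreal_leI power_mono) auto
    finally show ?thesis using True by (simp add: add_left_mono)
  qed simp
  have "ennreal (norm (?V a) * mD) = (\<integral>\<^sup>+x. ennreal (norm (?V a)) * indicator D x \<partial>lborel)"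
    using mD(1) by (simp add: nn_integral_cmult_indicator mD(2) ennreal_mult)
  also have "\<dots> \<le> (\<integral>\<^sup>+x. ennreal (norm (?V x) + diamD * G1 x) * indicator D x + ennreal (diamD\<^sup>2) * (Q x * indicator D x) \<partial>lborel)"
    by (rule nn_integral_mono) (rule pw)
  also have "\<dots> = (\<integral>\<^sup>+x. ennreal (norm (?V x) + diamD * G1 x) * indicator D x \<partial>lborel) + ennreal (diamD\<^sup>2) * (\<integral>\<^sup>+x. Q x * indicator D x \<partial>lborel)"
    by (subst nn_integral_add) (auto simp: nn_integral_cmult)
  also have "(\<integral>\<^sup>+x. ennreal (norm (?V x) + diamD * G1 x) * indicator D x \<partial>lborel) = ennreal (\<integral>x. norm (?V x) + diamD * G1 x \<partial>LD)"
    unfolding nn_integral_lebesgue_on[OF D_sets(1), symmetric]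
    using sqi_LD_integrable[OF V(1)] sqi_imp_integrable(1)[OF finite_LD G1(1)] G0 diamD(1)
    by (intro nn_integral_eq_integral) auto
  also have "ennreal (\<integral>x. norm (?V x) + diamD * G1 x \<partial>LD) + ennreal (diamD\<^sup>2) * (\<integral>\<^sup>+x. Q x * indicator D x \<partial>lborel)
     \<le> ennreal (sqrt mD * (mollC * B) + diamD * (sqrt mD * (real CARD('d) * mollC * B))) + ennreal (diamD\<^sup>2) * ennreal (2 * sqrt mD * ?K)"
  proof (rule add_mono[OF ennreal_leI mult_left_mono[OF Q]])
    have "(\<integral>x. norm (?V x) + diamD * G1 x \<partial>LD) = (\<integral>x. norm (?V x) \<partial>LD) + diamD * (\<integral>x. norm (G1 x) \<partial>LD)"
      using sqi_LD_integrable[OF V(1)] sqi_imp_integrable(1)[OF finite_LD G1(1)] G0 by simp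
    also have "\<dots> \<le> sqrt mD * l2n LD ?V + diamD * (sqrt mD * l2n LD G1)"
      using sqi_imp_integrable(2)[OF finite_LD V(1)] sqi_imp_integrable(2)[OF finite_LD G1(1)] diamD(1)
      unfolding mD(3) by (intro add_mono mult_left_mono) auto
    also have "\<dots> \<le> sqrt mD * (mollC * B) + diamD * (sqrt mD * (real CARD('d) * mollC * B))"
      using V(2) G1(2) mD(1) diamD(1) by (intro add_mono mult_left_mono) auto
    finally show "(\<integral>x. norm (?V x) + diamD * G1 x \<partial>LD) \<le> sqrt mD * (mollC * B) + diamD * (sqrt mD * (real CARD('d) * mollC * B))" .
  qed simp
  also have "\<dots> = ennreal (sqrt mD * (mollC * B) + diamD * (sqrt mD * (real CARD('d) * mollC * B)) + diamD\<^sup>2 * (2 * sqrt mD * ?K))"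
    using mD(1) mollC h(9) diamD(1) by (subst ennreal_mult[symmetric], simp, simp, subst ennreal_plus[symmetric]) simp_all
  also have "sqrt mD * (mollC * B) + diamD * (sqrt mD * (real CARD('d) * mollC * B)) + diamD\<^sup>2 * (2 * sqrt mD * ?K) = mD * (sobC_inf * B)"
  proof -
    have "mD * (sobC_inf * B) = (mD * sobC_inf) * B" by simp
    also have "mD * sobC_inf = sqrt mD * (mollC + diamD * (real CARD('d) * mollC)) + diamD\<^sup>2 * (2 * sqrt mD * ((real CARD('d))\<^sup>2 * mollC))"
      using mD(1) by (simp add: sobC_inf_def)
    finally show ?thesis by (simp add: algebra_simps)
  qed
  finally have "norm (?V a) * mD \<le> mD * (sobC_inf * B)"
  proof (subst (asm) ennreal_le_iff)
    have "sobC_inf \<ge> 0" unfolding sobC_inf_def using mD(1) mollC diamD(1)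
      by (intro divide_nonneg_pos add_nonneg_nonneg mult_nonneg_nonneg) auto
    then show "0 \<le> mD * (sobC_inf * B)" using mD(1) h(9) by simp
  qed
  then show ?thesis using mD(1) by (simp add: mult.commute)
qed

lemma sobolev_inf:
  assumes h2: "h2 v w ww B" shows "AE x in LD. norm (v x) \<le> sobC_inf * B"
  by (rule l2n_tendsto_bounded[OF moll_L2(1)[OF h2D(1)[OF h2]] h2D(1)[OF h2] moll_L2_tendsto[OF h2D(1)[OF h2]]])
     (auto simp: space_restrict_space intro!: AE_I2 moll_bounded[OF h2])

end

section \<open>Finite element functions\<close>

lemma integral_lborel_translate:
  fixes f :: "'a::euclidean_space \<Rightarrow> 'b::{banach, second_countable_topology}"
  assumes "f \<in> borel_measurable borel"
  shows "(\<integral>x. f (x + a) \<partial>lborel) = (\<integral>x. f x \<partial>lborel)"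
proof -
  have "(\<integral>x. f x \<partial>lborel) = (\<integral>x. f x \<partial>distr lborel borel (\<lambda>x. a + x))" by (subst lborel_distr_plus) simp
  also have "\<dots> = (\<integral>x. f (a + x) \<partial>lborel)" using assms by (subst integral_distr) auto
  finally show ?thesis by (simp add: add.commute)
qed

lemma integral_lebesgue_on_lborel:
  fixes f :: "'a::euclidean_space \<Rightarrow> 'b::{banach, second_countable_topology}"
  assumes "f \<in> borel_measurable borel" "S \<in> sets borel"
  shows "(\<integral>x. f x \<partial>lebesgue_on S) = (\<integral>x. indicator S x *\<^sub>R f x \<partial>lborel)"
proof -
  have "(\<integral>x. f x \<partial>lebesgue_on S) = (\<integral>x. indicator S x *\<^sub>R f x \<partial>lebesgue)"
    using assms(2) by (intro integral_lebesgue_on_indicator) auto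
  also have "\<dots> = (\<integral>x. indicator S x *\<^sub>R f x \<partial>lborel)"
    by (intro integral_completion) (use assms(1) in \<open>auto intro!: borel_measurable_scaleR borel_measurable_indicator assms(2)\<close>)
  finally show ?thesis .
qed

context convex_dom begin

text \<open>Translation invariance moves the difference quotient from the test function to v; the
  two Lipschitz bounds allow dominated convergence on both sides. This gives weak derivatives of
  piecewise affine functions without integrating by parts over the elements.\<close>

lemma lipschitz_has_weak_deriv:
  fixes v :: "real^'d \<Rightarrow> real^3"
  assumes lip: "\<And>x y. x \<in> D \<Longrightarrow> y \<in> D \<Longrightarrow> norm (v x - v y) \<le> L * norm (x - y)"
    and w: "w \<in> borel_measurable borel" "\<And>x. norm (w x) \<le> B"
    and der: "AE x in LD. ((\<lambda>t. (v (x + t *\<^sub>R axis j 1) - v x) /\<^sub>R t) \<longlongrightarrow> w x) (at 0)"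
  shows "has_weak_deriv D [j] v w" "sqi LD v" "sqi LD w"
proof -
  let ?e = "axis j 1 :: real^'d"
  have L: "L \<ge> 0"
  proof -
    have "c \<in> D" using ball_D r_pos by auto
    moreover have "c + r *\<^sub>R ?e \<in> D" using ball_D r_pos by (auto simp: dist_norm norm_axis_1)
    ultimately have "0 \<le> L * norm (c - (c + r *\<^sub>R ?e))" using lip norm_ge_zero order_trans by blast
    then show ?thesis using r_pos by (simp add: norm_axis_1 zero_le_mult_iff)
  qed
  have cont: "continuous_on D v"
    using lip by (intro lipschitz_on_continuous_on[of L]) (auto intro!: lipschitz_onI simp: dist_norm L)
  have vb: "norm (v x) \<le> norm (v c) + L * diamD" if "x \<in> D" for x
  proof -
    have c: "c \<in> D" using ball_D r_pos by auto
    have "norm (v x) \<le> norm (v c) + norm (v x - v c)" using norm_triangle_ineq[of "v c" "v x - v c"] by simp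
    also have "norm (v x - v c) \<le> L * norm (x - c)" by (rule lip[OF that c])
    also have "\<dots> \<le> L * diamD" using diamD(2)[of x c] that c closure_subset L by (intro mult_left_mono) auto
    finally show ?thesis by simp
  qed
  \<comment> \<open>Extension by zero. Its jump at the boundary is harmless, because all shifts are
    shorter than a margin \<delta> by which the support of \<phi> stays inside D.\<close>
  define vt where "vt = (\<lambda>x. indicator D x *\<^sub>R v x)"
  have vtm [measurable]: "vt \<in> borel_measurable borel"
    unfolding vt_def by (rule borel_measurable_continuous_on_indicator[OF _ cont]) simp
  have "vt \<in> borel_measurable LD" by (rule borel_imp_lebesgue_on[OF vtm])
  then have vm: "v \<in> borel_measurable LD"
    by (rule measurable_cong[THEN iffD1, rotated]) (simp add: vt_def space_restrict_space)
  show sv: "sqi LD v" using vb by (intro sqi_bounded[OF finite_LD vm] AE_I2) (auto simp: space_restrict_space)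
  show sw: "sqi LD w" using w(2) by (intro sqi_bounded[OF finite_LD borel_imp_lebesgue_on[OF w(1)]]) auto
  note [measurable] = w(1)
  show "has_weak_deriv D [j] v w"
    unfolding has_weak_deriv_def
  proof (intro conjI allI impI sqi_locally_integrable sv sw)
    fix \<phi> assume \<phi>: "test_function D \<phi>"
    obtain K where K: "compact K" "K \<subseteq> D" "\<And>x. x \<notin> K \<Longrightarrow> \<phi> x = 0"
      using \<phi> by (auto simp: test_function_def)
    obtain \<delta> where \<delta>: "\<delta> > 0" "(\<Union>x\<in>K. ball x \<delta>) \<subseteq> D"
      using compact_subset_open_imp_ball_epsilon_subset[OF K(1) open_D K(2)] by blast
    obtain C where C: "C > 0" "\<And>x. \<bar>\<phi> x\<bar> \<le> C" using test_function_bounded[OF \<phi>] by blast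
    have Cabs: "\<bar>\<phi> x\<bar> \<le> \<bar>C\<bar>" for x using C by (metis abs_of_pos)
    obtain M where M: "M > 0" "\<And>x y. \<bar>\<phi> x - \<phi> y\<bar> \<le> M * norm (x - y)" using test_function_lipschitz[OF \<phi>] by blast
    have phim [measurable]: "\<phi> \<in> borel_measurable borel"
      by (intro borel_measurable_continuous_onI smooth_continuous test_function_smooth[OF \<phi>])
    define t where "t = (\<lambda>n. \<delta> / (real n + 2))"
    have t: "t n > 0" "t n < \<delta>" for n
    proof -
      have "\<delta> * 1 < \<delta> * (real n + 2)" using \<delta>(1) by (intro mult_strict_left_mono) auto
      then show "t n > 0" "t n < \<delta>" using \<delta>(1) by (auto simp: t_def divide_less_eq)
    qed
    have tne: "t n \<noteq> 0" for n using t(1)[of n] by simp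
    have t0: "t \<longlonglongrightarrow> 0" unfolding t_def by real_asymp
    have inD: "x - t n *\<^sub>R ?e \<in> D" if "x \<in> K" for x n
    proof -
      have "x - t n *\<^sub>R ?e \<in> ball x \<delta>" using t[of n] by (simp add: dist_norm norm_axis_1)
      then show ?thesis using \<delta>(2) that by blast
    qed
    let ?d = "iter_partial [j] \<phi>"
    have dphi: "(\<lambda>n. (\<phi> (x + t n *\<^sub>R ?e) - \<phi> x) / t n) \<longlonglongrightarrow> ?d x" for x
    proof -
      let ?F = "frechet_derivative \<phi> (at x)"
      have d: "(\<phi> has_derivative ?F) (at x)" by (rule smooth_imp_has_derivative[OF test_function_smooth[OF \<phi>]])
      have lin: "linear ?F" using d has_derivative_linear by blast
      have "((\<lambda>s. x + s *\<^sub>R ?e) has_derivative (\<lambda>s. s *\<^sub>R ?e)) (at 0)"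
        by (auto intro!: derivative_eq_intros)
      moreover have "(\<phi> has_derivative ?F) (at (x + 0 *\<^sub>R ?e))" using d by simp
      ultimately have "((\<lambda>s. \<phi> (x + s *\<^sub>R ?e)) has_derivative (\<lambda>s. ?F (s *\<^sub>R ?e))) (at 0)"
        by (rule has_derivative_compose)
      then have "((\<lambda>s. \<phi> (x + s *\<^sub>R ?e)) has_real_derivative ?F ?e) (at 0)"
        unfolding has_field_derivative_def
        by (rule has_derivative_eq_rhs) (auto simp only: linear_cmul[OF lin] real_scaleR_def mult.commute)
      then have "((\<lambda>s. (\<phi> (x + s *\<^sub>R ?e) - \<phi> x) / s) \<longlongrightarrow> ?F ?e) (at 0)" by (simp add: DERIV_def)
      from this[unfolded tendsto_at_iff_sequentially comp_def, rule_format, of t] show ?thesis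
        using tne t0 by simp
    qed
    have [measurable]: "?d \<in> borel_measurable borel"
      by (intro borel_measurable_continuous_onI smooth_continuous test_function_smooth[OF iter_partial_test[OF \<phi>]])
    have vti: "integrable lborel vt"
    proof -
      have "integrable lborel (\<lambda>x. indicator D x *\<^sub>R (norm (v c) + L * diamD))"
        using mD(2) by (intro integrable_scaleR_left integrable_real_indicator) auto
      then show ?thesis
      proof (rule Bochner_Integration.integrable_bound)
        show "AE x in lborel. norm (vt x) \<le> norm (indicator D x *\<^sub>R (norm (v c) + L * diamD))"
          using vb by (auto simp: vt_def indicator_def intro: order_trans[OF _ abs_ge_self])
      qed simp
    qed
    have lim1: "(\<lambda>n. \<integral>x. ((\<phi> (x + t n *\<^sub>R ?e) - \<phi> x) / t n) *\<^sub>R vt x \<partial>lborel) \<longlonglongrightarrow> (\<integral>x. ?d x *\<^sub>R vt x \<partial>lborel)"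
    proof (rule integral_dominated_convergence[where w="\<lambda>x. M * norm (vt x)"])
      show "AE x in lborel. norm (((\<phi> (x + t n *\<^sub>R ?e) - \<phi> x) / t n) *\<^sub>R vt x) \<le> M * norm (vt x)" for n
      proof (rule AE_I2)
        fix x
        have "\<bar>(\<phi> (x + t n *\<^sub>R ?e) - \<phi> x) / t n\<bar> \<le> M"
          using M(2)[of "x + t n *\<^sub>R ?e" x] t[of n] by (simp add: norm_axis_1 divide_le_eq abs_divide)
        then show "norm (((\<phi> (x + t n *\<^sub>R ?e) - \<phi> x) / t n) *\<^sub>R vt x) \<le> M * norm (vt x)"
          unfolding norm_scaleR real_norm_def by (rule mult_right_mono) simp
      qed
    qed (use vti dphi in \<open>auto intro!: tendsto_scaleR simp del: iter_partial.simps\<close>)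
    have alg1: "(p *\<^sub>R a - p *\<^sub>R b) /\<^sub>R s = p *\<^sub>R ((a - b) /\<^sub>R s)" for p s and a b :: "real^3"
      by (simp add: scaleR_diff_right[symmetric] mult.commute)
    have alg2: "((p - q) / s) *\<^sub>R b = (p *\<^sub>R b - q *\<^sub>R b) /\<^sub>R s" for p q s and b :: "real^3"
      by (simp add: scaleR_diff_left[symmetric] divide_inverse mult.commute)
    have shift: "(\<integral>x. ((\<phi> (x + t n *\<^sub>R ?e) - \<phi> x) / t n) *\<^sub>R vt x \<partial>lborel)
       = (\<integral>x. \<phi> x *\<^sub>R ((vt (x - t n *\<^sub>R ?e) - vt x) /\<^sub>R t n) \<partial>lborel)" for n
    proof -
      have i1: "integrable lborel (\<lambda>x. \<phi> (x + a) *\<^sub>R vt x)" for a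
      proof (rule Bochner_Integration.integrable_bound[of _ "\<lambda>x. C *\<^sub>R vt x"])
        show "AE x in lborel. norm (\<phi> (x + a) *\<^sub>R vt x) \<le> norm (C *\<^sub>R vt x)"
          unfolding norm_scaleR real_norm_def by (intro AE_I2 mult_right_mono Cabs) simp
      qed (use vti in auto)
      have "(\<integral>x. \<phi> (x + t n *\<^sub>R ?e) *\<^sub>R vt x \<partial>lborel) = (\<integral>x. (\<lambda>y. \<phi> y *\<^sub>R vt (y - t n *\<^sub>R ?e)) (x + t n *\<^sub>R ?e) \<partial>lborel)"
        by simp
      also have "\<dots> = (\<integral>x. \<phi> x *\<^sub>R vt (x - t n *\<^sub>R ?e) \<partial>lborel)"
        by (rule integral_lborel_translate) measurable
      finally have eq: "(\<integral>x. \<phi> (x + t n *\<^sub>R ?e) *\<^sub>R vt x \<partial>lborel) = (\<integral>x. \<phi> x *\<^sub>R vt (x - t n *\<^sub>R ?e) \<partial>lborel)" .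
      have i2: "integrable lborel (\<lambda>x. \<phi> x *\<^sub>R vt (x - t n *\<^sub>R ?e))"
      proof -
        have "integrable lborel (\<lambda>x. vt (x - t n *\<^sub>R ?e))"
        proof -
          have "integrable (distr lborel borel (\<lambda>x. - (t n *\<^sub>R ?e) + x)) vt" unfolding lborel_distr_plus by (rule vti)
          then have "integrable lborel (\<lambda>x. vt (- (t n *\<^sub>R ?e) + x))" by (subst (asm) integrable_distr_eq) auto
          then show ?thesis by simp
        qed
        note vs = this
        show ?thesis
        proof (rule Bochner_Integration.integrable_bound[of _ "\<lambda>x. C *\<^sub>R vt (x - t n *\<^sub>R ?e)", rotated 2])
          show "AE x in lborel. norm (\<phi> x *\<^sub>R vt (x - t n *\<^sub>R ?e)) \<le> norm (C *\<^sub>R vt (x - t n *\<^sub>R ?e))"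
            unfolding norm_scaleR real_norm_def by (intro AE_I2 mult_right_mono Cabs) simp
        qed (use vs in auto)
      qed
      have "(\<integral>x. ((\<phi> (x + t n *\<^sub>R ?e) - \<phi> x) / t n) *\<^sub>R vt x \<partial>lborel)
         = (\<integral>x. (\<phi> (x + t n *\<^sub>R ?e) *\<^sub>R vt x - \<phi> (x + 0) *\<^sub>R vt x) /\<^sub>R t n \<partial>lborel)"
        by (simp only: alg2 add_0_right)
      also have "\<dots> = ((\<integral>x. \<phi> x *\<^sub>R vt (x - t n *\<^sub>R ?e) \<partial>lborel) - (\<integral>x. \<phi> (x + 0) *\<^sub>R vt x \<partial>lborel)) /\<^sub>R t n"
        by (simp only: integral_scaleR_right Bochner_Integration.integral_diff[OF i1 i1] eq)
      also have "\<dots> = (\<integral>x. (\<phi> x *\<^sub>R vt (x - t n *\<^sub>R ?e) - \<phi> (x + 0) *\<^sub>R vt x) /\<^sub>R t n \<partial>lborel)"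
        by (simp only: integral_scaleR_right Bochner_Integration.integral_diff[OF i2 i1])
      finally show ?thesis by (simp only: alg1 add_0_right)
    qed
    have lim2: "(\<lambda>n. \<integral>x. \<phi> x *\<^sub>R ((vt (x - t n *\<^sub>R ?e) - vt x) /\<^sub>R t n) \<partial>LD) \<longlonglongrightarrow> (\<integral>x. \<phi> x *\<^sub>R (- w x) \<partial>LD)"
    proof (rule integral_dominated_convergence[where w="\<lambda>x. C * L"])
      show "AE x in LD. norm (\<phi> x *\<^sub>R ((vt (x - t n *\<^sub>R ?e) - vt x) /\<^sub>R t n)) \<le> C * L" for n
      proof (rule AE_I2)
        fix x
        show "norm (\<phi> x *\<^sub>R ((vt (x - t n *\<^sub>R ?e) - vt x) /\<^sub>R t n)) \<le> C * L"
        proof (cases "x \<in> K")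
          case True
          then have xD: "x \<in> D" using K(2) by blast
          have "norm (vt (x - t n *\<^sub>R ?e) - vt x) \<le> L * t n"
            using lip[OF inD[OF True] xD, of n] inD[OF True, of n] xD t[of n] by (simp add: vt_def norm_axis_1)
          then have "norm ((vt (x - t n *\<^sub>R ?e) - vt x) /\<^sub>R t n) \<le> L"
            using t[of n] by (simp add: divide_inverse_commute[symmetric] divide_le_eq)
          then show ?thesis unfolding norm_scaleR[of "\<phi> x"] real_norm_def using C L by (intro mult_mono) auto
        qed (use K(3) C L in simp)
      qed
      show "AE x in LD. (\<lambda>n. \<phi> x *\<^sub>R ((vt (x - t n *\<^sub>R ?e) - vt x) /\<^sub>R t n)) \<longlonglongrightarrow> \<phi> x *\<^sub>R (- w x)"
        using der
      proof eventually_elim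
        case (elim x)
        show ?case
        proof (cases "x \<in> K")
          case True
          then have xD: "x \<in> D" using K(2) by blast
          have t': "(\<lambda>n. - t n) \<longlonglongrightarrow> 0" using tendsto_minus[OF t0] by simp
          have "(\<lambda>n. (v (x + (- t n) *\<^sub>R ?e) - v x) /\<^sub>R (- t n)) \<longlonglongrightarrow> w x"
            using elim[unfolded tendsto_at_iff_sequentially comp_def, rule_format, of "\<lambda>n. - t n"] tne t'
            by simp
          from tendsto_minus[OF this] have "(\<lambda>n. (vt (x - t n *\<^sub>R ?e) - vt x) /\<^sub>R t n) \<longlonglongrightarrow> - w x"
            using inD[OF True] xD by (simp add: vt_def)
          then show ?thesis by (intro tendsto_scaleR tendsto_const)
        qed (use K(3) in simp)
      qed
      show "integrable LD (\<lambda>x. C * L)" using finite_LD by (simp add: finite_measure.integrable_const)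
    qed (auto intro!: borel_imp_lebesgue_on)
    have LDeq: "(\<integral>x. \<phi> x *\<^sub>R ((vt (x - t n *\<^sub>R ?e) - vt x) /\<^sub>R t n) \<partial>lborel) = (\<integral>x. \<phi> x *\<^sub>R ((vt (x - t n *\<^sub>R ?e) - vt x) /\<^sub>R t n) \<partial>LD)" for n
    proof -
      have "indicator D x *\<^sub>R (\<phi> x *\<^sub>R ((vt (x - t n *\<^sub>R ?e) - vt x) /\<^sub>R t n)) = \<phi> x *\<^sub>R ((vt (x - t n *\<^sub>R ?e) - vt x) /\<^sub>R t n)" for x
        using K(2,3) by (cases "x \<in> K") auto
      moreover have "(\<lambda>x. \<phi> x *\<^sub>R ((vt (x - t n *\<^sub>R ?e) - vt x) /\<^sub>R t n)) \<in> borel_measurable borel" by measurable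
      ultimately show ?thesis by (simp only: integral_lebesgue_on_lborel[OF _ D_sets(2)])
    qed
    have "(\<integral>x. ?d x *\<^sub>R vt x \<partial>lborel) = (\<integral>x. \<phi> x *\<^sub>R (- w x) \<partial>LD)"
      using LIMSEQ_unique[OF lim1[unfolded shift LDeq] lim2] .
    also have "(\<integral>x. ?d x *\<^sub>R vt x \<partial>lborel) = (\<integral>x. ?d x *\<^sub>R vt x \<partial>LD)"
    proof -
      have "indicator D x *\<^sub>R (?d x *\<^sub>R vt x) = ?d x *\<^sub>R vt x" for x
        by (cases "x \<in> D") (simp_all add: vt_def)
      moreover have "(\<lambda>x. ?d x *\<^sub>R vt x) \<in> borel_measurable borel" by measurable
      ultimately show ?thesis by (simp only: integral_lebesgue_on_lborel[OF _ D_sets(2)])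
    qed
    also have "\<dots> = (\<integral>x. ?d x *\<^sub>R v x \<partial>LD)"
      by (rule Bochner_Integration.integral_cong) (auto simp: vt_def space_restrict_space)
    finally show "(\<integral>x. ?d x *\<^sub>R v x \<partial>LD) = (- 1) ^ length [j] *\<^sub>R (\<integral>x. \<phi> x *\<^sub>R w x \<partial>LD)"
      by simp
  qed
qed

end

text \<open>A single mesh. Quasi-uniformity enters only through \<rho>, so a constant built from D
  and \<rho> is uniform over the whole family.\<close>

locale fem_dom = convex_dom3 D c r for D :: "(real^'d::finite) set" and c r +
  fixes T :: "(real^'d) set set" and h \<rho> :: real
  assumes mesh_T: "mesh D T" and h_pos: "h > 0" and rho_pos: "\<rho> > 0"
    and diam_K: "\<And>K. K \<in> T \<Longrightarrow> diameter K \<le> h"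
    and ball_K: "\<And>K. K \<in> T \<Longrightarrow> \<exists>x. cball x (\<rho> * h) \<subseteq> K"
begin

lemma fin_T: "finite T" using mesh_T by (simp add: mesh_def triangulation_def)

lemma Union_T: "\<Union>T = closure D" using mesh_T by (simp add: mesh_def)

lemma K_simplex:
  assumes "K \<in> T"
  obtains C where "finite C" "\<not> affine_dependent C" "card C = CARD('d) + 1" "K = convex hull C"
proof -
  have "int CARD('d) simplex K" using mesh_T assms by (simp add: mesh_def)
  then obtain C where C: "\<not> affine_dependent C" "int (card C) = int CARD('d) + 1" "K = convex hull C"
    by (auto simp: simplex_def)
  have "card C = CARD('d) + 1" using C(2) by linarith
  moreover have "finite C" using calculation card.infinite by fastforce
  ultimately show ?thesis using that C by blast
qed

lemma K_props:
  assumes "K \<in> T"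
  shows "compact K" "convex K" "closed K" "K \<subseteq> closure D" "interior K \<subseteq> D" "K \<in> sets borel" "negligible (frontier K)"
proof -
  obtain C where C: "finite C" "K = convex hull C" using K_simplex[OF assms] by metis
  show "compact K" using C by (simp add: finite_imp_compact_convex_hull)
  then show "closed K" "K \<in> sets borel" by (auto simp: compact_imp_closed)
  show cv: "convex K" using C by simp
  show sub: "K \<subseteq> closure D" using Union_T assms by blast
  have "interior K \<subseteq> interior (closure D)" by (rule interior_mono[OF sub])
  also have "interior (closure D) = D" using convex_interior_closure[OF convex_D] open_D by (simp add: interior_open)
  finally show "interior K \<subseteq> D" .
  show "negligible (frontier K)" by (rule negligible_convex_frontier[OF cv])
qed

text \<open>The intersection is a face of both simplices, and a face that meets the interior is the
  whole simplex.\<close>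

lemma K_int_disjoint:
  assumes "K \<in> T" "K' \<in> T" "x \<in> interior K" "x \<in> interior K'" shows "K = K'"
proof -
  have f: "(K \<inter> K') face_of K" "(K' \<inter> K) face_of K'"
    using mesh_T assms(1,2) by (auto simp: mesh_def triangulation_def)
  have x: "x \<in> K" "x \<in> K'" using assms interior_subset by blast+
  have "K \<inter> K' = K" using face_of_disjoint_interior[OF f(1)] assms(3) x by blast
  moreover have "K' \<inter> K = K'" using face_of_disjoint_interior[OF f(2)] assms(4) x by blast
  ultimately show ?thesis by blast
qed

lemma K_int_iff:
  assumes "K \<in> T" "x \<in> interior K" "K' \<in> T" shows "x \<in> interior K' \<longleftrightarrow> K' = K"
  using K_int_disjoint[OF assms(1,3,2)] assms(2) by auto

abbreviation LK where "LK K \<equiv> lebesgue_on (interior K)"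

text \<open>Frontiers of convex sets are null sets. Integrals over D therefore split over the open
  elements, on which discrete gradients are constant.\<close>

lemma AE_interior: "AE x in lebesgue. indicator D x = (\<Sum>K\<in>T. indicator (interior K) x :: ennreal)"
proof -
  have "negligible (\<Union>K\<in>T. frontier K)" using fin_T K_props(7) by (intro negligible_Union) auto
  then have "AE x in lebesgue. x \<notin> (\<Union>K\<in>T. frontier K)"
    by (intro AE_not_in) (simp add: negligible_iff_null_sets)
  then show ?thesis
  proof eventually_elim
    case (elim x)
    show ?case
    proof (cases "x \<in> D")
      case True
      then obtain K where K: "K \<in> T" "x \<in> K" using Union_T closure_subset by blast
      then have xi: "x \<in> interior K" using elim K_props(3)[OF K(1)] by (auto simp: frontier_def)
      have "(\<Sum>K'\<in>T. indicator (interior K') x :: ennreal) = (\<Sum>K'\<in>T. if K' = K then 1 else 0)"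
        by (intro sum.cong) (simp_all add: indicator_def K_int_iff[OF K(1) xi])
      then show ?thesis using True K fin_T by simp
    next
      case False
      then have "indicator (interior K) x = (0::ennreal)" if "K \<in> T" for K
        using K_props(5)[OF that] by (auto simp: indicator_def)
      then show ?thesis using False by simp
    qed
  qed
qed

lemma LK_measurable: "K \<in> T \<Longrightarrow> f \<in> borel_measurable LD \<Longrightarrow> f \<in> borel_measurable (LK K)"
  using measurable_restrict_mono K_props(5) by blast

lemma nn_integral_split:
  fixes f :: "real^'d \<Rightarrow> ennreal"
  assumes f: "f \<in> borel_measurable LD"
  shows "(\<integral>\<^sup>+x. f x \<partial>LD) = (\<Sum>K\<in>T. \<integral>\<^sup>+x. f x \<partial>LK K)"
proof -
  have m: "(\<lambda>x. f x * indicator (interior K) x) \<in> borel_measurable lebesgue" if "K \<in> T" for K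
    using LK_measurable[OF that f] by (simp add: borel_measurable_restrict_space_iff_ennreal)
  have "(\<integral>\<^sup>+x. f x \<partial>LD) = (\<integral>\<^sup>+x. f x * indicator D x \<partial>lebesgue)" by (simp add: nn_integral_restrict_space)
  also have "\<dots> = (\<integral>\<^sup>+x. (\<Sum>K\<in>T. f x * indicator (interior K) x) \<partial>lebesgue)"
    by (rule nn_integral_cong_AE) (use AE_interior in \<open>auto simp: sum_distrib_left elim!: eventually_mono\<close>)
  also have "\<dots> = (\<Sum>K\<in>T. \<integral>\<^sup>+x. f x * indicator (interior K) x \<partial>lebesgue)" by (rule nn_integral_sum) (rule m)
  also have "\<dots> = (\<Sum>K\<in>T. \<integral>\<^sup>+x. f x \<partial>LK K)" by (intro sum.cong) (auto simp: nn_integral_restrict_space)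
  finally show ?thesis .
qed

lemma AE_LD_I:
  assumes "\<And>K x. K \<in> T \<Longrightarrow> x \<in> interior K \<Longrightarrow> P x" shows "AE x in LD. P x"
proof -
  have "AE x in lebesgue. x \<in> D \<longrightarrow> P x" using AE_interior
  proof eventually_elim
    case (elim x)
    show ?case
    proof
      assume "x \<in> D"
      then have "(\<Sum>K\<in>T. indicator (interior K) x :: ennreal) \<noteq> 0" using elim by auto
      then obtain K where "K \<in> T" "indicator (interior K) x \<noteq> (0::ennreal)" by (meson sum.neutral)
      then show "P x" using assms by (auto simp: indicator_def split: if_splits)
    qed
  qed
  then show ?thesis by (simp add: AE_restrict_space_iff)
qed

lemma LK_finite: "K \<in> T \<Longrightarrow> finite_measure (LK K)"
  using K_props(1)[of K] bounded_subset[OF compact_imp_bounded interior_subset]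
  by (intro finite_measure_lebesgue_on bounded_set_imp_lmeasurable) auto

lemma LK_sqi:
  assumes "K \<in> T" "sqi LD f" shows "sqi (LK K) f"
proof -
  have "integrable (LK K) (\<lambda>x. (norm (f x))\<^sup>2)"
  proof -
    have "(\<integral>\<^sup>+x. ennreal ((norm (f x))\<^sup>2) \<partial>LK K) \<le> (\<integral>\<^sup>+x. ennreal ((norm (f x))\<^sup>2) \<partial>LD)"
      using K_props(5)[OF assms(1)]
      by (simp add: nn_integral_restrict_space) (intro nn_integral_mono, auto simp: indicator_def)
    also have "\<dots> < \<infinity>" using sqi_ennreal[OF assms(2)] by simp
    finally show ?thesis
      using LK_measurable[OF assms(1) sqiD(1)[OF assms(2)]] by (auto simp: integrable_iff_bounded)
  qed
  then show ?thesis using LK_measurable[OF assms(1) sqiD(1)[OF assms(2)]] by (simp add: sqi_def)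
qed

lemma l2n_split:
  fixes f :: "real^'d \<Rightarrow> 'b::euclidean_space"
  assumes f: "sqi LD f" shows "(l2n LD f)\<^sup>2 = (\<Sum>K\<in>T. (l2n (LK K) f)\<^sup>2)"
proof -
  have [measurable]: "f \<in> borel_measurable LD" using f by auto
  have "ennreal ((l2n LD f)\<^sup>2) = (\<Sum>K\<in>T. ennreal ((l2n (LK K) f)\<^sup>2))"
    using nn_integral_split[of "\<lambda>x. ennreal ((norm (f x))\<^sup>2)"] sqi_ennreal[OF f] sqi_ennreal[OF LK_sqi[OF _ f]]
    by simp
  also have "\<dots> = ennreal (\<Sum>K\<in>T. (l2n (LK K) f)\<^sup>2)" by (rule sum_ennreal) simp
  finally show ?thesis by (simp add: sum_nonneg)
qed

abbreviation Vh where "Vh \<equiv> fem_space D T"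

definition fA :: "(real^'d \<Rightarrow> real^3) \<Rightarrow> (real^'d) set \<Rightarrow> real^'d^3" where
  "fA v K = (SOME A. \<exists>b. \<forall>x\<in>K. v x = A *v x + b)"

lemma fA:
  assumes "v \<in> Vh" "K \<in> T"
  obtains b where "\<And>x. x \<in> K \<Longrightarrow> v x = fA v K *v x + b"
proof -
  have "\<exists>A b. \<forall>x\<in>K. v x = A *v x + b" using assms by (auto simp: fem_space_def)
  then have "\<exists>b. \<forall>x\<in>K. v x = fA v K *v x + b" unfolding fA_def by (rule someI_ex)
  then show ?thesis using that by blast
qed

lemma fA_diff: "v \<in> Vh \<Longrightarrow> K \<in> T \<Longrightarrow> x \<in> K \<Longrightarrow> y \<in> K \<Longrightarrow> v x - v y = fA v K *v (x - y)"
proof -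
  assume a: "v \<in> Vh" "K \<in> T" "x \<in> K" "y \<in> K"
  obtain b where "\<And>x. x \<in> K \<Longrightarrow> v x = fA v K *v x + b" using fA[OF a(1,2)] by blast
  then show "v x - v y = fA v K *v (x - y)" using a(3,4) by (simp add: matrix_vector_mult_diff_distrib)
qed

lemma Vh_lin:
  assumes "v \<in> Vh" "w \<in> Vh" shows "(\<lambda>x. a *\<^sub>R v x + b *\<^sub>R w x) \<in> Vh"
  unfolding fem_space_def
proof (intro CollectI conjI ballI)
  show "continuous_on (closure D) (\<lambda>x. a *\<^sub>R v x + b *\<^sub>R w x)"
    using assms by (intro continuous_intros) (auto simp: fem_space_def)
  fix K assume K: "K \<in> T"
  obtain b1 where b1: "\<And>x. x \<in> K \<Longrightarrow> v x = fA v K *v x + b1" using fA[OF assms(1) K] by blast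
  obtain b2 where b2: "\<And>x. x \<in> K \<Longrightarrow> w x = fA w K *v x + b2" using fA[OF assms(2) K] by blast
  have "\<forall>x\<in>K. a *\<^sub>R v x + b *\<^sub>R w x = (a *\<^sub>R fA v K + b *\<^sub>R fA w K) *v x + (a *\<^sub>R b1 + b *\<^sub>R b2)"
    using b1 b2 by (simp add: matrix_vector_mult_add_rdistrib scaleR_matrix_vector_assoc scaleR_add_right)
  then show "\<exists>A b'. \<forall>x\<in>K. a *\<^sub>R v x + b *\<^sub>R w x = A *v x + b'" by blast
qed

lemma Vh_diff: "v \<in> Vh \<Longrightarrow> w \<in> Vh \<Longrightarrow> (\<lambda>x. v x - w x) \<in> Vh"
  using Vh_lin[of v w 1 "-1"] by simp

text \<open>On a segment inside the convex closure, the finitely many elements cut out closed sets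
  of parameters on each of which the function is Lipschitz; these pieces combine to a Lipschitz
  bound on the whole parameter interval.\<close>

lemma Vh_lipschitz:
  assumes v: "v \<in> Vh"
  obtains L where "L \<ge> 0" "\<And>x y. x \<in> closure D \<Longrightarrow> y \<in> closure D \<Longrightarrow> norm (v x - v y) \<le> L * norm (x - y)"
proof -
  define L where "L = (\<Sum>K\<in>T. onorm ((*v) (fA v K)))"
  have on: "onorm ((*v) (fA v K)) \<ge> 0" for K by (intro onorm_pos_le matrix_vector_mul_bounded_linear)
  have L0: "L \<ge> 0" unfolding L_def using on by (simp add: sum_nonneg)
  have LK: "norm (v x - v y) \<le> L * norm (x - y)" if "K \<in> T" "x \<in> K" "y \<in> K" for K x y
  proof -
    have "norm (v x - v y) \<le> onorm ((*v) (fA v K)) * norm (x - y)"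
      unfolding fA_diff[OF v that] by (rule onorm[OF matrix_vector_mul_bounded_linear])
    also have "\<dots> \<le> L * norm (x - y)"
      unfolding L_def using that(1) fin_T on by (intro mult_right_mono member_le_sum) auto
    finally show ?thesis .
  qed
  show ?thesis
  proof (rule that[OF L0])
    fix x y assume xy: "x \<in> closure D" "y \<in> closure D"
    let ?f = "\<lambda>t::real. v (x + t *\<^sub>R (y - x))"
    let ?U = "\<lambda>K. {t \<in> {0..1}. x + t *\<^sub>R (y - x) \<in> K}"
    have "(L * norm (y - x))-lipschitz_on {0..1} ?f"
    proof (rule lipschitz_on_closed_Union[where I=T and U="?U"])
      fix K assume K: "K \<in> T"
      show "(L * norm (y - x))-lipschitz_on (?U K) ?f"
      proof (rule lipschitz_onI)
        fix s t assume st: "s \<in> ?U K" "t \<in> ?U K"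
        have "(x + s *\<^sub>R (y - x)) - (x + t *\<^sub>R (y - x)) = (s - t) *\<^sub>R (y - x)" by (simp add: algebra_simps)
        then have "norm ((x + s *\<^sub>R (y - x)) - (x + t *\<^sub>R (y - x))) = \<bar>s - t\<bar> * norm (y - x)" by simp
        then show "dist (?f s) (?f t) \<le> L * norm (y - x) * dist s t"
          using LK[OF K, of "x + s *\<^sub>R (y - x)" "x + t *\<^sub>R (y - x)"] st
          by (simp add: dist_norm mult_ac)
      qed (use L0 in simp)
      have "closed ({0..1::real} \<inter> (\<lambda>t. x + t *\<^sub>R (y - x)) -` K)"
        using K_props(3)[OF K] by (intro continuous_closed_preimage continuous_intros) auto
      also have "{0..1::real} \<inter> (\<lambda>t. x + t *\<^sub>R (y - x)) -` K = ?U K" by auto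
      finally show "closed (?U K)" .
    next
      show "{0..1} \<subseteq> (\<Union>K\<in>T. ?U K)"
      proof
        fix t :: real assume t: "t \<in> {0..1}"
        then have "x + t *\<^sub>R (y - x) \<in> \<Union>T" unfolding Union_T by (rule segment_in_closure[OF xy])
        then show "t \<in> (\<Union>K\<in>T. ?U K)" using t by blast
      qed
    qed (use L0 fin_T in auto)
    from lipschitz_onD[OF this, of 0 1] show "norm (v x - v y) \<le> L * norm (x - y)"
      by (simp add: dist_norm norm_minus_commute)
  qed
qed

text \<open>The piecewise constant derivative, with the junk value \<open>0\<close> on the boundaries of the elements.\<close>

definition fgrad :: "(real^'d \<Rightarrow> real^3) \<Rightarrow> 'd \<Rightarrow> real^'d \<Rightarrow> real^3" where
  "fgrad v j x = (\<Sum>K\<in>T. indicator (interior K) x *\<^sub>R (fA v K *v axis j 1))"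

lemma fgrad_eq:
  assumes K: "K \<in> T" "x \<in> interior K" shows "fgrad v j x = fA v K *v axis j 1"
proof -
  have "fgrad v j x = (\<Sum>K'\<in>T. if K' = K then fA v K *v axis j 1 else 0)"
    unfolding fgrad_def
    by (intro sum.cong) (simp_all add: indicator_def K_int_iff[OF K])
  then show ?thesis using K fin_T by simp
qed

text \<open>Inside an element the difference quotient is constant for small shifts, so the pointwise
  derivative demanded by \<open>lipschitz_has_weak_deriv\<close> exists off the skeleton of the
  mesh.\<close>

lemma Vh_H1:
  assumes v: "v \<in> Vh"
  shows "v \<in> H_set D 1" "AE x in LD. pd j v x = fgrad v j x" "has_weak_deriv D [j] v (fgrad v j)" "sqi LD (fgrad v j)"
    "\<exists>B. \<forall>x. norm (fgrad v j x) \<le> B"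
proof -
  obtain L where L: "L \<ge> 0" "\<And>x y. x \<in> closure D \<Longrightarrow> y \<in> closure D \<Longrightarrow> norm (v x - v y) \<le> L * norm (x - y)"
    using Vh_lipschitz[OF v] by blast
  have bnd: "norm (fgrad v j x) \<le> (\<Sum>K\<in>T. norm (fA v K *v axis j 1))" for j x
    unfolding fgrad_def by (rule order_trans[OF norm_sum sum_mono]) (auto simp: indicator_def)
  have meas: "fgrad v j \<in> borel_measurable borel" for j
    unfolding fgrad_def[abs_def] by measurable
  have der: "AE x in LD. ((\<lambda>t. (v (x + t *\<^sub>R axis j 1) - v x) /\<^sub>R t) \<longlongrightarrow> fgrad v j x) (at 0)" for j
  proof (rule AE_LD_I)
    fix K x assume K: "K \<in> T" "x \<in> interior K"
    have "((\<lambda>t. x + t *\<^sub>R axis j 1) \<longlongrightarrow> x + 0 *\<^sub>R axis j 1) (at (0::real))" by (intro tendsto_intros)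
    then have "\<forall>\<^sub>F t in at (0::real). x + t *\<^sub>R axis j 1 \<in> interior K"
      using K(2) by (intro topological_tendstoD[OF _ open_interior]) auto
    then have "\<forall>\<^sub>F t in at (0::real). fgrad v j x = (v (x + t *\<^sub>R axis j 1) - v x) /\<^sub>R t"
      using eventually_neq_at_within[of 0 0 UNIV]
    proof eventually_elim
      case (elim t)
      have "v (x + t *\<^sub>R axis j 1) - v x = fA v K *v (t *\<^sub>R axis j 1)"
        using fA_diff[OF v K(1), of "x + t *\<^sub>R axis j 1" x] elim(1) K(2) interior_subset by auto
      then show ?case using elim(2) fgrad_eq[OF K] by (simp add: matrix_vector_mult_scaleR)
    qed
    then show "((\<lambda>t. (v (x + t *\<^sub>R axis j 1) - v x) /\<^sub>R t) \<longlongrightarrow> fgrad v j x) (at 0)"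
      by (rule Lim_transform_eventually[OF tendsto_const])
  qed
  have wd: "has_weak_deriv D [j] v (fgrad v j)" "sqi LD v" "sqi LD (fgrad v j)" for j
  proof -
    have l: "norm (v x - v y) \<le> L * norm (x - y)" if "x \<in> D" "y \<in> D" for x y
      using L(2) that closure_subset by blast
    show "has_weak_deriv D [j] v (fgrad v j)" "sqi LD v" "sqi LD (fgrad v j)"
      by (rule lipschitz_has_weak_deriv[OF l meas bnd der]; assumption)+
  qed
  then show "has_weak_deriv D [j] v (fgrad v j)" "sqi LD (fgrad v j)" by auto
  show "v \<in> H_set D 1" by (rule H1_I[OF wd(2,1,3)])
  show "AE x in LD. pd j v x = fgrad v j x" by (rule weak_deriv_AE[OF wd(1)])
  show "\<exists>B. \<forall>x. norm (fgrad v j x) \<le> B" using bnd by blast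
qed

end

section \<open>Interpolation and inverse estimates\<close>

text \<open>Moving one vertex to the origin turns affine into linear independence, where values can
  be prescribed and extended linearly.\<close>

lemma affine_interpolation:
  fixes V :: "real^'d::finite \<Rightarrow> real^3"
  assumes "\<not> affine_dependent C"
  shows "\<exists>(A::real^'d^3) b. \<forall>a\<in>C. A *v a + b = V a"
proof (cases "C = {}")
  case False
  then obtain a0 where a0: "a0 \<in> C" by blast
  define B where "B = (\<lambda>x. - a0 + x) ` (C - {a0})"
  have "independent B" using affine_dependent_iff_dependent2[OF a0] assms by (simp add: B_def)
  from linear_independent_extend[OF this, of "\<lambda>y. V (a0 + y) - V a0"] obtain g where
    g: "linear g" "\<And>x. x \<in> B \<Longrightarrow> g x = V (a0 + x) - V a0" by blast
  have "matrix g *v a + (V a0 - g a0) = V a" if "a \<in> C" for a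
  proof -
    have "g (a - a0) = V a - V a0"
    proof (cases "a = a0")
      case False
      then have "a - a0 \<in> B" using that unfolding B_def by force
      then show ?thesis using g(2)[of "a - a0"] by simp
    qed (use g(1) in \<open>simp add: linear_0\<close>)
    then show ?thesis using g(1) by (simp add: matrix_works linear_diff algebra_simps)
  qed
  then show ?thesis by blast
qed simp

lemma ennreal_sum_power2_le:
  fixes s :: "'a \<Rightarrow> ennreal"
  assumes "finite C"
  shows "(\<Sum>a\<in>C. s a)\<^sup>2 \<le> of_nat (card C) * (\<Sum>a\<in>C. (s a)\<^sup>2)"
  using Cauchy_Schwarz_nn_integral[of "\<lambda>_. 1" "count_space C" s] assms
  by (simp add: nn_integral_count_space_finite)

lemma affine_matrix_combination:
  fixes A :: "real^'d::finite^'n::finite"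
  assumes "s + t = 1"
  shows "A *v (s *\<^sub>R x + t *\<^sub>R y) + b = s *\<^sub>R (A *v x + b) + t *\<^sub>R (A *v y + b)"
proof -
  have "(s + t) *\<^sub>R b = b" using assms by simp
  then have b: "s *\<^sub>R b + t *\<^sub>R b = b" by (simp only: scaleR_left_distrib)
  have "A *v (s *\<^sub>R x + t *\<^sub>R y) + (s *\<^sub>R b + t *\<^sub>R b) = s *\<^sub>R (A *v x + b) + t *\<^sub>R (A *v y + b)"
    by (simp add: matrix_vector_right_distrib matrix_vector_mult_scaleR scaleR_add_right)
  then show ?thesis unfolding b .
qed

section \<open>Nodal interpolation\<close>

context fem_dom begin

definition vts :: "(real^'d) set \<Rightarrow> (real^'d) set" where
  "vts K = (SOME C. finite C \<and> \<not> affine_dependent C \<and> card C = CARD('d) + 1 \<and> K = convex hull C)"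

lemma vts:
  assumes "K \<in> T"
  shows "finite (vts K)" "\<not> affine_dependent (vts K)" "card (vts K) = CARD('d) + 1" "K = convex hull vts K"
proof -
  have "\<exists>C. finite C \<and> \<not> affine_dependent C \<and> card C = CARD('d) + 1 \<and> K = convex hull C"
    using K_simplex[OF assms] by metis
  from someI_ex[OF this, folded vts_def]
  show "finite (vts K)" "\<not> affine_dependent (vts K)" "card (vts K) = CARD('d) + 1" "K = convex hull vts K"
    by blast+
qed

lemma vts_sub: "K \<in> T \<Longrightarrow> a \<in> vts K \<Longrightarrow> a \<in> K"
  using vts(4) hull_subset by fastforce

text \<open>The affine pieces fit together because the intersection of two elements is a common
  face: it is the hull of vertices shared by both, and affine maps that agree on these agree on the
  hull.\<close>

lemma interpolant_exists:
  obtains p where "p \<in> Vh" "\<And>K a. K \<in> T \<Longrightarrow> a \<in> vts K \<Longrightarrow> p a = V a"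
proof -
  have "\<exists>A b. \<forall>a\<in>vts K. A *v a + b = V a" if "K \<in> T" for K
    by (rule affine_interpolation[OF vts(2)[OF that]])
  then have "\<forall>K\<in>T. \<exists>M. \<forall>a\<in>vts K. fst M *v a + snd M = V a" by (metis fst_conv snd_conv)
  then obtain M where M: "\<forall>K\<in>T. \<forall>a\<in>vts K. fst (M K) *v a + snd (M K) = V a" by (rule bchoice[THEN exE])
  define A where "A = (\<lambda>K. fst (M K))"
  define b where "b = (\<lambda>K. snd (M K))"
  have Ab: "A K *v a + b K = V a" if "K \<in> T" "a \<in> vts K" for K a
    using M that by (simp add: A_def b_def)
  define f where "f = (\<lambda>K x. A K *v x + b K)"
  have cons: "f K x = f K' x" if K: "K \<in> T" "K' \<in> T" and x: "x \<in> K" "x \<in> K'" for K K' x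
  proof -
    have "(K \<inter> K') face_of K" "(K' \<inter> K) face_of K'"
      using mesh_T K by (auto simp: mesh_def triangulation_def)
    then have "(K \<inter> K') face_of (convex hull vts K)" "(K \<inter> K') face_of (convex hull vts K')"
      unfolding vts(4)[OF K(1), symmetric] vts(4)[OF K(2), symmetric] by (simp_all only: Int_commute)
    then have "\<exists>C. C \<subseteq> vts K \<and> K \<inter> K' = convex hull C" "\<exists>C. C \<subseteq> vts K' \<and> K \<inter> K' = convex hull C"
      by (simp_all only: face_of_convex_hull_affine_independent[OF vts(2)[OF K(1)]] face_of_convex_hull_affine_independent[OF vts(2)[OF K(2)]])
    then obtain C C' where C: "C \<subseteq> vts K" "K \<inter> K' = convex hull C" and C': "C' \<subseteq> vts K'" "K \<inter> K' = convex hull C'"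
      by (elim exE conjE)
    have ind: "\<not> affine_dependent C" "\<not> affine_dependent C'"
      by (rule affine_independent_subset[OF vts(2)[OF K(1)] C(1)], rule affine_independent_subset[OF vts(2)[OF K(2)] C'(1)])
    \<comment> \<open>Both sets are the extreme points of the same convex set.\<close>
    have "C = C'"
    proof (rule set_eqI)
      fix a
      have "convex hull C = convex hull C'" using C(2) C'(2) by (simp only:)
      then show "a \<in> C \<longleftrightarrow> a \<in> C'"
        using extreme_point_of_convex_hull_affine_independent[OF ind(1), of a] extreme_point_of_convex_hull_affine_independent[OF ind(2), of a]
        by (simp only:)
    qed
    have eqC: "f K a = f K' a" if "a \<in> C" for a
    proof -
      have "a \<in> vts K" "a \<in> vts K'" using that C(1) C'(1) \<open>C = C'\<close> by auto
      then show ?thesis unfolding f_def using Ab[OF K(1)] Ab[OF K(2)] by simp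
    qed
    have "convex {x. f K x = f K' x}"
      unfolding convex_def f_def
    proof (intro ballI allI impI, unfold mem_Collect_eq)
      fix y z and s t :: real
      assume a: "A K *v y + b K = A K' *v y + b K'" "A K *v z + b K = A K' *v z + b K'" "s + t = 1"
      show "A K *v (s *\<^sub>R y + t *\<^sub>R z) + b K = A K' *v (s *\<^sub>R y + t *\<^sub>R z) + b K'"
        unfolding affine_matrix_combination[OF a(3)] a(1,2) ..
    qed
    then have "convex hull C \<subseteq> {x. f K x = f K' x}" using eqC by (intro hull_minimal) auto
    then show ?thesis using x C(2) by blast
  qed
  define p where "p = (\<lambda>x. f (SOME K. K \<in> T \<and> x \<in> K) x)"
  have p: "p x = f K x" if "K \<in> T" "x \<in> K" for K x
  proof -
    have "(SOME K. K \<in> T \<and> x \<in> K) \<in> T \<and> x \<in> (SOME K. K \<in> T \<and> x \<in> K)"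
      by (rule someI[of "\<lambda>K. K \<in> T \<and> x \<in> K" K]) (use that in simp)
    then show ?thesis unfolding p_def using cons that by blast
  qed
  have "p \<in> Vh"
    unfolding fem_space_def
  proof (intro CollectI conjI ballI)
    have "continuous_on (\<Union>K\<in>T. K) p"
    proof (rule continuous_on_closed_Union[OF fin_T])
      fix K assume K: "K \<in> T"
      show "closed K" by (rule K_props(3)[OF K])
      have "continuous_on K (f K)" unfolding f_def
        by (intro continuous_intros linear_continuous_on matrix_vector_mul_bounded_linear)
      then show "continuous_on K p" by (rule continuous_on_eq) (use p K in simp)
    qed
    then show "continuous_on (closure D) p" using Union_T by simp
    show "\<exists>A b. \<forall>x\<in>K. p x = A *v x + b" if "K \<in> T" for K
      using p[OF that] unfolding f_def by blast
  qed
  moreover have "p a = V a" if "K \<in> T" "a \<in> vts K" for K a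
    using p[OF that(1) vts_sub[OF that]] Ab[OF that] by (simp add: f_def)
  ultimately show ?thesis using that by blast
qed

text \<open>Squared norms are additive over elements, so a local estimate with a common factor
  becomes global with the same factor.\<close>

lemma split_bound:
  fixes f :: "real^'d \<Rightarrow> 'b::euclidean_space" and g :: "real^'d \<Rightarrow> 'e::euclidean_space"
  assumes f: "f \<in> borel_measurable LD" and g: "sqi LD g" and "k \<ge> 0"
    and le: "\<And>K. K \<in> T \<Longrightarrow> (\<integral>\<^sup>+x. ennreal ((norm (f x))\<^sup>2) \<partial>LK K) \<le> ennreal (k\<^sup>2) * (\<integral>\<^sup>+x. ennreal ((norm (g x))\<^sup>2) \<partial>LK K)"
  shows "sqi LD f" "l2n LD f \<le> k * l2n LD g"
proof -
  have [measurable]: "f \<in> borel_measurable LD" "g \<in> borel_measurable LD" using f g by auto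
  have "(\<integral>\<^sup>+x. ennreal ((norm (f x))\<^sup>2) \<partial>LD) = (\<Sum>K\<in>T. \<integral>\<^sup>+x. ennreal ((norm (f x))\<^sup>2) \<partial>LK K)"
    by (rule nn_integral_split) measurable
  also have "\<dots> \<le> (\<Sum>K\<in>T. ennreal (k\<^sup>2) * (\<integral>\<^sup>+x. ennreal ((norm (g x))\<^sup>2) \<partial>LK K))" by (rule sum_mono) (rule le)
  also have "\<dots> = ennreal (k\<^sup>2) * (\<integral>\<^sup>+x. ennreal ((norm (g x))\<^sup>2) \<partial>LD)"
    by (subst nn_integral_split) (auto simp: sum_distrib_left)
  also have "\<dots> = ennreal ((k * l2n LD g)\<^sup>2)" unfolding sqi_ennreal[OF g] by (simp add: ennreal_mult power_mult_distrib)
  finally show "sqi LD f" "l2n LD f \<le> k * l2n LD g"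
    using sqiI_ennreal[OF f] \<open>k \<ge> 0\<close> by auto
qed

lemma nn_integral_LK_closed:
  assumes "K \<in> T"
  shows "(\<integral>\<^sup>+x. f x * indicator K x \<partial>lborel) = (\<integral>\<^sup>+x. f x \<partial>LK K)"
proof -
  have "AE x in lebesgue. x \<notin> frontier K"
    using K_props(7)[OF assms] by (intro AE_not_in) (simp add: negligible_iff_null_sets)
  then have "AE x in lebesgue. f x * indicator K x = f x * indicator (interior K) x"
    using K_props(3)[OF assms] interior_subset[of K]
    by (auto elim!: eventually_mono simp: frontier_def indicator_def)
  then have "(\<integral>\<^sup>+x. f x * indicator K x \<partial>lebesgue) = (\<integral>\<^sup>+x. f x * indicator (interior K) x \<partial>lebesgue)"
    by (rule nn_integral_cong_AE)
  then show ?thesis by (simp add: nn_integral_completion nn_integral_restrict_space)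
qed

text \<open>\<open>V0\<close> and \<open>W\<close> stand for value and gradient at x. The
  interpolant minus this first-order polynomial is affine on K and bounded at the vertices by the
  Taylor remainders \<beta>, hence on all of K; its slope is read off from two points of K at
  distance \<open>\<rho> * h\<close>. Expanding at the running point x keeps the remainders
  integrable in x.\<close>

lemma interpolation_pointwise:
  assumes p: "p \<in> Vh" and K: "K \<in> T" "x \<in> interior K"
    and \<beta>: "\<And>a. a \<in> vts K \<Longrightarrow> norm (p a - (V0 + (\<Sum>j\<in>UNIV. (s * (a - x) $ j) *\<^sub>R W j))) \<le> \<beta> a"
  shows "norm (p x - V0) \<le> (\<Sum>a\<in>vts K. \<beta> a)"
    "norm (fA p K *v axis j 1 - s *\<^sub>R W j) \<le> 2 / (\<rho> * h) * (\<Sum>a\<in>vts K. \<beta> a)"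
proof -
  obtain b where b: "\<And>z. z \<in> K \<Longrightarrow> p z = fA p K *v z + b" using fA[OF p K(1)] by blast
  define M :: "real^'d \<Rightarrow> real^3" where "M = (\<lambda>z. \<Sum>j\<in>UNIV. (s * z $ j) *\<^sub>R W j)"
  have Mlin: "M (s1 *\<^sub>R y + s2 *\<^sub>R z) = s1 *\<^sub>R M y + s2 *\<^sub>R M z" for s1 s2 y z
    unfolding M_def by (simp add: scaleR_sum_right sum.distrib[symmetric] algebra_simps)
  define q where "q = (\<lambda>z. (fA p K *v z + b) - V0 - M (z - x))"
  define Q where "Q = (\<Sum>a\<in>vts K. \<beta> a)"
  have qaff: "q (s1 *\<^sub>R y + s2 *\<^sub>R z) = s1 *\<^sub>R q y + s2 *\<^sub>R q z" if "s1 + s2 = 1" for s1 s2 y z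
  proof -
    have e: "s1 *\<^sub>R w + s2 *\<^sub>R w = w" for w :: "real^'n::finite"
      unfolding scaleR_left_distrib[symmetric] that by simp
    have "s1 *\<^sub>R y + s2 *\<^sub>R z - (s1 *\<^sub>R x + s2 *\<^sub>R x) = s1 *\<^sub>R (y - x) + s2 *\<^sub>R (z - x)"
      by (simp add: scaleR_diff_right)
    then have Mx: "M (s1 *\<^sub>R y + s2 *\<^sub>R z - x) = s1 *\<^sub>R M (y - x) + s2 *\<^sub>R M (z - x)"
      unfolding e by (simp only: Mlin)
    have "q (s1 *\<^sub>R y + s2 *\<^sub>R z) = (s1 *\<^sub>R (fA p K *v y + b) + s2 *\<^sub>R (fA p K *v z + b))
      - (s1 *\<^sub>R V0 + s2 *\<^sub>R V0) - (s1 *\<^sub>R M (y - x) + s2 *\<^sub>R M (z - x))"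
      unfolding q_def affine_matrix_combination[OF that] Mx e ..
    also have "\<dots> = s1 *\<^sub>R q y + s2 *\<^sub>R q z" by (simp add: q_def scaleR_diff_right)
    finally show ?thesis .
  qed
  have r0: "\<beta> a \<ge> 0" if "a \<in> vts K" for a using \<beta>[OF that] norm_ge_zero order_trans by blast
  have "convex {z. norm (q z) \<le> Q}"
    unfolding convex_def
  proof (intro ballI allI impI, unfold mem_Collect_eq)
    fix y z and s1 s2 :: real
    assume a: "norm (q y) \<le> Q" "norm (q z) \<le> Q" "0 \<le> s1" "0 \<le> s2" "s1 + s2 = 1"
    have "norm (q (s1 *\<^sub>R y + s2 *\<^sub>R z)) \<le> s1 * norm (q y) + s2 * norm (q z)"
      unfolding qaff[OF a(5)] using norm_triangle_ineq[of "s1 *\<^sub>R q y" "s2 *\<^sub>R q z"] a by simp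
    also have "\<dots> \<le> s1 * Q + s2 * Q" using a by (intro add_mono mult_left_mono) auto
    also have "\<dots> = Q" using a(5) by (metis distrib_right mult_1)
    finally show "norm (q (s1 *\<^sub>R y + s2 *\<^sub>R z)) \<le> Q" .
  qed
  moreover have "vts K \<subseteq> {z. norm (q z) \<le> Q}"
  proof
    fix a assume a: "a \<in> vts K"
    have "q a = p a - (V0 + M (a - x))" unfolding q_def using b[OF vts_sub[OF K(1) a]] by simp
    then have "norm (q a) \<le> \<beta> a" using \<beta>[OF a] by (simp add: M_def)
    also have "\<beta> a \<le> Q" unfolding Q_def using a vts(1)[OF K(1)] r0 by (intro member_le_sum) auto
    finally show "a \<in> {z. norm (q z) \<le> Q}" by simp
  qed
  ultimately have qK: "norm (q z) \<le> Q" if "z \<in> K" for z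
    using hull_minimal[of "vts K" "{z. norm (q z) \<le> Q}" convex] vts(4)[OF K(1)] that by blast
  have xK: "x \<in> K" using K(2) interior_subset by blast
  have "q x = p x - V0" using b[OF xK] Mlin[of 0 x 0 x] by (simp add: q_def)
  then show "norm (p x - V0) \<le> (\<Sum>a\<in>vts K. \<beta> a)" using qK[OF xK] by (simp add: Q_def)
  obtain x0 where x0: "cball x0 (\<rho> * h) \<subseteq> K" using ball_K[OF K(1)] by blast
  let ?R = "\<rho> * h"
  have R: "?R > 0" using rho_pos h_pos by simp
  let ?e = "axis j 1 :: real^'d"
  have "x0 + ?R *\<^sub>R ?e \<in> K" "x0 \<in> K" using x0 R by (auto simp: dist_norm norm_axis_1)
  then have "norm (q (x0 + ?R *\<^sub>R ?e) - q x0) \<le> Q + Q"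
    using qK norm_triangle_ineq4[of "q (x0 + ?R *\<^sub>R ?e)" "q x0"] by (meson add_mono order_trans)
  moreover have "q (x0 + ?R *\<^sub>R ?e) - q x0 = ?R *\<^sub>R (fA p K *v ?e - s *\<^sub>R W j)"
  proof -
    have "M ?e = s *\<^sub>R W j"
      unfolding M_def by (subst sum.remove[of _ j]) (auto simp: axis_def intro!: sum.neutral)
    moreover have "M (x0 + ?R *\<^sub>R ?e - x) = M (x0 - x) + ?R *\<^sub>R M ?e"
      using Mlin[of 1 "x0 - x" ?R ?e] by (simp add: algebra_simps)
    moreover have "fA p K *v (x0 + ?R *\<^sub>R ?e) = fA p K *v x0 + ?R *\<^sub>R (fA p K *v ?e)"
      by (simp add: matrix_vector_right_distrib matrix_vector_mult_scaleR)
    ultimately show ?thesis by (simp add: q_def scaleR_diff_right)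
  qed
  ultimately have "?R * norm (fA p K *v ?e - s *\<^sub>R W j) \<le> 2 * Q" using R by simp
  then show "norm (fA p K *v axis j 1 - s *\<^sub>R W j) \<le> 2 / (\<rho> * h) * (\<Sum>a\<in>vts K. \<beta> a)"
    using R by (simp add: Q_def field_simps)
qed

text \<open>The factor 2 is the root of the constant in \<open>segment_average_L2\<close>, d + 1
  counts vertices, and d^2 mollified second derivatives contribute \<open>mollC\<close>
  each.\<close>

definition intC :: real where "intC = 2 * (real CARD('d) + 1) * ((real CARD('d))\<^sup>2 * mollC)"

lemma intC_pos: "intC > 0"
  unfolding intC_def using mollC by (intro mult_pos_pos) (auto intro: add_nonneg_pos)

text \<open>With \<alpha> = 1 this serves the values, with \<alpha> =
  \<open>2 / (\<rho> * h)\<close> the gradients, which gives the orders h^2 and h. Under the square,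
  one factor d + 1 comes from Cauchy-Schwarz for the sum over the vertices, the other from adding
  their equal bounds.\<close>

lemma interpolation_remainder_L2:
  assumes h2: "h2 v w ww B" and K: "K \<in> T"
    and f: "\<And>x. x \<in> interior K \<Longrightarrow> norm (f x) \<le> \<alpha> * (\<Sum>a\<in>vts K. norm (moll n v a - (moll n v x + (\<Sum>j\<in>UNIV. ((1 - ms n) * (a - x) $ j) *\<^sub>R moll n (w j) x))))"
    and "\<alpha> \<ge> 0"
  shows "(\<integral>\<^sup>+x. ennreal ((norm (f x))\<^sup>2) \<partial>LK K)
    \<le> ennreal ((2 * \<alpha> * h\<^sup>2 * (real CARD('d) + 1))\<^sup>2) * (\<integral>\<^sup>+x. ennreal ((norm (\<Sum>j\<in>UNIV. \<Sum>i\<in>UNIV. norm (moll n (ww j i) x)))\<^sup>2) \<partial>LK K)"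
proof -
  note hh = h2D[OF h2]
  define G where "G = (\<lambda>z. \<Sum>j\<in>UNIV. \<Sum>i\<in>UNIV. norm (moll n (ww j i) z))"
  have G0: "G z \<ge> 0" for z unfolding G_def by (simp add: sum_nonneg)
  have [measurable]: "G \<in> borel_measurable borel" unfolding G_def using moll_borel[OF hh(12)] by measurable
  have [measurable]: "K \<in> sets borel" by (rule K_props(6)[OF K])
  define S where "S = (\<lambda>a x. \<integral>\<^sup>+\<tau>. ennreal \<tau> * ennreal (G (a + \<tau> *\<^sub>R (x - a))) * indicator {0..1} \<tau> \<partial>lborel)"
  have [measurable]: "S a \<in> borel_measurable borel" for a unfolding S_def by measurable
  let ?N = "\<integral>\<^sup>+x. (ennreal (G x))\<^sup>2 \<partial>LK K"
  have pw: "ennreal ((norm (f x))\<^sup>2) \<le> ennreal ((\<alpha> * h\<^sup>2)\<^sup>2) * (of_nat (CARD('d) + 1) * (\<Sum>a\<in>vts K. (S a x)\<^sup>2))" if x: "x \<in> interior K" for x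
  proof -
    have xK: "x \<in> K" using x interior_subset by blast
    let ?R = "\<lambda>a. norm (moll n v a - (moll n v x + (\<Sum>j\<in>UNIV. ((1 - ms n) * (a - x) $ j) *\<^sub>R moll n (w j) x)))"
    have R: "ennreal (?R a) \<le> ennreal (h\<^sup>2) * S a x" if a: "a \<in> vts K" for a
    proof -
      have aK: "a \<in> K" by (rule vts_sub[OF K a])
      have cl: "a \<in> closure D" "x \<in> closure D" using aK xK K_props(4)[OF K] by auto
      have "dist x a \<le> diameter K" by (rule diameter_bounded_bound[OF compact_imp_bounded[OF K_props(1)[OF K]] xK aK])
      then have d: "norm (x - a) \<le> h" using diam_K[OF K] by (simp add: dist_norm)
      have "ennreal (?R a) \<le> ennreal ((norm (x - a))\<^sup>2) * S a x"
        unfolding S_def G_def by (rule moll_taylor[OF hh(3,6,10,11,12) cl])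
      also have "\<dots> \<le> ennreal (h\<^sup>2) * S a x" using d by (intro mult_right_mono ennreal_leI power_mono) auto
      finally show ?thesis .
    qed
    have "ennreal (norm (f x)) \<le> ennreal (\<alpha> * (\<Sum>a\<in>vts K. ?R a))" by (rule ennreal_leI[OF f[OF x]])
    also have "\<dots> = ennreal \<alpha> * (\<Sum>a\<in>vts K. ennreal (?R a))"
      using \<open>\<alpha> \<ge> 0\<close> by (simp add: ennreal_mult sum_nonneg)
    also have "\<dots> \<le> ennreal \<alpha> * (\<Sum>a\<in>vts K. ennreal (h\<^sup>2) * S a x)" by (intro mult_left_mono sum_mono R) auto
    also have "\<dots> = ennreal (\<alpha> * h\<^sup>2) * (\<Sum>a\<in>vts K. S a x)"
      using \<open>\<alpha> \<ge> 0\<close> by (simp add: ennreal_mult sum_distrib_left[symmetric] mult.assoc)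
    finally have "(ennreal (norm (f x)))\<^sup>2 \<le> (ennreal (\<alpha> * h\<^sup>2) * (\<Sum>a\<in>vts K. S a x))\<^sup>2" by (rule power_mono) simp
    also have "\<dots> = ennreal ((\<alpha> * h\<^sup>2)\<^sup>2) * (\<Sum>a\<in>vts K. S a x)\<^sup>2"
      unfolding power_mult_distrib using \<open>\<alpha> \<ge> 0\<close> by (subst ennreal_power) (auto simp: power_mult_distrib)
    also have "\<dots> \<le> ennreal ((\<alpha> * h\<^sup>2)\<^sup>2) * (of_nat (card (vts K)) * (\<Sum>a\<in>vts K. (S a x)\<^sup>2))"
      by (intro mult_left_mono ennreal_sum_power2_le vts(1)[OF K]) simp
    finally show ?thesis unfolding vts(3)[OF K] by (simp add: ennreal_power)
  qed
  have Sint: "(\<integral>\<^sup>+x. (S a x)\<^sup>2 \<partial>LK K) \<le> 4 * ?N" if a: "a \<in> vts K" for a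
  proof -
    have "(\<integral>\<^sup>+x. (S a x)\<^sup>2 \<partial>LK K) = (\<integral>\<^sup>+x. (S a x)\<^sup>2 * indicator K x \<partial>lborel)"
      by (rule nn_integral_LK_closed[OF K, symmetric])
    also have "\<dots> \<le> 4 * (\<integral>\<^sup>+x. (ennreal (G x))\<^sup>2 * indicator K x \<partial>lborel)"
      unfolding S_def using dim3 by (intro segment_average_L2 K_props(2)[OF K] vts_sub[OF K a]) auto
    also have "(\<integral>\<^sup>+x. (ennreal (G x))\<^sup>2 * indicator K x \<partial>lborel) = ?N" by (rule nn_integral_LK_closed[OF K])
    finally show ?thesis .
  qed
  have [measurable]: "S a \<in> borel_measurable (LK K)" for a by (rule borel_imp_lebesgue_on) measurable
  have "(\<integral>\<^sup>+x. ennreal ((norm (f x))\<^sup>2) \<partial>LK K) \<le> (\<integral>\<^sup>+x. ennreal ((\<alpha> * h\<^sup>2)\<^sup>2) * (of_nat (CARD('d) + 1) * (\<Sum>a\<in>vts K. (S a x)\<^sup>2)) \<partial>LK K)"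
    using pw by (intro nn_integral_mono) (simp add: space_restrict_space)
  also have "\<dots> = ennreal ((\<alpha> * h\<^sup>2)\<^sup>2) * (of_nat (CARD('d) + 1) * (\<Sum>a\<in>vts K. \<integral>\<^sup>+x. (S a x)\<^sup>2 \<partial>LK K))"
    by (simp add: nn_integral_cmult nn_integral_sum)
  also have "\<dots> \<le> ennreal ((\<alpha> * h\<^sup>2)\<^sup>2) * (of_nat (CARD('d) + 1) * (\<Sum>a\<in>vts K. 4 * ?N))"
    by (intro mult_left_mono sum_mono Sint) auto
  also have "\<dots> = ennreal ((\<alpha> * h\<^sup>2)\<^sup>2) * (ennreal (real (CARD('d) + 1)) * (ennreal (real (CARD('d) + 1)) * (ennreal 4 * ?N)))"
    by (simp only: sum_constant vts(3)[OF K] ennreal_of_nat_eq_real_of_nat ennreal_numeral)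
  also have "\<dots> = ennreal ((2 * \<alpha> * h\<^sup>2 * (real CARD('d) + 1))\<^sup>2) * ?N"
    by (simp only: mult.assoc[symmetric] ennreal_mult[symmetric] zero_le_power2 of_nat_0_le_iff zero_le_numeral mult_nonneg_nonneg)
       (simp add: power2_eq_square algebra_simps)
  also have "?N = (\<integral>\<^sup>+x. ennreal ((norm (G x))\<^sup>2) \<partial>LK K)" using G0 by (simp add: ennreal_power)
  finally show ?thesis unfolding G_def .
qed

text \<open>The interpolated function is \<open>moll n v\<close>, whose vertex values are
  meaningful. The index n depends on h and is so large that mollification adds at most h^2 to the
  value error and h to the gradient error; this is the summand 1 in both constants.\<close>

lemma fem_approximation:
  assumes h2: "h2 v w ww B"
  obtains p where "p \<in> Vh" "l2n LD (\<lambda>x. p x - v x) \<le> (intC * B + 1) * h\<^sup>2"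
    "\<And>j. l2n LD (\<lambda>x. fgrad p j x - w j x) \<le> (2 / \<rho> * intC * B + 1) * h"
proof -
  note hh = h2D[OF h2]
  have c1: "\<forall>\<^sub>F n in sequentially. l2n LD (\<lambda>x. moll n v x - v x) < h\<^sup>2"
    using h_pos by (intro order_tendstoD(2)[OF moll_L2_tendsto[OF hh(1)]]) simp
  have "\<forall>\<^sub>F n in sequentially. l2n LD (\<lambda>x. moll n (w j) x - w j x) < h / 2" for j
    using h_pos by (intro order_tendstoD(2)[OF moll_L2_tendsto[OF hh(4)]]) simp
  then have c2: "\<forall>\<^sub>F n in sequentially. \<forall>j. l2n LD (\<lambda>x. moll n (w j) x - w j x) < h / 2"
    by (simp add: eventually_all_finite)
  \<comment> \<open>The gradient of \<open>moll n v\<close> is \<open>1 - ms n\<close> times the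
    mollified gradient; this condition controls the missing part.\<close>
  have "(\<lambda>n. ms n * (mollC * B)) \<longlonglongrightarrow> 0 * (mollC * B)"
    unfolding ms_def by (intro tendsto_mult_right) real_asymp
  then have c3: "\<forall>\<^sub>F n in sequentially. ms n * (mollC * B) < h / 2"
    using h_pos by (intro order_tendstoD(2)) auto
  obtain n where n: "l2n LD (\<lambda>x. moll n v x - v x) < h\<^sup>2" "\<And>j. l2n LD (\<lambda>x. moll n (w j) x - w j x) < h / 2" "ms n * (mollC * B) < h / 2"
    using eventually_happens'[OF _ eventually_conj[OF c1 eventually_conj[OF c2 c3]]] by auto
  obtain p where p: "p \<in> Vh" "\<And>K a. K \<in> T \<Longrightarrow> a \<in> vts K \<Longrightarrow> p a = moll n v a"
    using interpolant_exists[of "moll n v"] by blast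
  let ?G = "\<lambda>x. \<Sum>j\<in>UNIV. \<Sum>i\<in>UNIV. norm (moll n (ww j i) x)"
  let ?R = "\<lambda>K x. \<Sum>a\<in>vts K. norm (moll n v a - (moll n v x + (\<Sum>j\<in>UNIV. ((1 - ms n) * (a - x) $ j) *\<^sub>R moll n (w j) x)))"
  note G = moll_sum2_sqi[OF h2, of n]
  have pw: "norm (p x - moll n v x) \<le> 1 * ?R K x" "norm (fgrad p j x - (1 - ms n) *\<^sub>R moll n (w j) x) \<le> 2 / (\<rho> * h) * ?R K x"
    if K: "K \<in> T" "x \<in> interior K" for K x j
  proof -
    have "norm (p a - (moll n v x + (\<Sum>j\<in>UNIV. ((1 - ms n) * (a - x) $ j) *\<^sub>R moll n (w j) x)))
      \<le> norm (moll n v a - (moll n v x + (\<Sum>j\<in>UNIV. ((1 - ms n) * (a - x) $ j) *\<^sub>R moll n (w j) x)))" if "a \<in> vts K" for a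
      using p(2)[OF K(1) that] by simp
    from interpolation_pointwise[OF p(1) K this]
    show "norm (p x - moll n v x) \<le> 1 * ?R K x" "norm (fgrad p j x - (1 - ms n) *\<^sub>R moll n (w j) x) \<le> 2 / (\<rho> * h) * ?R K x"
      unfolding fgrad_eq[OF K] by auto
  qed
  have mV: "moll n v \<in> borel_measurable LD" "\<And>j. moll n (w j) \<in> borel_measurable LD"
    by (rule moll_LD[OF hh(10)], rule moll_LD[OF hh(11)])
  have ps: "sqi LD p" using H1_D(1)[OF Vh_H1(1)[OF p(1)]] .
  note fs = Vh_H1(4)[OF p(1)]
  have m1: "(\<lambda>x. p x - moll n v x) \<in> borel_measurable LD"
    by (intro borel_measurable_diff sqiD(1)[OF ps] mV)
  have m2: "(\<lambda>x. fgrad p j x - (1 - ms n) *\<^sub>R moll n (w j) x) \<in> borel_measurable LD" for j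
    by (intro borel_measurable_diff borel_measurable_scaleR borel_measurable_const sqiD(1)[OF fs] mV)
  have R: "\<rho> * h > 0" using rho_pos h_pos by simp
  have b1: "l2n LD (\<lambda>x. p x - moll n v x) \<le> (2 * 1 * h\<^sup>2 * (real CARD('d) + 1)) * l2n LD ?G"
    by (rule split_bound(2)[OF m1 G(1) _ interpolation_remainder_L2[OF h2 _ pw(1)]]) auto
  have b2: "l2n LD (\<lambda>x. fgrad p j x - (1 - ms n) *\<^sub>R moll n (w j) x) \<le> (2 * (2 / (\<rho> * h)) * h\<^sup>2 * (real CARD('d) + 1)) * l2n LD ?G" for j
    by (rule split_bound(2)[OF m2 G(1) _ interpolation_remainder_L2[OF h2 _ pw(2)]]) (use R in auto)
  have Gb: "2 * (real CARD('d) + 1) * l2n LD ?G \<le> intC * B"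
  proof -
    have "2 * (real CARD('d) + 1) * l2n LD ?G \<le> 2 * (real CARD('d) + 1) * ((real CARD('d))\<^sup>2 * mollC * B)"
      using G(2) by (intro mult_left_mono) auto
    then show ?thesis by (simp add: intC_def mult.assoc)
  qed
  have 1: "l2n LD (\<lambda>x. p x - v x) \<le> (intC * B + 1) * h\<^sup>2"
  proof -
    have "l2n LD (\<lambda>x. p x - v x) \<le> l2n LD (\<lambda>x. p x - moll n v x) + l2n LD (\<lambda>x. moll n v x - v x)"
      by (rule l2n_triangle3[OF ps moll_L2(1)[OF hh(1)] hh(1)])
    also have "\<dots> \<le> h\<^sup>2 * (2 * (real CARD('d) + 1) * l2n LD ?G) + h\<^sup>2"
    proof -
      have "(2 * 1 * h\<^sup>2 * (real CARD('d) + 1)) * l2n LD ?G = h\<^sup>2 * (2 * (real CARD('d) + 1) * l2n LD ?G)"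
        by (simp add: algebra_simps)
      then show ?thesis using b1 n(1) by linarith
    qed
    also have "\<dots> \<le> h\<^sup>2 * (intC * B) + h\<^sup>2" using Gb by (simp add: mult_left_mono)
    finally show ?thesis by (simp add: algebra_simps)
  qed
  have 2: "l2n LD (\<lambda>x. fgrad p j x - w j x) \<le> (2 / \<rho> * intC * B + 1) * h" for j
  proof -
    have Mb: "l2n LD (moll n (w j)) \<le> mollC * B"
      unfolding mollC_def by (rule order_trans[OF moll_L2(2)[OF hh(4)] mult_left_mono[OF hh(5)]]) simp
    have "l2n LD (\<lambda>x. (1 - ms n) *\<^sub>R moll n (w j) x - w j x) = l2n LD (\<lambda>x. (moll n (w j) x - w j x) - ms n *\<^sub>R moll n (w j) x)"
      by (simp add: algebra_simps)
    also have "\<dots> \<le> l2n LD (\<lambda>x. moll n (w j) x - w j x) + l2n LD (\<lambda>x. ms n *\<^sub>R moll n (w j) x)"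
      by (intro l2n_triangle_diff sqi_diff sqi_scaleR moll_L2(1) hh)
    also have "l2n LD (\<lambda>x. ms n *\<^sub>R moll n (w j) x) \<le> ms n * (mollC * B)"
      using Mb ms[of n] by (simp add: l2n_scaleR)
    finally have 3: "l2n LD (\<lambda>x. (1 - ms n) *\<^sub>R moll n (w j) x - w j x) \<le> h" using n(2)[of j] n(3) by simp
    have "l2n LD (\<lambda>x. fgrad p j x - w j x) \<le> l2n LD (\<lambda>x. fgrad p j x - (1 - ms n) *\<^sub>R moll n (w j) x) + l2n LD (\<lambda>x. (1 - ms n) *\<^sub>R moll n (w j) x - w j x)"
      by (rule l2n_triangle3) (intro fs sqi_scaleR moll_L2(1) hh)+
    also have "\<dots> \<le> (2 / \<rho> * h) * (2 * (real CARD('d) + 1) * l2n LD ?G) + h"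
    proof -
      have "(2 * (2 / (\<rho> * h)) * h\<^sup>2 * (real CARD('d) + 1)) * l2n LD ?G = (2 / \<rho> * h) * (2 * (real CARD('d) + 1) * l2n LD ?G)"
        using R h_pos rho_pos by (simp add: field_simps power2_eq_square)
      then show ?thesis using b2[of j] 3 by simp
    qed
    also have "\<dots> \<le> (2 / \<rho> * h) * (intC * B) + h"
      using Gb h_pos rho_pos by (intro add_right_mono mult_left_mono) auto
    finally show ?thesis by (simp add: algebra_simps)
  qed
  show ?thesis using that[OF p(1) 1 2] .
qed

section \<open>Inverse estimates on quasi-uniform meshes\<close>

lemma measure_ball_scale:
  "R \<ge> 0 \<Longrightarrow> measure lebesgue (ball (x::real^'d) R) = unit_ball_vol (real CARD('d)) * R ^ CARD('d)"
  "R \<ge> 0 \<Longrightarrow> measure lebesgue (cball (x::real^'d) R) = unit_ball_vol (real CARD('d)) * R ^ CARD('d)"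
  using content_ball[of R x] content_cball[of R x] by (simp_all add: measure_completion)

lemma l2n_LK_const:
  assumes "K \<in> T" "\<And>x. x \<in> interior K \<Longrightarrow> f x = a"
  shows "(l2n (LK K) f)\<^sup>2 = measure lebesgue (interior K) * (norm a)\<^sup>2"
proof -
  interpret finite_measure "LK K" by (rule LK_finite[OF assms(1)])
  have "(\<integral>x. (norm (f x))\<^sup>2 \<partial>LK K) = (\<integral>x. (norm a)\<^sup>2 \<partial>LK K)"
    by (rule Bochner_Integration.integral_cong) (use assms(2) in \<open>auto simp: space_restrict_space\<close>)
  also have "\<dots> = measure lebesgue (interior K) * (norm a)\<^sup>2"
    by (simp add: space_restrict_space measure_restrict_space)
  finally show ?thesis by (simp add: l2n_sq)
qed

definition invC :: real where "invC = sqrt ((2 / \<rho>) ^ CARD('d)) * (4 / \<rho>)"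

text \<open>On an element \<xi> is affine, so its derivative is the difference of two values at
  distance half the radius of the inscribed ball. Integrating over the concentric half ball and
  comparing its volume with that of a ball of radius h containing K gives the factor
  \<open>(2 / \<rho>) ^ d\<close> in \<open>invC\<^sup>2\<close>.\<close>

lemma inverse_estimate:
  assumes \<xi>: "\<xi> \<in> Vh" shows "l2n LD (fgrad \<xi> j) \<le> invC / h * l2n LD \<xi>"
proof (rule split_bound(2))
  have s: "sqi LD \<xi>" by (rule H1_D(1)[OF Vh_H1(1)[OF \<xi>]])
  show "sqi LD \<xi>" by (rule s)
  show "fgrad \<xi> j \<in> borel_measurable LD" using Vh_H1(4)[OF \<xi>] by auto
  show "0 \<le> invC / h" using rho_pos h_pos by (simp add: invC_def)
  fix K assume K: "K \<in> T"
  let ?a = "fA \<xi> K *v axis j 1"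
  let ?\<omega> = "unit_ball_vol (real CARD('d))"
  obtain x0 where x0: "cball x0 (\<rho> * h) \<subseteq> K" using ball_K[OF K] by blast
  define R where "R = \<rho> * h"
  have R: "R > 0" using rho_pos h_pos by (simp add: R_def)
  have ballK: "ball x0 R \<subseteq> interior K" using x0 by (intro interior_maximal) (auto simp: R_def)
  \<comment> \<open>For x in the ball of radius R/2, both x and e + x lie in the ball of radius
    R.\<close>
  define e where "e = (R / 2) *\<^sub>R (axis j 1 :: real^'d)"
  have en: "norm e = R / 2" using R by (simp add: e_def norm_axis_1)
  define g where "g = (\<lambda>x. indicator (ball x0 R) x *\<^sub>R \<xi> x)"
  have cont: "continuous_on (ball x0 R) \<xi>"
  proof (rule continuous_on_subset)
    show "continuous_on (closure D) \<xi>" using \<xi> by (simp add: fem_space_def)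
    show "ball x0 R \<subseteq> closure D" using ballK interior_subset[of K] K_props(4)[OF K] by blast
  qed
  have [measurable]: "g \<in> borel_measurable borel"
    unfolding g_def by (rule borel_measurable_continuous_on_indicator[OF _ cont]) simp
  let ?f = "\<lambda>x. ennreal ((norm (g x))\<^sup>2)"
  have "ennreal ((R / 2)\<^sup>2 * (norm ?a)\<^sup>2) * emeasure lborel (ball x0 (R / 2))
     = (\<integral>\<^sup>+x. ennreal ((R / 2)\<^sup>2 * (norm ?a)\<^sup>2) * indicator (ball x0 (R/2)) x \<partial>lborel)"
    by (simp add: nn_integral_cmult_indicator)
  also have "\<dots> \<le> (\<integral>\<^sup>+x. 2 * ?f (e + 1 *\<^sub>R x) + 2 * ?f x \<partial>lborel)"
  proof (rule nn_integral_mono)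
    fix x
    show "ennreal ((R / 2)\<^sup>2 * (norm ?a)\<^sup>2) * indicator (ball x0 (R/2)) x \<le> 2 * ?f (e + 1 *\<^sub>R x) + 2 * ?f x"
    proof (cases "x \<in> ball x0 (R/2)")
      case True
      have xb: "x \<in> ball x0 R" using True R by auto
      have "dist x0 (e + x) \<le> dist x0 x + norm e"
        using norm_triangle_ineq4[of "x0 - x" e] by (simp add: dist_norm diff_diff_eq add.commute)
      then have xe: "e + x \<in> ball x0 R" using True en by auto
      have "\<xi> (e + x) - \<xi> x = fA \<xi> K *v (e + x - x)"
        using subsetD[OF ballK xb] subsetD[OF ballK xe] subsetD[OF interior_subset[of K]] by (intro fA_diff[OF \<xi> K]) blast+
      also have "\<dots> = (R / 2) *\<^sub>R ?a" by (simp add: e_def matrix_vector_mult_scaleR)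
      finally have "g (e + x) - g x = (R / 2) *\<^sub>R ?a" using xb xe by (simp add: g_def)
      then have "(R / 2)\<^sup>2 * (norm ?a)\<^sup>2 = (norm (g (e + x) - g x))\<^sup>2" using R by (simp add: power_mult_distrib power_divide)
      also have "\<dots> \<le> (norm (g (e + x)) + norm (g x))\<^sup>2" by (intro power_mono norm_triangle_ineq4) simp
      also have "\<dots> \<le> 2 * (norm (g (e + x)))\<^sup>2 + 2 * (norm (g x))\<^sup>2"
        using sum_squares_bound[of "norm (g (e + x))" "norm (g x)"] by (simp add: power2_sum)
      finally have "ennreal ((R / 2)\<^sup>2 * (norm ?a)\<^sup>2) \<le> ennreal (2 * (norm (g (e + x)))\<^sup>2 + 2 * (norm (g x))\<^sup>2)"
        by (rule ennreal_leI)
      also have "\<dots> = 2 * ?f (e + 1 *\<^sub>R x) + 2 * ?f x" by (simp add: ennreal_mult)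
      finally show ?thesis using True by simp
    qed simp
  qed
  also have "\<dots> = 2 * (\<integral>\<^sup>+x. ?f (e + 1 *\<^sub>R x) \<partial>lborel) + 2 * (\<integral>\<^sup>+x. ?f x \<partial>lborel)"
    by (subst nn_integral_add) (auto simp: nn_integral_cmult)
  also have "(\<integral>\<^sup>+x. ?f (e + 1 *\<^sub>R x) \<partial>lborel) = (\<integral>\<^sup>+x. ?f x \<partial>lborel)"
    by (subst nn_integral_lborel_affine[of "?f" 1 e]) auto
  also have "2 * (\<integral>\<^sup>+x. ?f x \<partial>lborel) + 2 * (\<integral>\<^sup>+x. ?f x \<partial>lborel) = 4 * (\<integral>\<^sup>+x. ?f x \<partial>lborel)"
    by (simp add: distrib_right[symmetric])
  also have "(\<integral>\<^sup>+x. ?f x \<partial>lborel) \<le> (\<integral>\<^sup>+x. ennreal ((norm (\<xi> x))\<^sup>2) \<partial>LK K)"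
  proof -
    have "interior K \<in> sets lebesgue" by simp
    then show ?thesis
      using ballK by (subst nn_integral_lebesgue_on) (auto intro!: nn_integral_mono simp: g_def indicator_def)
  qed
  finally have main: "ennreal ((R / 2)\<^sup>2 * (norm ?a)\<^sup>2) * emeasure lborel (ball x0 (R / 2)) \<le> 4 * (\<integral>\<^sup>+x. ennreal ((norm (\<xi> x))\<^sup>2) \<partial>LK K)"
    by (simp add: mult_left_mono)
  have em: "emeasure lborel (ball x0 (R / 2)) = ennreal (?\<omega> * (R / 2) ^ CARD('d))"
    using R by (simp add: emeasure_ball)
  have \<xi>K: "(\<integral>\<^sup>+x. ennreal ((norm (\<xi> x))\<^sup>2) \<partial>LK K) = ennreal ((l2n (LK K) \<xi>)\<^sup>2)"
    by (rule sqi_ennreal[OF LK_sqi[OF K s]])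
  have \<omega>: "?\<omega> > 0" by simp
  have "ennreal ((R / 2)\<^sup>2 * (norm ?a)\<^sup>2 * (?\<omega> * (R / 2) ^ CARD('d))) \<le> ennreal (4 * (l2n (LK K) \<xi>)\<^sup>2)"
    using main R \<omega> unfolding em \<xi>K by (simp add: ennreal_mult)
  then have main': "(R / 2)\<^sup>2 * (norm ?a)\<^sup>2 * (?\<omega> * (R / 2) ^ CARD('d)) \<le> 4 * (l2n (LK K) \<xi>)\<^sup>2"
    by (subst (asm) ennreal_le_iff) auto
  have mK: "measure lebesgue (interior K) \<le> ?\<omega> * h ^ CARD('d)"
  proof -
    have x0K: "x0 \<in> K" using x0 R by (auto simp: R_def)
    have "K \<subseteq> cball x0 h"
      using order_trans[OF diameter_bounded_bound[OF compact_imp_bounded[OF K_props(1)[OF K]] x0K] diam_K[OF K]] by auto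
    then have "measure lebesgue (interior K) \<le> measure lebesgue (cball x0 h)"
      using interior_subset by (intro measure_mono_fmeasurable) auto
    then show ?thesis using measure_ball_scale(2)[of h x0] h_pos by simp
  qed
  have "(\<integral>\<^sup>+x. ennreal ((norm (fgrad \<xi> j x))\<^sup>2) \<partial>LK K) = ennreal (measure lebesgue (interior K) * (norm ?a)\<^sup>2)"
    using sqi_ennreal[OF LK_sqi[OF K Vh_H1(4)[OF \<xi>]], of j] l2n_LK_const[OF K, of "fgrad \<xi> j" ?a] fgrad_eq[OF K] by simp
  also have "\<dots> \<le> ennreal ((invC / h)\<^sup>2 * (l2n (LK K) \<xi>)\<^sup>2)"
  proof (rule ennreal_leI)
    have "measure lebesgue (interior K) * (norm ?a)\<^sup>2 \<le> ?\<omega> * h ^ CARD('d) * (norm ?a)\<^sup>2" using mK by (intro mult_right_mono) auto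
    also have "\<dots> = ((2 / \<rho>) ^ CARD('d) * (2 / R)\<^sup>2) * ((R / 2)\<^sup>2 * (norm ?a)\<^sup>2 * (?\<omega> * (R / 2) ^ CARD('d)))"
    proof -
      have "h ^ CARD('d) = (2 / \<rho>) ^ CARD('d) * (R / 2) ^ CARD('d)" using rho_pos by (simp add: R_def power_mult_distrib[symmetric])
      moreover have "(2 / R)\<^sup>2 * (R / 2)\<^sup>2 = 1" using R by (simp add: power_mult_distrib[symmetric])
      ultimately show ?thesis by (simp add: mult_ac)
    qed
    also have "\<dots> \<le> ((2 / \<rho>) ^ CARD('d) * (2 / R)\<^sup>2) * (4 * (l2n (LK K) \<xi>)\<^sup>2)"
      using main' rho_pos by (intro mult_left_mono) auto
    also have "\<dots> = (invC / h)\<^sup>2 * (l2n (LK K) \<xi>)\<^sup>2"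
      using rho_pos h_pos by (simp add: invC_def R_def power_mult_distrib power_divide field_simps)
    finally show "measure lebesgue (interior K) * (norm ?a)\<^sup>2 \<le> (invC / h)\<^sup>2 * (l2n (LK K) \<xi>)\<^sup>2" .
  qed
  finally show "(\<integral>\<^sup>+x. ennreal ((norm (fgrad \<xi> j x))\<^sup>2) \<partial>LK K) \<le> ennreal ((invC / h)\<^sup>2) * (\<integral>\<^sup>+x. ennreal ((norm (\<xi> x))\<^sup>2) \<partial>LK K)"
    unfolding \<xi>K by (simp add: ennreal_mult)
qed

text \<open>For a constant on K, passing from L^2 to L^4 costs a negative power of the volume of K.
  The part coming from g regains this power by Cauchy-Schwarz on K, so only the error E pays, with
  E^4 / h^d. Squaring a sum of two terms twice produces the 8.\<close>

lemma fgrad_L4: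
  assumes p: "p \<in> Vh" and g: "sqi LD g" "sqi LD (\<lambda>x. (norm (g x))\<^sup>2)"
    and E: "l2n LD (\<lambda>x. fgrad p j x - g x) \<le> E"
  shows "sqi LD (\<lambda>x. (norm (fgrad p j x))\<^sup>2)"
    "(l2n LD (\<lambda>x. (norm (fgrad p j x))\<^sup>2))\<^sup>2 \<le> 8 * (l2n LD (\<lambda>x. (norm (g x))\<^sup>2))\<^sup>2 + 8 * E ^ 4 / (unit_ball_vol (real CARD('d)) * (\<rho> * h) ^ CARD('d))"
proof -
  note fs = Vh_H1(4)[OF p, of j]
  have E0: "E \<ge> 0" using E l2n_nonneg order_trans by blast
  let ?f = "fgrad p j"
  let ?mm = "unit_ball_vol (real CARD('d)) * (\<rho> * h) ^ CARD('d)"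
  have m0: "?mm > 0" using rho_pos h_pos by simp
  obtain Bf where Bf: "\<And>x. norm (?f x) \<le> Bf" using Vh_H1(5)[OF p, of j] by blast
  show f2: "sqi LD (\<lambda>x. (norm (?f x))\<^sup>2)"
  proof (rule sqi_bounded[OF finite_LD])
    show "AE x in LD. norm ((norm (?f x))\<^sup>2) \<le> Bf\<^sup>2" using Bf by (auto intro!: power_mono)
  qed (use fs in auto)
  have dd: "sqi LD (\<lambda>x. ?f x - g x)" by (rule sqi_diff[OF fs g(1)])
  have "(l2n LD (\<lambda>x. (norm (?f x))\<^sup>2))\<^sup>2 = (\<Sum>K\<in>T. (l2n (LK K) (\<lambda>x. (norm (?f x))\<^sup>2))\<^sup>2)" by (rule l2n_split[OF f2])
  also have "\<dots> \<le> (\<Sum>K\<in>T. 8 * (l2n (LK K) (\<lambda>x. (norm (g x))\<^sup>2))\<^sup>2 + 8 * E\<^sup>2 / ?mm * (l2n (LK K) (\<lambda>x. ?f x - g x))\<^sup>2)"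
  proof (rule sum_mono)
    fix K assume K: "K \<in> T"
    let ?a = "fA p K *v axis j 1"
    let ?m = "measure lebesgue (interior K)"
    define P where "P = l2n (LK K) (\<lambda>x. (norm (g x))\<^sup>2)"
    define \<Delta> where "\<Delta> = (l2n (LK K) (\<lambda>x. ?f x - g x))\<^sup>2"
    have mm: "?m \<ge> ?mm"
    proof -
      obtain x0 where x0: "cball x0 (\<rho> * h) \<subseteq> K" using ball_K[OF K] by blast
      have "ball x0 (\<rho> * h) \<subseteq> interior K" using x0 by (intro interior_maximal) auto
      moreover have "bounded (interior K)" using K_props(1)[OF K] bounded_subset[OF compact_imp_bounded interior_subset] by blast
      ultimately have "measure lebesgue (ball x0 (\<rho> * h)) \<le> ?m"
        by (intro measure_mono_fmeasurable bounded_set_imp_lmeasurable) auto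
      then show ?thesis using measure_ball_scale(1)[of "\<rho> * h" x0] rho_pos h_pos by simp
    qed
    then have m: "?m > 0" using m0 by linarith
    have Kf: "(l2n (LK K) ?f)\<^sup>2 = ?m * (norm ?a)\<^sup>2" by (rule l2n_LK_const[OF K]) (rule fgrad_eq[OF K])
    have Kf2: "(l2n (LK K) (\<lambda>x. (norm (?f x))\<^sup>2))\<^sup>2 = ?m * (norm ?a) ^ 4"
      using l2n_LK_const[OF K, of "\<lambda>x. (norm (?f x))\<^sup>2" "(norm ?a)\<^sup>2"] fgrad_eq[OF K] by simp
    have gP: "(l2n (LK K) g)\<^sup>2 \<le> sqrt ?m * P"
    proof -
      have "(\<integral>x. norm ((norm (g x))\<^sup>2) \<partial>LK K) \<le> sqrt (measure (LK K) (space (LK K))) * P"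
        unfolding P_def by (rule sqi_imp_integrable(2)[OF LK_finite[OF K] LK_sqi[OF K g(2)]])
      then show ?thesis by (simp add: l2n_sq measure_restrict_space space_restrict_space)
    qed
    have "l2n (LK K) ?f \<le> l2n (LK K) g + l2n (LK K) (\<lambda>x. ?f x - g x)"
      using l2n_triangle[OF LK_sqi[OF K g(1)] LK_sqi[OF K dd]] by simp
    then have "(l2n (LK K) ?f)\<^sup>2 \<le> (l2n (LK K) g + l2n (LK K) (\<lambda>x. ?f x - g x))\<^sup>2" by (rule power_mono) simp
    also have "\<dots> \<le> 2 * (l2n (LK K) g)\<^sup>2 + 2 * \<Delta>"
      using sum_squares_bound[of "l2n (LK K) g" "l2n (LK K) (\<lambda>x. ?f x - g x)"] by (simp add: power2_sum \<Delta>_def)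
    also have "\<dots> \<le> 2 * (sqrt ?m * P) + 2 * \<Delta>" using gP by simp
    finally have "(?m * (norm ?a)\<^sup>2)\<^sup>2 \<le> (2 * (sqrt ?m * P) + 2 * \<Delta>)\<^sup>2" unfolding Kf by (rule power_mono) (use m in simp)
    also have "\<dots> \<le> 8 * (sqrt ?m * P)\<^sup>2 + 8 * \<Delta>\<^sup>2"
      using sum_squares_bound[of "2 * (sqrt ?m * P)" "2 * \<Delta>"] by (simp add: power2_sum power_mult_distrib)
    also have "\<dots> = 8 * (?m * P\<^sup>2) + 8 * \<Delta>\<^sup>2" using m by (simp add: power_mult_distrib)
    finally have "?m * (?m * (norm ?a) ^ 4) \<le> ?m * (8 * P\<^sup>2 + 8 * \<Delta>\<^sup>2 / ?m)"
      using m by (simp add: power_mult_distrib power2_eq_square power4_eq_xxxx algebra_simps)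
    then have "?m * (norm ?a) ^ 4 \<le> 8 * P\<^sup>2 + 8 * \<Delta>\<^sup>2 / ?m" using m by (simp only: mult_le_cancel_left_pos)
    also have "8 * \<Delta>\<^sup>2 / ?m \<le> 8 * (E\<^sup>2 * \<Delta>) / ?mm"
    proof -
      have "\<Delta> \<le> (l2n LD (\<lambda>x. ?f x - g x))\<^sup>2"
        unfolding \<Delta>_def l2n_split[OF dd] using K fin_T by (intro member_le_sum) auto
      also have "\<dots> \<le> E\<^sup>2" using E by (intro power_mono) auto
      finally have "\<Delta>\<^sup>2 \<le> E\<^sup>2 * \<Delta>" unfolding power2_eq_square[of \<Delta>] by (intro mult_right_mono) (simp_all add: \<Delta>_def)
      then show ?thesis using mm m0 by (intro frac_le) (auto simp: \<Delta>_def)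
    qed
    finally show "(l2n (LK K) (\<lambda>x. (norm (?f x))\<^sup>2))\<^sup>2 \<le> 8 * (l2n (LK K) (\<lambda>x. (norm (g x))\<^sup>2))\<^sup>2 + 8 * E\<^sup>2 / ?mm * (l2n (LK K) (\<lambda>x. ?f x - g x))\<^sup>2"
      unfolding Kf2 P_def \<Delta>_def by (simp add: mult.assoc)
  qed
  also have "\<dots> = 8 * (l2n LD (\<lambda>x. (norm (g x))\<^sup>2))\<^sup>2 + 8 * E\<^sup>2 / ?mm * (l2n LD (\<lambda>x. ?f x - g x))\<^sup>2"
    by (simp only: sum.distrib sum_distrib_left[symmetric] l2n_split[OF g(2)] l2n_split[OF dd])
  also have "8 * E\<^sup>2 / ?mm * (l2n LD (\<lambda>x. ?f x - g x))\<^sup>2 \<le> 8 * E\<^sup>2 / ?mm * E\<^sup>2"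
    using E m0 by (intro mult_left_mono power_mono) auto
  also have "8 * E\<^sup>2 / ?mm * E\<^sup>2 = 8 * E ^ 4 / ?mm" by (simp add: power4_eq_xxxx power2_eq_square)
  finally show "(l2n LD (\<lambda>x. (norm (?f x))\<^sup>2))\<^sup>2 \<le> 8 * (l2n LD (\<lambda>x. (norm (g x))\<^sup>2))\<^sup>2 + 8 * E ^ 4 / ?mm" by simp
qed

end

section \<open>Functions of time\<close>

lemma lebesgue_on_AE_measurable:
  fixes f g :: "'a::euclidean_space \<Rightarrow> 'b::euclidean_space"
  assumes "f \<in> borel_measurable (lebesgue_on S)" "AE x in lebesgue_on S. f x = g x" "S \<in> sets lebesgue"
  shows "g \<in> borel_measurable (lebesgue_on S)"
proof -
  have "(\<lambda>x. if x \<in> S then f x else 0) \<in> borel_measurable lebesgue" using assms(1,3) by (simp add: borel_measurable_if)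
  moreover have "AE x in lebesgue. (if x \<in> S then f x else 0) = (if x \<in> S then g x else 0)"
    using assms(2,3) by (subst (asm) AE_restrict_space_iff) (auto elim!: eventually_mono)
  ultimately have "(\<lambda>x. if x \<in> S then g x else 0) \<in> borel_measurable lebesgue"
    by (rule borel_measurable_AE)
  then show ?thesis using assms(3) by (simp add: borel_measurable_if)
qed

text \<open>Mollifying in time with a kernel that stays inside (0,T) for all centres between s and t
  turns the weak derivative into a classical one bounded by C. Uniform continuity of f removes the
  mollification up to an arbitrary e.\<close>

lemma weak_derivative_lipschitz:
  fixes f f1 :: "real \<Rightarrow> real"
  assumes f: "continuous_on {0..T} f" and f1: "integrable (lebesgue_on {0<..<T}) f1"
    and C: "AE t in lebesgue_on {0<..<T}. \<bar>f1 t\<bar> \<le> C" "C \<ge> 0"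
    and wd: "\<And>\<phi>. test_function {0<..<T} \<phi> \<Longrightarrow>
       (\<integral>t. deriv \<phi> t * f t \<partial>lebesgue_on {0<..<T}) = - (\<integral>t. \<phi> t * f1 t \<partial>lebesgue_on {0<..<T})"
    and st: "0 < s" "s \<le> t" "t < T"
  shows "\<bar>f t - f s\<bar> \<le> C * (t - s)"
proof (rule field_le_epsilon)
  fix e :: real assume e: "e > 0"
  let ?L = "lebesgue_on {0<..<T}"
  have fin: "finite_measure ?L" by (intro finite_measure_lebesgue_on bounded_set_imp_lmeasurable) auto
  have "uniformly_continuous_on {0..T} f" using f by (intro compact_uniformly_continuous) auto
  then obtain d where d: "d > 0" "\<And>x y. x \<in> {0..T} \<Longrightarrow> y \<in> {0..T} \<Longrightarrow> \<bar>y - x\<bar> < d \<Longrightarrow> \<bar>f y - f x\<bar> < e / 2"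
    using e unfolding uniformly_continuous_on_def dist_real_def by (metis half_gt_zero)
  \<comment> \<open>Smaller than d for uniform continuity, and smaller than s and T - t so that
    kernels centred in [s,t] are test functions on (0,T).\<close>
  define \<delta> where "\<delta> = min (d / 2) (min (s / 2) ((T - t) / 2))"
  have \<delta>: "\<delta> > 0" "\<delta> < d" "\<delta> < s" "\<delta> < T - t"
  proof -
    have a: "\<delta> \<le> d / 2" "\<delta> \<le> s / 2" "\<delta> \<le> (T - t) / 2" unfolding \<delta>_def min_def by auto
    show "\<delta> > 0" using d st by (auto simp: \<delta>_def)
    show "\<delta> < d" using a(1) d(1) by linarith
    show "\<delta> < s" using a(2) st by linarith
    have "T - t > 0" using st(3) by simp
    then have "(T - t) / 2 < T - t" by simp
    with a(3) show "\<delta> < T - t" by (rule le_less_trans)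
  qed
  define m where "m = bump_mass (0::real) \<delta>"
  have m: "m > 0" unfolding m_def by (rule bump_mass_pos[OF \<delta>(1)])
  define k where "k = (\<lambda>y::real. 1 / m * bump 0 \<delta> y)"
  have keq: "k (\<sigma> - \<tau>) = 1 / m * bump \<tau> \<delta> \<sigma>" for \<sigma> \<tau> by (simp add: k_def bump_shift)
  have ktest: "test_function UNIV k" unfolding k_def by (rule test_function_bump[OF \<delta>(1)]) simp
  have kt: "test_function {0<..<T} (\<lambda>\<sigma>. k (\<sigma> - \<tau>))" if "\<tau> \<in> {s..t}" for \<tau>
    unfolding keq using \<delta> that by (intro test_function_bump) (auto simp: dist_real_def)
  have k0: "k y \<ge> 0" for y using m by (simp add: k_def)
  have kint: "integrable ?L (\<lambda>\<sigma>. k (\<sigma> - \<tau>))" "(\<integral>\<sigma>. k (\<sigma> - \<tau>) \<partial>?L) = 1" if \<tau>: "\<tau> \<in> {s..t}" for \<tau>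
  proof -
    have kb: "integrable lborel (\<lambda>\<sigma>. k (\<sigma> - \<tau>))" unfolding keq by (intro integrable_mult_right integrable_bump \<delta>(1))
    have z: "indicator {0<..<T} \<sigma> * k (\<sigma> - \<tau>) = k (\<sigma> - \<tau>)" for \<sigma>
    proof (cases "\<sigma> \<in> {0<..<T}")
      case False
      then have "\<sigma> \<notin> cball \<tau> \<delta>" using \<delta> \<tau> by (auto simp: dist_real_def)
      then have b0: "bump \<tau> \<delta> \<sigma> = 0" by (rule bump_eq_0[OF \<delta>(1)])
      show ?thesis unfolding keq b0 by simp
    qed simp
    have "integrable lebesgue (\<lambda>\<sigma>. k (\<sigma> - \<tau>))"
      using kb by (subst integrable_completion) (auto dest: borel_measurable_integrable)
    then show "integrable ?L (\<lambda>\<sigma>. k (\<sigma> - \<tau>))" by (simp add: integrable_restrict_space z)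
    have "(\<integral>\<sigma>. k (\<sigma> - \<tau>) \<partial>?L) = (\<integral>\<sigma>. k (\<sigma> - \<tau>) \<partial>lborel)"
      using kb by (subst integral_lebesgue_on_lborel) (auto simp: z dest: borel_measurable_integrable)
    also have "\<dots> = 1 / m * bump_mass (0 + \<tau>) \<delta>" unfolding keq bump_mass_def by simp
    finally show "(\<integral>\<sigma>. k (\<sigma> - \<tau>) \<partial>?L) = 1" unfolding bump_mass_shift using m by (simp add: m_def)
  qed
  obtain B where B: "\<And>y. \<bar>k y\<bar> \<le> B" using test_function_bounded[OF ktest] by metis
  obtain L where L: "L > 0" "\<And>x y. \<bar>k x - k y\<bar> \<le> L * norm (x - y)" using test_function_lipschitz[OF ktest] by metis
  have fi: "integrable ?L f"
  proof -
    have "set_integrable lebesgue {0<..<T} f"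
      by (rule set_integrable_subset[OF absolutely_integrable_continuous_real[OF f]]) auto
    then have "integrable lebesgue (\<lambda>x. indicator {0<..<T} x *\<^sub>R f x)" unfolding set_integrable_def .
    then show ?thesis by (subst integrable_restrict_space) simp_all
  qed
  have Babs: "\<bar>k y\<bar> \<le> \<bar>B\<bar>" for y by (rule order_trans[OF B abs_ge_self])
  have kfi: "integrable ?L (\<lambda>\<sigma>. k (\<sigma> - \<tau>) * q \<sigma>)" if q: "integrable ?L q" and \<tau>: "\<tau> \<in> {s..t}" for q \<tau>
  proof (rule Bochner_Integration.integrable_bound[of _ "\<lambda>\<sigma>. B * q \<sigma>"])
    show "AE x in ?L. norm (k (x - \<tau>) * q x) \<le> norm (B * q x)"
    proof (rule AE_I2)
      show "norm (k (x - \<tau>) * q x) \<le> norm (B * q x)" for x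
        unfolding real_norm_def abs_mult by (rule mult_right_mono[OF Babs abs_ge_zero])
    qed
    show "(\<lambda>\<sigma>. k (\<sigma> - \<tau>) * q \<sigma>) \<in> borel_measurable ?L"
      by (rule borel_measurable_times[OF borel_measurable_integrable[OF kint(1)[OF \<tau>]] borel_measurable_integrable[OF q]])
  qed (intro integrable_mult_right q)
  define F where "F = (\<lambda>\<tau>. \<integral>\<sigma>. k (\<sigma> - \<tau>) *\<^sub>R f \<sigma> \<partial>?L)"
  have kder: "(k has_real_derivative deriv k y) (at y)" for y
  proof -
    let ?F = "frechet_derivative k (at y)"
    have d: "(k has_derivative ?F) (at y)"
      by (rule smooth_imp_has_derivative[OF test_function_smooth[OF ktest]])
    have lin: "linear ?F" using d has_derivative_linear by blast
    have "?F h = ?F 1 * h" for h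
    proof -
      have "?F (h *\<^sub>R 1) = h *\<^sub>R ?F 1" by (rule linear_cmul[OF lin])
      then show ?thesis by simp
    qed
    then have "?F = (*) (?F 1)" by (rule ext)
    then have dk: "(k has_real_derivative ?F 1) (at y)" using d by (simp add: has_field_derivative_def)
    show ?thesis unfolding DERIV_imp_deriv[OF dk] by (rule dk)
  qed
  have Fder: "(F has_real_derivative (\<integral>\<sigma>. k (\<sigma> - \<tau>) * f1 \<sigma> \<partial>?L)) (at \<tau>)" if \<tau>: "\<tau> \<in> {s..t}" for \<tau>
  proof -
    have "(F has_vector_derivative (\<integral>\<sigma>. (- deriv k (\<sigma> - \<tau>)) *\<^sub>R f \<sigma> \<partial>?L)) (at \<tau>)"
      unfolding F_def
    proof (rule has_vector_derivative_integral[where B=B and L=L])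
      show "(\<lambda>\<sigma>. k (\<sigma> - \<tau>)) \<in> borel_measurable ?L" for \<tau>
        by (intro borel_imp_lebesgue_on borel_measurable_continuous_onI continuous_on_compose2[OF smooth_continuous[OF test_function_smooth[OF ktest], of UNIV]] continuous_intros) auto
      show "\<bar>k (\<sigma> - s') - k (\<sigma> - \<tau>)\<bar> \<le> L * \<bar>s' - \<tau>\<bar>" for s' \<sigma>
        using L(2)[of "\<sigma> - s'" "\<sigma> - \<tau>"] by (simp add: abs_minus_commute)
      have "((\<lambda>s. k (\<sigma> - s)) has_real_derivative deriv k (\<sigma> - \<tau>) * (0 - 1)) (at \<tau>)" for \<sigma>
        by (rule DERIV_chain2[OF kder]) (auto intro!: derivative_eq_intros)
      then show "((\<lambda>s. k (\<sigma> - s)) has_real_derivative - deriv k (\<sigma> - \<tau>)) (at \<tau>)" for \<sigma> by simp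
    qed (use B fi in auto)
    also have "(\<integral>\<sigma>. (- deriv k (\<sigma> - \<tau>)) *\<^sub>R f \<sigma> \<partial>?L) = - (\<integral>\<sigma>. deriv (\<lambda>\<sigma>. k (\<sigma> - \<tau>)) \<sigma> * f \<sigma> \<partial>?L)"
    proof -
      have "deriv (\<lambda>\<sigma>. k (\<sigma> - \<tau>)) \<sigma> = deriv k (\<sigma> - \<tau>)" for \<sigma>
      proof (rule DERIV_imp_deriv)
        have "((\<lambda>\<sigma>. \<sigma> - \<tau>) has_real_derivative 1) (at \<sigma>)" by (auto intro!: derivative_eq_intros)
        from DERIV_chain2[OF kder this] show "((\<lambda>\<sigma>. k (\<sigma> - \<tau>)) has_real_derivative deriv k (\<sigma> - \<tau>)) (at \<sigma>)" by simp
      qed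
      then show ?thesis by simp
    qed
    also have "\<dots> = (\<integral>\<sigma>. k (\<sigma> - \<tau>) * f1 \<sigma> \<partial>?L)" using wd[OF kt[OF \<tau>]] by simp
    finally show ?thesis by (simp add: has_real_derivative_iff_has_vector_derivative)
  qed
  have Fb: "\<bar>\<integral>\<sigma>. k (\<sigma> - \<tau>) * f1 \<sigma> \<partial>?L\<bar> \<le> C" if \<tau>: "\<tau> \<in> {s..t}" for \<tau>
  proof -
    have ae: "AE \<sigma> in ?L. norm (k (\<sigma> - \<tau>) * f1 \<sigma>) \<le> k (\<sigma> - \<tau>) * C"
      using C(1) by eventually_elim (simp add: abs_mult k0 mult_left_mono)
    have i1: "integrable ?L (\<lambda>\<sigma>. k (\<sigma> - \<tau>) * f1 \<sigma>)" by (rule kfi[OF f1 \<tau>])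
    have "norm (\<integral>\<sigma>. k (\<sigma> - \<tau>) * f1 \<sigma> \<partial>?L) \<le> (\<integral>\<sigma>. norm (k (\<sigma> - \<tau>) * f1 \<sigma>) \<partial>?L)"
      by (rule integral_norm_bound)
    also have "\<dots> \<le> (\<integral>\<sigma>. k (\<sigma> - \<tau>) * C \<partial>?L)"
      by (rule integral_mono_AE[OF integrable_norm[OF i1] integrable_mult_left[OF kint(1)[OF \<tau>]] ae])
    finally have "norm (\<integral>\<sigma>. k (\<sigma> - \<tau>) * f1 \<sigma> \<partial>?L) \<le> (\<integral>\<sigma>. k (\<sigma> - \<tau>) * C \<partial>?L)" .
    then show ?thesis using kint[OF \<tau>] by simp
  qed
  have F1: "\<bar>F t - F s\<bar> \<le> C * (t - s)"
  proof -
    have "norm (F t - F s) \<le> C * norm (t - s)"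
      by (rule field_differentiable_bound[of "{s..t}" F "\<lambda>\<tau>. \<integral>\<sigma>. k (\<sigma> - \<tau>) * f1 \<sigma> \<partial>?L"])
         (use Fder Fb st in \<open>auto intro: has_field_derivative_at_within\<close>)
    then show ?thesis using st by simp
  qed
  have F2: "\<bar>F \<tau> - f \<tau>\<bar> \<le> e / 2" if \<tau>: "\<tau> \<in> {s..t}" for \<tau>
  proof -
    have i: "integrable ?L (\<lambda>\<sigma>. k (\<sigma> - \<tau>) * f \<sigma>)" by (rule kfi[OF fi \<tau>])
    have "F \<tau> - f \<tau> = (\<integral>\<sigma>. k (\<sigma> - \<tau>) * (f \<sigma> - f \<tau>) \<partial>?L)"
      using kint[OF \<tau>] i by (simp add: F_def right_diff_distrib)
    also have "norm \<dots> \<le> (\<integral>\<sigma>. norm (k (\<sigma> - \<tau>) * (f \<sigma> - f \<tau>)) \<partial>?L)" by (rule integral_norm_bound)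
    also have "\<dots> \<le> (\<integral>\<sigma>. k (\<sigma> - \<tau>) * (e / 2) \<partial>?L)"
    proof (rule integral_mono)
      show "integrable ?L (\<lambda>\<sigma>. norm (k (\<sigma> - \<tau>) * (f \<sigma> - f \<tau>)))"
        using i kint(1)[OF \<tau>] by (simp add: right_diff_distrib)
      fix \<sigma> assume "\<sigma> \<in> space ?L"
      then have \<sigma>: "\<sigma> \<in> {0<..<T}" by (simp add: space_restrict_space)
      show "norm (k (\<sigma> - \<tau>) * (f \<sigma> - f \<tau>)) \<le> k (\<sigma> - \<tau>) * (e / 2)"
      proof (cases "k (\<sigma> - \<tau>) = 0")
        case False
        then have "\<sigma> \<in> cball \<tau> \<delta>" unfolding keq using bump_eq_0[OF \<delta>(1)] by fastforce
        then have "\<bar>\<sigma> - \<tau>\<bar> < d" using \<delta>(2) by (auto simp: dist_real_def abs_minus_commute)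
        then have "\<bar>f \<sigma> - f \<tau>\<bar> < e / 2" using \<sigma> \<tau> st by (intro d(2)) auto
        from mult_left_mono[OF less_imp_le[OF this] k0[of "\<sigma> - \<tau>"]]
        show ?thesis unfolding real_norm_def abs_mult abs_of_nonneg[OF k0] .
      qed simp
    qed (use kint(1)[OF \<tau>] in auto)
    also have "\<dots> = e / 2" using kint[OF \<tau>] by simp
    finally show ?thesis by simp
  qed
  have "\<bar>F s - f s\<bar> \<le> e / 2" "\<bar>F t - f t\<bar> \<le> e / 2" using F2[of s] F2[of t] st(2) by simp_all
  then show "\<bar>f t - f s\<bar> \<le> C * (t - s) + e" using F1 by linarith
qed

section \<open>Bochner integrals tested with fixed functions; Lipschitz continuity in time\<close>

context convex_dom begin

lemma H1_sum:
  assumes "\<And>i. i \<in> I \<Longrightarrow> v i \<in> H_set D 1" "g \<in> H_set D 1"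
  shows "(\<lambda>x. \<Sum>i\<in>I. a i *\<^sub>R v i x) \<in> H_set D 1 \<and> hip e (\<lambda>x. \<Sum>i\<in>I. a i *\<^sub>R v i x) g = (\<Sum>i\<in>I. a i * hip e (v i) g)"
  using assms(1)
proof (induction I rule: infinite_finite_induct)
  case (insert i I)
  then have IH: "(\<lambda>x. \<Sum>i\<in>I. a i *\<^sub>R v i x) \<in> H_set D 1" "hip e (\<lambda>x. \<Sum>i\<in>I. a i *\<^sub>R v i x) g = (\<Sum>i\<in>I. a i * hip e (v i) g)"
    by auto
  have vi: "v i \<in> H_set D 1" using insert by simp
  have eq: "(\<lambda>x. \<Sum>i\<in>insert i I. a i *\<^sub>R v i x) = (\<lambda>x. a i *\<^sub>R v i x + 1 *\<^sub>R (\<Sum>i\<in>I. a i *\<^sub>R v i x))"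
    using insert by simp
  show ?case unfolding eq using H1_lin(1)[OF vi IH(1), of "a i" 1] hip_lin[OF vi IH(1) assms(2), of e "a i" 1] IH(2) insert(1,2)
    by (simp del: One_nat_def)
next
  case (infinite I)
  have "hip e (\<lambda>x. 0) g = 0" using hip_lin[OF assms(2,2,2), of e 0 0] by simp
  with infinite show ?case using H1_zero by simp
next
  case empty
  have "hip e (\<lambda>x. 0) g = 0" using hip_lin[OF assms(2,2,2), of e 0 0] by simp
  then show ?case using H1_zero by simp
qed

abbreviation LT where "LT T \<equiv> lebesgue_on {0<..<T::real}"

text \<open>Pairing with a fixed g replaces the vector-valued integral by a real one. For simple
  functions this is linearity, as the range is finite.\<close>

lemma time_simple_scalar:
  assumes s: "time_simple T (H_space D 1) s" and g: "g \<in> H_set D 1"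
  shows "integrable (LT T) (\<lambda>t. hip e (s t) g)" "(\<integral>t. hip e (s t) g \<partial>LT T) = hip e (time_simple_integral T s) g"
    "time_simple_integral T s \<in> H_set D 1"
proof -
  let ?R = "s ` {0<..<T}"
  let ?A = "\<lambda>f. {t \<in> {0<..<T}. s t = f}"
  have fin: "finite ?R" and sub: "?R \<subseteq> H_set D 1" and A: "?A f \<in> sets lebesgue" for f
    using s by (auto simp: time_simple_def W_space_def)
  have Am: "?A f \<in> lmeasurable" for f
  proof (rule bounded_set_imp_lmeasurable[OF _ A])
    show "bounded (?A f)" by (rule bounded_subset[OF bounded_box[of 0 T]]) (auto simp: box_real)
  qed
  have AT: "?A f \<in> sets (LT T)" for f using A[of f] by (subst sets_restrict_space_iff) auto
  have eA: "emeasure (LT T) (?A f) = ennreal (measure lebesgue (?A f))" for f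
    using Am[of f] A[of f] by (subst emeasure_restrict_space) (auto simp: emeasure_eq_measure2)
  have eq: "hip e (s t) g = (\<Sum>f\<in>?R. hip e f g * indicator (?A f) t)" if "t \<in> {0<..<T}" for t
  proof -
    have "(\<Sum>f\<in>?R. hip e f g * indicator (?A f) t) = (\<Sum>f\<in>?R. if f = s t then hip e f g else 0)"
      using that by (intro sum.cong) (auto simp: indicator_def)
    also have "\<dots> = hip e (s t) g" using fin that by simp
    finally show ?thesis by simp
  qed
  have i: "integrable (LT T) (\<lambda>t. hip e f g * indicator (?A f) t)" for f
    using AT eA by (intro integrable_mult_right integrable_real_indicator) auto
  have "integrable (LT T) (\<lambda>t. \<Sum>f\<in>?R. hip e f g * indicator (?A f) t)" by (intro Bochner_Integration.integrable_sum i)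
  then show "integrable (LT T) (\<lambda>t. hip e (s t) g)"
    by (rule Bochner_Integration.integrable_cong[THEN iffD2, rotated 2]) (use eq in \<open>auto simp: space_restrict_space\<close>)
  have H: "time_simple_integral T s \<in> H_set D 1 \<and> hip e (time_simple_integral T s) g = (\<Sum>f\<in>?R. measure lebesgue (?A f) * hip e f g)"
    unfolding time_simple_integral_def by (rule H1_sum[OF _ g]) (rule subsetD[OF sub])
  have "(\<integral>t. hip e (s t) g \<partial>LT T) = (\<integral>t. (\<Sum>f\<in>?R. hip e f g * indicator (?A f) t) \<partial>LT T)"
    by (rule Bochner_Integration.integral_cong) (use eq in \<open>auto simp: space_restrict_space\<close>)
  also have "\<dots> = (\<Sum>f\<in>?R. \<integral>t. hip e f g * indicator (?A f) t \<partial>LT T)" by (rule Bochner_Integration.integral_sum) (rule i)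
  also have "\<dots> = (\<Sum>f\<in>?R. measure lebesgue (?A f) * hip e f g)"
  proof (intro sum.cong refl)
    fix f
    have "measure (LT T) (?A f) = measure lebesgue (?A f)" using eA[of f] by (simp add: measure_def)
    then show "(\<integral>t. hip e f g * indicator (?A f) t \<partial>LT T) = measure lebesgue (?A f) * hip e f g"
      using AT[of f] sets.sets_into_space[OF AT[of f]] by (simp add: Int_absorb1 Int_absorb2)
  qed
  also have "\<dots> = hip e (time_simple_integral T s) g" using H by simp
  finally show "(\<integral>t. hip e (s t) g \<partial>LT T) = hip e (time_simple_integral T s) g" .
  show "time_simple_integral T s \<in> H_set D 1"
    using H by blast
qed

lemma time_simple_H1: "time_simple T (H_space D 1) s \<Longrightarrow> t \<in> {0<..<T} \<Longrightarrow> s t \<in> H_set D 1"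
  by (auto simp: time_simple_def W_space_def)

lemma hip_diff_le:
  assumes "v \<in> H_set D 1" "w \<in> H_set D 1" "g \<in> H_set D 1"
  shows "\<bar>hip 1 v g - hip 1 w g\<bar> \<le> H_norm D 1 (\<lambda>x. v x - w x) * hn 1 g"
  using hip_Cauchy_Schwarz[OF _ H1_diff(1)[OF assms(1,2)] assms(3), of 1] hip_diff[OF assms, of 1]
  unfolding H1_norm_eq[OF H1_diff(1)[OF assms(1,2)]] by simp

lemma strongly_measurable_scalar:
  assumes "strongly_measurable T (H_space D 1) u" and g: "g \<in> H_set D 1"
  shows "(\<lambda>t. hip 1 (u t) g) \<in> borel_measurable (LT T)" "AE t in LT T. u t \<in> H_set D 1"
proof -
  obtain s :: "nat \<Rightarrow> real \<Rightarrow> real^'d \<Rightarrow> real^3" where s: "\<And>i. time_simple T (H_space D 1) (s i)"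
    "AE t in LT T. (\<lambda>i. H_norm D 1 (\<lambda>x. s i t x - u t x)) \<longlonglongrightarrow> 0"
    using assms(1) unfolding strongly_measurable_def W_space_def snd_conv by blast
  show u: "AE t in LT T. u t \<in> H_set D 1" using assms(1) by (simp add: strongly_measurable_def W_space_def)
  have [measurable]: "(\<lambda>t. hip 1 (s i t) g) \<in> borel_measurable (LT T)" for i
    using time_simple_scalar(1)[OF s(1) g] by auto
  have "AE t in LT T. lim (\<lambda>i. hip 1 (s i t) g) = hip 1 (u t) g"
    using s(2) u AE_space
  proof eventually_elim
    case (elim t)
    then have t: "t \<in> {0<..<T}" by (simp add: space_restrict_space)
    have "(\<lambda>i. H_norm D 1 (\<lambda>x. s i t x - u t x) * hn 1 g) \<longlonglongrightarrow> 0 * hn 1 g" using elim(1) by (intro tendsto_intros)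
    then have "(\<lambda>i. hip 1 (s i t) g - hip 1 (u t) g) \<longlonglongrightarrow> 0"
      by (intro Lim_null_comparison[of "\<lambda>i. hip 1 (s i t) g - hip 1 (u t) g"])
         (use hip_diff_le[OF time_simple_H1[OF s(1) t] elim(2) g] in auto)
    then show ?case by (simp add: LIM_zero_cancel limI)
  qed
  then show "(\<lambda>t. hip 1 (u t) g) \<in> borel_measurable (LT T)"
    by (rule lebesgue_on_AE_measurable[rotated]) (auto intro: borel_measurable_lim_metric)
qed

text \<open>The normalisation of g makes the pairing a contraction, so approximation of u by simple
  functions in the mean passes directly to the real-valued functions.\<close>

lemma has_time_integral_scalar:
  assumes "has_time_integral T (H_space D 1) u I" and g: "g \<in> H_set D 1" "hn 1 g \<le> 1"
  shows "integrable (LT T) (\<lambda>t. hip 1 (u t) g)" "(\<integral>t. hip 1 (u t) g \<partial>LT T) = hip 1 I g"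
proof -
  have sm: "strongly_measurable T (H_space D 1) u" and I: "I \<in> H_set D 1"
    using assms(1) by (auto simp: has_time_integral_def W_space_def)
  obtain s :: "nat \<Rightarrow> real \<Rightarrow> real^'d \<Rightarrow> real^3" where s: "\<And>i. time_simple T (H_space D 1) (s i)"
    "(\<lambda>i. \<integral>\<^sup>+t. ennreal (H_norm D 1 (\<lambda>x. u t x - s i t x)) \<partial>LT T) \<longlonglongrightarrow> 0"
    "(\<lambda>i. H_norm D 1 (\<lambda>x. time_simple_integral T (s i) x - I x)) \<longlonglongrightarrow> 0"
    using assms(1) unfolding has_time_integral_def W_space_def snd_conv by blast
  note [measurable] = strongly_measurable_scalar(1)[OF sm g(1)]
  note u = strongly_measurable_scalar(2)[OF sm g(1)]
  note si = time_simple_scalar(1,2)[OF s(1) g(1), where e=1] time_simple_scalar(3)[OF s(1) g(1)]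
  have [measurable]: "(\<lambda>t. hip 1 (s i t) g) \<in> borel_measurable (LT T)" for i using si(1) by auto
  have nn: "(\<integral>\<^sup>+t. ennreal (norm (hip 1 (u t) g - hip 1 (s i t) g)) \<partial>LT T)
     \<le> (\<integral>\<^sup>+t. ennreal (H_norm D 1 (\<lambda>x. u t x - s i t x)) \<partial>LT T)" for i
  proof (rule nn_integral_mono_AE)
    show "AE t in LT T. ennreal (norm (hip 1 (u t) g - hip 1 (s i t) g)) \<le> ennreal (H_norm D 1 (\<lambda>x. u t x - s i t x))"
      using u AE_space
    proof eventually_elim
      case (elim t)
      then have "t \<in> {0<..<T}" by (simp add: space_restrict_space)
      note h = time_simple_H1[OF s(1) this, of i]
      have "H_norm D 1 (\<lambda>x. u t x - s i t x) \<ge> 0"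
        unfolding H1_norm_eq[OF H1_diff(1)[OF elim(1) h]] by simp
      then have "H_norm D 1 (\<lambda>x. u t x - s i t x) * hn 1 g \<le> H_norm D 1 (\<lambda>x. u t x - s i t x)"
        using g(2) by (simp add: mult_left_le)
      then show ?case using hip_diff_le[OF elim(1) h g(1)] by (intro ennreal_leI) (simp only: real_norm_def)
    qed
  qed
  have "\<forall>\<^sub>F i in sequentially. (\<integral>\<^sup>+t. ennreal (H_norm D 1 (\<lambda>x. u t x - s i t x)) \<partial>LT T) < 1"
    by (rule order_tendstoD(2)[OF s(2)]) simp
  then obtain i where "(\<integral>\<^sup>+t. ennreal (H_norm D 1 (\<lambda>x. u t x - s i t x)) \<partial>LT T) < 1"
    using eventually_happens' by force
  then have "(\<integral>\<^sup>+t. ennreal (norm (hip 1 (u t) g - hip 1 (s i t) g)) \<partial>LT T) < \<infinity>"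
    by (rule less_trans[OF le_less_trans[OF nn[of i]]]) simp
  then have "integrable (LT T) (\<lambda>t. hip 1 (u t) g - hip 1 (s i t) g)" by (simp add: integrable_iff_bounded)
  from Bochner_Integration.integrable_add[OF this si(1)[of i]]
  show int: "integrable (LT T) (\<lambda>t. hip 1 (u t) g)" by simp
  have le: "ennreal (norm ((\<integral>t. hip 1 (u t) g \<partial>LT T) - hip 1 (time_simple_integral T (s i)) g))
      \<le> (\<integral>\<^sup>+t. ennreal (H_norm D 1 (\<lambda>x. u t x - s i t x)) \<partial>LT T)" for i
  proof -
    have "(\<integral>t. hip 1 (u t) g \<partial>LT T) - hip 1 (time_simple_integral T (s i)) g = (\<integral>t. hip 1 (u t) g - hip 1 (s i t) g \<partial>LT T)"
      using int si(1)[of i] si(2)[of i] by simp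
    also have "ennreal (norm \<dots>) \<le> (\<integral>\<^sup>+t. ennreal (norm (hip 1 (u t) g - hip 1 (s i t) g)) \<partial>LT T)"
      using int si(1)[of i] by (intro integral_norm_bound_ennreal) simp
    also note nn[of i]
    finally show ?thesis .
  qed
  have "(\<lambda>i. ennreal (norm ((\<integral>t. hip 1 (u t) g \<partial>LT T) - hip 1 (time_simple_integral T (s i)) g))) \<longlonglongrightarrow> 0"
    by (rule tendsto_sandwich[OF _ _ tendsto_const s(2)]) (use le in auto)
  then have "(\<lambda>i. norm ((\<integral>t. hip 1 (u t) g \<partial>LT T) - hip 1 (time_simple_integral T (s i)) g)) \<longlonglongrightarrow> 0"
    by (subst (asm) ennreal_0[symmetric], subst (asm) tendsto_ennreal_iff) auto
  then have 1: "(\<lambda>i. (\<integral>t. hip 1 (u t) g \<partial>LT T) - hip 1 (time_simple_integral T (s i)) g) \<longlonglongrightarrow> 0"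
    by (simp only: tendsto_norm_zero_iff)
  have 2: "(\<lambda>i. hip 1 (time_simple_integral T (s i)) g - hip 1 I g) \<longlonglongrightarrow> 0"
  proof (rule Lim_null_comparison)
    show "(\<lambda>i. H_norm D 1 (\<lambda>x. time_simple_integral T (s i) x - I x) * hn 1 g) \<longlonglongrightarrow> 0"
      using tendsto_mult_right[OF s(3), of "hn 1 g"] by simp
    show "\<forall>\<^sub>F i in sequentially. norm (hip 1 (time_simple_integral T (s i)) g - hip 1 I g) \<le> H_norm D 1 (\<lambda>x. time_simple_integral T (s i) x - I x) * hn 1 g"
      using hip_diff_le[OF si(3) I g(1)] by simp
  qed
  have "(\<lambda>i::nat. (\<integral>t. hip 1 (u t) g \<partial>LT T) - hip 1 I g) \<longlonglongrightarrow> 0"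
    using tendsto_add[OF 1 2] by simp
  then show "(\<integral>t. hip 1 (u t) g \<partial>LT T) = hip 1 I g" by (simp add: LIMSEQ_const_iff)
qed

end

text \<open>Valid at the end points too: each relative neighbourhood of t, even without t, contains
  a nonempty open set, which is not negligible.\<close>

lemma AE_dense:
  fixes T t \<delta> :: real
  assumes ae: "AE t in lebesgue_on {0<..<T}. P t" and t: "t \<in> {0..T}" "T > 0" and \<delta>: "\<delta> > 0"
  obtains s where "P s" "s \<in> {0<..<T}" "s \<noteq> t" "\<bar>s - t\<bar> < \<delta>"
proof -
  have "AE s in lebesgue. s \<in> {0<..<T} \<longrightarrow> P s"
    using ae by (subst (asm) AE_restrict_space_iff) auto
  then obtain N where N: "N \<in> null_sets lebesgue" "{s \<in> space lebesgue. \<not> (s \<in> {0<..<T} \<longrightarrow> P s)} \<subseteq> N"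
    unfolding eventually_ae_filter by blast
  define a b where "a = max 0 (t - \<delta>)" and "b = min T (t + \<delta>)"
  have ab: "a < b" "0 \<le> a" "b \<le> T" "t - \<delta> \<le> a" "b \<le> t + \<delta>" using t \<delta> unfolding a_def b_def by (simp_all add: min_def max_def)
  define U where "U = {a<..<b} - {t}"
  have "open U" unfolding U_def by (intro open_Diff) auto
  moreover have "U \<noteq> {}"
  proof -
    have "(a + b) / 2 \<in> {a<..<b}" "(3 * a + b) / 4 \<in> {a<..<b}" "(a + b) / 2 \<noteq> (3 * a + b) / 4" using ab(1) by (simp_all add: field_simps)
    then show ?thesis unfolding U_def by (metis Diff_iff empty_iff singletonD)
  qed
  ultimately have "\<not> negligible U" by (rule open_not_negligible)
  then have "\<not> U \<subseteq> N" using N(1) negligible_subset[of N U] unfolding negligible_iff_null_sets by blast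
  then obtain s where s: "s \<in> U" "s \<notin> N" by blast
  have s1: "a < s" "s < b" "s \<noteq> t" using s(1) by (simp_all add: U_def)
  have s2: "s \<in> {0<..<T}" using s1 ab by simp
  have "P s" using N(2) s(2) s2 by auto
  moreover have "\<bar>s - t\<bar> < \<delta>" using s1 ab by linarith
  ultimately show ?thesis using that s1(3) s2 by blast
qed

context convex_dom begin

lemma hip_scaleR: "v \<in> H_set D 1 \<Longrightarrow> g \<in> H_set D 1 \<Longrightarrow> hip e (\<lambda>x. a *\<^sub>R v x) g = a * hip e v g"
  using hip_lin[of v v g e a 0] by simp

lemma time_continuousD:
  assumes "time_continuous T (H_space D 1) u" "t \<in> {0..T}"
  shows "u t \<in> H_set D 1" "((\<lambda>s. H_norm D 1 (\<lambda>x. u s x - u t x)) \<longlongrightarrow> 0) (at t within {0..T})"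
  using assms by (auto simp: time_continuous_def W_space_def)

lemma hip_time_continuous:
  assumes u: "time_continuous T (H_space D 1) u" and g: "g \<in> H_set D 1" and e: "0 \<le> e" "e \<le> 1"
  shows "continuous_on {0..T} (\<lambda>t. hip e (u t) g)"
  unfolding continuous_on_def
proof
  fix t assume t: "t \<in> {0..T}"
  note tc = time_continuousD[OF u]
  have "((\<lambda>s. hip e (u s) g - hip e (u t) g) \<longlongrightarrow> 0) (at t within {0..T})"
  proof (rule Lim_null_comparison)
    show "((\<lambda>s. H_norm D 1 (\<lambda>x. u s x - u t x) * hn e g) \<longlongrightarrow> 0) (at t within {0..T})"
      using tendsto_mult_right[OF tc(2)[OF t], of "hn e g"] by simp
    have "norm (hip e (u s) g - hip e (u t) g) \<le> H_norm D 1 (\<lambda>x. u s x - u t x) * hn e g" if s: "s \<in> {0..T}" for s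
    proof -
      note d = H1_diff(1)[OF tc(1)[OF s] tc(1)[OF t]]
      have "norm (hip e (u s) g - hip e (u t) g) \<le> hn e (\<lambda>x. u s x - u t x) * hn e g"
        using hip_Cauchy_Schwarz[OF e(1) d g] hip_diff[OF tc(1)[OF s] tc(1)[OF t] g, of e] by simp
      also have "\<dots> \<le> H_norm D 1 (\<lambda>x. u s x - u t x) * hn e g"
        unfolding H1_norm_eq[OF d] using e by (intro mult_right_mono hn_le_1) auto
      finally show ?thesis .
    qed
    then show "\<forall>\<^sub>F s in at t within {0..T}. norm (hip e (u s) g - hip e (u t) g) \<le> H_norm D 1 (\<lambda>x. u s x - u t x) * hn e g"
      by (simp add: eventually_at_filter)
  qed
  then show "((\<lambda>t. hip e (u t) g) \<longlongrightarrow> hip e (u t) g) (at t within {0..T})" by (simp add: LIM_zero_cancel)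
qed

text \<open>By duality: for every g in the unit ball the real function \<open>hip 1 (u t) g\<close>
  has a weak derivative bounded by the same C. Taking for g the normalised increment of u recovers
  its H^1 norm.\<close>

lemma W1_time_lipschitz:
  assumes W: "u \<in> W1q_time T \<infinity> (H_space D 1)" and tc: "time_continuous T (H_space D 1) u" and T: "T > 0"
  obtains C where "C \<ge> 0" "\<And>s t. s \<in> {0..T} \<Longrightarrow> t \<in> {0..T} \<Longrightarrow> hn 1 (\<lambda>x. u t x - u s x) \<le> C * \<bar>t - s\<bar>"
proof -
  obtain u' where u': "u' \<in> Lq_time T \<infinity> (H_space D 1)" "has_weak_time_deriv T (H_space D 1) u u'"
    using W by (auto simp: W1q_time_def)
  obtain C0 where C0: "AE t in LT T. H_norm D 1 (u' t) \<le> C0" and sm: "strongly_measurable T (H_space D 1) u'"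
    using u'(1) by (auto simp: Lq_time_def W_space_def)
  define C where "C = max C0 0"
  have fin: "finite_measure (LT T)" by (intro finite_measure_lebesgue_on bounded_set_imp_lmeasurable) auto
  note uH = time_continuousD(1)[OF tc]
  have scal: "\<bar>hip 1 (u t) g - hip 1 (u s) g\<bar> \<le> C * (t - s)"
    if g: "g \<in> H_set D 1" "hn 1 g \<le> 1" and st: "0 < s" "s \<le> t" "t < T" for g s t
  proof (rule weak_derivative_lipschitz[OF _ _ _ _ _ st, where f="\<lambda>t. hip 1 (u t) g" and ?f1.0="\<lambda>t. hip 1 (u' t) g"])
    note m = strongly_measurable_scalar[OF sm g(1)]
    show "continuous_on {0..T} (\<lambda>t. hip 1 (u t) g)" by (rule hip_time_continuous[OF tc g(1)]) auto
    show ae: "AE t in LT T. \<bar>hip 1 (u' t) g\<bar> \<le> C"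
      using C0 m(2)
    proof eventually_elim
      case (elim t)
      have "\<bar>hip 1 (u' t) g\<bar> \<le> hn 1 (u' t) * hn 1 g" by (rule hip_Cauchy_Schwarz[OF _ elim(2) g(1)]) simp
      also have "\<dots> \<le> hn 1 (u' t)" using g(2) by (simp add: mult_left_le)
      finally show ?case using elim(1) unfolding H1_norm_eq[OF elim(2)] C_def by linarith
    qed
    show "integrable (LT T) (\<lambda>t. hip 1 (u' t) g)"
    proof (rule finite_measure.integrable_const_bound[OF fin _ m(1)])
      show "AE t in LT T. norm (hip 1 (u' t) g) \<le> C" using ae unfolding real_norm_def .
    qed
    show "C \<ge> 0" by (simp add: C_def)
    fix \<phi> assume \<phi>: "test_function {0<..<T} \<phi>"
    obtain I where I: "has_time_integral T (H_space D 1) (\<lambda>t x. deriv \<phi> t *\<^sub>R u t x) I"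
      "has_time_integral T (H_space D 1) (\<lambda>t x. \<phi> t *\<^sub>R u' t x) (\<lambda>x. - I x)"
      using u'(2) \<phi> by (auto simp: has_weak_time_deriv_def)
    have IH: "I \<in> H_set D 1" using I(1) by (simp add: has_time_integral_def W_space_def)
    note s1 = has_time_integral_scalar[OF I(1) g] and s2 = has_time_integral_scalar[OF I(2) g]
    have "(\<integral>t. deriv \<phi> t * hip 1 (u t) g \<partial>LT T) = (\<integral>t. hip 1 (\<lambda>x. deriv \<phi> t *\<^sub>R u t x) g \<partial>LT T)"
    proof (rule Bochner_Integration.integral_cong[OF refl])
      fix t assume "t \<in> space (LT T)"
      then have "t \<in> {0..T}" by (simp add: space_restrict_space)
      then show "deriv \<phi> t * hip 1 (u t) g = hip 1 (\<lambda>x. deriv \<phi> t *\<^sub>R u t x) g"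
        by (rule hip_scaleR[OF uH g(1), symmetric])
    qed
    also have "\<dots> = hip 1 I g" by (rule s1(2))
    also have "\<dots> = - hip 1 (\<lambda>x. - I x) g" using hip_scaleR[OF IH g(1), of 1 "-1"] by simp
    also have "hip 1 (\<lambda>x. - I x) g = (\<integral>t. hip 1 (\<lambda>x. \<phi> t *\<^sub>R u' t x) g \<partial>LT T)" by (rule s2(2)[symmetric])
    also have "\<dots> = (\<integral>t. \<phi> t * hip 1 (u' t) g \<partial>LT T)"
    proof (rule integral_cong_AE)
      show "(\<lambda>t. hip 1 (\<lambda>x. \<phi> t *\<^sub>R u' t x) g) \<in> borel_measurable (LT T)" using s2(1) by auto
      have "\<phi> \<in> borel_measurable (LT T)"
        by (intro borel_imp_lebesgue_on borel_measurable_continuous_onI smooth_continuous test_function_smooth[OF \<phi>])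
      then show "(\<lambda>t. \<phi> t * hip 1 (u' t) g) \<in> borel_measurable (LT T)" using m(1) by (rule borel_measurable_times)
      show "AE t in LT T. hip 1 (\<lambda>x. \<phi> t *\<^sub>R u' t x) g = \<phi> t * hip 1 (u' t) g"
        using m(2) by eventually_elim (rule hip_scaleR[OF _ g(1)])
    qed
    finally show "(\<integral>t. deriv \<phi> t * hip 1 (u t) g \<partial>LT T) = - (\<integral>t. \<phi> t * hip 1 (u' t) g \<partial>LT T)" .
  qed
  have scal': "\<bar>hip 1 (u t) g - hip 1 (u s) g\<bar> \<le> C * (t - s)"
    if g: "g \<in> H_set D 1" "hn 1 g \<le> 1" and st: "0 \<le> s" "s \<le> t" "t \<le> T" for g s t
  proof -
    define a where "a = (\<lambda>n::nat. 1 / (real n + 2))"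
    have a: "0 < a n" "a n < 1" for n by (auto simp: a_def field_simps)
    have a0: "a \<longlonglongrightarrow> 0" unfolding a_def by real_asymp
    \<comment> \<open>Points pulled slightly towards T/2. They are interior, keep the order of s and
      t, and converge to them, so the interior estimate extends to the closed interval.\<close>
    define \<sigma> where "\<sigma> = (\<lambda>n x. (1 - a n) * x + a n * (T / 2))"
    have \<sigma>in: "0 < \<sigma> n x \<and> \<sigma> n x < T" if "0 \<le> x" "x \<le> T" for n x
    proof
      show "0 < \<sigma> n x" unfolding \<sigma>_def using a[of n] that T by (intro add_nonneg_pos mult_nonneg_nonneg mult_pos_pos) auto
      have "(1 - a n) * x \<le> (1 - a n) * T" "a n * (T / 2) < a n * T"
        using a[of n] that T by (auto intro!: mult_left_mono mult_strict_left_mono)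
      then have "\<sigma> n x < (1 - a n) * T + a n * T" unfolding \<sigma>_def by linarith
      then show "\<sigma> n x < T" by (simp add: algebra_simps)
    qed
    have \<sigma>lim: "(\<lambda>n. \<sigma> n x) \<longlonglongrightarrow> x" for x
    proof -
      have "(\<lambda>n. (1 - a n) * x + a n * (T / 2)) \<longlonglongrightarrow> (1 - 0) * x + 0 * (T / 2)" by (intro tendsto_intros a0)
      then show ?thesis by (simp add: \<sigma>_def)
    qed
    have c: "continuous_on {0..T} (\<lambda>t. hip 1 (u t) g)" by (rule hip_time_continuous[OF tc g(1)]) auto
    have l: "(\<lambda>n. hip 1 (u (\<sigma> n x)) g) \<longlonglongrightarrow> hip 1 (u x) g" if "0 \<le> x" "x \<le> T" for x
    proof (rule continuous_on_tendsto_compose[OF c \<sigma>lim])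
      show "\<forall>\<^sub>F n in sequentially. \<sigma> n x \<in> {0..T}" using \<sigma>in[OF that] by (auto intro!: always_eventually less_imp_le)
    qed (use that in simp)
    show ?thesis
    proof (rule LIMSEQ_le)
      show "(\<lambda>n. \<bar>hip 1 (u (\<sigma> n t)) g - hip 1 (u (\<sigma> n s)) g\<bar>) \<longlonglongrightarrow> \<bar>hip 1 (u t) g - hip 1 (u s) g\<bar>"
        using st by (intro tendsto_intros l) auto
      show "(\<lambda>n. C * (\<sigma> n t - \<sigma> n s)) \<longlonglongrightarrow> C * (t - s)" by (intro tendsto_intros \<sigma>lim)
      have "\<sigma> n s \<le> \<sigma> n t" for n unfolding \<sigma>_def using a[of n] st by (auto intro: mult_left_mono)
      then show "\<exists>N. \<forall>n\<ge>N. \<bar>hip 1 (u (\<sigma> n t)) g - hip 1 (u (\<sigma> n s)) g\<bar> \<le> C * (\<sigma> n t - \<sigma> n s)"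
        using \<sigma>in[of s] \<sigma>in[of t] st by (intro exI[of _ 0] allI impI scal[OF g]) auto
    qed
  qed
  have main: "hn 1 (\<lambda>x. u t x - u s x) \<le> C * (t - s)" if st: "0 \<le> s" "s \<le> t" "t \<le> T" for s t
  proof (cases "hn 1 (\<lambda>x. u t x - u s x) = 0")
    case True
    then show ?thesis using st by (simp add: C_def)
  next
    case False
    define w where "w = (\<lambda>x. u t x - u s x)"
    define N where "N = hn 1 w"
    have us: "u s \<in> H_set D 1" "u t \<in> H_set D 1" using uH st by auto
    have wH: "w \<in> H_set D 1" unfolding w_def by (rule H1_diff(1)[OF us(2,1)])
    have N: "N > 0" using False hn_nonneg[of 1 w] by (simp add: N_def w_def less_le)
    let ?g = "\<lambda>x. (1 / N) *\<^sub>R w x"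
    have gH: "?g \<in> H_set D 1" by (rule H1_scaleR(1)[OF wH])
    have ww: "hip 1 w w = N\<^sup>2" unfolding N_def by (simp add: hn_sq)
    have "hip 1 w ?g = 1 / N * N\<^sup>2"
      unfolding hip_commute[of 1 w ?g] ww[symmetric] by (rule hip_scaleR[OF wH wH])
    then have wg: "hip 1 w ?g = N" using N by (simp add: power2_eq_square)
    have "hip 1 ?g ?g = 1" using hip_scaleR[OF wH gH, of 1 "1/N"] wg N by simp
    then have "hn 1 ?g \<le> 1" by (simp add: hn_def)
    from scal'[OF gH this st] have "\<bar>hip 1 w ?g\<bar> \<le> C * (t - s)"
      using hip_diff[OF us(2,1) gH, of 1] by (simp add: w_def)
    then show ?thesis using wg by (simp add: N_def w_def)
  qed
  show ?thesis
  proof (rule that[of C])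
    show "C \<ge> 0" by (simp add: C_def)
    fix s t assume st: "s \<in> {0..T}" "t \<in> {0..T}"
    show "hn 1 (\<lambda>x. u t x - u s x) \<le> C * \<bar>t - s\<bar>"
    proof (cases "s \<le> t")
      case True
      then show ?thesis using main[of s t] st by simp
    next
      case False
      then have "hn 1 (\<lambda>x. u s x - u t x) \<le> C * (s - t)" using main[of t s] st by simp
      then show ?thesis using hn_diff_commute[OF _ uH[OF st(2)] uH[OF st(1)], of 1] False by simp
    qed
  qed
qed

lemma H2_subset_H1: "v \<in> H_set D 2 \<Longrightarrow> v \<in> H_set D 1"
  unfolding Sobolev_set_def by auto

text \<open>The list \<open>[j, i]\<close> applies direction i to the test function before direction
  j. Testing \<open>pd j v\<close> with the i-th partial derivative of \<phi> therefore identifies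
  \<open>weak_deriv D [j, i] v\<close> as the derivative of \<open>pd j v\<close> in direction
  i.\<close>

lemma H2_h2:
  assumes v: "v \<in> H_set D 2" and B: "H_norm D 2 v \<le> B"
  shows "h2 v (\<lambda>j. pd j v) (\<lambda>j i. weak_deriv D [j, i] v) B"
proof -
  have wd: "has_weak_deriv D js v (weak_deriv D js v)" "sqi LD (weak_deriv D js v)" if "length js \<le> 2" for js
  proof -
    have "\<exists>w\<in>Lp_set D 2. has_weak_deriv D js v w" using v that unfolding Sobolev_set_def by blast
    then obtain w where w: "sqi LD w" "has_weak_deriv D js v w" unfolding Bex_def Lp2_iff by blast
    show "has_weak_deriv D js v (weak_deriv D js v)" by (rule weak_deriv_works[OF w(2)])
    show "sqi LD (weak_deriv D js v)" by (rule weak_deriv_sqi[OF w(2,1)])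
  qed
  have lp: "Lp_norm D 2 w powr 2 = (l2n LD w)\<^sup>2" for w :: "real^'d \<Rightarrow> real^3"
    by (simp add: Lp_norm_def l2n_sq powr_powr)
  have fin: "finite {js :: 'd list. length js \<le> 2}"
    using finite_lists_length_le[of "UNIV :: 'd set" 2] by simp
  have le: "l2n LD (weak_deriv D js v) \<le> B" if "length js \<le> 2" for js
  proof -
    have "(l2n LD (weak_deriv D js v))\<^sup>2 \<le> (\<Sum>js | length js \<le> 2. (l2n LD (weak_deriv D js v))\<^sup>2)"
      using fin that by (intro member_le_sum) auto
    then have "sqrt ((l2n LD (weak_deriv D js v))\<^sup>2) \<le> sqrt (\<Sum>js | length js \<le> 2. (l2n LD (weak_deriv D js v))\<^sup>2)"
      by (rule real_sqrt_le_mono)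
    also have "\<dots> = H_norm D 2 v" unfolding Sobolev_norm_def by (simp add: lp powr_half_sqrt sum_nonneg)
    finally show ?thesis using B by simp
  qed
  have v1: "sqi LD v" by (rule H1_D(1)[OF H2_subset_H1[OF v]])
  have nil: "l2n LD v \<le> B"
  proof -
    have "l2n LD (weak_deriv D [] v) = l2n LD v"
      by (rule l2n_cong_AE[OF sqiD(1)[OF wd(2)] sqiD(1)[OF v1] weak_deriv_AE[OF has_weak_deriv_Nil[OF v1]]]) simp
    then show ?thesis using le[of "[]"] by simp
  qed
  have second: "has_weak_deriv D [i] (pd j v) (weak_deriv D [j, i] v)" for i j
    unfolding has_weak_deriv_def
  proof (intro conjI allI impI)
    show "locally_integrable D (pd j v)" "locally_integrable D (weak_deriv D [j, i] v)"
      using wd(2) by (auto intro: sqi_locally_integrable)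
    fix \<phi> assume \<phi>: "test_function D \<phi>"
    have t: "test_function D (iter_partial [i] \<phi>)" by (rule iter_partial_test[OF \<phi>])
    have "length [j] \<le> 2" "length [j, i] \<le> 2" by simp_all
    from wd(1)[OF this(1)] wd(1)[OF this(2)]
    have e1: "(\<integral>x. iter_partial [j] (iter_partial [i] \<phi>) x *\<^sub>R v x \<partial>LD) = - (\<integral>x. iter_partial [i] \<phi> x *\<^sub>R pd j v x \<partial>LD)"
      and e2: "(\<integral>x. iter_partial [j, i] \<phi> x *\<^sub>R v x \<partial>LD) = (\<integral>x. \<phi> x *\<^sub>R weak_deriv D [j, i] v x \<partial>LD)"
      unfolding has_weak_deriv_def using t \<phi> by fastforce+
    have eq: "iter_partial [j] (iter_partial [i] \<phi>) = iter_partial [j, i] \<phi>" by simp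
    have "- (\<integral>x. iter_partial [i] \<phi> x *\<^sub>R pd j v x \<partial>LD) = (\<integral>x. \<phi> x *\<^sub>R weak_deriv D [j, i] v x \<partial>LD)"
      by (rule trans[OF e1[unfolded eq, symmetric] e2])
    then have "(\<integral>x. iter_partial [i] \<phi> x *\<^sub>R pd j v x \<partial>LD) = - (\<integral>x. \<phi> x *\<^sub>R weak_deriv D [j, i] v x \<partial>LD)"
      unfolding minus_equation_iff[of "\<integral>x. iter_partial [i] \<phi> x *\<^sub>R pd j v x \<partial>LD"] by (rule sym)
    then show "(\<integral>x. iter_partial [i] \<phi> x *\<^sub>R pd j v x \<partial>LD) = (- 1) ^ length [i] *\<^sub>R (\<integral>x. \<phi> x *\<^sub>R weak_deriv D [j, i] v x \<partial>LD)"
      by (simp del: iter_partial.simps)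
  qed
  show ?thesis
    unfolding h2_def by (intro conjI allI v1 nil wd le second) simp_all
qed

end

section \<open>Limits in \<open>H\<^sup>1\<close> of bounded sequences in
  \<open>H\<^sup>2\<close>\<close>

context convex_dom3 begin

lemma h2_grad_L4:
  assumes h: "h2 v w ww B"
  shows "sqi LD (\<lambda>x. (norm (w j x))\<^sup>2)" "l2n LD (\<lambda>x. (norm (w j x))\<^sup>2) \<le> sobC * ((1 + real CARD('d)) * B\<^sup>2)"
proof -
  note hh = h2D[OF h]
  have wH: "w j \<in> H_set D 1" by (rule H1_I[OF hh(4,6,7)])
  have "l2n LD (pd i (w j)) = l2n LD (ww j i)" for i
    by (rule l2n_cong_AE[OF sqiD(1)[OF H1_D(3)[OF wH]] sqiD(1)[OF hh(7)] weak_deriv_AE[OF hh(6)]])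
  then have "(hn 1 (w j))\<^sup>2 = (l2n LD (w j))\<^sup>2 + (\<Sum>i\<in>UNIV. (l2n LD (ww j i))\<^sup>2)"
    by (simp add: hn_sq hip_self)
  also have "\<dots> \<le> B\<^sup>2 + (\<Sum>i\<in>(UNIV::'d set). B\<^sup>2)"
    using hh by (intro add_mono sum_mono power_mono) auto
  finally have "(hn 1 (w j))\<^sup>2 \<le> (1 + real CARD('d)) * B\<^sup>2" by (simp add: algebra_simps)
  then have "sobC * (hn 1 (w j))\<^sup>2 \<le> sobC * ((1 + real CARD('d)) * B\<^sup>2)" using sobC_nonneg by (intro mult_left_mono)
  then show "sqi LD (\<lambda>x. (norm (w j x))\<^sup>2)" "l2n LD (\<lambda>x. (norm (w j x))\<^sup>2) \<le> sobC * ((1 + real CARD('d)) * B\<^sup>2)"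
    using sobolev_L4[OF wH] by auto
qed

text \<open>The values \<open>u t\<close> lie in \<open>H\<^sup>2\<close> for almost all times only; by continuity in \<open>H\<^sup>1\<close> every
  value is a limit of this kind, and nothing else about its second derivatives is used.\<close>

definition H2_limit :: "real \<Rightarrow> (real^'d \<Rightarrow> real^3) \<Rightarrow> bool" where
  "H2_limit B z \<longleftrightarrow> z \<in> H_set D 1 \<and> (\<forall>e>0. \<exists>v. v \<in> H_set D 2 \<and> H_norm D 2 v \<le> B \<and> hn 1 (\<lambda>x. v x - z x) < e)"

text \<open>The embedding constants see only B, so the bounds are uniform along an approximating
  sequence and survive the H^1 limit: the sup bound along a subsequence, the L^4 bound of the
  gradients by Fatou.\<close>

lemma H2_limit_bounds:
  assumes z: "H2_limit B z"
  shows "AE x in LD. norm (z x) \<le> sobC_inf * B" "sqi LD (\<lambda>x. (norm (pd j z x))\<^sup>2)"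
    "l2n LD (\<lambda>x. (norm (pd j z x))\<^sup>2) \<le> sobC * ((1 + real CARD('d)) * B\<^sup>2)"
proof -
  have zH: "z \<in> H_set D 1" using z by (simp add: H2_limit_def)
  have "\<exists>v. v \<in> H_set D 2 \<and> H_norm D 2 v \<le> B \<and> hn 1 (\<lambda>x. v x - z x) < 1 / real (Suc n)" for n
    using z unfolding H2_limit_def by simp
  then obtain v where v: "\<And>n. v n \<in> H_set D 2" "\<And>n. H_norm D 2 (v n) \<le> B" "\<And>n. hn 1 (\<lambda>x. v n x - z x) < 1 / real (Suc n)"
    by metis
  note h = H2_h2[OF v(1,2)] and vH = H2_subset_H1[OF v(1)]
  have lim: "(\<lambda>n. hn 1 (\<lambda>x. v n x - z x)) \<longlonglongrightarrow> 0"
    by (rule tendsto_sandwich[OF _ _ tendsto_const LIMSEQ_inverse_real_of_nat])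
       (use v(3) in \<open>auto intro!: always_eventually less_imp_le simp: inverse_eq_divide\<close>)
  have l0: "(\<lambda>n. l2n LD (\<lambda>x. v n x - z x)) \<longlonglongrightarrow> 0"
    by (rule tendsto_sandwich[OF _ _ tendsto_const lim]) (auto intro!: always_eventually l2n_le_hn)
  have l1: "(\<lambda>n. l2n LD (\<lambda>x. pd j (v n) x - pd j z x)) \<longlonglongrightarrow> 0"
  proof (rule tendsto_sandwich[OF _ _ tendsto_const lim])
    have "l2n LD (\<lambda>x. pd j (v n) x - pd j z x) \<le> hn 1 (\<lambda>x. v n x - z x)" for n
    proof -
      have "l2n LD (\<lambda>x. pd j (v n) x - pd j z x) = l2n LD (pd j (\<lambda>x. v n x - z x))"
        using H1_diff(2)[OF vH zH, of j n]
        by (intro l2n_cong_AE sqiD(1) sqi_diff H1_D(3) vH zH H1_diff(1)) (auto elim: eventually_mono)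
      then show ?thesis using pd_le_hn[of 1 j "\<lambda>x. v n x - z x"] by simp
    qed
    then show "\<forall>\<^sub>F n in sequentially. l2n LD (\<lambda>x. pd j (v n) x - pd j z x) \<le> hn 1 (\<lambda>x. v n x - z x)" by simp
  qed simp
  have B0: "B \<ge> 0" by (rule h2D(9)[OF h])
  show "AE x in LD. norm (z x) \<le> sobC_inf * B"
    by (rule l2n_tendsto_bounded[OF H1_D(1)[OF vH] H1_D(1)[OF zH] l0 sobolev_inf[OF h]])
  have b: "(\<integral>\<^sup>+x. ennreal (norm (pd j (v n) x) ^ 4) \<partial>LD) \<le> ennreal ((sobC * ((1 + real CARD('d)) * B\<^sup>2))\<^sup>2)" for n
  proof -
    have "(\<integral>\<^sup>+x. ennreal (norm (pd j (v n) x) ^ 4) \<partial>LD) = ennreal ((l2n LD (\<lambda>x. (norm (pd j (v n) x))\<^sup>2))\<^sup>2)"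
      using sqi_ennreal[OF h2_grad_L4(1)[OF h, of j n]] by simp
    then show ?thesis using h2_grad_L4(2)[OF h, of j n] by (simp only:) (intro ennreal_leI power_mono, auto)
  qed
  have nn: "0 \<le> sobC * ((1 + real CARD('d)) * B\<^sup>2)" using sobC_nonneg by (intro mult_nonneg_nonneg) auto
  show "sqi LD (\<lambda>x. (norm (pd j z x))\<^sup>2)" "l2n LD (\<lambda>x. (norm (pd j z x))\<^sup>2) \<le> sobC * ((1 + real CARD('d)) * B\<^sup>2)"
    by (rule l2n_tendsto_power2_bound[OF H1_D(3)[OF vH] H1_D(3)[OF zH] l1 b nn])+
qed

end

context fem_dom begin

text \<open>An H^2 function within \<open>min h (h\<^sup>2)\<close> of z is approximated instead,
  which raises the summand 1 to 2.\<close>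

lemma H2_limit_approximation:
  assumes z: "H2_limit B z"
  obtains p where "p \<in> Vh" "l2n LD (\<lambda>x. p x - z x) \<le> (intC * B + 2) * h\<^sup>2"
    "\<And>j. l2n LD (\<lambda>x. fgrad p j x - pd j z x) \<le> (2 / \<rho> * intC * B + 2) * h"
proof -
  have zH: "z \<in> H_set D 1" using z by (simp add: H2_limit_def)
  have "min h (h\<^sup>2) > 0" using h_pos by simp
  then obtain v where v: "v \<in> H_set D 2" "H_norm D 2 v \<le> B" "hn 1 (\<lambda>x. v x - z x) < min h (h\<^sup>2)"
    using z unfolding H2_limit_def by meson
  note vH = H2_subset_H1[OF v(1)]
  obtain p where p: "p \<in> Vh" "l2n LD (\<lambda>x. p x - v x) \<le> (intC * B + 1) * h\<^sup>2"
    "\<And>j. l2n LD (\<lambda>x. fgrad p j x - pd j v x) \<le> (2 / \<rho> * intC * B + 1) * h"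
    using fem_approximation[OF H2_h2[OF v(1,2)]] by blast
  show ?thesis
  proof (rule that[OF p(1)])
    have "l2n LD (\<lambda>x. p x - z x) \<le> l2n LD (\<lambda>x. p x - v x) + l2n LD (\<lambda>x. v x - z x)"
      by (intro l2n_triangle3 H1_D(1) Vh_H1(1) p(1) vH zH)
    also have "l2n LD (\<lambda>x. v x - z x) \<le> h\<^sup>2" using l2n_le_hn[of 1 "\<lambda>x. v x - z x"] v(3) by simp
    finally show "l2n LD (\<lambda>x. p x - z x) \<le> (intC * B + 2) * h\<^sup>2" using p(2) by (simp add: algebra_simps)
    fix j
    have "l2n LD (\<lambda>x. fgrad p j x - pd j z x) \<le> l2n LD (\<lambda>x. fgrad p j x - pd j v x) + l2n LD (\<lambda>x. pd j v x - pd j z x)"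
      by (intro l2n_triangle3 H1_D(3) Vh_H1(4) p(1) vH zH)
    also have "l2n LD (\<lambda>x. pd j v x - pd j z x) \<le> h"
    proof -
      have "l2n LD (\<lambda>x. pd j v x - pd j z x) = l2n LD (pd j (\<lambda>x. v x - z x))"
        using H1_diff(2)[OF vH zH, of j]
        by (intro l2n_cong_AE sqiD(1) sqi_diff H1_D(3) vH zH H1_diff(1)) (auto elim: eventually_mono)
      then show ?thesis using pd_le_hn[of 1 j "\<lambda>x. v x - z x"] v(3) by simp
    qed
    finally show "l2n LD (\<lambda>x. fgrad p j x - pd j z x) \<le> (2 / \<rho> * intC * B + 2) * h" using p(3)[of j] by (simp add: algebra_simps)
  qed
qed

end

section \<open>The variational form\<close>

text \<open>Hoelder's inequality for two L^4 factors, with F merely dominated by the product, so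
  that it covers inner products and cross products alike.\<close>

lemma sqi_product:
  assumes "sqi M (\<lambda>x. (norm (a x))\<^sup>2)" "sqi M (\<lambda>x. (norm (b x))\<^sup>2)"
    and F: "F \<in> borel_measurable M" "AE x in M. norm (F x) \<le> norm (a x) * norm (b x)"
  shows "sqi M F" "l2n M F \<le> sqrt (l2n M (\<lambda>x. (norm (a x))\<^sup>2) * l2n M (\<lambda>x. (norm (b x))\<^sup>2))"
proof -
  have i: "integrable M (\<lambda>x. (norm (a x))\<^sup>2 * (norm (b x))\<^sup>2)" using sqi_mult_integrable[OF assms(1,2)] by simp
  have le: "AE x in M. (norm (F x))\<^sup>2 \<le> (norm (a x))\<^sup>2 * (norm (b x))\<^sup>2"
    using F(2)
  proof eventually_elim
    case (elim x)
    then have "(norm (F x))\<^sup>2 \<le> (norm (a x) * norm (b x))\<^sup>2" by (intro power_mono) auto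
    then show ?case by (simp add: power_mult_distrib)
  qed
  have iF: "integrable M (\<lambda>x. (norm (F x))\<^sup>2)"
    by (rule Bochner_Integration.integrable_bound[OF i]) (use F(1) le in \<open>auto elim: eventually_mono\<close>)
  with F(1) show "sqi M F" by (simp add: sqi_def)
  have "(l2n M F)\<^sup>2 \<le> (\<integral>x. (norm (a x))\<^sup>2 * (norm (b x))\<^sup>2 \<partial>M)"
    unfolding l2n_sq by (rule integral_mono_AE[OF iF i le])
  also have "\<dots> \<le> l2n M (\<lambda>x. (norm (a x))\<^sup>2) * l2n M (\<lambda>x. (norm (b x))\<^sup>2)"
    using l2n_Cauchy_Schwarz[OF assms(1,2)] by simp
  finally show "l2n M F \<le> sqrt (l2n M (\<lambda>x. (norm (a x))\<^sup>2) * l2n M (\<lambda>x. (norm (b x))\<^sup>2))"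
    by (rule real_le_rsqrt)
qed

lemma norm_cross_le: "norm (cross3 x y) \<le> norm x * norm y"
proof (rule power2_le_imp_le)
  show "(norm (cross3 x y))\<^sup>2 \<le> (norm x * norm y)\<^sup>2" by (simp add: norm_cross power_mult_distrib)
qed simp

lemma borel_measurable_cross3:
  "f \<in> borel_measurable M \<Longrightarrow> g \<in> borel_measurable M \<Longrightarrow> (\<lambda>x. cross3 (f x) (g x)) \<in> borel_measurable M"
  by (rule borel_measurable_continuous_Pair[where H="cross3"])
     (auto intro!: continuous_on_cross continuous_on_fst continuous_on_snd continuous_on_id)

text \<open>The hypothesis on \<open>q\<close> is the variational equation with its time integrals over the open
  interval; letting \<open>t\<close> tend to the end points removes the restriction to interior times.\<close>

lemma integral_equation_increment:
  fixes p f1 f2 f3 :: "real \<Rightarrow> real"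
  assumes c: "continuous_on {0..T} p" "continuous_on {0..T} f1" "continuous_on {0..T} f2" "continuous_on {0..T} f3"
    and eq: "\<And>t. t \<in> {0<..<T} \<Longrightarrow> p t + k1 * (\<integral>s. f1 s \<partial>lebesgue_on {0<..<t}) + k2 * (\<integral>s. f2 s \<partial>lebesgue_on {0<..<t})
        + k3 * (\<integral>s. f3 s \<partial>lebesgue_on {0<..<t}) = q"
    and f: "\<And>s. f s = k1 * f1 s + k2 * f2 s + k3 * f3 s"
    and lip: "\<And>s t. s \<in> {0..T} \<Longrightarrow> t \<in> {0..T} \<Longrightarrow> \<bar>f s - f t\<bar> \<le> L * \<bar>s - t\<bar>"
    and T: "T > 0" and L: "L \<ge> 0"
  shows "p 0 = q"
    and "\<And>a b. 0 \<le> a \<Longrightarrow> a \<le> b \<Longrightarrow> b \<le> T \<Longrightarrow> \<bar>p b - p a + (b - a) * f b\<bar> \<le> L * (b - a)\<^sup>2"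
proof -
  have conv: "(\<integral>s. g s \<partial>lebesgue_on {0<..<t}) = integral {0..t} g"
    if g: "continuous_on {0..T} g" and t: "t \<in> {0<..<T}" for g :: "real \<Rightarrow> real" and t
  proof -
    have ct: "continuous_on {0..t} g" using g t by (auto intro: continuous_on_subset)
    have "set_integrable lebesgue {0<..<t} g"
      by (rule set_integrable_subset[OF absolutely_integrable_continuous_real[OF ct]]) auto
    then have "integrable lebesgue (\<lambda>x. indicator {0<..<t} x *\<^sub>R g x)" unfolding set_integrable_def .
    then have "integrable (lebesgue_on {0<..<t}) g" by (subst integrable_restrict_space) simp_all
    then have "(\<integral>s. g s \<partial>lebesgue_on {0<..<t}) = integral {0<..<t} g" by (rule lebesgue_integral_eq_integral) simp
    then show ?thesis by (simp add: integral_open_interval_real)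
  qed
  have fe: "f = (\<lambda>s. k1 * f1 s + k2 * f2 s + k3 * f3 s)" by (rule ext) (rule f)
  have fc: "continuous_on {0..T} f"
    unfolding fe by (intro continuous_on_add continuous_on_mult_left c)
  have int: "g integrable_on {a..b}" if "continuous_on {0..T} g" "0 \<le> a" "b \<le> T" for g :: "real \<Rightarrow> real" and a b
    using that by (intro integrable_continuous_real) (auto intro: continuous_on_subset)
  \<comment> \<open>E is constant on (0,T) by the equation and continuous on [0,T]; hence it equals
    q at both end points.\<close>
  define E where "E = (\<lambda>t. p t + integral {0..t} f)"
  have E1: "E t = q" if t: "t \<in> {0<..<T}" for t
  proof -
    have t': "0 \<le> (0::real)" "t \<le> T" using t by auto
    have "(f has_integral k1 * integral {0..t} f1 + k2 * integral {0..t} f2 + k3 * integral {0..t} f3) {0..t}"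
      unfolding fe
      by (intro has_integral_add has_integral_mult_right integrable_integral int[OF c(2) t'] int[OF c(3) t'] int[OF c(4) t'])
    then have "integral {0..t} f = k1 * integral {0..t} f1 + k2 * integral {0..t} f2 + k3 * integral {0..t} f3"
      by (rule integral_unique)
    then show ?thesis using eq[OF t] conv[OF c(2) t] conv[OF c(3) t] conv[OF c(4) t] by (simp add: E_def)
  qed
  have Ec: "continuous_on {0..T} E" unfolding E_def
    by (intro continuous_on_add c(1) indefinite_integral_continuous_1 int[OF fc]) auto
  have E: "E t = q" if "t \<in> {0..T}" for t
  proof (rule continuous_constant_on_closure[of "{0<..<T}" E])
    show "continuous_on (closure {0<..<T}) E" using Ec T by simp
    show "t \<in> closure {0<..<T}" using that T by simp
  qed (rule E1)
  show "p 0 = q" using E[of 0] T by (simp add: E_def)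
  fix a b assume ab: "0 \<le> a" "a \<le> b" "b \<le> T"
  have "integral {0..a} f + integral {a..b} f = integral {0..b} f"
    by (rule Henstock_Kurzweil_Integration.integral_combine) (use ab int[OF fc] in auto)
  then have 1: "p b - p a = - integral {a..b} f" using E[of a] E[of b] ab by (simp add: E_def)
  have "norm (integral {a..b} (\<lambda>s. f s - f b)) \<le> (L * (b - a)) * (b - a)"
  proof (rule integral_bound)
    show "continuous_on {a..b} (\<lambda>s. f s - f b)" using fc ab by (intro continuous_intros) (auto intro: continuous_on_subset)
    fix s assume s: "s \<in> {a..b}"
    then have "\<bar>f s - f b\<bar> \<le> L * \<bar>s - b\<bar>" using ab by (intro lip) auto
    also have "\<dots> \<le> L * (b - a)" using s L by (intro mult_left_mono) auto
    finally show "norm (f s - f b) \<le> L * (b - a)" by simp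
  qed (rule ab(2))
  also have "integral {a..b} (\<lambda>s. f s - f b) = integral {a..b} f - (b - a) * f b"
    using int[OF fc ab(1,3)] ab by (subst Henstock_Kurzweil_Integration.integral_diff) auto
  finally show "\<bar>p b - p a + (b - a) * f b\<bar> \<le> L * (b - a)\<^sup>2" using 1 by (simp add: power2_eq_square abs_minus_commute)
qed

context convex_dom begin

lemma ip_diff:
  assumes "sqi LD v" "sqi LD w" "sqi LD z" shows "ip D (\<lambda>x. v x - w x) z = ip D v z - ip D w z"
  using ip_lin[OF assms, of 1 "-1"] by simp

lemma ip_grad_le:
  assumes "v \<in> H_set D 1" "w \<in> H_set D 1" shows "\<bar>ip_grad D v w\<bar> \<le> real CARD('d) * hn 1 v * hn 1 w"
proof -
  have "\<bar>ip_grad D v w\<bar> \<le> (\<Sum>j\<in>UNIV. \<bar>ip D (pd j v) (pd j w)\<bar>)" unfolding ip_grad_def by (rule sum_abs)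
  also have "\<dots> \<le> (\<Sum>j\<in>(UNIV::'d set). hn 1 v * hn 1 w)"
  proof (rule sum_mono)
    fix j
    have "\<bar>ip D (pd j v) (pd j w)\<bar> \<le> l2n LD (pd j v) * l2n LD (pd j w)" by (intro ip_le H1_D(3) assms)
    also have "\<dots> \<le> hn 1 v * hn 1 w" using pd_le_hn[of 1 j v] pd_le_hn[of 1 j w] by (intro mult_mono) auto
    finally show "\<bar>ip D (pd j v) (pd j w)\<bar> \<le> hn 1 v * hn 1 w" .
  qed
  finally show ?thesis by simp
qed

lemma pd_diff_l2n:
  assumes "v \<in> H_set D 1" "w \<in> H_set D 1"
  shows "l2n LD (\<lambda>x. pd j v x - pd j w x) = l2n LD (pd j (\<lambda>x. v x - w x))"
  using H1_diff(2)[OF assms, of j]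
  by (intro l2n_cong_AE sqiD(1) sqi_diff H1_D(3) assms H1_diff(1)) (auto elim: eventually_mono)

lemma ip_grad_diff:
  assumes "v \<in> H_set D 1" "w \<in> H_set D 1" "z \<in> H_set D 1"
  shows "ip_grad D (\<lambda>x. v x - w x) z = ip_grad D v z - ip_grad D w z"
  using ip_grad_lin[OF assms, of 1 "-1"] by simp

end

section \<open>Difference estimates for the nonlinear form\<close>

context convex_dom3 begin

definition form :: "real \<Rightarrow> real \<Rightarrow> real \<Rightarrow> real \<Rightarrow> (real^'d \<Rightarrow> real^3) \<Rightarrow> (real^'d \<Rightarrow> real^3) \<Rightarrow> (real^'d \<Rightarrow> real^3) \<Rightarrow> real" where
  "form \<kappa>1 \<gamma> \<kappa>2 \<mu> U R \<phi> = \<kappa>1 * ip_grad D R \<phi> + \<gamma> * ip_cross_grad D U R \<phi> + \<kappa>2 * ip D R \<phi>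
     + \<kappa>2 * \<mu> * ip D (\<lambda>x. (norm (U x))\<^sup>2 *\<^sub>R R x) \<phi>"

lemma sqi_quadratic:
  assumes v: "v \<in> H_set D 1" and w: "w \<in> H_set D 1"
  shows "sqi LD (\<lambda>x. v x \<bullet> w x)" "l2n LD (\<lambda>x. v x \<bullet> w x) \<le> sobC * hn 1 v * hn 1 w"
proof -
  note p = sqi_product[OF sobolev_L4(1)[OF v] sobolev_L4(1)[OF w], of "\<lambda>x. v x \<bullet> w x"]
  have m: "(\<lambda>x. v x \<bullet> w x) \<in> borel_measurable LD"
    using sqiD(1)[OF H1_D(1)[OF v]] sqiD(1)[OF H1_D(1)[OF w]] by (rule borel_measurable_inner)
  have cs: "AE x in LD. norm (v x \<bullet> w x) \<le> norm (v x) * norm (w x)" by (simp add: Cauchy_Schwarz_ineq2)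
  show "sqi LD (\<lambda>x. v x \<bullet> w x)" by (rule p(1)[OF m cs])
  have "l2n LD (\<lambda>x. v x \<bullet> w x) \<le> sqrt (l2n LD (\<lambda>x. (norm (v x))\<^sup>2) * l2n LD (\<lambda>x. (norm (w x))\<^sup>2))" by (rule p(2)[OF m cs])
  also have "\<dots> \<le> sqrt ((sobC * hn 1 v * hn 1 w)\<^sup>2)"
  proof (rule real_sqrt_le_mono)
    have "l2n LD (\<lambda>x. (norm (v x))\<^sup>2) * l2n LD (\<lambda>x. (norm (w x))\<^sup>2) \<le> (sobC * (hn 1 v)\<^sup>2) * (sobC * (hn 1 w)\<^sup>2)"
      using sobolev_L4(2)[OF v] sobolev_L4(2)[OF w] sobC_nonneg by (intro mult_mono) auto
    then show "l2n LD (\<lambda>x. (norm (v x))\<^sup>2) * l2n LD (\<lambda>x. (norm (w x))\<^sup>2) \<le> (sobC * hn 1 v * hn 1 w)\<^sup>2"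
      by (simp add: power2_eq_square mult_ac)
  qed
  also have "\<dots> = sobC * hn 1 v * hn 1 w" using sobC_nonneg by simp
  finally show "l2n LD (\<lambda>x. v x \<bullet> w x) \<le> sobC * hn 1 v * hn 1 w" .
qed

lemma sqi_norm_sq: "v \<in> H_set D 1 \<Longrightarrow> sqi LD (\<lambda>x. (norm (v x))\<^sup>2)"
  using sqi_quadratic(1)[of v v] by (simp add: power2_norm_eq_inner)

lemma cubic_integrable:
  assumes "U \<in> H_set D 1" "R \<in> H_set D 1" "\<phi> \<in> H_set D 1"
  shows "integrable LD (\<lambda>x. ((norm (U x))\<^sup>2 *\<^sub>R R x) \<bullet> \<phi> x)"
  using sqi_inner_integrable[OF sqi_norm_sq[OF assms(1)] sqi_quadratic(1)[OF assms(2,3)]] by simp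

text \<open>Based on |U|^2 R - |z|^2 z = ((U - z) . (U + z)) R + |z|^2 (R - z). The first part is a
  product of two scalar products in L^2, the second uses the sup bound of z.\<close>

lemma cubic_difference:
  assumes U: "U \<in> H_set D 1" and R: "R \<in> H_set D 1" and z: "z \<in> H_set D 1" and \<theta>: "\<theta> \<in> H_set D 1"
    and M: "AE x in LD. norm (z x) \<le> M" "M \<ge> 0"
  shows "\<bar>ip D (\<lambda>x. (norm (U x))\<^sup>2 *\<^sub>R R x) \<theta> - ip D (\<lambda>x. (norm (z x))\<^sup>2 *\<^sub>R z x) \<theta>\<bar>
    \<le> (sobC\<^sup>2 * hn 1 (\<lambda>x. U x - z x) * hn 1 (\<lambda>x. U x + z x) * hn 1 R + M\<^sup>2 * hn 1 (\<lambda>x. R x - z x)) * hn 1 \<theta>"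
proof -
  let ?p = "\<lambda>x. U x - z x" and ?q = "\<lambda>x. U x + z x" and ?e = "\<lambda>x. R x - z x"
  have pH: "?p \<in> H_set D 1" and qH: "?q \<in> H_set D 1" and eH: "?e \<in> H_set D 1"
    using H1_diff(1)[OF U z] H1_add(1)[OF U z] H1_diff(1)[OF R z] by auto
  note sp = sqi_quadratic[OF pH qH] and sR = sqi_quadratic[OF R \<theta>] and se = sqi_quadratic(1)[OF eH \<theta>]
  have i1: "integrable LD (\<lambda>x. (?p x \<bullet> ?q x) * (R x \<bullet> \<theta> x))" using sqi_inner_integrable[OF sp(1) sR(1)] by simp
  have i2: "integrable LD (\<lambda>x. (norm (z x))\<^sup>2 * (?e x \<bullet> \<theta> x))" using sqi_inner_integrable[OF sqi_norm_sq[OF z] se] by simp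
  have "ip D (\<lambda>x. (norm (U x))\<^sup>2 *\<^sub>R R x) \<theta> - ip D (\<lambda>x. (norm (z x))\<^sup>2 *\<^sub>R z x) \<theta>
      = (\<integral>x. ((norm (U x))\<^sup>2 *\<^sub>R R x) \<bullet> \<theta> x - ((norm (z x))\<^sup>2 *\<^sub>R z x) \<bullet> \<theta> x \<partial>LD)"
    unfolding ip_def by (rule Bochner_Integration.integral_diff[symmetric]) (intro cubic_integrable assms)+
  also have "\<dots> = (\<integral>x. (?p x \<bullet> ?q x) * (R x \<bullet> \<theta> x) + (norm (z x))\<^sup>2 * (?e x \<bullet> \<theta> x) \<partial>LD)"
    by (intro Bochner_Integration.integral_cong refl)
       (simp add: power2_norm_eq_inner algebra_simps inner_commute)
  also have "\<dots> = (\<integral>x. (?p x \<bullet> ?q x) * (R x \<bullet> \<theta> x) \<partial>LD) + (\<integral>x. (norm (z x))\<^sup>2 * (?e x \<bullet> \<theta> x) \<partial>LD)"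
    by (rule Bochner_Integration.integral_add[OF i1 i2])
  finally have eq: "ip D (\<lambda>x. (norm (U x))\<^sup>2 *\<^sub>R R x) \<theta> - ip D (\<lambda>x. (norm (z x))\<^sup>2 *\<^sub>R z x) \<theta>
     = (\<integral>x. (?p x \<bullet> ?q x) * (R x \<bullet> \<theta> x) \<partial>LD) + (\<integral>x. (norm (z x))\<^sup>2 * (?e x \<bullet> \<theta> x) \<partial>LD)" .
  have b1: "\<bar>\<integral>x. (?p x \<bullet> ?q x) * (R x \<bullet> \<theta> x) \<partial>LD\<bar> \<le> sobC\<^sup>2 * hn 1 ?p * hn 1 ?q * hn 1 R * hn 1 \<theta>"
  proof -
    have "\<bar>\<integral>x. (?p x \<bullet> ?q x) * (R x \<bullet> \<theta> x) \<partial>LD\<bar> \<le> l2n LD (\<lambda>x. ?p x \<bullet> ?q x) * l2n LD (\<lambda>x. R x \<bullet> \<theta> x)"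
      using l2n_inner_le[OF sp(1) sR(1)] by simp
    also have "\<dots> \<le> (sobC * hn 1 ?p * hn 1 ?q) * (sobC * hn 1 R * hn 1 \<theta>)"
      using sp(2) sR(2) sobC_nonneg by (intro mult_mono) auto
    finally show ?thesis by (simp add: power2_eq_square mult_ac)
  qed
  have b2: "\<bar>\<integral>x. (norm (z x))\<^sup>2 * (?e x \<bullet> \<theta> x) \<partial>LD\<bar> \<le> M\<^sup>2 * hn 1 ?e * hn 1 \<theta>"
  proof -
    have e2: "sqi LD ?e" and t2: "sqi LD \<theta>" using H1_D(1) eH \<theta> by auto
    have "norm (\<integral>x. (norm (z x))\<^sup>2 * (?e x \<bullet> \<theta> x) \<partial>LD) \<le> (\<integral>x. norm ((norm (z x))\<^sup>2 * (?e x \<bullet> \<theta> x)) \<partial>LD)"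
      by (rule integral_norm_bound)
    also have "\<dots> \<le> (\<integral>x. M\<^sup>2 * (norm (?e x) * norm (\<theta> x)) \<partial>LD)"
    proof (rule integral_mono_AE[OF integrable_norm[OF i2] integrable_mult_right[OF sqi_mult_integrable[OF e2 t2]]])
      show "AE x in LD. norm ((norm (z x))\<^sup>2 * (?e x \<bullet> \<theta> x)) \<le> M\<^sup>2 * (norm (?e x) * norm (\<theta> x))"
        using M(1)
      proof eventually_elim
        case (elim x)
        then have "(norm (z x))\<^sup>2 \<le> M\<^sup>2" by (intro power_mono) auto
        then have "(norm (z x))\<^sup>2 * \<bar>?e x \<bullet> \<theta> x\<bar> \<le> M\<^sup>2 * (norm (?e x) * norm (\<theta> x))"
          by (intro mult_mono Cauchy_Schwarz_ineq2) auto
        then show ?case by (simp add: abs_mult)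
      qed
    qed
    also have "\<dots> \<le> M\<^sup>2 * (l2n LD ?e * l2n LD \<theta>)" using l2n_Cauchy_Schwarz[OF e2 t2] by (simp add: mult_left_mono)
    also have "\<dots> \<le> M\<^sup>2 * (hn 1 ?e * hn 1 \<theta>)" by (intro mult_left_mono mult_mono l2n_le_hn) auto
    finally show ?thesis by simp
  qed
  show ?thesis unfolding eq using b1 b2 by (simp add: algebra_simps)
qed

lemma cross_sqi:
  assumes U: "U \<in> H_set D 1" and g: "sqi LD g" "sqi LD (\<lambda>x. (norm (g x))\<^sup>2)" "l2n LD (\<lambda>x. (norm (g x))\<^sup>2) \<le> Q"
  shows "sqi LD (\<lambda>x. cross3 (U x) (g x))" "l2n LD (\<lambda>x. cross3 (U x) (g x)) \<le> sqrt (sobC * Q) * hn 1 U"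
proof -
  have m: "(\<lambda>x. cross3 (U x) (g x)) \<in> borel_measurable LD"
    using sqiD(1)[OF H1_D(1)[OF U]] sqiD(1)[OF g(1)] by (rule borel_measurable_cross3)
  note p = sqi_product[OF sobolev_L4(1)[OF U] g(2) m AE_I2[OF norm_cross_le]]
  show "sqi LD (\<lambda>x. cross3 (U x) (g x))" by (rule p(1))
  have "l2n LD (\<lambda>x. (norm (U x))\<^sup>2) * l2n LD (\<lambda>x. (norm (g x))\<^sup>2) \<le> sobC * (hn 1 U)\<^sup>2 * Q"
    using sobolev_L4(2)[OF U] g(3) sobC_nonneg by (intro mult_mono) auto
  then have "sqrt (l2n LD (\<lambda>x. (norm (U x))\<^sup>2) * l2n LD (\<lambda>x. (norm (g x))\<^sup>2)) \<le> sqrt (sobC * Q * (hn 1 U)\<^sup>2)"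
    by (simp add: mult_ac)
  also have "\<dots> = sqrt (sobC * Q) * hn 1 U" by (simp add: real_sqrt_mult)
  finally show "l2n LD (\<lambda>x. cross3 (U x) (g x)) \<le> sqrt (sobC * Q) * hn 1 U" using p(2) by linarith
qed

lemma cross_bounded_sqi:
  assumes z: "z \<in> borel_measurable LD" "AE x in LD. norm (z x) \<le> M" "M \<ge> 0" and g: "sqi LD g"
  shows "sqi LD (\<lambda>x. cross3 (z x) (g x))" "l2n LD (\<lambda>x. cross3 (z x) (g x)) \<le> M * l2n LD g"
proof -
  have m: "(\<lambda>x. cross3 (z x) (g x)) \<in> borel_measurable LD" using z(1) sqiD(1)[OF g] by (rule borel_measurable_cross3)
  have ae: "AE x in LD. norm (cross3 (z x) (g x)) \<le> norm (M *\<^sub>R g x)"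
    using z(2)
  proof eventually_elim
    case (elim x)
    then have "norm (z x) * norm (g x) \<le> M * norm (g x)" by (rule mult_right_mono) simp
    then show ?case using norm_cross_le[of "z x" "g x"] z(3) by simp
  qed
  show "sqi LD (\<lambda>x. cross3 (z x) (g x))" by (rule sqi_bound[OF sqi_scaleR[OF g] m ae])
  show "l2n LD (\<lambda>x. cross3 (z x) (g x)) \<le> M * l2n LD g"
    using l2n_mono[OF sqi_scaleR[OF g] m ae] z(3) by (simp add: l2n_scaleR)
qed

text \<open>With p for a partial derivative, U x pR - z x pz = (U - z) x pR + z x (pR - pz). The L^4
  bound is used on the gradient of R, the sup bound on the exact value z.\<close>

lemma cross_difference:
  assumes U: "U \<in> H_set D 1" and R: "R \<in> H_set D 1" and z: "z \<in> H_set D 1" and \<theta>: "\<theta> \<in> H_set D 1"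
    and M: "AE x in LD. norm (z x) \<le> M" "M \<ge> 0"
    and Q: "\<And>j. sqi LD (\<lambda>x. (norm (pd j R x))\<^sup>2)" "\<And>j. l2n LD (\<lambda>x. (norm (pd j R x))\<^sup>2) \<le> Q"
  shows "\<bar>ip_cross_grad D U R \<theta> - ip_cross_grad D z z \<theta>\<bar>
    \<le> real CARD('d) * (sqrt (sobC * Q) * hn 1 (\<lambda>x. U x - z x) + M * hn 1 (\<lambda>x. R x - z x)) * hn 1 \<theta>"
proof -
  let ?p = "\<lambda>x. U x - z x" and ?e = "\<lambda>x. R x - z x"
  let ?B = "sqrt (sobC * Q) * hn 1 ?p + M * hn 1 ?e"
  have pH: "?p \<in> H_set D 1" using H1_diff(1)[OF U z] by auto
  have Q0: "Q \<ge> 0" using Q(2) l2n_nonneg order_trans by blast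
  have j: "\<bar>ip D (\<lambda>x. cross3 (U x) (pd j R x)) (pd j \<theta>) - ip D (\<lambda>x. cross3 (z x) (pd j z x)) (pd j \<theta>)\<bar> \<le> ?B * hn 1 \<theta>" for j
  proof -
    let ?d = "\<lambda>x. pd j R x - pd j z x"
    note sd = sqi_diff[OF H1_D(3)[OF R] H1_D(3)[OF z], of j j]
    note s1 = cross_sqi[OF pH H1_D(3)[OF R] Q] and s2 = cross_bounded_sqi[OF sqiD(1)[OF H1_D(1)[OF z]] M sd]
    note s3 = cross_sqi(1)[OF U H1_D(3)[OF R] Q] and s4 = cross_bounded_sqi(1)[OF sqiD(1)[OF H1_D(1)[OF z]] M H1_D(3)[OF z]]
    note st = H1_D(3)[OF \<theta>, of j]
    let ?F = "\<lambda>x. cross3 (?p x) (pd j R x) + cross3 (z x) (?d x)"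
    have "ip D (\<lambda>x. cross3 (U x) (pd j R x)) (pd j \<theta>) - ip D (\<lambda>x. cross3 (z x) (pd j z x)) (pd j \<theta>)
       = ip D (\<lambda>x. cross3 (U x) (pd j R x) - cross3 (z x) (pd j z x)) (pd j \<theta>)"
      by (rule ip_diff[OF s3 s4 st, symmetric])
    also have "(\<lambda>x. cross3 (U x) (pd j R x) - cross3 (z x) (pd j z x)) = ?F"
      by (rule ext) (simp add: left_diff_distrib cross_minus_left cross_add_left Cross3.left_diff_distrib Cross3.right_diff_distrib)
    finally have "ip D (\<lambda>x. cross3 (U x) (pd j R x)) (pd j \<theta>) - ip D (\<lambda>x. cross3 (z x) (pd j z x)) (pd j \<theta>) = ip D ?F (pd j \<theta>)" .
    moreover have "\<bar>ip D ?F (pd j \<theta>)\<bar> \<le> l2n LD ?F * l2n LD (pd j \<theta>)" by (rule ip_le[OF sqi_add[OF s1(1) s2(1)] st])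
    moreover have "l2n LD ?F * l2n LD (pd j \<theta>) \<le> ?B * hn 1 \<theta>"
    proof (rule mult_mono)
      have "l2n LD ?F \<le> l2n LD (\<lambda>x. cross3 (?p x) (pd j R x)) + l2n LD (\<lambda>x. cross3 (z x) (?d x))"
        by (rule l2n_triangle[OF s1(1) s2(1)])
      also have "l2n LD (\<lambda>x. cross3 (z x) (?d x)) \<le> M * hn 1 ?e"
      proof (rule order_trans[OF s2(2)])
        have "l2n LD ?d \<le> hn 1 ?e" using pd_le_hn[of 1 j ?e] pd_diff_l2n[OF R z, of j] by simp
        then show "M * l2n LD ?d \<le> M * hn 1 ?e" using M(2) by (rule mult_left_mono)
      qed
      finally show "l2n LD ?F \<le> ?B" using s1(2)[of j] by linarith
      show "l2n LD (pd j \<theta>) \<le> hn 1 \<theta>" using pd_le_hn[of 1 j \<theta>] by simp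
      show "0 \<le> ?B" using Q0 sobC_nonneg M(2) by simp
    qed simp
    ultimately show ?thesis by linarith
  qed
  have "\<bar>ip_cross_grad D U R \<theta> - ip_cross_grad D z z \<theta>\<bar>
     \<le> (\<Sum>j\<in>UNIV. \<bar>ip D (\<lambda>x. cross3 (U x) (pd j R x)) (pd j \<theta>) - ip D (\<lambda>x. cross3 (z x) (pd j z x)) (pd j \<theta>)\<bar>)"
    unfolding ip_cross_grad_def sum_subtractf[symmetric] by (rule sum_abs)
  also have "\<dots> \<le> (\<Sum>j\<in>(UNIV::'d set). ?B * hn 1 \<theta>)" by (rule sum_mono) (rule j)
  finally show ?thesis by (simp add: mult.assoc)
qed

text \<open>M bounds z in the sup norm, Q bounds the squared gradient of R in L^2, and A bounds U +
  z and R in H^1.\<close>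

definition formC :: "real \<Rightarrow> real \<Rightarrow> real \<Rightarrow> real \<Rightarrow> real \<Rightarrow> real \<Rightarrow> real \<Rightarrow> real" where
  "formC \<kappa>1 \<gamma> \<kappa>2 \<mu> M Q A = (\<kappa>1 * real CARD('d) + \<kappa>2) + \<bar>\<gamma>\<bar> * real CARD('d) * (sqrt (sobC * Q) + M)
     + \<kappa>2 * \<mu> * (sobC\<^sup>2 * A\<^sup>2 + M\<^sup>2)"

lemma formC_nonneg: "\<kappa>1 \<ge> 0 \<Longrightarrow> \<kappa>2 \<ge> 0 \<Longrightarrow> \<mu> \<ge> 0 \<Longrightarrow> M \<ge> 0 \<Longrightarrow> Q \<ge> 0 \<Longrightarrow> formC \<kappa>1 \<gamma> \<kappa>2 \<mu> M Q A \<ge> 0"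
  unfolding formC_def using sobC_nonneg by (intro add_nonneg_nonneg mult_nonneg_nonneg) auto

lemma form_difference:
  assumes U: "U \<in> H_set D 1" and R: "R \<in> H_set D 1" and z: "z \<in> H_set D 1" and \<theta>: "\<theta> \<in> H_set D 1"
    and M: "AE x in LD. norm (z x) \<le> M" "M \<ge> 0"
    and Q: "\<And>j. sqi LD (\<lambda>x. (norm (pd j R x))\<^sup>2)" "\<And>j. l2n LD (\<lambda>x. (norm (pd j R x))\<^sup>2) \<le> Q"
    and A: "hn 1 (\<lambda>x. U x + z x) \<le> A" "hn 1 R \<le> A"
    and k: "\<kappa>1 \<ge> 0" "\<kappa>2 \<ge> 0" "\<mu> \<ge> 0"
  shows "\<bar>form \<kappa>1 \<gamma> \<kappa>2 \<mu> U R \<theta> - form \<kappa>1 \<gamma> \<kappa>2 \<mu> z z \<theta>\<bar>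
    \<le> formC \<kappa>1 \<gamma> \<kappa>2 \<mu> M Q A * (hn 1 (\<lambda>x. U x - z x) + hn 1 (\<lambda>x. R x - z x)) * hn 1 \<theta>"
proof -
  define p e t where "p = hn 1 (\<lambda>x. U x - z x)" "e = hn 1 (\<lambda>x. R x - z x)" "t = hn 1 \<theta>"
  have n: "p \<ge> 0" "e \<ge> 0" "t \<ge> 0" by (auto simp: p_e_t_def)
  have Q0: "Q \<ge> 0" using Q(2) l2n_nonneg order_trans by blast
  let ?d = "real CARD('d)" let ?S = "sqrt (sobC * Q)"
  have S: "?S \<ge> 0" using Q0 sobC_nonneg by simp
  have eH: "(\<lambda>x. R x - z x) \<in> H_set D 1" using H1_diff(1)[OF R z] .
  have 1: "\<bar>ip_grad D R \<theta> - ip_grad D z \<theta>\<bar> \<le> ?d * (p + e) * t"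
  proof -
    have "\<bar>ip_grad D R \<theta> - ip_grad D z \<theta>\<bar> \<le> ?d * e * t"
      using ip_grad_le[OF eH \<theta>] ip_grad_diff[OF R z \<theta>] by (simp add: p_e_t_def)
    also have "\<dots> \<le> ?d * (p + e) * t" using n by (intro mult_right_mono mult_left_mono) auto
    finally show ?thesis .
  qed
  have 2: "\<bar>ip D R \<theta> - ip D z \<theta>\<bar> \<le> (p + e) * t"
  proof -
    have "\<bar>ip D R \<theta> - ip D z \<theta>\<bar> \<le> l2n LD (\<lambda>x. R x - z x) * l2n LD \<theta>"
      using ip_le[OF H1_D(1)[OF eH] H1_D(1)[OF \<theta>]] ip_diff[OF H1_D(1)[OF R] H1_D(1)[OF z] H1_D(1)[OF \<theta>]] by simp
    also have "\<dots> \<le> e * t" unfolding p_e_t_def by (intro mult_mono l2n_le_hn) auto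
    also have "\<dots> \<le> (p + e) * t" using n by (intro mult_right_mono) auto
    finally show ?thesis .
  qed
  have 3: "\<bar>ip_cross_grad D U R \<theta> - ip_cross_grad D z z \<theta>\<bar> \<le> ?d * (?S + M) * (p + e) * t"
  proof -
    have "?S * p + M * e \<le> (?S + M) * (p + e)" using S M(2) n by (simp add: algebra_simps)
    then have "?d * (?S * p + M * e) * t \<le> ?d * ((?S + M) * (p + e)) * t" using n by (intro mult_right_mono mult_left_mono) auto
    then have "?d * (?S * p + M * e) * t \<le> ?d * (?S + M) * (p + e) * t" by (simp only: mult.assoc)
    then show ?thesis using cross_difference[OF U R z \<theta> M Q] unfolding p_e_t_def by linarith
  qed
  have 4: "\<bar>ip D (\<lambda>x. (norm (U x))\<^sup>2 *\<^sub>R R x) \<theta> - ip D (\<lambda>x. (norm (z x))\<^sup>2 *\<^sub>R z x) \<theta>\<bar> \<le> (sobC\<^sup>2 * A\<^sup>2 + M\<^sup>2) * (p + e) * t"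
  proof -
    have "sobC\<^sup>2 * p * hn 1 (\<lambda>x. U x + z x) * hn 1 R \<le> sobC\<^sup>2 * p * A * A"
      using n A order_trans[OF hn_nonneg A(2)] by (intro mult_mono) auto
    then have "sobC\<^sup>2 * p * hn 1 (\<lambda>x. U x + z x) * hn 1 R + M\<^sup>2 * e \<le> sobC\<^sup>2 * A\<^sup>2 * p + M\<^sup>2 * e"
      by (simp add: power2_eq_square mult_ac)
    also have "\<dots> \<le> (sobC\<^sup>2 * A\<^sup>2 + M\<^sup>2) * (p + e)" using n by (simp add: algebra_simps)
    finally have "(sobC\<^sup>2 * p * hn 1 (\<lambda>x. U x + z x) * hn 1 R + M\<^sup>2 * e) * t \<le> (sobC\<^sup>2 * A\<^sup>2 + M\<^sup>2) * (p + e) * t"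
      using n(3) by (rule mult_right_mono)
    then show ?thesis using cubic_difference[OF U R z \<theta> M] by (simp add: p_e_t_def)
  qed
  have "\<bar>form \<kappa>1 \<gamma> \<kappa>2 \<mu> U R \<theta> - form \<kappa>1 \<gamma> \<kappa>2 \<mu> z z \<theta>\<bar>
     = \<bar>\<kappa>1 * (ip_grad D R \<theta> - ip_grad D z \<theta>) + \<gamma> * (ip_cross_grad D U R \<theta> - ip_cross_grad D z z \<theta>)
       + \<kappa>2 * (ip D R \<theta> - ip D z \<theta>) + \<kappa>2 * \<mu> * (ip D (\<lambda>x. (norm (U x))\<^sup>2 *\<^sub>R R x) \<theta> - ip D (\<lambda>x. (norm (z x))\<^sup>2 *\<^sub>R z x) \<theta>)\<bar>"
    unfolding form_def by (simp add: algebra_simps)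
  also have "\<dots> \<le> \<kappa>1 * \<bar>ip_grad D R \<theta> - ip_grad D z \<theta>\<bar> + \<bar>\<gamma>\<bar> * \<bar>ip_cross_grad D U R \<theta> - ip_cross_grad D z z \<theta>\<bar>
       + \<kappa>2 * \<bar>ip D R \<theta> - ip D z \<theta>\<bar> + \<kappa>2 * \<mu> * \<bar>ip D (\<lambda>x. (norm (U x))\<^sup>2 *\<^sub>R R x) \<theta> - ip D (\<lambda>x. (norm (z x))\<^sup>2 *\<^sub>R z x) \<theta>\<bar>"
    using k by (intro order_trans[OF abs_triangle_ineq] add_mono) (auto simp: abs_mult)
  also have "\<dots> \<le> \<kappa>1 * (?d * (p + e) * t) + \<bar>\<gamma>\<bar> * (?d * (?S + M) * (p + e) * t) + \<kappa>2 * ((p + e) * t)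
       + \<kappa>2 * \<mu> * ((sobC\<^sup>2 * A\<^sup>2 + M\<^sup>2) * (p + e) * t)"
    using k by (intro add_mono mult_left_mono 1 2 3 4) auto
  also have "\<dots> = formC \<kappa>1 \<gamma> \<kappa>2 \<mu> M Q A * (p + e) * t" unfolding formC_def by (simp add: algebra_simps)
  finally show ?thesis by (simp add: p_e_t_def)
qed

text \<open>Linearity in R is not automatic, since a non-integrable integrand has integral 0. The
  L^4 hypotheses on the gradients make the cross products square integrable, so that the integrals
  may be separated.\<close>

lemma form_diff_middle:
  assumes U: "U \<in> H_set D 1" and R: "R1 \<in> H_set D 1" "R2 \<in> H_set D 1" and \<phi>: "\<phi> \<in> H_set D 1"
    and Q: "\<And>j. sqi LD (\<lambda>x. (norm (pd j R1 x))\<^sup>2)" "\<And>j. sqi LD (\<lambda>x. (norm (pd j R2 x))\<^sup>2)"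
  shows "form \<kappa>1 \<gamma> \<kappa>2 \<mu> U (\<lambda>x. R1 x - R2 x) \<phi> = form \<kappa>1 \<gamma> \<kappa>2 \<mu> U R1 \<phi> - form \<kappa>1 \<gamma> \<kappa>2 \<mu> U R2 \<phi>"
proof -
  have H: "(\<lambda>x. R1 x - R2 x) \<in> H_set D 1" by (rule H1_diff(1)[OF R])
  have "ip D (\<lambda>x. cross3 (U x) (pd j (\<lambda>x. R1 x - R2 x) x)) (pd j \<phi>)
     = ip D (\<lambda>x. cross3 (U x) (pd j R1 x)) (pd j \<phi>) - ip D (\<lambda>x. cross3 (U x) (pd j R2 x)) (pd j \<phi>)" for j
  proof -
    note s = cross_sqi(1)[OF U H1_D(3)[OF R(1)] Q(1) order_refl, of j] cross_sqi(1)[OF U H1_D(3)[OF R(2)] Q(2) order_refl, of j]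
    have ae: "AE x in LD. cross3 (U x) (pd j R1 x) - cross3 (U x) (pd j R2 x) = cross3 (U x) (pd j (\<lambda>x. R1 x - R2 x) x)"
      using H1_diff(2)[OF R, of j] by eventually_elim (simp add: Cross3.right_diff_distrib)
    have m: "(\<lambda>x. cross3 (U x) (pd j (\<lambda>x. R1 x - R2 x) x)) \<in> borel_measurable LD"
      by (intro borel_measurable_cross3 sqiD(1) H1_D(1) H1_D(3) U H)
    have s3: "sqi LD (\<lambda>x. cross3 (U x) (pd j (\<lambda>x. R1 x - R2 x) x))" by (rule sqi_cong_AE[OF sqi_diff[OF s] m ae])
    show ?thesis
      using ip_cong_AE[OF sqi_diff[OF s] s3 H1_D(3)[OF \<phi>] ae] ip_diff[OF s H1_D(3)[OF \<phi>]] by simp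
  qed
  then have 1: "ip_cross_grad D U (\<lambda>x. R1 x - R2 x) \<phi> = ip_cross_grad D U R1 \<phi> - ip_cross_grad D U R2 \<phi>"
    unfolding ip_cross_grad_def by (simp add: sum_subtractf)
  have 2: "ip D (\<lambda>x. (norm (U x))\<^sup>2 *\<^sub>R (R1 x - R2 x)) \<phi> = ip D (\<lambda>x. (norm (U x))\<^sup>2 *\<^sub>R R1 x) \<phi> - ip D (\<lambda>x. (norm (U x))\<^sup>2 *\<^sub>R R2 x) \<phi>"
    unfolding ip_def
    by (subst Bochner_Integration.integral_diff[symmetric, OF cubic_integrable[OF U R(1) \<phi>] cubic_integrable[OF U R(2) \<phi>]])
       (simp add: scaleR_diff_right inner_diff_left)
  show ?thesis unfolding form_def 1 2 ip_grad_diff[OF R \<phi>] ip_diff[OF H1_D(1)[OF R(1)] H1_D(1)[OF R(2)] H1_D(1)[OF \<phi>]]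
    by (simp add: algebra_simps)
qed

lemma form_nonneg:
  assumes k: "\<kappa>1 \<ge> 0" "\<kappa>2 \<ge> 0" "\<mu> \<ge> 0"
  shows "form \<kappa>1 \<gamma> \<kappa>2 \<mu> U R R \<ge> 0"
proof -
  have "ip_cross_grad D U R R = 0" unfolding ip_cross_grad_def ip_def by (simp add: dot_cross_self)
  moreover have "ip_grad D R R \<ge> 0" unfolding ip_grad_def ip_def by (intro sum_nonneg integral_nonneg_AE) auto
  moreover have "ip D R R \<ge> 0" "ip D (\<lambda>x. (norm (U x))\<^sup>2 *\<^sub>R R x) R \<ge> 0" unfolding ip_def by (auto intro!: integral_nonneg_AE)
  ultimately show ?thesis unfolding form_def using k by simp
qed

text \<open>With the coefficients 0, 0, 1 only the reaction terms of \<open>form\<close> remain, so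
  their continuity in time is a case of the general estimate.\<close>

lemma ip_cubic_split:
  assumes "w \<in> H_set D 1" "\<phi> \<in> H_set D 1"
  shows "ip D (\<lambda>x. (1 + \<mu> * (norm (w x))\<^sup>2) *\<^sub>R w x) \<phi> = form 0 0 1 \<mu> w w \<phi>"
proof -
  have "(\<integral>x. w x \<bullet> \<phi> x + \<mu> * (((norm (w x))\<^sup>2 *\<^sub>R w x) \<bullet> \<phi> x) \<partial>LD)
     = (\<integral>x. w x \<bullet> \<phi> x \<partial>LD) + \<mu> * (\<integral>x. ((norm (w x))\<^sup>2 *\<^sub>R w x) \<bullet> \<phi> x \<partial>LD)"
    using sqi_inner_integrable[OF H1_D(1) H1_D(1), OF assms] cubic_integrable[OF assms(1,1,2)]
    by (subst Bochner_Integration.integral_add) (auto intro!: integrable_mult_right)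
  then show ?thesis by (simp add: form_def ip_def algebra_simps inner_add_left)
qed

end

section \<open>The error analysis\<close>

text \<open>The sum e j + H satisfies a homogeneous recursion with factor 1 + K k. The increment
  contains the old value only, so no term has to be absorbed on the left and k stays
  arbitrary.\<close>

lemma discrete_gronwall:
  fixes e :: "nat \<Rightarrow> real"
  assumes step: "\<And>j. j < n \<Longrightarrow> e (Suc j) \<le> e j + K * k * (e j + H)"
    and nn: "\<And>j. e j \<ge> 0" "K \<ge> 0" "k \<ge> 0" "H \<ge> 0"
  shows "e n \<le> exp (K * (real n * k)) * (e 0 + H)"
proof -
  have "j \<le> n \<Longrightarrow> e j + H \<le> exp (K * (real j * k)) * (e 0 + H)" for j
  proof (induction j)
    case (Suc j)
    have "e (Suc j) + H \<le> (1 + K * k) * (e j + H)" using step[of j] Suc by (simp add: algebra_simps)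
    also have "\<dots> \<le> exp (K * k) * (e j + H)" using nn by (intro mult_right_mono exp_ge_add_one_self) auto
    also have "\<dots> \<le> exp (K * k) * (exp (K * (real j * k)) * (e 0 + H))" using Suc by (intro mult_left_mono) auto
    also have "\<dots> = exp (K * (real (Suc j) * k)) * (e 0 + H)"
    proof -
      have "exp (K * k) * exp (K * (real j * k)) = exp (K * (real (Suc j) * k))"
        by (simp add: mult_exp_exp algebra_simps)
      then show ?thesis by (simp only: mult.assoc[symmetric])
    qed
    finally show ?case .
  qed simp
  from this[of n] show ?thesis using nn(4) by simp
qed

context convex_dom3 begin

lemma hn1_le_sum: "hn 1 v \<le> l2n LD v + (\<Sum>j\<in>UNIV. l2n LD (pd j v))"
proof (rule power2_le_imp_le)
  let ?f = "\<lambda>j. l2n LD (pd j v)"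
  have "L2_set ?f UNIV \<le> sum ?f UNIV" by (rule L2_set_le_sum) simp
  then have "(L2_set ?f UNIV)\<^sup>2 \<le> (sum ?f UNIV)\<^sup>2" by (rule power_mono) simp
  then have "(\<Sum>j\<in>UNIV. (?f j)\<^sup>2) \<le> (sum ?f UNIV)\<^sup>2" by (simp add: L2_set_def sum_nonneg)
  then have "(hn 1 v)\<^sup>2 \<le> (l2n LD v)\<^sup>2 + (sum ?f UNIV)\<^sup>2" by (simp add: hn_sq hip_self)
  also have "\<dots> \<le> (l2n LD v + sum ?f UNIV)\<^sup>2" by (simp add: power2_sum sum_nonneg)
  finally show "(hn 1 v)\<^sup>2 \<le> (l2n LD v + sum ?f UNIV)\<^sup>2" .
qed (simp add: sum_nonneg)

text \<open>An H^2 function at distance below 1 has d + 1 norms bounded by B.\<close>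

definition zB :: "real \<Rightarrow> real" where "zB B = (1 + real CARD('d)) * B + 1"

lemma H2_limit_H1: "H2_limit B z \<Longrightarrow> z \<in> H_set D 1" by (simp add: H2_limit_def)

lemma H2_limit_hn:
  assumes "H2_limit B z" shows "hn 1 z \<le> zB B" "B \<ge> 0"
proof -
  note zH = H2_limit_H1[OF assms]
  have "\<exists>v. v \<in> H_set D 2 \<and> H_norm D 2 v \<le> B \<and> hn 1 (\<lambda>x. v x - z x) < 1"
    using assms zero_less_one unfolding H2_limit_def by blast
  then obtain v where v: "v \<in> H_set D 2" "H_norm D 2 v \<le> B" "hn 1 (\<lambda>x. v x - z x) < 1" by blast
  note vH = H2_subset_H1[OF v(1)] and h = h2D[OF H2_h2[OF v(1,2)]]
  show "B \<ge> 0" by (rule h(9))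
  have "(\<Sum>j\<in>UNIV. l2n LD (pd j v)) \<le> (\<Sum>j\<in>(UNIV::'d set). B)" by (rule sum_mono) (rule h(5))
  then have "hn 1 v \<le> (1 + real CARD('d)) * B" using hn1_le_sum[of v] h(2) by (simp add: algebra_simps)
  moreover have "hn 1 (\<lambda>x. v x - (v x - z x)) \<le> hn 1 v + hn 1 (\<lambda>x. v x - z x)"
    by (rule hn_triangle_diff[OF _ vH H1_diff(1)[OF vH zH]]) simp
  ultimately show "hn 1 z \<le> zB B" using v(3) by (simp add: zB_def)
qed

definition solM :: "real \<Rightarrow> real" where "solM B = max 0 (sobC_inf * B)"

definition solQ :: "real \<Rightarrow> real" where "solQ B = sobC * ((1 + real CARD('d)) * B\<^sup>2)"

lemma H2_limit_solM:
  assumes "H2_limit B z" shows "AE x in LD. norm (z x) \<le> solM B" "solM B \<ge> 0"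
proof -
  show "AE x in LD. norm (z x) \<le> solM B"
    using H2_limit_bounds(1)[OF assms] by eventually_elim (simp add: solM_def)
qed (simp add: solM_def)

text \<open>With U = R = w the two differences in \<open>form_difference\<close> coincide, hence the
  factor 2.\<close>

lemma form_increment:
  assumes s: "H2_limit B w" "H2_limit B z" and \<phi>: "\<phi> \<in> H_set D 1" and k: "\<kappa>1 \<ge> 0" "\<kappa>2 \<ge> 0" "\<mu> \<ge> 0"
  shows "\<bar>form \<kappa>1 \<gamma> \<kappa>2 \<mu> w w \<phi> - form \<kappa>1 \<gamma> \<kappa>2 \<mu> z z \<phi>\<bar>
    \<le> 2 * formC \<kappa>1 \<gamma> \<kappa>2 \<mu> (solM B) (solQ B) (2 * zB B) * hn 1 (\<lambda>x. w x - z x) * hn 1 \<phi>"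
proof -
  note H = H2_limit_H1[OF s(1)] H2_limit_H1[OF s(2)]
  have b: "hn 1 w \<le> zB B" "hn 1 z \<le> zB B" using H2_limit_hn(1) s by auto
  have A: "hn 1 (\<lambda>x. w x + z x) \<le> 2 * zB B" using hn_triangle[OF _ H, of 1] b by simp
  have A2: "hn 1 w \<le> 2 * zB B" using b(1) hn_nonneg[of 1 w] by linarith
  have "\<bar>form \<kappa>1 \<gamma> \<kappa>2 \<mu> w w \<phi> - form \<kappa>1 \<gamma> \<kappa>2 \<mu> z z \<phi>\<bar>
    \<le> formC \<kappa>1 \<gamma> \<kappa>2 \<mu> (solM B) (solQ B) (2 * zB B) * (hn 1 (\<lambda>x. w x - z x) + hn 1 (\<lambda>x. w x - z x)) * hn 1 \<phi>"
    using H2_limit_bounds(2,3)[OF s(1)]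
    by (intro form_difference[OF H(1,1,2) \<phi> H2_limit_solM[OF s(2)] _ _ A A2 k]) (simp_all add: solQ_def)
  then show ?thesis by simp
qed

text \<open>Along u the form is Lipschitz in time because u is so in H^1. The equation integrates
  its three terms separately; suitable coefficients of \<open>form\<close> give the continuity of
  each of them.\<close>

lemma variational_increment:
  assumes tc: "time_continuous T (H_space D 1) u" and T: "T > 0"
    and lip: "\<And>s t. s \<in> {0..T} \<Longrightarrow> t \<in> {0..T} \<Longrightarrow> hn 1 (\<lambda>x. u t x - u s x) \<le> C * \<bar>t - s\<bar>" "C \<ge> 0"
    and H2: "\<And>t. t \<in> {0..T} \<Longrightarrow> H2_limit B (u t)"
    and e: "0 < e" "e < 1" and k: "\<kappa>1 \<ge> 0" "\<kappa>2 \<ge> 0" "\<mu> \<ge> 0" and \<phi>: "\<phi> \<in> H_set D 1"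
    and eq: "\<And>t. t \<in> {0<..<T} \<Longrightarrow>
        ip D (u t) \<phi> + e * ip_grad D (u t) \<phi>
        + \<kappa>1 * (\<integral>s. ip_grad D (u s) \<phi> \<partial>lebesgue_on {0<..<t})
        + \<gamma> * (\<integral>s. ip_cross_grad D (u s) (u s) \<phi> \<partial>lebesgue_on {0<..<t})
        + \<kappa>2 * (\<integral>s. ip D (\<lambda>x. (1 + \<mu> * (norm (u s x))\<^sup>2) *\<^sub>R u s x) \<phi> \<partial>lebesgue_on {0<..<t}) = q"
  shows "hip e (u 0) \<phi> = q"
    and "\<And>a b. 0 \<le> a \<Longrightarrow> a \<le> b \<Longrightarrow> b \<le> T \<Longrightarrow>
      \<bar>hip e (u b) \<phi> - hip e (u a) \<phi> + (b - a) * form \<kappa>1 \<gamma> \<kappa>2 \<mu> (u b) (u b) \<phi>\<bar>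
        \<le> 2 * formC \<kappa>1 \<gamma> \<kappa>2 \<mu> (solM B) (solQ B) (2 * zB B) * C * (b - a)\<^sup>2 * hn 1 \<phi>"
proof -
  note uH = time_continuousD(1)[OF tc]
  have B0: "B \<ge> 0" using H2_limit_hn(2)[OF H2[of 0]] T by simp
  have Q0: "solQ B \<ge> 0" using sobC_nonneg by (simp add: solQ_def)
  let ?F = "\<lambda>a b c d. formC a b c d (solM B) (solQ B) (2 * zB B)"
  have F0: "?F a b c d \<ge> 0" if "a \<ge> 0" "c \<ge> 0" "d \<ge> 0" for a b c d
    by (intro formC_nonneg that Q0) (simp add: solM_def)
  have flip: "\<bar>form a b c d (u s) (u s) \<phi> - form a b c d (u t) (u t) \<phi>\<bar> \<le> 2 * ?F a b c d * C * hn 1 \<phi> * \<bar>s - t\<bar>"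
    if "a \<ge> 0" "c \<ge> 0" "d \<ge> 0" "s \<in> {0..T}" "t \<in> {0..T}" for a b c d s t
  proof -
    have "\<bar>form a b c d (u s) (u s) \<phi> - form a b c d (u t) (u t) \<phi>\<bar> \<le> 2 * ?F a b c d * hn 1 (\<lambda>x. u s x - u t x) * hn 1 \<phi>"
      by (rule form_increment[OF H2[OF that(4)] H2[OF that(5)] \<phi> that(1-3)])
    also have "\<dots> \<le> 2 * ?F a b c d * (C * \<bar>s - t\<bar>) * hn 1 \<phi>"
      using F0[OF that(1-3)] by (intro mult_right_mono mult_left_mono lip that) auto
    finally show ?thesis by (simp add: mult_ac)
  qed
  have fcont: "continuous_on {0..T} (\<lambda>s. form a b c d (u s) (u s) \<phi>)" if "a \<ge> 0" "c \<ge> 0" "d \<ge> 0" for a b c d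
  proof -
    have "(2 * ?F a b c d * C * hn 1 \<phi>)-lipschitz_on {0..T} (\<lambda>s. form a b c d (u s) (u s) \<phi>)"
    proof (rule lipschitz_onI)
      show "0 \<le> 2 * ?F a b c d * C * hn 1 \<phi>" using F0[OF that] lip(2) by simp
      fix s t assume "s \<in> {0..T}" "t \<in> {0..T}"
      from flip[OF that this]
      show "dist (form a b c d (u s) (u s) \<phi>) (form a b c d (u t) (u t) \<phi>) \<le> 2 * ?F a b c d * C * hn 1 \<phi> * dist s t"
        unfolding dist_real_def .
    qed
    then show ?thesis by (rule lipschitz_on_continuous_on)
  qed
  define f1 f2 f3 where "f1 = (\<lambda>s. ip_grad D (u s) \<phi>)" "f2 = (\<lambda>s. ip_cross_grad D (u s) (u s) \<phi>)"
    "f3 = (\<lambda>s. ip D (\<lambda>x. (1 + \<mu> * (norm (u s x))\<^sup>2) *\<^sub>R u s x) \<phi>)"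
  define f where "f = (\<lambda>s. \<kappa>1 * f1 s + \<gamma> * f2 s + \<kappa>2 * f3 s)"
  have f3: "f3 s = form 0 0 1 \<mu> (u s) (u s) \<phi>" if "s \<in> {0..T}" for s
    unfolding f1_f2_f3_def by (rule ip_cubic_split[OF uH[OF that] \<phi>])
  have ff: "f s = form \<kappa>1 \<gamma> \<kappa>2 \<mu> (u s) (u s) \<phi>" if "s \<in> {0..T}" for s
    unfolding f_def f3[OF that] by (simp add: f1_f2_f3_def form_def algebra_simps)
  \<comment> \<open>The positional arguments of \<open>fcont\<close> come in the order a, c, d, b of
    its premises and conclusion, so the last one is the coefficient of the cross term.\<close>
  have c1: "continuous_on {0..T} f1" using fcont[of 1 0 0 0] by (simp add: form_def f1_f2_f3_def)
  have c2: "continuous_on {0..T} f2" using fcont[of 0 0 0 1] by (simp add: form_def f1_f2_f3_def)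
  have c3: "continuous_on {0..T} f3"
    using fcont[of 0 1 \<mu> 0] k by (subst continuous_on_cong[OF refl f3]) auto
  have cp: "continuous_on {0..T} (\<lambda>t. hip e (u t) \<phi>)" by (rule hip_time_continuous[OF tc \<phi>]) (use e in auto)
  have E: "hip e (u t) \<phi> + \<kappa>1 * (\<integral>s. f1 s \<partial>lebesgue_on {0<..<t}) + \<gamma> * (\<integral>s. f2 s \<partial>lebesgue_on {0<..<t})
     + \<kappa>2 * (\<integral>s. f3 s \<partial>lebesgue_on {0<..<t}) = q" if "t \<in> {0<..<T}" for t
    using eq[OF that] by (simp add: hip_def f1_f2_f3_def)
  let ?L = "2 * ?F \<kappa>1 \<gamma> \<kappa>2 \<mu> * C * hn 1 \<phi>"
  have L: "\<bar>f s - f t\<bar> \<le> ?L * \<bar>s - t\<bar>" if "s \<in> {0..T}" "t \<in> {0..T}" for s t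
    unfolding ff[OF that(1)] ff[OF that(2)] by (rule flip[OF k that])
  have L0: "?L \<ge> 0" using F0[OF k] lip(2) by simp
  have fe: "f s = \<kappa>1 * f1 s + \<gamma> * f2 s + \<kappa>2 * f3 s" for s by (simp add: f_def)
  show "hip e (u 0) \<phi> = q"
    by (rule integral_equation_increment(1)[where f=f, OF cp c1 c2 c3 E fe L T L0])
  fix a b assume ab: "0 \<le> a" "a \<le> b" "b \<le> T"
  have "\<bar>hip e (u b) \<phi> - hip e (u a) \<phi> + (b - a) * f b\<bar> \<le> ?L * (b - a)\<^sup>2"
    by (rule integral_equation_increment(2)[where f=f, OF cp c1 c2 c3 E fe L T L0 ab])
  then show "\<bar>hip e (u b) \<phi> - hip e (u a) \<phi> + (b - a) * form \<kappa>1 \<gamma> \<kappa>2 \<mu> (u b) (u b) \<phi>\<bar>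
        \<le> 2 * formC \<kappa>1 \<gamma> \<kappa>2 \<mu> (solM B) (solQ B) (2 * zB B) * C * (b - a)\<^sup>2 * hn 1 \<phi>"
    using ff[of b] ab by (simp add: mult_ac)
qed

text \<open>The scheme starts from the projection of u0, the error analysis from the continuous
  representative at time 0. Testing the equality of their energy pairings with the difference itself
  shows that the two agree almost everywhere, so the projection property carries over.\<close>

lemma L2_projection_initial:
  assumes u: "v \<in> H_set D 1" "u0 \<in> H_set D 1" and e: "e > 0"
    and eq: "\<And>\<phi>. \<phi> \<in> H_set D 1 \<Longrightarrow> hip e v \<phi> = hip e u0 \<phi>" and p: "sqi LD p" "sqi LD \<phi>"
    and z: "ip D (\<lambda>x. u0 x - p x) \<phi> = 0"
  shows "ip D (\<lambda>x. v x - p x) \<phi> = 0"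
proof -
  let ?w = "\<lambda>x. v x - u0 x"
  have w: "?w \<in> H_set D 1" by (rule H1_diff(1)[OF u])
  have "hip e ?w ?w = 0" using hip_diff[OF u w, of e] eq[OF w] by simp
  then have "hn e ?w = 0" by (simp add: hn_def)
  then have "l2n LD ?w = 0" using l2n_le_hn[of e ?w] e l2n_nonneg[of LD ?w] by linarith
  then have "ip D ?w \<phi> = 0" using ip_le[OF H1_D(1)[OF w] p(2)] by simp
  then show ?thesis
    using z ip_diff[OF H1_D(1)[OF u(1)] H1_D(1)[OF u(2)] p(2)] ip_diff[OF H1_D(1)[OF u(1)] p] ip_diff[OF H1_D(1)[OF u(2)] p]
    by simp
qed

end

section \<open>Discrete approximation in the energy norm and the error recursion\<close>

context fem_dom begin

lemma Vh_L4:
  assumes p: "p \<in> Vh" shows "sqi LD (\<lambda>x. (norm (pd j p x))\<^sup>2)"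
proof -
  obtain M where M: "\<And>x. norm (fgrad p j x) \<le> M" using Vh_H1(5)[OF p, of j] by blast
  have m: "(\<lambda>x. (norm (fgrad p j x))\<^sup>2) \<in> borel_measurable LD" using sqiD(1)[OF Vh_H1(4)[OF p, of j]] by measurable
  have "sqi LD (\<lambda>x. (norm (fgrad p j x))\<^sup>2)"
  proof (rule sqi_bounded[OF finite_LD m])
    show "AE x in LD. norm ((norm (fgrad p j x))\<^sup>2) \<le> M\<^sup>2" by (intro AE_I2) (simp add: M power_mono)
  qed
  moreover have "(\<lambda>x. (norm (pd j p x))\<^sup>2) \<in> borel_measurable LD"
    using sqiD(1)[OF H1_D(3)[OF Vh_H1(1)[OF p], of j]] by measurable
  moreover have "AE x in LD. (norm (fgrad p j x))\<^sup>2 = (norm (pd j p x))\<^sup>2"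
    using Vh_H1(2)[OF p, of j] by eventually_elim simp
  ultimately show ?thesis by (rule sqi_cong_AE)
qed

text \<open>The bound of \<open>fgrad_L4\<close> for a gradient error E h: since d \<le> 3, the
  quotient h^4 / h^d is a positive power of h and can be replaced by that of the largest mesh size
  h0.\<close>

definition ritzQ :: "real \<Rightarrow> real \<Rightarrow> real \<Rightarrow> real" where
  "ritzQ B h0 E = sqrt (8 * (solQ B)\<^sup>2 + 8 * (E ^ 4 * h0 ^ (4 - CARD('d)) / (unit_ball_vol (real CARD('d)) * \<rho> ^ CARD('d))))"

lemma Vh_gradient_L4:
  assumes p: "p \<in> Vh" and z: "H2_limit B z" and E: "l2n LD (\<lambda>x. pd j p x - pd j z x) \<le> E * h" and h0: "h \<le> h0"
  shows "l2n LD (\<lambda>x. (norm (pd j p x))\<^sup>2) \<le> ritzQ B h0 E"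
proof -
  note zH = H2_limit_H1[OF z] and pH = Vh_H1(1)[OF p]
  have "l2n LD (\<lambda>x. fgrad p j x - pd j z x) = l2n LD (\<lambda>x. pd j p x - pd j z x)"
    using Vh_H1(2)[OF p, of j]
    by (intro l2n_cong_AE sqiD(1) sqi_diff H1_D(3) Vh_H1(4) p pH zH) (auto elim: eventually_mono)
  then have E': "l2n LD (\<lambda>x. fgrad p j x - pd j z x) \<le> E * h" using E by simp
  note f = fgrad_L4[OF p H1_D(3)[OF zH] H2_limit_bounds(2)[OF z] E']
  have eq: "l2n LD (\<lambda>x. (norm (pd j p x))\<^sup>2) = l2n LD (\<lambda>x. (norm (fgrad p j x))\<^sup>2)"
    using Vh_H1(2)[OF p, of j]
    by (intro l2n_cong_AE sqiD(1) Vh_L4[OF p] f(1)) (auto elim: eventually_mono)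
  have d: "CARD('d) \<le> 3" by (rule dim3)
  have "(E * h) ^ 4 / (unit_ball_vol (real CARD('d)) * (\<rho> * h) ^ CARD('d))
      = E ^ 4 * h ^ (4 - CARD('d)) / (unit_ball_vol (real CARD('d)) * \<rho> ^ CARD('d))"
  proof -
    have "h ^ 4 = h ^ (4 - CARD('d)) * h ^ CARD('d)" using d by (simp flip: power_add)
    then show ?thesis using h_pos by (simp add: power_mult_distrib)
  qed
  also have "\<dots> \<le> E ^ 4 * h0 ^ (4 - CARD('d)) / (unit_ball_vol (real CARD('d)) * \<rho> ^ CARD('d))"
    using h_pos h0 rho_pos by (intro divide_right_mono mult_left_mono power_mono) auto
  finally have t: "(E * h) ^ 4 / (unit_ball_vol (real CARD('d)) * (\<rho> * h) ^ CARD('d))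
     \<le> E ^ 4 * h0 ^ (4 - CARD('d)) / (unit_ball_vol (real CARD('d)) * \<rho> ^ CARD('d))" .
  have q: "(l2n LD (\<lambda>x. (norm (pd j z x))\<^sup>2))\<^sup>2 \<le> (solQ B)\<^sup>2"
    using H2_limit_bounds(3)[OF z] unfolding solQ_def by (intro power_mono) auto
  have "(l2n LD (\<lambda>x. (norm (fgrad p j x))\<^sup>2))\<^sup>2
     \<le> 8 * (solQ B)\<^sup>2 + 8 * (E ^ 4 * h0 ^ (4 - CARD('d)) / (unit_ball_vol (real CARD('d)) * \<rho> ^ CARD('d)))"
    using f(2) t q by linarith
  then show ?thesis unfolding eq ritzQ_def by (rule real_le_rsqrt)
qed

text \<open>The H^1 error per unit of h: the L^2 part is of order h^2 and gives one factor to h0,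
  each of the d derivatives contributes its own constant.\<close>

definition apC :: "real \<Rightarrow> real \<Rightarrow> real" where
  "apC B h0 = (intC * B + 2) * h0 + real CARD('d) * (2 / \<rho> * intC * B + 2)"

lemma H2_limit_approximation_hn:
  assumes z: "H2_limit B z" and h0: "h \<le> h0"
  obtains p where "p \<in> Vh" "l2n LD (\<lambda>x. p x - z x) \<le> (intC * B + 2) * h\<^sup>2" "hn 1 (\<lambda>x. p x - z x) \<le> apC B h0 * h"
proof -
  note zH = H2_limit_H1[OF z]
  obtain p where p: "p \<in> Vh" "l2n LD (\<lambda>x. p x - z x) \<le> (intC * B + 2) * h\<^sup>2"
    "\<And>j. l2n LD (\<lambda>x. fgrad p j x - pd j z x) \<le> (2 / \<rho> * intC * B + 2) * h"
    using H2_limit_approximation[OF z] by blast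
  have B0: "B \<ge> 0" by (rule H2_limit_hn(2)[OF z])
  have "l2n LD (pd j (\<lambda>x. p x - z x)) \<le> (2 / \<rho> * intC * B + 2) * h" for j
  proof -
    have "l2n LD (pd j (\<lambda>x. p x - z x)) = l2n LD (\<lambda>x. pd j p x - pd j z x)" by (rule pd_diff_l2n[OF Vh_H1(1)[OF p(1)] zH, symmetric])
    also have "\<dots> = l2n LD (\<lambda>x. fgrad p j x - pd j z x)"
      using Vh_H1(2)[OF p(1), of j]
      by (intro l2n_cong_AE sqiD(1) sqi_diff H1_D(3) Vh_H1(1,4) p(1) zH) (auto elim: eventually_mono)
    finally show ?thesis using p(3)[of j] by simp
  qed
  then have "(\<Sum>j\<in>UNIV. l2n LD (pd j (\<lambda>x. p x - z x))) \<le> (\<Sum>j\<in>(UNIV::'d set). (2 / \<rho> * intC * B + 2) * h)" by (rule sum_mono)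
  moreover have "(intC * B + 2) * h\<^sup>2 \<le> (intC * B + 2) * h0 * h"
  proof -
    have "h * h \<le> h0 * h" using h0 h_pos by (intro mult_right_mono) auto
    then have "(intC * B + 2) * (h * h) \<le> (intC * B + 2) * (h0 * h)" using intC_pos B0 by (intro mult_left_mono) auto
    then show ?thesis by (simp add: power2_eq_square mult_ac)
  qed
  ultimately have "hn 1 (\<lambda>x. p x - z x) \<le> apC B h0 * h"
    using hn1_le_sum[of "\<lambda>x. p x - z x"] p(2) by (simp add: apC_def algebra_simps)
  with p(1,2) that show ?thesis by blast
qed

definition inC :: "real \<Rightarrow> real \<Rightarrow> real" where
  "inC B h0 = apC B h0 + (intC * B + 2) * (h0 + real CARD('d) * invC)"

text \<open>The difference w between the projection P and a good approximant p is a discrete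
  function of L^2 size h^2, because w is the projection of z - p. The inverse estimate exchanges one
  power of h for a derivative.\<close>

lemma L2_projection_error:
  assumes z: "H2_limit B z" and h0: "h \<le> h0" and P: "P \<in> Vh" "\<And>\<phi>. \<phi> \<in> Vh \<Longrightarrow> ip D (\<lambda>x. z x - P x) \<phi> = 0"
  shows "hn 1 (\<lambda>x. P x - z x) \<le> inC B h0 * h"
proof -
  note zH = H2_limit_H1[OF z] and PH = Vh_H1(1)[OF P(1)]
  obtain p where p: "p \<in> Vh" "l2n LD (\<lambda>x. p x - z x) \<le> (intC * B + 2) * h\<^sup>2" "hn 1 (\<lambda>x. p x - z x) \<le> apC B h0 * h"
    using H2_limit_approximation_hn[OF z h0] by blast
  note pH = Vh_H1(1)[OF p(1)]
  have B0: "B \<ge> 0" by (rule H2_limit_hn(2)[OF z])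
  let ?c = "intC * B + 2"
  have c: "?c \<ge> 0" using intC_pos B0 by simp
  define w where "w = (\<lambda>x. P x - p x)"
  have wV: "w \<in> Vh" unfolding w_def by (rule Vh_diff[OF P(1) p(1)])
  note wH = Vh_H1(1)[OF wV]
  note s = H1_D(1)[OF PH] H1_D(1)[OF pH] H1_D(1)[OF zH] H1_D(1)[OF wH]
  have "l2n LD w \<le> l2n LD (\<lambda>x. p x - z x)"
  proof (cases "l2n LD w = 0")
    case False
    have "(l2n LD w)\<^sup>2 = ip D w w" by (simp add: ip_self)
    also have "\<dots> = ip D (\<lambda>x. z x - p x) w"
      using P(2)[OF wV] ip_diff[OF s(1,2,4)] ip_diff[OF s(3,2,4)] ip_diff[OF s(3,1,4)] by (simp add: w_def)
    also have "\<dots> \<le> l2n LD (\<lambda>x. z x - p x) * l2n LD w" using ip_le[OF sqi_diff[OF s(3,2)] s(4)] by linarith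
    finally have "l2n LD w * l2n LD w \<le> l2n LD (\<lambda>x. p x - z x) * l2n LD w"
      by (simp add: power2_eq_square l2n_minus_commute[of LD z])
    then show ?thesis by (rule mult_right_le_imp_le) (use False l2n_nonneg[of LD w] in linarith)
  qed simp
  then have w0: "l2n LD w \<le> ?c * h\<^sup>2" using p(2) by linarith
  have iC: "invC \<ge> 0" using rho_pos by (simp add: invC_def)
  have w1: "l2n LD (pd j w) \<le> ?c * invC * h" for j
  proof -
    have "l2n LD (pd j w) = l2n LD (fgrad w j)"
      by (rule l2n_cong_AE[OF sqiD(1)[OF H1_D(3)[OF wH]] sqiD(1)[OF Vh_H1(4)[OF wV]] Vh_H1(2)[OF wV]])
    also have "\<dots> \<le> invC / h * l2n LD w" by (rule inverse_estimate[OF wV])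
    also have "\<dots> \<le> invC / h * (?c * h\<^sup>2)" using iC h_pos w0 by (intro mult_left_mono) auto
    also have "\<dots> = ?c * invC * h" using h_pos by (simp add: power2_eq_square)
    finally show ?thesis .
  qed
  have "(\<Sum>j\<in>UNIV. l2n LD (pd j w)) \<le> (\<Sum>j\<in>(UNIV::'d set). ?c * invC * h)" by (rule sum_mono) (rule w1)
  moreover have "?c * h\<^sup>2 \<le> ?c * (h0 * h)"
    using c h0 h_pos by (intro mult_left_mono) (auto simp: power2_eq_square)
  ultimately have "hn 1 w \<le> ?c * (h0 * h) + real CARD('d) * (?c * invC * h)"
    using hn1_le_sum[of w] w0 by simp
  moreover have "hn 1 (\<lambda>x. w x + (p x - z x)) \<le> hn 1 w + hn 1 (\<lambda>x. p x - z x)"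
    by (rule hn_triangle[OF _ wH H1_diff(1)[OF pH zH]]) simp
  ultimately show ?thesis using p(3) by (simp add: w_def inC_def algebra_simps)
qed

text \<open>An approximate Ritz projection suffices, so that no minimiser has to be constructed.\<close>

lemma approximate_ritz_projection:
  assumes z: "z \<in> H_set D 1" and e: "e > 0" and d: "\<delta> > 0"
  obtains R where "R \<in> Vh" "\<And>\<phi>. \<phi> \<in> Vh \<Longrightarrow> \<bar>hip e (\<lambda>x. z x - R x) \<phi>\<bar> \<le> \<delta> * hn e \<phi>"
    "\<And>p. p \<in> Vh \<Longrightarrow> hn e (\<lambda>x. z x - R x) \<le> hn e (\<lambda>x. z x - p x) + \<delta>"
proof -
  have e0: "e \<ge> 0" using e by simp
  define J where "J = (\<lambda>v. (hn e (\<lambda>x. z x - v x))\<^sup>2)"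
  have ne: "J ` Vh \<noteq> {}"
  proof -
    have "(\<lambda>x. 0) \<in> Vh" unfolding fem_space_def
      by (auto intro!: exI[of _ "0 :: real^'d^3"] exI[of _ "0 :: real^3"])
    then show ?thesis by blast
  qed
  have bd: "bdd_below (J ` Vh)" by (intro bdd_belowI[of _ 0]) (auto simp: J_def)
  have "Inf (J ` Vh) < Inf (J ` Vh) + \<delta>\<^sup>2" using d by simp
  then obtain R where R: "R \<in> Vh" "J R < Inf (J ` Vh) + \<delta>\<^sup>2" using cInf_lessD[OF ne] by blast
  \<comment> \<open>R minimises J up to \<delta>^2. On each line through R in \<open>Vh\<close> this
    makes a quadratic polynomial nonnegative, and its discriminant gives orthogonality up to
    \<delta>.\<close>
  have low: "J R \<le> J v + \<delta>\<^sup>2" if "v \<in> Vh" for v using cInf_lower[OF imageI[OF that] bd] R(2) by linarith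
  note RH = Vh_H1(1)[OF R(1)]
  have wH: "(\<lambda>x. z x - R x) \<in> H_set D 1" by (rule H1_diff(1)[OF z RH])
  show ?thesis
  proof (rule that[OF R(1)])
    fix \<phi> assume \<phi>: "\<phi> \<in> Vh"
    note \<phi>H = Vh_H1(1)[OF \<phi>]
    let ?w = "\<lambda>x. z x - R x"
    have "0 \<le> \<delta>\<^sup>2 - 2 * t * hip e ?w \<phi> + t\<^sup>2 * hip e \<phi> \<phi>" for t
    proof -
      have v: "(\<lambda>x. 1 *\<^sub>R R x + t *\<^sub>R \<phi> x) \<in> Vh" by (rule Vh_lin[OF R(1) \<phi>])
      define q where "q = (\<lambda>x. 1 *\<^sub>R ?w x + (- t) *\<^sub>R \<phi> x)"
      have eq: "(\<lambda>x. z x - (1 *\<^sub>R R x + t *\<^sub>R \<phi> x)) = q" unfolding q_def by (rule ext) simp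
      have lH: "q \<in> H_set D 1" unfolding q_def by (rule H1_lin(1)[OF wH \<phi>H])
      have q: "hip e q g = hip e ?w g - t * hip e \<phi> g" if "g \<in> H_set D 1" for g
        unfolding q_def using hip_lin[OF wH \<phi>H that, of e 1 "- t"] by simp
      have "J (\<lambda>x. 1 *\<^sub>R R x + t *\<^sub>R \<phi> x) = hip e q q" unfolding J_def eq by (rule hn_sq[OF e0])
      also have "\<dots> = hip e q ?w - t * hip e q \<phi>"
        unfolding q[OF lH] hip_commute[of e ?w q] hip_commute[of e \<phi> q] ..
      also have "\<dots> = hip e ?w ?w - 2 * t * hip e ?w \<phi> + t\<^sup>2 * hip e \<phi> \<phi>"
        unfolding q[OF wH] q[OF \<phi>H] hip_commute[of e \<phi> ?w] by (simp add: algebra_simps power2_eq_square)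
      finally show ?thesis using low[OF v] hn_sq[OF e0, of ?w] by (simp add: J_def)
    qed
    from sqrt_bound_quadratic[OF _ hip_self_nonneg[OF e0] this] have "(hip e ?w \<phi>)\<^sup>2 \<le> \<delta>\<^sup>2 * hip e \<phi> \<phi>" by simp
    then have "\<bar>hip e ?w \<phi>\<bar>\<^sup>2 \<le> (\<delta> * hn e \<phi>)\<^sup>2" by (simp add: power_mult_distrib hn_sq[OF e0])
    then show "\<bar>hip e ?w \<phi>\<bar> \<le> \<delta> * hn e \<phi>" by (rule power2_le_imp_le) (use d hn_nonneg[OF e0] in simp)
  next
    fix p assume p: "p \<in> Vh"
    have n: "hn e (\<lambda>x. z x - p x) \<ge> 0" by (rule hn_nonneg[OF e0])
    have "(hn e (\<lambda>x. z x - R x))\<^sup>2 \<le> (hn e (\<lambda>x. z x - p x))\<^sup>2 + \<delta>\<^sup>2" using low[OF p] by (simp add: J_def)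
    also have "\<dots> \<le> (hn e (\<lambda>x. z x - p x) + \<delta>)\<^sup>2" using n d by (simp add: power2_sum)
    finally show "hn e (\<lambda>x. z x - R x) \<le> hn e (\<lambda>x. z x - p x) + \<delta>" by (rule power2_le_imp_le) (use n d in simp)
  qed
qed

text \<open>A common bound for U + z and R in H^1: the a priori bound of the iterates converted by
  \<open>1 / sqrt e\<close>, bounds for z, and the Ritz error at the largest mesh size h0.\<close>

definition stabC :: "real \<Rightarrow> real \<Rightarrow> real \<Rightarrow> real" where
  "stabC e B h0 = (zB B + inC B h0 * h0) / sqrt e + 2 * zB B + (apC B h0 + 1) / sqrt e * h0"

definition stepF :: "real \<Rightarrow> real \<Rightarrow> real \<Rightarrow> real \<Rightarrow> real \<Rightarrow> real \<Rightarrow> real \<Rightarrow> real" where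
  "stepF \<kappa>1 \<gamma> \<kappa>2 \<mu> e B h0 = formC \<kappa>1 \<gamma> \<kappa>2 \<mu> (solM B) (ritzQ B h0 ((apC B h0 + 1) / sqrt e)) (stabC e B h0)"

definition rateC :: "real \<Rightarrow> real \<Rightarrow> real \<Rightarrow> real \<Rightarrow> real" where
  "rateC F P e C = F / sqrt e * ((1 + 2 * P) / sqrt e + C) + 2 * F * C / sqrt e + 2"

lemma constants_nonneg:
  assumes "B \<ge> 0" "h0 \<ge> 0" shows "zB B \<ge> 0" "apC B h0 \<ge> 0" "inC B h0 \<ge> 0" "solQ B \<ge> 0" "ritzQ B h0 E \<ge> 0"
proof -
  note iC = less_imp_le[OF intC_pos]
  have inv: "invC \<ge> 0" using rho_pos by (simp add: invC_def)
  show "zB B \<ge> 0" using assms by (simp add: zB_def)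
  show ap: "apC B h0 \<ge> 0" unfolding apC_def
    using assms iC rho_pos by (intro add_nonneg_nonneg mult_nonneg_nonneg) auto
  show "inC B h0 \<ge> 0" unfolding inC_def
    using assms iC inv ap by (intro add_nonneg_nonneg mult_nonneg_nonneg) auto
  show "solQ B \<ge> 0" using sobC_nonneg by (simp add: solQ_def)
  show "ritzQ B h0 E \<ge> 0" unfolding ritzQ_def
    using assms rho_pos by (intro real_sqrt_ge_zero add_nonneg_nonneg mult_nonneg_nonneg divide_nonneg_nonneg) auto
qed

text \<open>Here z j is the exact value at time level j, and the differential equation is present
  only through \<open>cons\<close>. The sum F dominates both the constant of the form difference and
  that of the consistency error.\<close>

lemma discrete_error:
  fixes z U :: "nat \<Rightarrow> real^'d \<Rightarrow> real^3"
  assumes h0: "h \<le> h0" and e: "0 < e" "e < 1" and k: "k > 0" and \<kappa>: "\<kappa>1 \<ge> 0" "\<kappa>2 \<ge> 0" "\<mu> \<ge> 0" and C: "C \<ge> 0"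
    and z: "\<And>j. j \<le> N \<Longrightarrow> H2_limit B (z j)"
    and U: "\<And>j. j \<le> N \<Longrightarrow> U j \<in> Vh"
    and scheme: "\<And>j \<phi>. j < N \<Longrightarrow> \<phi> \<in> Vh \<Longrightarrow>
        hip e (\<lambda>x. U (Suc j) x - U j x) \<phi> + k * form \<kappa>1 \<gamma> \<kappa>2 \<mu> (U j) (U (Suc j)) \<phi> = 0"
    and cons: "\<And>j \<phi>. j < N \<Longrightarrow> \<phi> \<in> H_set D 1 \<Longrightarrow>
        \<bar>hip e (z (Suc j)) \<phi> - hip e (z j) \<phi> + k * form \<kappa>1 \<gamma> \<kappa>2 \<mu> (z (Suc j)) (z (Suc j)) \<phi>\<bar> \<le> 2 * F0 * C * k\<^sup>2 * hn 1 \<phi>"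
    and F0: "F0 \<ge> 0"
    and lip: "\<And>j. j < N \<Longrightarrow> hn 1 (\<lambda>x. z (Suc j) x - z j x) \<le> C * k"
    and init: "\<And>\<phi>. \<phi> \<in> Vh \<Longrightarrow> ip D (\<lambda>x. z 0 x - U 0 x) \<phi> = 0"
    and n: "n \<le> N"
  defines "P \<equiv> apC B h0 + 1" and "F \<equiv> stepF \<kappa>1 \<gamma> \<kappa>2 \<mu> e B h0 + F0"
  shows "hn e (\<lambda>x. U n x - z n x) \<le> (inC B h0 + 2 * P + 1) * exp (rateC F P e C * (real n * k)) * (h + k)"
proof -
  define s where "s = sqrt e"
  have s: "s > 0" "e \<ge> 0" "e \<le> 1" using e by (auto simp: s_def)
  have B0: "B \<ge> 0" by (rule H2_limit_hn(2)[OF z[of 0]]) simp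
  have h00: "h0 \<ge> 0" using h0 h_pos by simp
  note cn = constants_nonneg[OF B0 h00]
  have P0: "P \<ge> 1" using cn(2) by (simp add: P_def)
  have zH: "z j \<in> H_set D 1" if "j \<le> N" for j by (rule H2_limit_H1[OF z[OF that]])
  have UH: "U j \<in> H_set D 1" if "j \<le> N" for j by (rule Vh_H1(1)[OF U[OF that]])
  have h1: "hn 1 v \<le> hn e v / s" for v unfolding s_def by (rule hn_1_le) (use s e in auto)
  have hle: "hn e v \<le> hn 1 v" for v by (rule hn_le_1) (use s in auto)
  have nn: "hn e v \<ge> 0" "hn 1 v \<ge> 0" for v using s by auto
  have I0: "hn 1 (\<lambda>x. U 0 x - z 0 x) \<le> inC B h0 * h"
    by (rule L2_projection_error[OF z h0 U init]) simp_all
  have U0: "hn e (U 0) \<le> zB B + inC B h0 * h0"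
  proof -
    have "hn 1 (\<lambda>x. (U 0 x - z 0 x) + z 0 x) \<le> hn 1 (\<lambda>x. U 0 x - z 0 x) + hn 1 (z 0)"
      by (rule hn_triangle[OF _ H1_diff(1)[OF UH zH] zH]) simp_all
    moreover have "inC B h0 * h \<le> inC B h0 * h0" using cn(3) h0 by (rule mult_left_mono[rotated])
    moreover have "hn 1 (z 0) \<le> zB B" by (rule H2_limit_hn(1)[OF z]) simp
    ultimately have "hn 1 (U 0) \<le> zB B + inC B h0 * h0" using I0 by simp
    then show ?thesis using hle[of "U 0"] by linarith
  qed
  have mono: "hn e (U (Suc j)) \<le> hn e (U j)" if j: "j < N" for j
  proof (cases "hn e (U (Suc j)) = 0")
    case True then show ?thesis using nn by simp
  next
    case False
    have l: "Suc j \<le> N" "j \<le> N" using j by auto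
    have "0 \<le> k * form \<kappa>1 \<gamma> \<kappa>2 \<mu> (U j) (U (Suc j)) (U (Suc j))" using form_nonneg[OF \<kappa>] k by simp
    then have "hip e (\<lambda>x. U (Suc j) x - U j x) (U (Suc j)) \<le> 0" using scheme[OF j U[OF l(1)]] by linarith
    then have "hip e (U (Suc j)) (U (Suc j)) \<le> hip e (U j) (U (Suc j))"
      using hip_diff[OF UH[OF l(1)] UH[OF l(2)] UH[OF l(1)], of e] by simp
    also have "\<dots> \<le> hn e (U j) * hn e (U (Suc j))" using hip_Cauchy_Schwarz[OF s(2) UH[OF l(2)] UH[OF l(1)]] by simp
    finally have "hn e (U (Suc j)) * hn e (U (Suc j)) \<le> hn e (U j) * hn e (U (Suc j))"
      using hn_sq[OF s(2), of "U (Suc j)"] by (simp add: power2_eq_square)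
    then show ?thesis by (rule mult_right_le_imp_le) (use False nn[of "U (Suc j)"] in linarith)
  qed
  have apriori: "j \<le> N \<Longrightarrow> hn e (U j) \<le> zB B + inC B h0 * h0" for j
  proof (induction j)
    case (Suc j) then show ?case using mono[of j] by simp
  qed (rule U0)
  \<comment> \<open>At most h, so the approximate Ritz projection keeps the order of the best
    approximation; at most k^2, because two such defects enter each step.\<close>
  define \<delta> where "\<delta> = min h (k\<^sup>2)"
  have \<delta>: "\<delta> > 0" "\<delta> \<le> h" "\<delta> \<le> k\<^sup>2" using h_pos k by (auto simp: \<delta>_def)
  have "\<exists>R. R \<in> Vh \<and> (\<forall>\<phi>\<in>Vh. \<bar>hip e (\<lambda>x. z j x - R x) \<phi>\<bar> \<le> \<delta> * hn e \<phi>) \<and> hn e (\<lambda>x. z j x - R x) \<le> P * h" if j: "j \<le> N" for j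
  proof -
    obtain R where R: "R \<in> Vh" "\<And>\<phi>. \<phi> \<in> Vh \<Longrightarrow> \<bar>hip e (\<lambda>x. z j x - R x) \<phi>\<bar> \<le> \<delta> * hn e \<phi>"
      "\<And>p. p \<in> Vh \<Longrightarrow> hn e (\<lambda>x. z j x - R x) \<le> hn e (\<lambda>x. z j x - p x) + \<delta>"
      using approximate_ritz_projection[OF zH[OF j] e(1) \<delta>(1)] by blast
    obtain p where p: "p \<in> Vh" "hn 1 (\<lambda>x. p x - z j x) \<le> apC B h0 * h"
      using H2_limit_approximation_hn[OF z[OF j] h0] by blast
    have "hn e (\<lambda>x. z j x - p x) \<le> apC B h0 * h"
      using hn_diff_commute[OF s(2) zH[OF j] Vh_H1(1)[OF p(1)]] hle[of "\<lambda>x. p x - z j x"] p(2) by linarith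
    then have "hn e (\<lambda>x. z j x - R x) \<le> P * h" using R(3)[OF p(1)] \<delta>(2) by (simp add: P_def algebra_simps)
    with R show ?thesis by blast
  qed
  then have "\<forall>j. \<exists>R. j \<le> N \<longrightarrow> R \<in> Vh \<and> (\<forall>\<phi>\<in>Vh. \<bar>hip e (\<lambda>x. z j x - R x) \<phi>\<bar> \<le> \<delta> * hn e \<phi>) \<and> hn e (\<lambda>x. z j x - R x) \<le> P * h"
    by blast
  from choice[OF this] obtain R where R':
    "\<forall>j. j \<le> N \<longrightarrow> R j \<in> Vh \<and> (\<forall>\<phi>\<in>Vh. \<bar>hip e (\<lambda>x. z j x - R j x) \<phi>\<bar> \<le> \<delta> * hn e \<phi>) \<and> hn e (\<lambda>x. z j x - R j x) \<le> P * h" ..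
  have R: "R j \<in> Vh" "\<phi> \<in> Vh \<Longrightarrow> \<bar>hip e (\<lambda>x. z j x - R j x) \<phi>\<bar> \<le> \<delta> * hn e \<phi>"
    "hn e (\<lambda>x. z j x - R j x) \<le> P * h" if "j \<le> N" for j \<phi>
    using R' that by blast+
  have RH: "R j \<in> H_set D 1" if "j \<le> N" for j by (rule Vh_H1(1)[OF R(1)[OF that]])
  have R4: "hn e (\<lambda>x. R j x - z j x) \<le> P * h" if "j \<le> N" for j
    using R(3)[OF that] hn_diff_commute[OF s(2) zH[OF that] RH[OF that]] by simp
  have R5: "hn 1 (\<lambda>x. R j x - z j x) \<le> P / s * h" if "j \<le> N" for j
    using h1[of "\<lambda>x. R j x - z j x"] divide_right_mono[OF R4[OF that] less_imp_le[OF s(1)]] by simp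
  have RL4: "l2n LD (\<lambda>x. (norm (pd i (R j) x))\<^sup>2) \<le> ritzQ B h0 (P / s)" if "j \<le> N" for i j
  proof (rule Vh_gradient_L4[OF R(1)[OF that] z[OF that] _ h0])
    show "l2n LD (\<lambda>x. pd i (R j) x - pd i (z j) x) \<le> P / s * h"
      using pd_diff_l2n[OF RH[OF that] zH[OF that], of i] pd_le_hn[of 1 i "\<lambda>x. R j x - z j x"] R5[OF that] by simp
  qed
  let ?A = "stabC e B h0"
  have A1: "hn 1 (\<lambda>x. U i x + z j x) \<le> ?A" if ij: "i \<le> N" "j \<le> N" for i j
  proof -
    have "hn 1 (\<lambda>x. U i x + z j x) \<le> hn 1 (U i) + hn 1 (z j)" by (rule hn_triangle[OF _ UH[OF ij(1)] zH[OF ij(2)]]) simp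
    moreover have "hn 1 (U i) \<le> (zB B + inC B h0 * h0) / s"
      using h1[of "U i"] divide_right_mono[OF apriori[OF ij(1)] less_imp_le[OF s(1)]] by linarith
    moreover have "hn 1 (z j) \<le> zB B" by (rule H2_limit_hn(1)[OF z[OF ij(2)]])
    moreover have "0 \<le> P / s * h0" using P0 s h00 by simp
    ultimately show ?thesis using cn(1) unfolding stabC_def P_def[symmetric] s_def[symmetric] by linarith
  qed
  have A2: "hn 1 (R j) \<le> ?A" if j: "j \<le> N" for j
  proof -
    have "hn 1 (\<lambda>x. (R j x - z j x) + z j x) \<le> hn 1 (\<lambda>x. R j x - z j x) + hn 1 (z j)"
      by (rule hn_triangle[OF _ H1_diff(1)[OF RH[OF j] zH[OF j]] zH[OF j]]) simp
    moreover have "hn 1 (z j) \<le> zB B" by (rule H2_limit_hn(1)[OF z[OF j]])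
    moreover have "P / s * h \<le> P / s * h0" using P0 s h0 by (intro mult_left_mono) auto
    moreover have "0 \<le> (zB B + inC B h0 * h0) / s" using cn h00 s by simp
    ultimately show ?thesis using R5[OF j] cn(1) unfolding stabC_def P_def[symmetric] s_def[symmetric] by simp
  qed
  let ?F = "stepF \<kappa>1 \<gamma> \<kappa>2 \<mu> e B h0"
  have Fn: "?F \<ge> 0" unfolding stepF_def by (intro formC_nonneg \<kappa> cn) (simp add: solM_def)
  have FF: "?F \<le> F" "F0 \<le> F" "F \<ge> 0" using F0 Fn by (auto simp: F_def)
  define \<theta> where "\<theta> = (\<lambda>j x. U j x - R j x)"
  have \<theta>V: "\<theta> j \<in> Vh" if "j \<le> N" for j unfolding \<theta>_def by (rule Vh_diff[OF U[OF that] R(1)[OF that]])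
  have \<theta>H: "\<theta> j \<in> H_set D 1" if "j \<le> N" for j by (rule Vh_H1(1)[OF \<theta>V[OF that]])
  let ?K = "rateC F P e C"
  have K0: "?K \<ge> 0" unfolding rateC_def using FF P0 C s e
    by (intro add_nonneg_nonneg mult_nonneg_nonneg divide_nonneg_nonneg) auto
  have step: "hn e (\<theta> (Suc j)) \<le> hn e (\<theta> j) + ?K * k * (hn e (\<theta> j) + (h + k))" if j: "j < N" for j
  proof -
    have l: "Suc j \<le> N" "j \<le> N" using j by auto
    let ?t = "\<theta> (Suc j)" and ?z = "z (Suc j)"
    note tV = \<theta>V[OF l(1)] and tH = \<theta>H[OF l(1)]
    define a b where "a = hn e ?t" and "b = hn e (\<theta> j)"
    have ab: "a \<ge> 0" "b \<ge> 0" using nn by (auto simp: a_def b_def)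
    have ta: "hn 1 ?t \<le> a / s" unfolding a_def by (rule h1)
    have lin: "form \<kappa>1 \<gamma> \<kappa>2 \<mu> (U j) ?t ?t = form \<kappa>1 \<gamma> \<kappa>2 \<mu> (U j) (U (Suc j)) ?t - form \<kappa>1 \<gamma> \<kappa>2 \<mu> (U j) (R (Suc j)) ?t"
      using form_diff_middle[OF UH[OF l(2)] UH[OF l(1)] RH[OF l(1)] tH Vh_L4[OF U[OF l(1)]] Vh_L4[OF R(1)[OF l(1)]]]
      by (simp add: \<theta>_def)
    \<comment> \<open>Nonnegativity of the form at \<theta> replaces the new iterate by R in one
      direction, and this one-sided bound is all that the estimate of \<open>hip e ?t ?t\<close>
      uses.\<close>
    have f1: "form \<kappa>1 \<gamma> \<kappa>2 \<mu> (U j) (R (Suc j)) ?t \<le> form \<kappa>1 \<gamma> \<kappa>2 \<mu> (U j) (U (Suc j)) ?t"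
      using lin form_nonneg[OF \<kappa>, of \<gamma> "U j" ?t] by linarith
    have Pz: "hn 1 (\<lambda>x. U j x - ?z x) \<le> (b + P * h) / s + C * k"
    proof -
      have t1: "hn 1 (\<lambda>x. (\<theta> j x + (R j x - z j x)) - (?z x - z j x)) \<le> hn 1 (\<lambda>x. \<theta> j x + (R j x - z j x)) + hn 1 (\<lambda>x. ?z x - z j x)"
        by (rule hn_triangle_diff[OF _ H1_add(1)[OF \<theta>H[OF l(2)] H1_diff(1)[OF RH[OF l(2)] zH[OF l(2)]]] H1_diff(1)[OF zH[OF l(1)] zH[OF l(2)]]]) simp
      have t2: "hn 1 (\<lambda>x. \<theta> j x + (R j x - z j x)) \<le> hn 1 (\<theta> j) + hn 1 (\<lambda>x. R j x - z j x)"
        by (rule hn_triangle[OF _ \<theta>H[OF l(2)] H1_diff(1)[OF RH[OF l(2)] zH[OF l(2)]]]) simp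
      have eq: "(\<lambda>x. (\<theta> j x + (R j x - z j x)) - (?z x - z j x)) = (\<lambda>x. U j x - ?z x)" by (rule ext) (simp add: \<theta>_def)
      have "hn 1 (\<theta> j) \<le> b / s" unfolding b_def by (rule h1)
      then show ?thesis using t1[unfolded eq] t2 R5[OF l(2)] lip[OF j] by (simp add: add_divide_distrib)
    qed
    have f2: "\<bar>form \<kappa>1 \<gamma> \<kappa>2 \<mu> (U j) (R (Suc j)) ?t - form \<kappa>1 \<gamma> \<kappa>2 \<mu> ?z ?z ?t\<bar>
       \<le> F * (((b + P * h) / s + C * k) + P / s * h) * (a / s)"
    proof -
      have "\<bar>form \<kappa>1 \<gamma> \<kappa>2 \<mu> (U j) (R (Suc j)) ?t - form \<kappa>1 \<gamma> \<kappa>2 \<mu> ?z ?z ?t\<bar>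
        \<le> ?F * (hn 1 (\<lambda>x. U j x - ?z x) + hn 1 (\<lambda>x. R (Suc j) x - ?z x)) * hn 1 ?t"
        unfolding stepF_def P_def[symmetric] s_def[symmetric]
        by (rule form_difference[OF UH[OF l(2)] RH[OF l(1)] zH[OF l(1)] tH H2_limit_solM[OF z[OF l(1)]]
              Vh_L4[OF R(1)[OF l(1)]] RL4[OF l(1)] A1[OF l(2,1)] A2[OF l(1)] \<kappa>])
      also have "\<dots> \<le> F * (((b + P * h) / s + C * k) + P / s * h) * (a / s)"
        using FF Fn nn ab s P0 h_pos C k by (intro mult_mono add_mono Pz R5 l(1) ta FF(1)) auto
      finally show ?thesis .
    qed
    have c1: "\<bar>hip e ?z ?t - hip e (z j) ?t + k * form \<kappa>1 \<gamma> \<kappa>2 \<mu> ?z ?z ?t\<bar> \<le> 2 * F * C * k\<^sup>2 * (a / s)"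
    proof (rule order_trans[OF cons[OF j tH]])
      show "2 * F0 * C * k\<^sup>2 * hn 1 ?t \<le> 2 * F * C * k\<^sup>2 * (a / s)"
        using FF F0 C nn by (intro mult_mono ta) auto
    qed
    have r1: "\<bar>hip e (\<lambda>x. ?z x - R (Suc j) x) ?t\<bar> \<le> k\<^sup>2 * a" "\<bar>hip e (\<lambda>x. z j x - R j x) ?t\<bar> \<le> k\<^sup>2 * a"
      using R(2)[OF l(1) tV] R(2)[OF l(2) tV] mult_right_mono[OF \<delta>(3) ab(1)] unfolding a_def by linarith+
    have d1: "hip e (\<lambda>x. ?z x - R (Suc j) x) ?t = hip e ?z ?t - hip e (R (Suc j)) ?t"
      "hip e (\<lambda>x. z j x - R j x) ?t = hip e (z j) ?t - hip e (R j) ?t"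
      by (rule hip_diff[OF zH RH tH], use l in auto)+
    have d2: "hip e ?t ?t = hip e (U (Suc j)) ?t - hip e (R (Suc j)) ?t" "hip e (\<theta> j) ?t = hip e (U j) ?t - hip e (R j) ?t"
      using hip_diff[OF UH[OF l(1)] RH[OF l(1)] tH, of e] hip_diff[OF UH[OF l(2)] RH[OF l(2)] tH, of e] by (simp_all add: \<theta>_def)
    have sc: "hip e (U (Suc j)) ?t - hip e (U j) ?t + k * form \<kappa>1 \<gamma> \<kappa>2 \<mu> (U j) (U (Suc j)) ?t = 0"
      using scheme[OF j tV] hip_diff[OF UH[OF l(1)] UH[OF l(2)] tH, of e] by simp
    have g: "k * form \<kappa>1 \<gamma> \<kappa>2 \<mu> ?z ?z ?t - k * form \<kappa>1 \<gamma> \<kappa>2 \<mu> (U j) (U (Suc j)) ?t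
       \<le> k * (F * (((b + P * h) / s + C * k) + P / s * h) * (a / s))"
    proof -
      have "form \<kappa>1 \<gamma> \<kappa>2 \<mu> ?z ?z ?t - form \<kappa>1 \<gamma> \<kappa>2 \<mu> (U j) (U (Suc j)) ?t \<le> F * (((b + P * h) / s + C * k) + P / s * h) * (a / s)"
        using f1 f2 by linarith
      from mult_left_mono[OF this less_imp_le[OF k]] show ?thesis by (simp only: right_diff_distrib)
    qed
    have "hip e (\<theta> j) ?t \<le> b * a"
      using hip_Cauchy_Schwarz[OF s(2) \<theta>H[OF l(2)] tH] by (simp add: a_def b_def)
    then have "hip e ?t ?t \<le> b * a + k * (F * (((b + P * h) / s + C * k) + P / s * h) * (a / s)) + 2 * F * C * k\<^sup>2 * (a / s) + 2 * (k\<^sup>2 * a)"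
      using d1 d2 sc g c1 r1 by linarith
    also have "\<dots> = (b + k * (F * (((b + P * h) / s + C * k) + P / s * h) / s) + 2 * F * C * k\<^sup>2 / s + 2 * k\<^sup>2) * a"
      using s(1) by (simp add: field_simps)
    also have "hip e ?t ?t = a * a" using hn_sq[OF s(2), of ?t] by (simp add: a_def power2_eq_square)
    \<comment> \<open>Every term on the right carries one factor a, so dividing by it leaves a
      recursion for the norms themselves with no new error on the right.\<close>
    finally have aa: "a * a \<le> (b + k * (F * (((b + P * h) / s + C * k) + P / s * h) / s) + 2 * F * C * k\<^sup>2 / s + 2 * k\<^sup>2) * a" .
    have n1: "0 \<le> b + k * (F * (((b + P * h) / s + C * k) + P / s * h) / s) + 2 * F * C * k\<^sup>2 / s + 2 * k\<^sup>2"
      using ab k FF P0 h_pos s C by (intro add_nonneg_nonneg mult_nonneg_nonneg divide_nonneg_nonneg) auto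
    have "a \<le> b + k * (F * (((b + P * h) / s + C * k) + P / s * h) / s) + 2 * F * C * k\<^sup>2 / s + 2 * k\<^sup>2"
    proof (cases "a = 0")
      case False
      show ?thesis by (rule mult_right_le_imp_le[OF aa]) (use False ab in linarith)
    qed (use n1 in simp)
    also have "\<dots> \<le> b + ?K * k * (b + (h + k))"
    proof -
      define x y where "x = F / s / s" and "y = F * C / s"
      have xy: "x \<ge> 0" "y \<ge> 0" using FF C s by (auto simp: x_def y_def)
      have L: "k * (F * (((b + P * h) / s + C * k) + P / s * h) / s) + 2 * F * C * k\<^sup>2 / s + 2 * k\<^sup>2
         = k * (x * (b + 2 * P * h) + y * k + 2 * y * k + 2 * k)"
        using s(1) by (simp add: x_def y_def field_simps power2_eq_square)
      have Kx: "?K = x * (1 + 2 * P) + y + 2 * y + 2" using s(1) by (simp add: rateC_def s_def[symmetric] x_def y_def field_simps)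
      have "x * (b + 2 * P * h) + y * k + 2 * y * k + 2 * k \<le> ?K * (b + (h + k))"
      proof -
        have "0 \<le> x * (h + k) + x * (2 * P) * (b + k) + (y + 2 * y + 2) * (b + h)"
          using xy ab h_pos k P0 by (intro add_nonneg_nonneg mult_nonneg_nonneg) auto
        then show ?thesis unfolding Kx by (simp add: algebra_simps)
      qed
      from mult_left_mono[OF this less_imp_le[OF k]]
      have "k * (x * (b + 2 * P * h) + y * k + 2 * y * k + 2 * k) \<le> ?K * k * (b + (h + k))" by (simp add: mult_ac)
      then show ?thesis using L by linarith
    qed
    finally show ?thesis by (simp add: a_def b_def)
  qed
  have "hn e (\<theta> n) \<le> exp (?K * (real n * k)) * (hn e (\<theta> 0) + (h + k))"
    by (rule discrete_gronwall[where e="\<lambda>j. hn e (\<theta> j)"]) (use step n nn K0 k h_pos in auto)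
  moreover have "hn e (\<theta> 0) \<le> inC B h0 * h + P * h"
  proof -
    have "hn e (\<lambda>x. (U 0 x - z 0 x) + (z 0 x - R 0 x)) \<le> hn e (\<lambda>x. U 0 x - z 0 x) + hn e (\<lambda>x. z 0 x - R 0 x)"
      by (rule hn_triangle[OF s(2) H1_diff(1)[OF UH zH] H1_diff(1)[OF zH RH]]) simp_all
    then show ?thesis using I0 hle[of "\<lambda>x. U 0 x - z 0 x"] R(3)[of 0] by (simp add: \<theta>_def)
  qed
  ultimately have "hn e (\<theta> n) \<le> exp (?K * (real n * k)) * ((inC B h0 * h + P * h) + (h + k))"
    by (meson add_mono_thms_linordered_semiring(3) exp_ge_zero mult_left_mono order_trans)
  moreover have "hn e (\<lambda>x. U n x - z n x) \<le> hn e (\<theta> n) + P * h"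
  proof -
    have "hn e (\<lambda>x. \<theta> n x + (R n x - z n x)) \<le> hn e (\<theta> n) + hn e (\<lambda>x. R n x - z n x)"
      by (rule hn_triangle[OF s(2) \<theta>H[OF n] H1_diff(1)[OF RH[OF n] zH[OF n]]])
    then show ?thesis using R4[OF n] by (simp add: \<theta>_def)
  qed
  moreover have "P * h \<le> exp (?K * (real n * k)) * (P * h)"
  proof -
    have "1 \<le> exp (?K * (real n * k))" using K0 k by simp
    from mult_right_mono[OF this, of "P * h"] show ?thesis using P0 h_pos by simp
  qed
  ultimately have "hn e (\<lambda>x. U n x - z n x) \<le> exp (?K * (real n * k)) * ((inC B h0 * h + P * h) + (h + k) + P * h)"
    by (simp add: distrib_left)
  also have "\<dots> \<le> exp (?K * (real n * k)) * ((inC B h0 + 2 * P + 1) * (h + k))"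
  proof (rule mult_left_mono)
    have "0 \<le> (inC B h0 + 2 * P) * k" using cn(3) P0 k by simp
    then show "(inC B h0 * h + P * h) + (h + k) + P * h \<le> (inC B h0 + 2 * P + 1) * (h + k)" by (simp add: algebra_simps)
  qed simp
  finally show ?thesis by (simp add: mult_ac)
qed

end

section \<open>From the strong solution and the scheme to the discrete error\<close>

context convex_dom3 begin

text \<open>For almost every time the value lies in a fixed ball of H^2; such times are dense in
  [0,T], and Lipschitz continuity in H^1 brings their values close to any given u t. The denominator
  C + 1 allows for C = 0.\<close>

lemma W1_H2_limit:
  assumes W: "u \<in> W1q_time T \<infinity> (H_space D 2)" and tc: "time_continuous T (H_space D 1) u" and T: "T > 0"
    and lip: "\<And>s t. s \<in> {0..T} \<Longrightarrow> t \<in> {0..T} \<Longrightarrow> hn 1 (\<lambda>x. u t x - u s x) \<le> C * \<bar>t - s\<bar>" "C \<ge> 0"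
  obtains B where "\<And>t. t \<in> {0..T} \<Longrightarrow> H2_limit B (u t)"
proof -
  have "u \<in> Lq_time T \<infinity> (H_space D 2)" using W unfolding W1q_time_def by blast
  then have sm: "strongly_measurable T (H_space D 2) u" and "\<exists>B. AE t in LT T. H_norm D 2 (u t) \<le> B"
    unfolding Lq_time_def W_space_def by auto
  then obtain B where B: "AE t in LT T. H_norm D 2 (u t) \<le> B" by blast
  have "AE t in LT T. u t \<in> H_set D 2" using sm unfolding strongly_measurable_def W_space_def fst_conv by blast
  then have ae: "AE t in LT T. u t \<in> H_set D 2 \<and> H_norm D 2 (u t) \<le> B" using B by eventually_elim blast
  show ?thesis
  proof (rule that[of B])
    fix t assume t: "t \<in> {0..T}"
    show "H2_limit B (u t)" unfolding H2_limit_def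
    proof (intro conjI allI impI)
      show "u t \<in> H_set D 1" by (rule time_continuousD(1)[OF tc t])
      fix e :: real assume e: "e > 0"
      then have d: "e / (C + 1) > 0" using lip(2) by simp
      obtain s where s: "u s \<in> H_set D 2 \<and> H_norm D 2 (u s) \<le> B" "s \<in> {0<..<T}" "\<bar>s - t\<bar> < e / (C + 1)"
        using AE_dense[OF ae t T d] by blast
      have "C * \<bar>s - t\<bar> \<le> (C + 1) * \<bar>s - t\<bar>" by (rule mult_right_mono) simp_all
      also have "\<dots> < e" using s(3) lip(2) by (simp add: pos_less_divide_eq mult.commute)
      finally have "hn 1 (\<lambda>x. u s x - u t x) < e" using lip(1)[OF t, of s] s(2) by simp
      then show "\<exists>v. v \<in> H_set D 2 \<and> H_norm D 2 v \<le> B \<and> hn 1 (\<lambda>x. v x - u t x) < e" using s(1) by blast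
    qed
  qed
qed

text \<open>The scheme multiplied by the step size, so that the difference quotient becomes the
  increment that appears in the energy estimates.\<close>

lemma fem_scheme_hip:
  assumes s: "fem_scheme D \<kappa>1 \<kappa>2 \<mu> \<gamma> e T u0 \<T> N U" and N: "N \<ge> 1" "T > 0"
    and V: "fem_space D \<T> \<subseteq> H_set D 1"
  shows "is_L2_projection D (fem_space D \<T>) u0 (U 0)" and "\<And>j. j \<le> N \<Longrightarrow> U j \<in> fem_space D \<T>"
    and "\<And>j \<phi>. j < N \<Longrightarrow> \<phi> \<in> fem_space D \<T> \<Longrightarrow>
      hip e (\<lambda>x. U (Suc j) x - U j x) \<phi> + T / real N * form \<kappa>1 \<gamma> \<kappa>2 \<mu> (U j) (U (Suc j)) \<phi> = 0"
proof -
  let ?k = "T / real N"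
  have k: "?k > 0" using N by simp
  have cancel: "x + a * y = 0" if "a > 0" "a * (1 / a * x + y) = 0" for a x y :: real
    using that by (simp add: distrib_left)
  note S = s[unfolded fem_scheme_def Let_def]
  show p: "is_L2_projection D (fem_space D \<T>) u0 (U 0)" using S by blast
  show U: "U j \<in> fem_space D \<T>" if "j \<le> N" for j
  proof (cases "j = 0")
    case True then show ?thesis using p by (simp add: is_L2_projection_def)
  next
    case False
    then have "j \<in> {1..N}" using that by simp
    then show ?thesis using S by blast
  qed
  fix j \<phi> assume j: "j < N" and \<phi>: "\<phi> \<in> fem_space D \<T>"
  have "Suc j \<in> {1..N}" using j by simp
  then have "ip D (\<lambda>x. (1 / ?k) *\<^sub>R (U (Suc j) x - U (Suc j - 1) x)) \<phi> + e * ip_grad D (\<lambda>x. (1 / ?k) *\<^sub>R (U (Suc j) x - U (Suc j - 1) x)) \<phi>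
      + \<kappa>1 * ip_grad D (U (Suc j)) \<phi> + \<gamma> * ip_cross_grad D (U (Suc j - 1)) (U (Suc j)) \<phi>
      + \<kappa>2 * ip D (U (Suc j)) \<phi> + \<kappa>2 * \<mu> * ip D (\<lambda>x. (norm (U (Suc j - 1) x))\<^sup>2 *\<^sub>R U (Suc j) x) \<phi> = 0"
    using S \<phi> by blast
  then have e1: "hip e (\<lambda>x. (1 / ?k) *\<^sub>R (U (Suc j) x - U j x)) \<phi> + form \<kappa>1 \<gamma> \<kappa>2 \<mu> (U j) (U (Suc j)) \<phi> = 0"
    unfolding hip_def form_def diff_Suc_1 by linarith
  have d: "(\<lambda>x. U (Suc j) x - U j x) \<in> H_set D 1" by (rule H1_diff(1)) (use U V j in auto)
  have "hip e (\<lambda>x. (1 / ?k) *\<^sub>R (U (Suc j) x - U j x)) \<phi> = 1 / ?k * hip e (\<lambda>x. U (Suc j) x - U j x) \<phi>"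
    by (rule hip_scaleR[OF d subsetD[OF V \<phi>]])
  with e1 have "?k * (1 / ?k * hip e (\<lambda>x. U (Suc j) x - U j x) \<phi> + form \<kappa>1 \<gamma> \<kappa>2 \<mu> (U j) (U (Suc j)) \<phi>) = 0" by simp
  then show "hip e (\<lambda>x. U (Suc j) x - U j x) \<phi> + ?k * form \<kappa>1 \<gamma> \<kappa>2 \<mu> (U j) (U (Suc j)) \<phi> = 0"
    by (rule cancel[OF k])
qed

end

text \<open>Since h is attained as the diameter of an element, it is bounded by the diameter of the
  closure of D; this supplies one h0 for the entire family.\<close>

lemma fem_dom_quasi_uniform:
  fixes D :: "(real^'d::finite) set"
  assumes dom: "convex_dom3 D c r" and h: "h > 0" "mesh D \<T>" "Max (diameter ` \<T>) = h"
    and \<rho>: "\<rho> > 0" "\<And>K. K \<in> \<T> \<Longrightarrow> \<exists>x. cball x (\<rho> * h) \<subseteq> K"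
  shows "fem_dom D c r \<T> h \<rho>" "h \<le> diameter (closure D)"
proof -
  have fin: "finite \<T>" and un: "\<Union>\<T> = closure D" using h(2) by (auto simp: mesh_def triangulation_def)
  have "diameter K \<le> h" if "K \<in> \<T>" for K using Max_ge[of "diameter ` \<T>" "diameter K"] fin that h(3) by simp
  then show "fem_dom D c r \<T> h \<rho>"
    unfolding fem_dom_def fem_dom_axioms_def using dom h \<rho> by simp
  have bd: "bounded D" "r > 0" "cball c r \<subseteq> D" using dom unfolding convex_dom3_def convex_dom_def by auto
  then have "c \<in> D" by (auto intro: subsetD)
  then have "\<T> \<noteq> {}" using un closure_subset by fastforce
  then have "h \<in> diameter ` \<T>" using Max_in[of "diameter ` \<T>"] fin h(3) by simp
  then obtain K where K: "K \<in> \<T>" "h = diameter K" by blast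
  then show "h \<le> diameter (closure D)" using un bd(1) by (auto intro!: diameter_subset bounded_closure)
qed

theorem theorem6p4:
  fixes D :: "(real^'d::finite) set"
    and H :: "real set"
    and \<T> :: "real \<Rightarrow> (real^'d) set set"
    and \<kappa>1 \<kappa>2 \<mu> \<gamma> \<epsilon> T :: real
    and u0 :: "real^'d \<Rightarrow> real^3"
    and u :: "real \<Rightarrow> real^'d \<Rightarrow> real^3"
  assumes "CARD('d) \<in> {1, 2, 3}"
    and "convex_polytopal_domain D"
    and "quasi_uniform_family D H \<T>"
    and "\<kappa>1 > 0" "\<kappa>2 > 0" "\<mu> > 0"
    and "T > 0"
    and "0 < \<epsilon>" "\<epsilon> < 1"
    and "strong_solution D \<kappa>1 \<kappa>2 \<mu> \<gamma> \<epsilon> T u0 u"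
    and "u \<in> Lq_time T \<infinity> (W_space D 2 3)"
    and "u \<in> W1q_time T \<infinity> (H_space D 2)"
  shows "\<exists>c>0. \<forall>h\<in>H. \<forall>N\<ge>1. \<forall>U. fem_scheme D \<kappa>1 \<kappa>2 \<mu> \<gamma> \<epsilon> T u0 (\<T> h) N U \<longrightarrow>
           (\<forall>n\<in>{1..N}. H_norm D 1 (\<lambda>x. U n x - u (real n * (T / real N)) x)
              \<le> c * exp (c * T) * (h + T / real N))"
proof -
  have dom: "open D" "D \<noteq> {}" "bounded D" "convex D" using assms(2) by (auto simp: convex_polytopal_domain_def)
  obtain x0 where x0: "x0 \<in> D" using dom(2) by blast
  obtain r where r: "r > 0" "cball x0 r \<subseteq> D" using dom(1) x0 unfolding open_contains_cball by blast
  have cd: "convex_dom3 D x0 r"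
    unfolding convex_dom3_def convex_dom_def convex_dom3_axioms_def using dom r assms(1) by auto
  interpret convex_dom3 D x0 r by (rule cd)
  have \<kappa>: "\<kappa>1 \<ge> 0" "\<kappa>2 \<ge> 0" "\<mu> \<ge> 0" using assms(4-6) by auto
  have W: "u \<in> W1q_time T \<infinity> (H_space D 1)" and tc: "time_continuous T (H_space D 1) u" and u0: "u0 \<in> H_set D 1"
    using assms(10) by (auto simp: strong_solution_def H1_Delta_set_def)
  have eq: "ip D (u t) \<phi> + \<epsilon> * ip_grad D (u t) \<phi>
        + \<kappa>1 * (\<integral>s. ip_grad D (u s) \<phi> \<partial>lebesgue_on {0<..<t})
        + \<gamma> * (\<integral>s. ip_cross_grad D (u s) (u s) \<phi> \<partial>lebesgue_on {0<..<t})
        + \<kappa>2 * (\<integral>s. ip D (\<lambda>x. (1 + \<mu> * (norm (u s x))\<^sup>2) *\<^sub>R u s x) \<phi> \<partial>lebesgue_on {0<..<t}) = hip \<epsilon> u0 \<phi>"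
    if "\<phi> \<in> H_set D 1" "t \<in> {0<..<T}" for \<phi> t
    using assms(10) that unfolding strong_solution_def hip_def by blast
  obtain C where C: "C \<ge> 0" "\<And>s t. s \<in> {0..T} \<Longrightarrow> t \<in> {0..T} \<Longrightarrow> hn 1 (\<lambda>x. u t x - u s x) \<le> C * \<bar>t - s\<bar>"
    using W1_time_lipschitz[OF W tc assms(7)] by blast
  obtain B where B: "\<And>t. t \<in> {0..T} \<Longrightarrow> H2_limit B (u t)"
    using W1_H2_limit[OF assms(12) tc assms(7) C(2,1)] by blast
  define F0 where "F0 = formC \<kappa>1 \<gamma> \<kappa>2 \<mu> (solM B) (solQ B) (2 * zB B)"
  have F0: "F0 \<ge> 0" unfolding F0_def by (intro formC_nonneg \<kappa>) (simp_all add: solM_def solQ_def sobC_nonneg)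
  have vi1: "hip \<epsilon> (u 0) \<phi> = hip \<epsilon> u0 \<phi>" if "\<phi> \<in> H_set D 1" for \<phi>
    by (rule variational_increment(1)[where u=u, OF tc assms(7) C(2) C(1) B assms(8,9) \<kappa> that eq[OF that]])
  have vi2: "\<bar>hip \<epsilon> (u b) \<phi> - hip \<epsilon> (u a) \<phi> + (b - a) * form \<kappa>1 \<gamma> \<kappa>2 \<mu> (u b) (u b) \<phi>\<bar> \<le> 2 * F0 * C * (b - a)\<^sup>2 * hn 1 \<phi>"
    if "\<phi> \<in> H_set D 1" "0 \<le> a" "a \<le> b" "b \<le> T" for \<phi> a b
    unfolding F0_def
    by (rule variational_increment(2)[where u=u, OF tc assms(7) C(2) C(1) B assms(8,9) \<kappa> that(1) eq[OF that(1)] that(2-4)])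
  obtain \<rho> where \<rho>: "\<rho> > 0" "\<And>h K. h \<in> H \<Longrightarrow> K \<in> \<T> h \<Longrightarrow> \<exists>x. cball x (\<rho> * h) \<subseteq> K"
    using assms(3) unfolding quasi_uniform_family_def by blast
  define h0 where "h0 = diameter (closure D)"
  have fem: "fem_dom D x0 r (\<T> h) h \<rho>" "h \<le> h0" if "h \<in> H" for h
  proof -
    have h: "h > 0" "mesh D (\<T> h)" "Max (diameter ` \<T> h) = h" using assms(3) that unfolding quasi_uniform_family_def by auto
    show "fem_dom D x0 r (\<T> h) h \<rho>" "h \<le> h0" unfolding h0_def
      by (rule fem_dom_quasi_uniform[OF cd h \<rho>(1) \<rho>(2)[OF that]], assumption)+
  qed
  \<comment> \<open>Outside the locale these constants take only D or its dimension and \<rho> from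
    the locale, neither the mesh nor h; hence c can be fixed before h is.\<close>
  define P where "P = fem_dom.apC TYPE('d) \<rho> B h0 + 1"
  define K1 where "K1 = fem_dom.inC TYPE('d) \<rho> B h0 + 2 * P + 1"
  define K2 where "K2 = fem_dom.rateC (fem_dom.stepF D \<rho> \<kappa>1 \<gamma> \<kappa>2 \<mu> \<epsilon> B h0 + F0) P \<epsilon> C"
  \<comment> \<open>The same c stands in front and in the exponent, so it has to dominate both
    constants; \<open>1 / sqrt \<epsilon>\<close> converts the energy norm into the H^1
    norm.\<close>
  define c where "c = \<bar>K1 / sqrt \<epsilon>\<bar> + \<bar>K2\<bar> + 1"
  have c: "c > 0" "K1 / sqrt \<epsilon> \<le> c" "K2 \<le> c"
    unfolding c_def using abs_ge_self[of "K1 / sqrt \<epsilon>"] abs_ge_self[of K2] abs_ge_zero[of "K1 / sqrt \<epsilon>"] abs_ge_zero[of K2]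
    by linarith+
  show ?thesis
  proof (intro exI[of _ c] conjI ballI allI impI)
    show "c > 0" by (rule c(1))
    fix h N U n assume h: "h \<in> H" and N: "1 \<le> (N::nat)" and S: "fem_scheme D \<kappa>1 \<kappa>2 \<mu> \<gamma> \<epsilon> T u0 (\<T> h) N U" and n: "n \<in> {1..N}"
    interpret F: fem_dom D x0 r "\<T> h" h \<rho> by (rule fem(1)[OF h])
    define k where "k = T / real N"
    have k: "k > 0" "real N * k = T" using assms(7) N by (simp_all add: k_def)
    have nT: "real n * k \<in> {0..T}" if "n \<le> N" for n
    proof -
      have "real n * k \<le> real N * k" using that k(1) by (intro mult_right_mono) auto
      then show ?thesis using k by simp
    qed
    define z where "z = (\<lambda>j. u (real j * k))"
    have V: "F.Vh \<subseteq> H_set D 1" by (rule subsetI) (rule F.Vh_H1(1))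
    note sch = fem_scheme_hip[OF S N assms(7) V, folded k_def]
    have zH: "z j \<in> H_set D 1" if "j \<le> N" for j unfolding z_def by (rule time_continuousD(1)[OF tc nT[OF that]])
    have inc: "real (Suc j) * k - real j * k = k" for j by (simp add: field_simps)
    have err: "hn \<epsilon> (\<lambda>x. U n x - z n x) \<le> K1 * exp (K2 * (real n * k)) * (h + k)"
      unfolding K1_def K2_def P_def
    proof (rule F.discrete_error[where N=N and U=U and z=z and k=k, OF fem(2)[OF h] assms(8,9) k(1) \<kappa> C(1) _ sch(2,3) _ F0])
      show "H2_limit B (z j)" if "j \<le> N" for j unfolding z_def by (rule B[OF nT[OF that]])
      show "n \<le> N" using n by simp
      show "hn 1 (\<lambda>x. z (Suc j) x - z j x) \<le> C * k" if "j < N" for j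
        using C(2)[OF nT[of j] nT[of "Suc j"]] that k(1) unfolding z_def inc by simp
      show "\<bar>hip \<epsilon> (z (Suc j)) \<phi> - hip \<epsilon> (z j) \<phi> + k * form \<kappa>1 \<gamma> \<kappa>2 \<mu> (z (Suc j)) (z (Suc j)) \<phi>\<bar> \<le> 2 * F0 * C * k\<^sup>2 * hn 1 \<phi>"
        if j: "j < N" and \<phi>: "\<phi> \<in> H_set D 1" for j \<phi>
      proof -
        have "0 \<le> real j * k" "real j * k \<le> real (Suc j) * k" "real (Suc j) * k \<le> T"
          using nT[of j] nT[of "Suc j"] j k(1) by (auto intro!: mult_right_mono simp del: of_nat_Suc)
        from vi2[OF \<phi> this] show ?thesis unfolding z_def inc .
      qed
      show "ip D (\<lambda>x. z 0 x - U 0 x) \<phi> = 0" if \<phi>: "\<phi> \<in> fem_space D (\<T> h)" for \<phi>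
      proof (rule L2_projection_initial[OF zH u0 assms(8)])
        show "hip \<epsilon> (z 0) \<psi> = hip \<epsilon> u0 \<psi>" if "\<psi> \<in> H_set D 1" for \<psi>
          using vi1[OF that] by (simp add: z_def)
        show "sqi LD (U 0)" "sqi LD \<phi>" using H1_D(1) F.Vh_H1(1) sch(2)[of 0] \<phi> by auto
        show "ip D (\<lambda>x. u0 x - U 0 x) \<phi> = 0" using sch(1) \<phi> by (simp add: is_L2_projection_def)
      qed simp
    qed
    have nN: "n \<le> N" using n by simp
    have dH: "(\<lambda>x. U n x - z n x) \<in> H_set D 1" by (rule H1_diff(1)[OF F.Vh_H1(1)[OF sch(2)[OF nN]] zH[OF nN]])
    have tn: "0 \<le> real n * k" "real n * k \<le> T" using nT[OF nN] by auto
    have hk: "h + k \<ge> 0" using k F.h_pos by simp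
    have "H_norm D 1 (\<lambda>x. U n x - z n x) \<le> hn \<epsilon> (\<lambda>x. U n x - z n x) / sqrt \<epsilon>"
      unfolding H1_norm_eq[OF dH] by (rule hn_1_le) (use assms(8,9) in auto)
    also have "\<dots> \<le> K1 * exp (K2 * (real n * k)) * (h + k) / sqrt \<epsilon>"
      using err by (rule divide_right_mono) (use assms(8) in simp)
    also have "\<dots> = K1 / sqrt \<epsilon> * (exp (K2 * (real n * k)) * (h + k))" by simp
    also have "\<dots> \<le> c * (exp (c * T) * (h + k))"
    proof (rule mult_mono)
      have "K2 * (real n * k) \<le> c * (real n * k)" using c(3) tn(1) by (rule mult_right_mono)
      also have "\<dots> \<le> c * T" using tn(2) c(1) by (intro mult_left_mono) auto
      finally show "exp (K2 * (real n * k)) * (h + k) \<le> exp (c * T) * (h + k)" using hk by (intro mult_right_mono) simp_all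
    qed (use c hk in auto)
    finally show "H_norm D 1 (\<lambda>x. U n x - u (real n * (T / real N)) x) \<le> c * exp (c * T) * (h + T / real N)"
      by (simp add: z_def k_def mult.assoc)
  qed
qed

end
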